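(* Let $\mathbb{G}$ be a Carnot group with $\mathbb{G}\neq\mathbb{R}$ that admits a ball of uniformly deformable directions. Then $\mathbb{G}$ contains a universal differentiability set $N\subset\mathbb{G}$ of Hausdorff dimension one with respect to the Carnot-Carathéodory metric (in particular, $N$ has measure zero with respect to the Haar measure). In particular, for every $n\ge 2$ the model filiform group $\mathbb{E}_n$ contains a universal differentiability set of Hausdorff dimension one with respect to the Carnot-Carathéodory metric.
   Context: A Carnot group $\mathbb{G}$ of step $s$ is a simply connected Lie group whose Lie algebra $\mathfrak g$ decomposes as $\mathfrak g=V_1\oplus\cdots\oplus V_s$ with $V_i=[V_1,V_{i-1}]$ for $i=2,\dots,s$ and $[V_1,V_s]=0$. $V_1$ is the horizontal layer and $r=\dim V_1$ is the rank; elements of $V_1$ are regarded as left-invariant vector fields. Fix a basis $X_1,\dots,X_n$ of $\mathfrak g$ adapted to the stratification ($X_1,\dots,X_r$ is a basis of $V_1$), and identify $\mathbb{G}$ with $\mathbb{R}^n$ by $(x_1,\dots,x_n)\leftrightarrow\exp(x_1X_1+\cdots+x_nX_n)$ (exponential coordinates of the first kind; the identity is $0$). Let $\omega$ be the inner product norm on $V_1$ making $X_1,\dots,X_r$ orthonormal. Let $p(x)=(x_1,\dots,x_r)$ for $x\in\mathbb{G}$, and $p(E)=(a_1,\dots,a_r)$ for $E=\sum_{i\le r}a_iX_i\in V_1$; then $\omega(E)=|p(E)|$ and $\exp(E)=E(0)=(p(E),0)\in\mathbb{R}^n$. $\langle\cdot,\cdot\rangle$ is the Euclidean inner product in coordinates.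 Dilations: for $\lambda>0$, $\delta_\lambda\big(\exp(\sum_i Y_i)\big)=\exp(\sum_i\lambda^iY_i)$ for $Y_i\in V_i$. An absolutely continuous curve $\gamma:[a,b]\to\mathbb{G}$ is horizontal if $\gamma'(t)=\sum_{j=1}^r u_j(t)X_j(\gamma(t))$ for a.e. $t$ with $u_j\in L^1[a,b]$; its length is $\int_a^b|u|$. The Carnot-Carathéodory (CC) distance $d(x,y)$ is the infimum of lengths of horizontal curves joining $x$ to $y$; write $d(x)=d(x,0)$. Lipschitz maps on or into $\mathbb{G}$ and $\mathrm{Lip}_{\mathbb{G}}$ are taken with respect to $d$. Horizontal lines are curves of the form $t\mapsto q\exp(tV)$ with $q\in\mathbb{G}$, $V\in V_1$. A curve is formed by joining at most $N$ horizontal lines if its domain can be divided into at most $N$ consecutive intervals on each of which it coincides with a horizontal line. Differentiability: $L:\mathbb{G}\to\mathbb{R}$ is $\mathbb{G}$-linear if $L(xy)=L(x)+L(y)$ and $L(\delta_\lambda(x))=\lambda L(x)$ for all $x,y\in\mathbb{G}$, $\lambda>0$. A map $f:\mathbb{G}\to\mathbb{R}$ is (Pansu) differentiable at $x$ if there is a $\mathbb{G}$-linear $L$ with $\lim_{y\to x}|f(y)-f(x)-L(x^{-1}y)|/d(x,y)=0$. A set $N\subset\mathbb{G}$ is a universal differentiability set if every Lipschitz map $f:\mathbb{G}\to\mathbb{R}$ is differentiable at some point of $N$. Deformable directions: $E\in V_1$ with $\omega(E)=1$ is deformable, with parameters $C_E$ (a positive constant), $N_E$ (a positive integer) and $\Delta_E:(0,\infty)\to(0,\infty)$,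 if for every $0<\ell<1$, $\eta\in(0,\infty)$, $0<\Delta<\Delta_E(\eta)$ and $u\in\mathbb{G}$ with $d(u)\le1$, there is a Lipschitz horizontal curve $g:\mathbb{R}\to\mathbb{G}$ formed by joining at most $N_E$ horizontal lines such that: (1) $g(t)=\exp(tE)$ for $|t|\ge \ell$; (2) $g(\zeta)=\delta_{\Delta \ell}(u)$ where $\zeta:=\langle\delta_{\Delta \ell}(u),E(0)\rangle$; (3) $\mathrm{Lip}_{\mathbb{G}}(g)\le1+\eta\Delta$; (4) $|(p\circ g)'(t)-p(E)|\le C_E\Delta$ for all but finitely many $t\in\mathbb{R}$. $E$ is deformable if such parameters exist. $\mathbb{G}$ admits a ball of uniformly deformable directions if there is an open ball $B\subset V_1$ (with respect to $\omega$, meeting the unit sphere $\{\omega=1\}$) such that every $E\in B$ with $\omega(E)=1$ is deformable with the same parameters $C_B,N_B,\Delta_B$. Model filiform groups: for $n\ge2$, $\mathbb{E}_n$ is the Carnot group of step $n-1$ whose Lie algebra has a basis $X_1,\dots,X_n$ with only non-vanishing bracket relations $[X_i,X_1]=X_{i+1}$ for $1<i<n$, with stratification $V_1=\mathrm{Span}\{X_1,X_2\}$, $V_i=\mathrm{Span}\{X_{i+1}\}$ for $1<i<n$. *)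

theory Defs
  imports "HOL-Analysis.Analysis"
begin

section \<open>Smooth maps and absolutely continuous curves\<close>

primrec C_k :: "nat \<Rightarrow> ('a::euclidean_space \<Rightarrow> 'b::euclidean_space) \<Rightarrow> bool" where
  "C_k 0 f \<longleftrightarrow> continuous_on UNIV f"
| "C_k (Suc k) f \<longleftrightarrow>
     (\<exists>f'. (\<forall>x. (f has_derivative f' x) (at x)) \<and> (\<forall>v. C_k k (\<lambda>x. f' x v)))"

definition smooth :: "('a::euclidean_space \<Rightarrow> 'b::euclidean_space) \<Rightarrow> bool" where
  "smooth f \<longleftrightarrow> (\<forall>k. C_k k f)"

definition abs_continuous_curve :: "real \<Rightarrow> real \<Rightarrow> (real \<Rightarrow> 'a::real_normed_vector) \<Rightarrow> bool" where
  "abs_continuous_curve a b f \<longleftrightarrow>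
     (\<forall>\<epsilon>>0. \<exists>\<delta>>0. \<forall>(m::nat) l r.
        (\<forall>i<m. a \<le> l i \<and> l i \<le> r i \<and> r i \<le> b) \<and>
        (\<forall>i<m. \<forall>j<m. i \<noteq> j \<longrightarrow> {l i<..<r i} \<inter> {l j<..<r j} = {}) \<and>
        (\<Sum>i<m. r i - l i) < \<delta>
        \<longrightarrow> (\<Sum>i<m. norm (f (r i) - f (l i))) < \<epsilon>)"


section \<open>Lipschitz maps and Hausdorff dimension for an explicitly given distance\<close>

definition Lipschitz_wrt ::
    "('x \<Rightarrow> 'x \<Rightarrow> real) \<Rightarrow> ('y \<Rightarrow> 'y \<Rightarrow> real) \<Rightarrow> ('x \<Rightarrow> 'y) \<Rightarrow> bool" where
  "Lipschitz_wrt d d' f \<longleftrightarrow> (\<exists>L\<ge>0. \<forall>x y. d' (f x) (f y) \<le> L * d x y)"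

definition Lip_const ::
    "('x \<Rightarrow> 'x \<Rightarrow> real) \<Rightarrow> ('y \<Rightarrow> 'y \<Rightarrow> real) \<Rightarrow> ('x \<Rightarrow> 'y) \<Rightarrow> real" where
  "Lip_const d d' f = Inf {L. L \<ge> 0 \<and> (\<forall>x y. d' (f x) (f y) \<le> L * d x y)}"

definition ediam :: "('x \<Rightarrow> 'x \<Rightarrow> real) \<Rightarrow> 'x set \<Rightarrow> ennreal" where
  "ediam d U = (SUP x\<in>U. SUP y\<in>U. ennreal (d x y))"

text \<open>The bound on the diameters makes them finite, so that \<open>enn2real\<close> loses nothing.\<close>

definition Hausdorff_premeasure ::
    "('x \<Rightarrow> 'x \<Rightarrow> real) \<Rightarrow> real \<Rightarrow> real \<Rightarrow> 'x set \<Rightarrow> ennreal" where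
  "Hausdorff_premeasure d \<alpha> \<delta> S =
     (INF U\<in>{U :: nat \<Rightarrow> 'x set. S \<subseteq> (\<Union>i. U i) \<and> (\<forall>i. ediam d (U i) \<le> ennreal \<delta>)}.
        \<Sum>i. ennreal (enn2real (ediam d (U i)) powr \<alpha>))"

definition Hausdorff_measure ::
    "('x \<Rightarrow> 'x \<Rightarrow> real) \<Rightarrow> real \<Rightarrow> 'x set \<Rightarrow> ennreal" where
  "Hausdorff_measure d \<alpha> S = (SUP \<delta>\<in>{0<..}. Hausdorff_premeasure d \<alpha> \<delta> S)"

text \<open>
  Only exponents \<open>\<alpha> > 0\<close> are used: this does not change the infimum, and it avoids the
  convention \<open>0 powr 0 = 0\<close>, under which singletons would not count for \<open>\<alpha> = 0\<close>.
\<close>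

definition Hausdorff_dim :: "('x \<Rightarrow> 'x \<Rightarrow> real) \<Rightarrow> 'x set \<Rightarrow> ereal" where
  "Hausdorff_dim d S = (INF \<alpha>\<in>{\<alpha>. \<alpha> > 0 \<and> Hausdorff_measure d \<alpha> S = 0}. ereal \<alpha>)"


section \<open>The Lie algebra of a Lie group structure on a Euclidean space\<close>

text \<open>
  A group law \<open>m\<close> on \<open>'a\<close> with identity \<open>0\<close>. A vector \<open>v\<close>, viewed as a tangent vector at \<open>0\<close>,
  is identified with the left-invariant vector field taking the value \<open>v\<close> at \<open>0\<close>.
\<close>

definition left_inv_field ::
    "('a::euclidean_space \<Rightarrow> 'a \<Rightarrow> 'a) \<Rightarrow> 'a \<Rightarrow> 'a \<Rightarrow> 'a" where
  "left_inv_field m v x = frechet_derivative (\<lambda>y. m x y) (at 0) v"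

definition field_bracket ::
    "('a::euclidean_space \<Rightarrow> 'a) \<Rightarrow> ('a \<Rightarrow> 'a) \<Rightarrow> 'a \<Rightarrow> 'a" where
  "field_bracket X Y x =
     frechet_derivative Y (at x) (X x) - frechet_derivative X (at x) (Y x)"

definition lie_bracket ::
    "('a::euclidean_space \<Rightarrow> 'a \<Rightarrow> 'a) \<Rightarrow> 'a \<Rightarrow> 'a \<Rightarrow> 'a" where
  "lie_bracket m v w = field_bracket (left_inv_field m v) (left_inv_field m w) 0"


section \<open>Carnot groups in exponential coordinates of the first kind\<close>

text \<open>
  The underlying manifold is the Euclidean space \<open>'a\<close> (so simply connected), and the chosen
  basis of the Lie algebra, adapted to the stratification, is the standard basis: \<open>B i\<close> is the
  set of those basis vectors that span the \<open>i\<close>-th layer, for \<open>i = 1, \<dots>, s\<close>. Thus the layers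
  are automatically in direct sum, and the norm of \<open>'a\<close> restricted to the first layer is the
  inner product norm making the chosen basis of that layer orthonormal.

  The axiom \<open>exp_coords\<close> says that \<open>t \<mapsto> t *\<^sub>R v\<close> is a one-parameter subgroup. Its velocity at
  \<open>0\<close> is \<open>v\<close>, so it is the one generated by \<open>v\<close>; that is, the exponential map is the identity,
  which is what it means for the coordinates to be exponential of the first kind.
\<close>

locale carnot_group =
  fixes mult :: "'a::euclidean_space \<Rightarrow> 'a \<Rightarrow> 'a" (infixl "\<odot>" 70)
    and B :: "nat \<Rightarrow> 'a set"
    and s :: nat
  assumes assoc: "(x \<odot> y) \<odot> z = x \<odot> (y \<odot> z)"
    and left_unit: "0 \<odot> x = x"
    and right_unit: "x \<odot> 0 = x"
    and smooth_mult: "smooth (\<lambda>(x, y). x \<odot> y)"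
    and exp_coords: "(a *\<^sub>R v) \<odot> (b *\<^sub>R v) = (a + b) *\<^sub>R v"
    and step_pos: "1 \<le> s"
    and layers_cover: "(\<Union>i\<in>{1..s}. B i) = Basis"
    and layers_disjoint: "disjoint_family_on B {1..s}"
    and layers_generated: "i \<in> {2..s} \<Longrightarrow>
      span (B i) = span {lie_bracket mult v w |v w. v \<in> span (B 1) \<and> w \<in> span (B (i - 1))}"
    and last_layer_central: "v \<in> span (B 1) \<Longrightarrow> w \<in> span (B s) \<Longrightarrow> lie_bracket mult v w = 0"
    and last_layer_nonzero: "B s \<noteq> {}"
begin

definition layer :: "nat \<Rightarrow> 'a set" where
  "layer i = span (B i)"

definition layer_part :: "nat \<Rightarrow> 'a \<Rightarrow> 'a" where
  "layer_part i x = (\<Sum>b\<in>B i. (x \<bullet> b) *\<^sub>R b)"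

text \<open>
  \<open>p\<close> keeps the first \<open>r\<close> coordinates. Its target \<open>\<real>\<^sup>r\<close> is realised as the subspace \<open>layer 1\<close>
  of \<open>'a\<close>, so that \<open>p E = E\<close> for horizontal \<open>E\<close>.
\<close>

definition p :: "'a \<Rightarrow> 'a" where
  "p x = layer_part 1 x"

definition dilation :: "real \<Rightarrow> 'a \<Rightarrow> 'a" where
  "dilation c x = (\<Sum>i=1..s. c ^ i *\<^sub>R layer_part i x)"

definition ginv :: "'a \<Rightarrow> 'a" where
  "ginv x = - x"

lemma ginv_right: "x \<odot> ginv x = 0"
  using exp_coords[of 1 x "-1"] by (simp add: ginv_def)

lemma ginv_left: "ginv x \<odot> x = 0"
  using exp_coords[of "-1" x 1] by (simp add: ginv_def)

text \<open>
  The control \<open>u = (u\<^sub>1, \<dots>, u\<^sub>r)\<close> is the vector \<open>\<Sum>j u\<^sub>j X\<^sub>j\<close> of \<open>layer 1\<close>; left-invariant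
  fields being linear in the vector at \<open>0\<close>, \<open>left_inv_field mult (u t) x\<close> is
  \<open>\<Sum>j u\<^sub>j(t) X\<^sub>j(x)\<close>.
\<close>

definition horizontal_with_control ::
    "real \<Rightarrow> real \<Rightarrow> (real \<Rightarrow> 'a) \<Rightarrow> (real \<Rightarrow> 'a) \<Rightarrow> bool" where
  "horizontal_with_control a b \<gamma> u \<longleftrightarrow>
     abs_continuous_curve a b \<gamma> \<and>
     u absolutely_integrable_on {a..b} \<and>
     (\<forall>t\<in>{a..b}. u t \<in> layer 1) \<and>
     (AE t in lebesgue. t \<in> {a..b} \<longrightarrow>
        (\<gamma> has_vector_derivative left_inv_field mult (u t) (\<gamma> t)) (at t))"

definition cc_dist :: "'a \<Rightarrow> 'a \<Rightarrow> real" where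
  "cc_dist x y =
     Inf {integral {a..b} (\<lambda>t. norm (u t)) |a b \<gamma> u.
            a \<le> b \<and> horizontal_with_control a b \<gamma> u \<and> \<gamma> a = x \<and> \<gamma> b = y}"

definition horizontal_on_line :: "(real \<Rightarrow> 'a) \<Rightarrow> bool" where
  "horizontal_on_line g \<longleftrightarrow> (\<forall>a b. a \<le> b \<longrightarrow> (\<exists>u. horizontal_with_control a b g u))"

definition is_horizontal_line_on :: "real set \<Rightarrow> (real \<Rightarrow> 'a) \<Rightarrow> bool" where
  "is_horizontal_line_on I g \<longleftrightarrow> (\<exists>q. \<exists>V\<in>layer 1. \<forall>t\<in>I. g t = q \<odot> (t *\<^sub>R V))"

text \<open>Consecutive intervals are allowed to share an endpoint.\<close>

definition joins_horizontal_lines :: "nat \<Rightarrow> (real \<Rightarrow> 'a) \<Rightarrow> bool" where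
  "joins_horizontal_lines N g \<longleftrightarrow>
     (\<exists>k\<le>N. \<exists>I :: nat \<Rightarrow> real set.
        (\<Union>i<k. I i) = UNIV \<and>
        (\<forall>i<k. is_interval (I i) \<and> is_horizontal_line_on (I i) g) \<and>
        (\<forall>i j. i < j \<and> j < k \<longrightarrow> (\<forall>x\<in>I i. \<forall>y\<in>I j. x \<le> y)))"


subsection \<open>Differentiability\<close>

definition G_linear :: "('a \<Rightarrow> real) \<Rightarrow> bool" where
  "G_linear L \<longleftrightarrow>
     (\<forall>x y. L (x \<odot> y) = L x + L y) \<and> (\<forall>c>0. \<forall>x. L (dilation c x) = c * L x)"

definition pansu_differentiable_at :: "('a \<Rightarrow> real) \<Rightarrow> 'a \<Rightarrow> bool" where
  "pansu_differentiable_at f x \<longleftrightarrow>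
     (\<exists>L. G_linear L \<and>
        ((\<lambda>y. \<bar>f y - f x - L (ginv x \<odot> y)\<bar> / cc_dist x y) \<longlongrightarrow> 0) (at x))"

definition universal_differentiability_set :: "'a set \<Rightarrow> bool" where
  "universal_differentiability_set N \<longleftrightarrow>
     (\<forall>f :: 'a \<Rightarrow> real. Lipschitz_wrt cc_dist dist f \<longrightarrow>
        (\<exists>x\<in>N. pansu_differentiable_at f x))"


subsection \<open>Deformable directions\<close>

text \<open>In these coordinates \<open>exp (t E) = t *\<^sub>R E\<close>, and in particular \<open>E(0) = E\<close>.\<close>

definition deformable_with :: "'a \<Rightarrow> real \<Rightarrow> nat \<Rightarrow> (real \<Rightarrow> real) \<Rightarrow> bool" where
  "deformable_with E C N \<Delta>\<^sub>E \<longleftrightarrow>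
     E \<in> layer 1 \<and> norm E = 1 \<and> C > 0 \<and> N > 0 \<and> (\<forall>\<eta>>0. \<Delta>\<^sub>E \<eta> > 0) \<and>
     (\<forall>l \<eta> \<Delta> u. 0 < l \<and> l < 1 \<and> 0 < \<eta> \<and> 0 < \<Delta> \<and> \<Delta> < \<Delta>\<^sub>E \<eta> \<and> cc_dist u 0 \<le> 1 \<longrightarrow>
        (\<exists>g :: real \<Rightarrow> 'a.
           Lipschitz_wrt dist cc_dist g \<and> horizontal_on_line g \<and> joins_horizontal_lines N g \<and>
           (\<forall>t. \<bar>t\<bar> \<ge> l \<longrightarrow> g t = t *\<^sub>R E) \<and>
           g (dilation (\<Delta> * l) u \<bullet> E) = dilation (\<Delta> * l) u \<and>
           Lip_const dist cc_dist g \<le> 1 + \<eta> * \<Delta> \<and>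
           (\<exists>F. finite F \<and> (\<forall>t. t \<notin> F \<longrightarrow>
              (\<exists>D. ((p \<circ> g) has_vector_derivative D) (at t) \<and> norm (D - p E) \<le> C * \<Delta>)))))"

definition admits_ball_of_uniformly_deformable_directions :: bool where
  "admits_ball_of_uniformly_deformable_directions \<longleftrightarrow>
     (\<exists>E\<^sub>0\<in>layer 1. \<exists>\<rho>>0. \<exists>C N \<Delta>\<^sub>B.
        (\<exists>E\<in>layer 1 \<inter> ball E\<^sub>0 \<rho>. norm E = 1) \<and>
        (\<forall>E\<in>layer 1 \<inter> ball E\<^sub>0 \<rho>. norm E = 1 \<longrightarrow> deformable_with E C N \<Delta>\<^sub>B))"


subsection \<open>Haar measure\<close>

definition haar_measure :: "'a measure \<Rightarrow> bool" where
  "haar_measure \<mu> \<longleftrightarrow>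
     sets \<mu> = sets borel \<and>
     (\<forall>g. \<forall>A\<in>sets borel. emeasure \<mu> ((\<lambda>x. g \<odot> x) ` A) = emeasure \<mu> A) \<and>
     (\<forall>K. compact K \<longrightarrow> emeasure \<mu> K < \<infinity>) \<and>
     emeasure \<mu> UNIV \<noteq> 0"

end


section \<open>Model filiform groups\<close>

definition filiform_layer :: "(nat \<Rightarrow> 'a) \<Rightarrow> nat \<Rightarrow> 'a set" where
  "filiform_layer X i = (if i = 1 then {X 1, X 2} else {X (i + 1)})"

text \<open>
  The group \<open>E\<^sub>n\<close>, in exponential coordinates with respect to the basis \<open>X 1, \<dots>, X n\<close>. The
  brackets \<open>[X 1, X j]\<close> are those forced by antisymmetry.
\<close>

definition model_filiform ::
    "nat \<Rightarrow> ('a::euclidean_space \<Rightarrow> 'a \<Rightarrow> 'a) \<Rightarrow> (nat \<Rightarrow> 'a) \<Rightarrow> bool" where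
  "model_filiform n m X \<longleftrightarrow>
     bij_betw X {1..n} Basis \<and>
     carnot_group m (filiform_layer X) (n - 1) \<and>
     (\<forall>i\<in>{1..n}. \<forall>j\<in>{1..n}. lie_bracket m (X i) (X j) =
        (if 1 < i \<and> i < n \<and> j = 1 then X (i + 1)
         else if i = 1 \<and> 1 < j \<and> j < n then - X (j + 1)
         else 0))"

end

theory Submission
  imports Defs
begin

text \<open>
  Suppose that a Lipschitz function \<open>f\<close> has at \<open>x\<close>, in the direction \<open>E\<close>, a derivative that is maximal among
  the directional derivatives of \<open>f\<close> along horizontal unit vectors. If \<open>E\<close> is deformable, then \<open>f\<close> is
  differentiable at \<open>x\<close>, with a multiple of the coordinate along \<open>E\<close> as differential: were \<open>f (x ** z)\<close> far from
  the value predicted for some small \<open>z\<close>, a curve that follows the line through \<open>x\<close> except for a detour through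
  \<open>x ** z\<close> would yield a larger derivative, because it raises the speed by a factor of only \<open>1 + eta * Delta\<close>, with
  \<open>eta\<close> arbitrarily small, while \<open>f\<close> gains an amount of order \<open>Delta\<close>.

  A maximum need not be attained, and the points at which derivatives are compared must lie in a small set
  \<open>N\<close>. So \<open>N\<close> is a \<open>G\<^sub>\<delta>\<close> set containing the countably many lines \<open>rat_lines\<close>, and
  \<open>variational_principle\<close> constructs a convergent sequence of points of \<open>N\<close> and directions for which,
  after adding to \<open>f\<close> a linear function, the derivative in the limit is almost maximal. Derivatives pass to
  the limit only if the increments of \<open>f\<close> at successive points are close; hence maximality is obtained only
  with respect to points with increments close to those at \<open>x\<close>, with a tolerance \<open>omega\<close> of the gain in
  the derivative. A competitor on the detour therefore has to satisfy such a bound too. It is provided by a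
  mean value lemma, \<open>mean_value_slope\<close>, together with \<open>near_path_estimate\<close>, which bounds the
  deviation of the detour from a line. The detour itself is approximated by pieces of \<open>rat_lines\<close> in
  \<open>rational_deformation\<close>, and \<open>almost_maximal_estimate\<close> combines these facts.

  Thin neighbourhoods of \<open>rat_lines\<close> make \<open>N\<close> one-dimensional; as balls of radius \<open>r\<close> have measure
  of order at most \<open>r\<^sup>2\<close> if the rank is at least two (\<open>haar_dball\<close>), \<open>N\<close> is then a null set.

  In the model filiform groups all directions close to \<open>X 1\<close> are uniformly deformable: points close to the line
  are reached by \<open>n - 1\<close> pieces whose slopes solve a linear system (\<open>path_near_line\<close>), and pieces with
  component one along \<open>E\<close> exceed unit speed only to second order (\<open>deformable_near_X1\<close>).
\<close>

notation scaleR (infixr "*R" 75)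
no_notation matrix_matrix_mult (infixl "**" 70)
notation has_vector_derivative (infix "has'_vderiv" 50)
notation inner (infix "*." 70)
notation (input) LIMSEQ (infix "---->" 60)

section \<open>Real functions: absolute continuity, variation and derivatives\<close>

definition interval_family :: "real => real => real => 'i set => ('i => real) => ('i => real) => bool" where
 "interval_family a b delta I l r \<longleftrightarrow> finite I & (ALL i:I. a <= l i & l i <= r i & r i <= b) &
   (ALL i:I. ALL j:I. i ~= j --> {l i<..<r i} Int {l j<..<r j} = {}) & (SUM i:I. r i - l i) < delta"

lemma interval_familyI:
 assumes "finite I" "!!i. i : I ==> a <= l i & l i <= r i & r i <= b"
  "!!i j. i : I ==> j : I ==> i ~= j ==> {l i<..<r i} Int {l j<..<r j} = {}" "(SUM i:I. r i - l i) < delta"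
 shows "interval_family a b delta I l r" using assms by (simp add: interval_family_def)

lemma abs_continuous_iff:
 "abs_continuous_curve a b f \<longleftrightarrow> (ALL e>0. EX delta>0. ALL (m::nat) l r. interval_family a b delta {..<m} l r --> (SUM i<m. norm (f (r i) - f (l i))) < e)"
 unfolding abs_continuous_curve_def interval_family_def Ball_def lessThan_iff by simp

lemma abs_continuousE:
 assumes f: "abs_continuous_curve a b f" and e: "e > 0"
 obtains delta where "delta > 0" "!!(I::'i set) l r. interval_family a b delta I l r ==> (SUM i:I. norm (f (r i) - f (l i))) < e"
proof -
 obtain delta where d: "delta > 0" and
  D: "!!(m::nat) l r. interval_family a b delta {..<m} l r ==> (SUM i<m. norm (f (r i) - f (l i))) < e" using f e unfolding abs_continuous_iff by meson
 have "(SUM i:I. norm (f (r i) - f (l i))) < e" if I: "interval_family a b delta I l r" for I :: "'i set" and l r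
 proof -
  obtain h where h: "bij_betw h {..<card I} I" using ex_bij_betw_nat_finite[of I] I by (auto simp: atLeast0LessThan interval_family_def)
  have "h i : I" "j < card I ==> i ~= j ==> h i ~= h j" if "i < card I" for i j using h that by (auto simp: bij_betw_def inj_on_def)
  hence "interval_family a b delta {..<card I} (%i. l (h i)) (%i. r (h i))" using I sum.reindex_bij_betw[OF h, of "%i. r i - l i"] by (simp add: interval_family_def)
  from D[OF this] show ?thesis using sum.reindex_bij_betw[OF h, of "%i. norm (f (r i) - f (l i))"] by simp
 qed
 with d show ?thesis by (rule that)
qed

text \<open>
  In the Henstock--Kurzweil integral the exceptional null set is harmless: absolute continuity makes
  the tagged intervals with an exceptional tag contribute little once they lie in a small open set.
\<close>

lemma abs_continuous_has_integral:
 fixes f :: "real => 'a::euclidean_space"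
 assumes ab: "a <= b" and f: "abs_continuous_curve a b f"
  and D: "AE t in lebesgue. t : {a..b} --> (f has_vderiv v t) (at t)"
 shows "(v has_integral (f b - f a)) {a..b}"
proof -
 define E where "E = {t:{a..b}. ~ (f has_vderiv v t) (at t)}"
 have E: "negligible E"
 proof -
  obtain N where N: "{t. ~ (t : {a..b} --> (f has_vderiv v t) (at t))} <= N" "N : null_sets lebesgue" using D unfolding eventually_ae_filter by auto
  hence "negligible N" by (simp add: negligible_iff_null_sets)
  moreover have "E <= N" using N(1) unfolding E_def by auto
  ultimately show ?thesis using negligible_subset by blast
 qed
 define w where "w t = (if t : E then 0 else v t)" for t
 have "(w has_integral (f b - f a)) {a..b}"
 proof (cases "a = b")
  case False
  hence ab': "a < b" using ab by simp
  show ?thesis unfolding has_integral_factor_content_real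
  proof (intro allI impI)
   fix e :: real assume e: "e > 0"
   define e2 where "e2 = e * (b - a) / 2"
   have e2: "e2 > 0" using e ab' by (simp add: e2_def)
   obtain delta where d: "delta > 0" and
    AC: "!!(I::(real * real set) set) l r. interval_family a b delta I l r ==> (SUM i:I. norm (f (r i) - f (l i))) < e2"
    using abs_continuousE[OF f e2, where 'i = "real * real set"] by metis
   obtain U where U: "open U" "E <= U" "U - E : lmeasurable" "emeasure lebesgue (U - E) < ennreal delta"
    using sets_lebesgue_outer_open[OF negligible_imp_sets[OF E] d] by metis
   have Um: "U : lmeasurable" "measure lebesgue U < delta"
   proof -
    have UE: "U = (U - E) Un E" using U by auto
    show "U : lmeasurable" by (subst UE) (intro fmeasurable.Un U(3) negligible_imp_measurable[OF E])
    have "measure lebesgue (U - E) < delta" using U(3,4) d by (simp add: emeasure_eq_measure2 ennreal_less_iff)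
    moreover have "measure lebesgue (U - E) = measure lebesgue U"
     using U(3) E by (simp add: \<open>U : lmeasurable\<close> fmeasurableD measure_Diff_null_set negligible_iff_null_sets)
    ultimately show "measure lebesgue U < delta" by simp
   qed
   have "ALL t:{a..b} - E. EX eta. eta > 0 & (ALL y. abs (y - t) < eta --> norm (f y - f t - (y - t) *R v t) <= (e/2) * abs (y - t))"
   proof
    fix t assume "t : {a..b} - E"
    hence "(f has_vderiv v t) (at t)" by (auto simp: E_def)
    hence "(f has_derivative (%h. h *R v t)) (at t)" by (simp add: has_vector_derivative_def)
    thus "EX eta. eta > 0 & (ALL y. abs (y - t) < eta --> norm (f y - f t - (y - t) *R v t) <= (e/2) * abs (y - t))"
     unfolding has_derivative_at_alt using e half_gt_zero[OF e] by (metis real_norm_def)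
   qed
   from bchoice[OF this] obtain eta where eta0: "ALL t:{a..b} - E. eta t > 0 & (ALL y. abs (y - t) < eta t --> norm (f y - f t - (y - t) *R v t) <= (e/2) * abs (y - t))" ..
   have eta: "!!t. t : {a..b} ==> t ~: E ==> eta t > 0"
    "!!t y. t : {a..b} ==> t ~: E ==> abs (y - t) < eta t ==> norm (f y - f t - (y - t) *R v t) <= (e/2) * abs (y - t)" using eta0 by auto
   define g where "g t = (if t : E then U else if t : {a..b} then ball t (eta t) else ball t 1)" for t
   have "gauge g" unfolding gauge_def g_def using U eta(1) by auto
   moreover have "norm ((SUM (x, k):p. measure lborel k *R w x) - (f b - f a)) <= e * measure lborel {a..b}" if p: "p tagged_division_of {a..b}" and fine: "g fine p" for p
   proof -
    note P = tagged_division_ofD[OF p]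
    have fin: "finite p" by (rule P(1))
    have int: "EX l r. k = {l..r} & l <= x & x <= r & a <= l & r <= b" if xk: "(x,k) : p" for x k
    proof -
     obtain l r where lr: "k = cbox l r" using P(4)[OF xk] by blast
     have "x : k" "k <= {a..b}" using P(2,3)[OF xk] by auto
     thus ?thesis using lr by auto
    qed
    define L where "L i = Inf (snd i :: real set)" for i :: "real * real set"
    define R where "R i = Sup (snd i :: real set)" for i :: "real * real set"
    have LR: "k = {L (x,k)..R (x,k)}" "L (x,k) <= x" "x <= R (x,k)" "a <= L (x,k)" "R (x,k) <= b"
      "measure lborel k = R (x,k) - L (x,k)" if xk: "(x,k) : p" for x k
    proof -
     obtain l r where lr: "k = {l..r}" "l <= x" "x <= r" "a <= l" "r <= b" using int[OF xk] by blast
     hence "L (x,k) = l" "R (x,k) = r" by (auto simp: L_def R_def)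
     thus "k = {L (x,k)..R (x,k)}" "L (x,k) <= x" "x <= R (x,k)" "a <= L (x,k)" "R (x,k) <= b"
      "measure lborel k = R (x,k) - L (x,k)" using lr by auto
    qed
    define p1 where "p1 = {i:p. fst i : E}"
    have p1: "finite p1" "p1 <= p" using fin by (auto simp: p1_def)
    have kset: "EX l r. k = {l..r}" if k: "k : snd ` p1" for k
    proof -
     obtain x where "(x,k) : p" using k p1(2) by auto
     thus ?thesis using LR(1) by blast
    qed
    have p1t: "p1 tagged_partial_division_of {a..b}" by (rule tagged_partial_division_subset[OF _ p1(2)]) (use p in "simp add: tagged_division_of_def")
    have "f b - f a = (SUM (x,K):p. f (Sup K) - f (Inf K))" using additive_tagged_division_1[OF ab p, of f] by simp
    also have "... = (SUM i:p. f (R i) - f (L i))" by (rule sum.cong) (auto simp: L_def R_def)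
    finally have "(SUM (x, k):p. measure lborel k *R w x) - (f b - f a) = (SUM i:p. measure lborel (snd i) *R w (fst i) - (f (R i) - f (L i)))"
     by (simp add: sum_subtractf case_prod_beta)
    also have "norm ... <= (SUM i:p. norm (measure lborel (snd i) *R w (fst i) - (f (R i) - f (L i))))" by (rule norm_sum)
    also have "... = (SUM i:p1. norm (measure lborel (snd i) *R w (fst i) - (f (R i) - f (L i))))
      + (SUM i:p - p1. norm (measure lborel (snd i) *R w (fst i) - (f (R i) - f (L i))))" using sum.subset_diff[OF p1(2) fin] by (simp add: add.commute)
    also have "(SUM i:p1. norm (measure lborel (snd i) *R w (fst i) - (f (R i) - f (L i)))) = (SUM i:p1. norm (f (R i) - f (L i)))"
     by (rule sum.cong) (auto simp: p1_def w_def norm_minus_commute)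
    also have "... < e2"
    proof (rule AC[OF interval_familyI[OF p1(1)]])
     show "a <= L i & L i <= R i & R i <= b" if "i : p1" for i
     proof -
      have "(fst i, snd i) : p" using that p1(2) by auto
      from LR(2-5)[OF this] show ?thesis by simp
     qed
     show "{L i<..<R i} Int {L j<..<R j} = {}" if "i : p1" "j : p1" "i ~= j" for i j
     proof -
      have ip: "(fst i, snd i) : p" "(fst j, snd j) : p" using that p1 by auto
      have dj: "interior (snd i) Int interior (snd j) = {}" using P(5)[OF ip] that(3) by (simp add: prod_eq_iff)
      have se: "snd i = {L i..R i}" "snd j = {L j..R j}" by (rule LR(1)[OF ip(1), unfolded prod.collapse] LR(1)[OF ip(2), unfolded prod.collapse])+
      show ?thesis using dj unfolding se interior_atLeastAtMost_real .
     qed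
     have "(SUM i:p1. R i - L i) = (SUM (x,k):p1. measure lborel k)" by (rule sum.cong) (use LR(6) p1(2) in auto)
     also have "... = (SUM k:snd ` p1. measure lborel k)"
     proof (rule sum.over_tagged_division_lemma)
      show "p1 tagged_division_of \<Union>(snd ` p1)" by (rule tagged_partial_division_of_Union_self[OF p1t])
      show "measure lborel (cbox u v) = 0" if "box u v = {}" for u v :: real using that by (simp add: content_eq_0_interior)
     qed
     also have "... = measure lebesgue (\<Union>(snd ` p1))"
     proof -
      have "(snd ` p1) division_of \<Union>(snd ` p1)" by (rule division_of_tagged_division[OF tagged_partial_division_of_Union_self[OF p1t]])
      from content_division[OF this] have "(SUM k:snd ` p1. measure lebesgue k) = measure lebesgue (\<Union>(snd ` p1))" .
      moreover have "measure lebesgue k = measure lborel k" if "k : snd ` p1" for k using kset[OF that] by (auto simp: measure_completion)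
      ultimately show ?thesis by simp
     qed
     also have "... <= measure lebesgue U"
     proof (rule measure_mono_fmeasurable[OF _ _ Um(1)])
      show "\<Union>(snd ` p1) <= U" using fine unfolding p1_def fine_def g_def by fastforce
      show "\<Union>(snd ` p1) : sets lebesgue" using p1(1) kset by (intro sets.finite_Union) fastforce+
     qed
     also have "... < delta" by (rule Um)
     finally show "(SUM i:p1. R i - L i) < delta" .
    qed
    also have "(SUM i:p - p1. norm (measure lborel (snd i) *R w (fst i) - (f (R i) - f (L i)))) <= (SUM i:p - p1. (e/2) * measure lborel (snd i))"
    proof (rule sum_mono)
     fix i assume i: "i : p - p1"
     obtain x k where xk: "i = (x,k)" by fastforce
     have ip: "(x,k) : p" and xE: "x ~: E" using i by (auto simp: p1_def xk)
     note L = LR[OF ip]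
     have xab: "x : {a..b}" using L by auto
     have "k <= ball x (eta x)" using fine ip xE xab unfolding fine_def g_def by fastforce
     moreover have "L (x,k) : k" "R (x,k) : k" using L(1-3) by (metis atLeastAtMost_iff order.trans order_refl)+
     ultimately have "abs (L (x,k) - x) < eta x" "abs (R (x,k) - x) < eta x" by (auto simp: dist_real_def subset_eq abs_minus_commute)
     from eta(2)[OF xab xE this(1)] eta(2)[OF xab xE this(2)]
     have 1: "norm (f (L (x,k)) - f x - (L (x,k) - x) *R v x) <= e/2 * (x - L (x,k))"
       "norm (f (R (x,k)) - f x - (R (x,k) - x) *R v x) <= e/2 * (R (x,k) - x)" using L(2,3) by auto
     have "measure lborel k *R w x - (f (R (x,k)) - f (L (x,k))) = (f (L (x,k)) - f x - (L (x,k) - x) *R v x) - (f (R (x,k)) - f x - (R (x,k) - x) *R v x)"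
      using xE by (simp add: L(6) w_def algebra_simps)
     also have "norm ... <= e/2 * (x - L (x,k)) + e/2 * (R (x,k) - x)" by (rule order_trans[OF norm_triangle_ineq4 add_mono[OF 1]])
     also have "... = e/2 * measure lborel k" unfolding L(6) by (simp add: algebra_simps)
     finally show "norm (measure lborel (snd i) *R w (fst i) - (f (R i) - f (L i))) <= (e/2) * measure lborel (snd i)" by (simp add: xk)
    qed
    also have "... <= (SUM i:p. (e/2) * measure lborel (snd i))" using fin e by (intro sum_mono2) auto
    also have "... = (e/2) * (SUM (x,k):p. measure lborel k)" by (simp add: sum_distrib_left case_prod_beta)
    also have "... = (e/2) * measure lborel {a..b}" using additive_content_tagged_division[of p a b] p by simp
    finally show ?thesis using ab by (simp add: e2_def algebra_simps)
   qed
   ultimately show "EX d. gauge d & (ALL p. p tagged_division_of {a..b} & d fine p -->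
     norm ((SUM (x, k):p. measure lborel k *R w x) - (f b - f a)) <= e * measure lborel {a..b})" by (intro exI[of _ g] conjI allI impI) (assumption, elim conjE, assumption)
  qed
 qed (simp add: has_integral_refl(2))
 thus ?thesis by (rule has_integral_spike[OF E, rotated]) (auto simp: w_def)
qed

definition variation_le :: "(real => real) => real => bool" where
 "variation_le G V \<longleftrightarrow> (ALL F :: (real * real) set. finite F --> (ALL i:F. fst i <= snd i) -->
   pairwise (%i j. disjnt {fst i..snd i} {fst j..snd j}) F --> (SUM i:F. abs (G (snd i) - G (fst i))) <= V)"

definition steep_set :: "(real => real) => real => real set" where
 "steep_set G k = \<Union>{{c<..<d} |c d. c < d & k * (d - c) < abs (G d - G c)}"

lemma open_steep_set: "open (steep_set G k)" unfolding steep_set_def by (rule open_Union) auto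

lemma mem_steep_setI:
 assumes G: "continuous_on UNIV G" and cd: "c < d" "k * (d - c) < abs (G d - G c)" and x: "c <= x" "x <= d"
 shows "x : steep_set G k"
proof -
 define h where "h e = abs (G (d + e) - G (c - e)) - k * (d - c + 2 * e)" for e
 have Gi: "isCont G y" for y using G by (simp add: continuous_on_eq_continuous_at)
 have "isCont (%e. G (d + e)) 0" by (rule isCont_o2[OF _ Gi]) (intro continuous_intros)
 moreover have "isCont (%e. G (c - e)) 0" by (rule isCont_o2[OF _ Gi]) (intro continuous_intros)
 ultimately have hc: "isCont h 0" unfolding h_def by (intro continuous_intros)
 have "h 0 > 0" using cd by (simp add: h_def)
 hence "\<forall>\<^sub>F e in at 0. h e > 0" using hc unfolding isCont_def by (rule order_tendstoD(1)[rotated])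
 then obtain r where r: "r > 0" "!!e. e ~= 0 ==> abs e < r ==> h e > 0" unfolding eventually_at by (auto simp: dist_real_def)
 have "h (r/2) > 0" using r(2)[of "r/2"] r(1) by auto
 hence "k * ((d + r/2) - (c - r/2)) < abs (G (d + r/2) - G (c - r/2))" by (simp add: h_def algebra_simps)
 thus ?thesis unfolding steep_set_def using x r cd by (intro UnionI[of "{c - r/2<..<d + r/2}"]) (force, auto)
qed

text \<open>The weak-type maximal inequality, by the Vitali covering lemma.\<close>

lemma measure_steep_set:
 assumes V: "variation_le G V" and k: "k > 0"
 shows "steep_set G k : lmeasurable & measure lebesgue (steep_set G k) <= 5 * V / k"
proof -
 define K where "K = {i :: real * real. fst i < snd i & k * (snd i - fst i) < abs (G (snd i) - G (fst i))}"
 define a where "a i = (fst i + snd i) / 2" for i :: "real * real"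
 define r where "r i = (snd i - fst i) / 2" for i :: "real * real"
 have cb: "cball (a i) (t * r i) = {a i - t * r i..a i + t * r i}" for i t by (auto simp: cball_def dist_real_def)
 have cb1: "cball (a i) (r i) = {fst i..snd i}" for i using cb[of i 1] by (auto simp: a_def r_def field_simps)
 have single: "abs (G (snd i) - G (fst i)) <= V" if "fst i <= snd i" for i using V[unfolded variation_le_def, rule_format, of "{i}"] that by auto
 have sub: "steep_set G k <= (UN i:K. cball (a i) (r i))" unfolding cb1 by (force simp: steep_set_def K_def)
 have rb: "0 < r i & r i <= V / (2 * k)" if "i : K" for i using that single[of i] k by (auto simp: K_def r_def field_simps)
 obtain C where C: "countable C" "C <= K"
   "pairwise (%i j. disjnt (cball (a i) (r i)) (cball (a j) (r j))) C"
   "steep_set G k <= (UN i:C. cball (a i) (5 * r i))" by (rule Vitali_covering_lemma_cballs[OF sub rb])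
 have m: "measure lebesgue (UN i:F. cball (a i) (5 * r i)) <= 5 * V / k" if F: "F <= C" "finite F" for F
 proof -
  have "measure lebesgue (UN i:F. cball (a i) (5 * r i)) <= (SUM i:F. measure lebesgue (cball (a i) (5 * r i)))" by (rule measure_UNION_le[OF F(2)]) auto
  also have "... = (SUM i:F. 5 * (snd i - fst i))"
  proof (rule sum.cong[OF refl])
   fix i assume "i : F"
   hence "0 < r i" using rb F C by blast
   thus "measure lebesgue (cball (a i) (5 * r i)) = 5 * (snd i - fst i)" unfolding cb by (simp add: r_def field_simps)
  qed
  also have "... <= (SUM i:F. 5 / k * abs (G (snd i) - G (fst i)))"
  proof (rule sum_mono)
   fix i assume "i : F"
   hence "i : K" using F C by blast
   thus "5 * (snd i - fst i) <= 5 / k * abs (G (snd i) - G (fst i))" using k by (auto simp: K_def field_simps)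
  qed
  also have "... = 5 / k * (SUM i:F. abs (G (snd i) - G (fst i)))" by (simp add: sum_distrib_left)
  also have "(SUM i:F. abs (G (snd i) - G (fst i))) <= V"
  proof (rule V[unfolded variation_le_def, THEN spec, THEN mp, THEN mp, THEN mp, OF F(2)])
   show "ALL i:F. fst i <= snd i" using F C by (auto simp: K_def)
   show "pairwise (%i j. disjnt {fst i..snd i} {fst j..snd j}) F" using C(3) F(1) unfolding cb1 by (rule pairwise_subset)
  qed
  finally show ?thesis using k by (simp add: divide_right_mono)
 qed
 have meas: "(UN i:C. cball (a i) (5 * r i)) : lmeasurable" by (rule fmeasurable_UN_bound[OF C(1) _ m]) auto
 have le: "measure lebesgue (UN i:C. cball (a i) (5 * r i)) <= 5 * V / k" by (rule measure_UN_bound[OF C(1) _ m]) auto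
 have st: "steep_set G k : sets lebesgue" using open_steep_set lebesgue_openin by (simp add: borel_open)
 have "steep_set G k : lmeasurable" by (rule fmeasurableI2[OF meas C(4) st])
 moreover have "measure lebesgue (steep_set G k) <= measure lebesgue (UN i:C. cball (a i) (5 * r i))" by (rule measure_mono_fmeasurable[OF C(4) st meas])
 ultimately show ?thesis using le by simp
qed

section \<open>Almost everywhere differentiability of Lipschitz functions of a real variable\<close>

definition outer :: "real set => real" where
 "outer E = Inf {measure lebesgue O' |O'. open O' & E <= O' & O' : lmeasurable}"

lemma outer_le: "open U ==> E <= U ==> U : lmeasurable ==> outer E <= measure lebesgue U" unfolding outer_def by (rule cInf_lower) (blast, auto intro!: bdd_belowI[of _ 0])

lemma outer_le_lmeasurable:
 assumes "E <= S" "S : lmeasurable"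
 shows "outer E <= measure lebesgue S"
proof (rule field_le_epsilon)
 fix e :: real assume e: "e > 0"
 obtain T where T: "open T" "S <= T" "(T - S) : lmeasurable" "emeasure lebesgue (T - S) < ennreal e" using sets_lebesgue_outer_open[OF fmeasurableD[OF assms(2)] e] by metis
 have TS: "T = S Un (T - S)" using T by auto
 have Tm: "T : lmeasurable" by (subst TS) (intro fmeasurable.Un assms T)
 have "measure lebesgue (T - S) < e" using T(3,4) e by (simp add: emeasure_eq_measure2 ennreal_less_iff)
 moreover have "measure lebesgue T <= measure lebesgue S + measure lebesgue (T - S)" by (subst TS) (intro measure_Un_le fmeasurableD assms T)
 ultimately show "outer E <= measure lebesgue S + e" using outer_le[of T E] T(1,2) assms(1) Tm by (meson add_left_mono less_imp_le order_trans)
qed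

text \<open>
  If a strictly increasing function stretches arbitrarily small intervals around each point of a set by
  a factor of at most \<open>q\<close>, a Vitali cover shows that it stretches the outer measure by at most \<open>q\<close>.
\<close>

lemma outer_image_le:
 fixes F :: "real => real"
 assumes mono: "!!x y. x < y ==> F x < F y"
  and cont: "continuous_on UNIV F"
  and lip: "!!x y. abs (F x - F y) <= B * abs (x - y)"
  and q: "q >= 0"
  and E: "E <= U0" "U0 : lmeasurable" "open U0"
  and small: "!!x delta. x : E ==> delta > 0 ==> EX c d. c < d & d - c < delta & c <= x & x <= d & F d - F c <= q * (d - c)"
 shows "outer (F ` E) <= q * outer E"
proof -
 have *: "outer (F ` E) <= q * measure lebesgue U" if U: "open U" "E <= U" "U : lmeasurable" for U
 proof -
  define K where "K = {i :: real * real. fst i < snd i & {fst i..snd i} <= U & F (snd i) - F (fst i) <= q * (snd i - fst i)}"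
  define a where "a i = (fst i + snd i) / 2" for i :: "real * real"
  define r where "r i = (snd i - fst i) / 2" for i :: "real * real"
  have cb1: "cball (a i) (r i) = {fst i..snd i}" for i by (auto simp: cball_def dist_real_def a_def r_def field_simps abs_if)
  have r: "0 < r i" if "i : K" for i using that by (auto simp: K_def r_def)
  have fine: "EX i. i : K & x : cball (a i) (r i) & r i < d" if x: "x : E" and d: "0 < d" for x d
  proof -
   obtain e where e: "e > 0" "cball x e <= U" using U x open_contains_cball by (metis subsetD)
   obtain c c' where c: "c < c'" "c' - c < min d e" "c <= x" "x <= c'" "F c' - F c <= q * (c' - c)" using small[OF x, of "min d e"] d e by auto
   have "{c..c'} <= cball x e" using c by (auto simp: dist_real_def)
   hence "(c,c') : K" using c e by (auto simp: K_def)
   thus ?thesis unfolding cb1 using c by (intro exI[of _ "(c,c')"]) (auto simp: r_def)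
  qed
  obtain C where C: "countable C" "C <= K"
   "pairwise (%i j. disjnt (cball (a i) (r i)) (cball (a j) (r j))) C"
   "negligible (E - (UN i:C. cball (a i) (r i)))" by (rule Vitali_covering_theorem_cballs[OF r fine])
  define N where "N = F ` (E - (UN i:C. cball (a i) (r i)))"
  have N: "negligible N" unfolding N_def
  proof (rule negligible_locally_Lipschitz_image[OF _ C(4)])
   fix x assume "x : E - (UN i:C. cball (a i) (r i))"
   show "EX T B. open T & x : T & (ALL y:(E - (UN i:C. cball (a i) (r i))) Int T. norm (F y - F x) <= B * norm (y - x))"
    by (rule exI[of _ UNIV], rule exI[of _ B]) (use lip in auto)
  qed simp
  have m: "measure lebesgue (UN i:G. {F (fst i)..F (snd i)}) <= q * measure lebesgue U" if G: "G <= C" "finite G" for G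
  proof -
   have GK: "i : K" if "i : G" for i using that G C by blast
   have "measure lebesgue (UN i:G. {F (fst i)..F (snd i)}) <= (SUM i:G. measure lebesgue {F (fst i)..F (snd i)})" by (rule measure_UNION_le[OF G(2)]) auto
   also have "... <= (SUM i:G. q * (snd i - fst i))"
   proof (rule sum_mono)
    fix i assume "i : G"
    hence "i : K" using GK by blast
    thus "measure lebesgue {F (fst i)..F (snd i)} <= q * (snd i - fst i)" using mono[of "fst i" "snd i"] by (auto simp: K_def)
   qed
   also have "... = q * (SUM i:G. measure lebesgue {fst i..snd i})" unfolding sum_distrib_left using GK by (intro sum.cong refl) (force simp: K_def)
   also have "(SUM i:G. measure lebesgue {fst i..snd i}) = measure lebesgue (UN i:G. {fst i..snd i})" by (rule measure_UNION'[OF G(2), symmetric])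
     (auto intro!: pairwise_subset[OF C(3)[unfolded cb1] G(1)])
   also have "... <= measure lebesgue U" by (rule measure_mono_fmeasurable[OF _ _ U(3)]) (use GK G in "auto simp: K_def")
   finally show ?thesis using q by (simp add: mult_left_mono)
  qed
  have meas: "(UN i:C. {F (fst i)..F (snd i)}) : lmeasurable" by (rule fmeasurable_UN_bound[OF C(1) _ m]) auto
  have le: "measure lebesgue (UN i:C. {F (fst i)..F (snd i)}) <= q * measure lebesgue U" by (rule measure_UN_bound[OF C(1) _ m]) auto
  have mle: "x <= y ==> F x <= F y" for x y using mono[of x y] by (cases "x = y") auto
  have "F ` E <= N Un (UN i:C. {F (fst i)..F (snd i)})"
  proof
   fix y assume "y : F ` E"
   then obtain x where x: "x : E" "y = F x" by blast
   show "y : N Un (UN i:C. {F (fst i)..F (snd i)})"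
   proof (cases "EX i:C. x : {fst i..snd i}")
    case True
    then obtain i where "i : C" "fst i <= x" "x <= snd i" by auto
    thus ?thesis using mle[of "fst i" x] mle[of x "snd i"] x(2) by auto
   next
    case False
    hence "y : N" unfolding N_def cb1 using x by blast
    thus ?thesis by blast
   qed
  qed
  hence "outer (F ` E) <= measure lebesgue (N Un (UN i:C. {F (fst i)..F (snd i)}))" by (rule outer_le_lmeasurable) (intro fmeasurable.Un negligible_imp_measurable N meas)
  also have "... <= measure lebesgue N + measure lebesgue (UN i:C. {F (fst i)..F (snd i)})" by (intro measure_Un_le fmeasurableD meas negligible_imp_measurable N)
  also have "measure lebesgue N = 0" using N by (rule negligible_imp_measure0)
  finally show ?thesis using le by simp
 qed
 show ?thesis
 proof (cases "q = 0")
  case True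
  thus ?thesis using *[OF E(3,1,2)] by simp
 next
  case False
  hence q: "q > 0" using q by simp
  have "outer (F ` E) / q <= outer E" unfolding outer_def[of E] by (rule cInf_greatest) (use E q in blast, clarify, use * q in "simp add: divide_le_eq mult.commute")
  thus ?thesis using q by (simp add: field_simps)
 qed
qed

lemma negligible_if_outer_le_0:
 assumes "E <= U0" "U0 : lmeasurable" "open U0" and o: "outer E <= 0"
 shows "negligible E" unfolding negligible_outer
proof (intro allI impI)
 fix e :: real assume "e > 0"
 hence lt: "Inf {measure lebesgue O' |O'. open O' & E <= O' & O' : lmeasurable} < e" using o by (simp add: outer_def)
 have ne: "{measure lebesgue O' |O'. open O' & E <= O' & O' : lmeasurable} ~= {}" using assms by blast
 from cInf_lessD[OF ne lt] obtain x where "x : {measure lebesgue O' |O'. open O' & E <= O' & O' : lmeasurable}" "x < e" by (elim bexE)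
 thus "EX T. E <= T & T : lmeasurable & measure lebesgue T < e" by blast
qed

definition slopes_below :: "(real => real) => real => real => bool" where
 "slopes_below G q x \<longleftrightarrow> (ALL delta>0. EX c d. c < d & d - c < delta & c <= x & x <= d & G d - G c <= q * (d - c))"

definition slopes_above :: "(real => real) => real => real => bool" where
 "slopes_above G q x \<longleftrightarrow> (ALL delta>0. EX c d. c < d & d - c < delta & c <= x & x <= d & q * (d - c) <= G d - G c)"

text \<open>
  A set on which slopes at most \<open>p\<close> and slopes at least \<open>q > p\<close> both occur at all small scales is null:
  its image has at most \<open>p\<close> times its outer measure, and, looking at the inverse function, at least \<open>q\<close> times.
\<close>

lemma negligible_oscillation:
 fixes G :: "real => real"
 assumes G1: "!!x y. x <= y ==> y - x <= G y - G x"
  and G2: "!!x y. x <= y ==> G y - G x <= B * (y - x)"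
  and pq: "0 < p" "p < q"
 shows "negligible {x. -n < x & x < n & slopes_below G p x & slopes_above G q x}" (is "negligible ?E")
proof -
 have B: "B >= 1" using G1[of 0 1] G2[of 0 1] by simp
 have lip: "abs (G x - G y) <= B * abs (x - y)" for x y using G2[of x y] G2[of y x] G1[of x y] G1[of y x] by (cases "x <= y") (auto simp: abs_if algebra_simps)
 have mono: "G x < G y" if "x < y" for x y using G1[of x y] that by auto
 have cont: "continuous_on UNIV G" by (rule lipschitz_on_continuous_on[of B]) (use B lip in "auto intro!: lipschitz_onI simp: dist_real_def")
 have inj: "inj G" by (rule injI) (metis mono less_irrefl linorder_neqE)
 have surj: "EX x. G x = y" for y
 proof -
  define r where "r = abs (y - G 0)"
  have "G (- r) <= y" "y <= G r" using G1[of "-r" 0] G1[of 0 r] by (auto simp: r_def)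
  then obtain x where "- r <= x & x <= r & G x = y" using IVT'[of G "-r" y r] cont continuous_on_subset r_def by (metis abs_ge_zero neg_le_0_iff_le order_trans subset_UNIV)
  thus ?thesis by blast
 qed
 define H where "H = inv G"
 have GH: "G (H y) = y" for y unfolding H_def using surj[of y] by (metis f_inv_into_f rangeI)
 have HG: "H (G x) = x" for x unfolding H_def using inj by simp
 have H1: "0 < H y - H x & H y - H x <= y - x" if "x < y" for x y
 proof -
  have "H x < H y"
  proof (rule ccontr)
   assume "~ H x < H y"
   hence "G (H y) <= G (H x)" using mono[of "H y" "H x"] by (cases "H x = H y") auto
   thus False using that by (simp add: GH)
  qed
  thus ?thesis using G1[of "H x" "H y"] by (simp add: GH)
 qed
 have Hlip: "abs (H x - H y) <= 1 * abs (x - y)" for x y using H1[of x y] H1[of y x] by (cases x y rule: linorder_cases) auto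
 have Hcont: "continuous_on UNIV H" by (rule lipschitz_on_continuous_on[of 1]) (use Hlip in "auto intro!: lipschitz_onI simp: dist_real_def")
 have E0: "?E <= {-n<..<n}" by auto
 have s1: "EX c d. c < d & d - c < delta & c <= x & x <= d & G d - G c <= p * (d - c)" if "x : ?E" "delta > 0" for x delta using that by (auto simp: slopes_below_def)
 have o1: "outer (G ` ?E) <= p * outer ?E" by (rule outer_image_le[OF mono cont lip _ E0 _ _ s1]) (use pq in auto)
 have E1: "G ` ?E <= {G (-n)<..<G n}" using mono by auto
 have s2: "EX c d. c < d & d - c < delta & c <= y & y <= d & H d - H c <= (1/q) * (d - c)" if y: "y : G ` ?E" "delta > 0" for y delta
 proof -
  obtain x where x: "x : ?E" "y = G x" using y by blast
  have "delta / B > 0" using y B by auto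
  then obtain c d where cd: "c < d" "d - c < delta / B" "c <= x" "x <= d" "q * (d - c) <= G d - G c" using x(1) by (auto simp: slopes_above_def)
  have "G d - G c <= B * (d - c)" using G2 cd by simp
  also have "... < delta" using cd(2) B by (simp add: field_simps)
  finally have "G d - G c < delta" .
  moreover have "G c < G d" "G c <= y" "y <= G d" using mono[OF cd(1)] G1[OF cd(3)] G1[OF cd(4)] cd x by auto
  moreover have "H (G d) - H (G c) <= (1/q) * (G d - G c)" using cd(5) pq by (simp add: HG field_simps)
  ultimately show ?thesis by blast
 qed
 have o2: "outer (H ` G ` ?E) <= (1/q) * outer (G ` ?E)" by (rule outer_image_le[OF _ Hcont Hlip _ E1 _ _ s2]) (use pq H1 in auto)
 have "H ` G ` ?E = ?E" by (force simp: image_iff HG)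
 with o2 have "q * outer ?E <= outer (G ` ?E)" using pq by (simp add: field_simps)
 with o1 have "(q - p) * outer ?E <= 0" by (simp add: algebra_simps)
 hence "outer ?E <= 0" using pq by (simp add: mult_le_0_iff)
 thus ?thesis by (rule negligible_if_outer_le_0[OF E0, rotated 2]) auto
qed

text \<open>
  With \<open>(L + 1) * x\<close> added, all slopes lie between \<open>1\<close> and \<open>2 * L + 1\<close>. Where the difference quotients
  have no limit, two rational numbers separate slopes that occur at arbitrarily small scales.
\<close>

theorem lipschitz_differentiable_ae:
 fixes F :: "real => real"
 assumes lip: "!!x y. abs (F x - F y) <= L * abs (x - y)"
 shows "negligible {x. ~ F differentiable (at x)}"
proof -
 define G where "G x = F x + (L + 1) * x" for x
 define B where "B = 2 * L + 1"
 have G1: "y - x <= G y - G x" and G2: "G y - G x <= B * (y - x)" if "x <= y" for x y using lip[of y x] that by (auto simp: G_def B_def algebra_simps abs_if split: if_splits)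
 define S where "S = (%(p, q, n). if 0 < p & p < q then {x. - real n < x & x < real n & slopes_below G p x & slopes_above G q x} else {})"
 define A where "A = (UN i:\<rat> \<times> \<rat> \<times> (UNIV::nat set). S i)"
 have "negligible A" unfolding A_def
 proof (rule negligible_countable_Union)
  show "countable (S ` (\<rat> \<times> \<rat> \<times> (UNIV::nat set)))" by (intro countable_image countable_SIGMA countable_rat) auto
  fix T assume "T : S ` (\<rat> \<times> \<rat> \<times> (UNIV::nat set))"
  thus "negligible T" using negligible_oscillation[OF G1 G2] by (auto simp: S_def)
 qed
 moreover have "F differentiable (at x)" if x: "x ~: A" for x
 proof -
  have no: False if "0 < p" "p < q" "p : \<rat>" "q : \<rat>" "slopes_below G p x" "slopes_above G q x" for p q
  proof -
   obtain n where "abs x < real n" using reals_Archimedean2 by blast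
   hence "x : S (p, q, n)" using that by (auto simp: S_def abs_less_iff)
   thus False using x that unfolding A_def by blast
  qed
  define T where "T = {q. slopes_above G q x}"
  have T1: "1 : T" unfolding T_def slopes_above_def mem_Collect_eq
  proof (intro allI impI)
   fix delta :: real assume "delta > 0"
   thus "EX c d. c < d & d - c < delta & c <= x & x <= d & 1 * (d - c) <= G d - G c" using G1[of x "x + delta/2"] by (intro exI[of _ x] exI[of _ "x + delta/2"]) auto
  qed
  have Tb: "q <= B" if q: "q : T" for q
  proof -
   obtain c d where "c < d" and le: "q * (d - c) <= G d - G c" using q unfolding T_def slopes_above_def by (auto dest: spec[of _ 1])
   have "q * (d - c) <= B * (d - c)" using G2[OF less_imp_le[OF \<open>c < d\<close>]] le by linarith
   thus ?thesis using \<open>c < d\<close> by (metis diff_gt_0_iff_gt mult_le_cancel_right_pos)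
  qed
  have bdd: "bdd_above T" using Tb by (auto simp: bdd_above_def)
  define D where "D = Sup T"
  have close: "EX delta>0. ALL c d. c < d & d - c < delta & c <= x & x <= d --> abs (G d - G c - D * (d - c)) <= e * (d - c)" if e: "e > 0" for e
  proof -
   have "D + e ~: T" using cSup_upper[OF _ bdd, of "D+e"] e by (auto simp: D_def)
   then obtain delta1 where d1: "delta1 > 0" "!!c d. c < d ==> d - c < delta1 ==> c <= x ==> x <= d ==> G d - G c < (D + e) * (d - c)"
    unfolding T_def slopes_above_def by force
   have "~ slopes_below G (D - e) x"
   proof
    assume sb: "slopes_below G (D - e) x"
    then obtain c d where "c < d" and le: "G d - G c <= (D - e) * (d - c)" unfolding slopes_below_def by (auto dest: spec[of _ 1])
    have "1 * (d - c) <= (D - e) * (d - c)" unfolding mult_1_left by (rule order_trans[OF G1[OF less_imp_le[OF \<open>c < d\<close>]] le])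
    moreover have "d - c > 0" using \<open>c < d\<close> by simp
     ultimately have De: "1 <= D - e" by (metis mult_le_cancel_right_pos)
    obtain p where p: "p : \<rat>" "D - e < p" "p < D" using Rats_dense_in_real[of "D - e" D] e by auto
    obtain q where q: "q : \<rat>" "p < q" "q < D" using Rats_dense_in_real[of p D] p by auto
    have "EX t:T. q < t" using q(3) T1 less_cSupE[of q T] unfolding D_def by blast
    then obtain t where t: "slopes_above G t x" "q < t" by (auto simp: T_def)
    have "slopes_above G q x" unfolding slopes_above_def
    proof (intro allI impI)
     fix delta :: real assume "delta > 0"
     then obtain c d where cd: "c < d" "d - c < delta" "c <= x" "x <= d" "t * (d - c) <= G d - G c" using t(1) unfolding slopes_above_def by blast
     have "q * (d - c) <= t * (d - c)" using t(2) cd(1) by (intro mult_right_mono) auto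
     from order_trans[OF this cd(5)]
     show "EX c d. c < d & d - c < delta & c <= x & x <= d & q * (d - c) <= G d - G c" using cd(1-4) by blast
    qed
    moreover have "slopes_below G p x" unfolding slopes_below_def
    proof (intro allI impI)
     fix delta :: real assume "delta > 0"
     then obtain c d where cd: "c < d" "d - c < delta" "c <= x" "x <= d" "G d - G c <= (D - e) * (d - c)" using sb unfolding slopes_below_def by blast
     have "(D - e) * (d - c) <= p * (d - c)" using p(2) cd(1) by (intro mult_right_mono) auto
     from order_trans[OF cd(5) this]
     show "EX c d. c < d & d - c < delta & c <= x & x <= d & G d - G c <= p * (d - c)" using cd(1-4) by blast
    qed
    ultimately show False using no[of p q] p q De by auto
   qed
   then obtain delta2 where d2: "delta2 > 0" "!!c d. c < d ==> d - c < delta2 ==> c <= x ==> x <= d ==> (D - e) * (d - c) < G d - G c" unfolding slopes_below_def by force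
   show ?thesis
   proof (intro exI[of _ "min delta1 delta2"] conjI allI impI)
    fix c d assume cd: "c < d & d - c < min delta1 delta2 & c <= x & x <= d"
    show "abs (G d - G c - D * (d - c)) <= e * (d - c)" using d1(2)[of c d] d2(2)[of c d] cd by (simp add: abs_le_iff algebra_simps)
   qed (use d1 d2 in auto)
  qed
  have "(G has_derivative (%h. h *R D)) (at x)" unfolding has_derivative_at_alt
  proof (intro conjI allI impI)
   show "bounded_linear (%h. h *R D)" by (rule bounded_linear_scaleR_left)
   fix e :: real assume "e > 0"
   then obtain delta where d: "delta > 0" "!!c d. c < d ==> d - c < delta ==> c <= x ==> x <= d ==> abs (G d - G c - D * (d - c)) <= e * (d - c)" using close by meson
   show "EX d>0. ALL y. norm (y - x) < d --> norm (G y - G x - (y - x) *R D) <= e * norm (y - x)"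
   proof (intro exI[of _ delta] conjI d allI impI)
    fix y assume y: "norm (y - x) < delta"
    show "norm (G y - G x - (y - x) *R D) <= e * norm (y - x)" using d(2)[of x y] d(2)[of y x] y
     by (cases x y rule: linorder_cases) (auto simp: abs_if algebra_simps split: if_splits)
   qed
  qed
  hence "G differentiable (at x)" by (rule differentiableI)
  hence "(%x. G x - (L + 1) * x) differentiable (at x)" by (intro differentiable_diff) auto
  thus ?thesis by (simp add: G_def)
 qed
 ultimately show ?thesis by (elim negligible_subset) blast
qed

lemma abs_continuous_dominated:
 fixes f :: "real => 'a::real_normed_vector" and g :: "real => 'b::real_normed_vector"
 assumes f: "abs_continuous_curve a b f" and K: "K >= 0"
  and m: "mono_on {a'..b'} phi | antimono_on {a'..b'} phi"
  and lip: "!!x y. x : {a'..b'} ==> y : {a'..b'} ==> x <= y ==> phi x : {a..b} & abs (phi y - phi x) <= y - x & norm (g y - g x) <= K * norm (f (phi y) - f (phi x))"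
 shows "abs_continuous_curve a' b' g" unfolding abs_continuous_iff
proof (intro allI impI)
 fix e :: real assume e: "e > 0"
 hence "e / (K + 1) > 0" using K by simp
 then obtain delta where d: "delta > 0" and
  D: "!!(I::nat set) l r. interval_family a b delta I l r ==> (SUM i:I. norm (f (r i) - f (l i))) < e / (K + 1)" using abs_continuousE[OF f, where 'i = nat] by metis
 have "(SUM i<k. norm (g (r i) - g (l i))) < e" if A: "interval_family a' b' delta {..<k} l r" for k :: nat and l r
 proof -
  define l' where "l' i = min (phi (l i)) (phi (r i))" for i
  define r' where "r' i = max (phi (l i)) (phi (r i))" for i
  have lr: "l i : {a'..b'}" "r i : {a'..b'}" "l i <= r i" if "i < k" for i using A that by (force simp: interval_family_def)+
  have L: "r' i - l' i <= r i - l i" "a <= l' i & l' i <= r' i & r' i <= b"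
    "norm (g (r i) - g (l i)) <= K * norm (f (r' i) - f (l' i))" if "i < k" for i using lip[OF lr[OF that]] lip[OF lr(2)[OF that] lr(2)[OF that] order_refl]
   by (auto simp: l'_def r'_def min_def max_def norm_minus_commute)
  have "interval_family a b delta {..<k} l' r'"
  proof (rule interval_familyI)
   show "{l' i<..<r' i} Int {l' j<..<r' j} = {}" if ij: "i : {..<k}" "j : {..<k}" "i ~= j" for i j
   proof -
    have "{l i<..<r i} Int {l j<..<r j} = {}" using A ij by (simp add: interval_family_def)
    hence "r i <= l j | r j <= l i | l i = r i | l j = r j" using lr[of i] lr[of j] ij by (auto simp: Int_greaterThanLessThan)
    hence "r' i <= l' j | r' j <= l' i | l' i = r' i | l' j = r' j" using m lr[of i] lr[of j] ij unfolding monotone_on_def l'_def r'_def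
     by (smt (verit) lessThan_iff min_def max_def)
    thus ?thesis by auto
   qed
   have "(SUM i<k. r' i - l' i) <= (SUM i<k. r i - l i)" by (rule sum_mono) (simp add: L)
   thus "(SUM i<k. r' i - l' i) < delta" using A by (simp add: interval_family_def)
  qed (simp_all add: L)
  from D[OF this] have S: "(SUM i<k. norm (f (r' i) - f (l' i))) < e / (K + 1)" .
  have "(SUM i<k. norm (g (r i) - g (l i))) <= K * (SUM i<k. norm (f (r' i) - f (l' i)))" unfolding sum_distrib_left by (rule sum_mono) (simp add: L)
  also have "... <= K * (e / (K + 1))" using S K by (intro mult_left_mono) auto
  also have "... < e" using e K by (simp add: field_simps)
  finally show ?thesis .
 qed
 thus "EX delta>0. ALL (m::nat) l r. interval_family a' b' delta {..<m} l r --> (SUM i<m. norm (g (r i) - g (l i))) < e" using d by blast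
qed

lemma abs_continuous_lipschitz:
 fixes f :: "real => 'a::real_normed_vector"
 assumes lip: "!!x y. norm (f x - f y) <= L * abs (x - y)"
 shows "abs_continuous_curve a b f"
proof (rule abs_continuous_dominated[where phi = "%t. t" and K = L])
 show "abs_continuous_curve a b (%t. t)" unfolding abs_continuous_iff interval_family_def by auto
 show "L >= 0" using order_trans[OF norm_ge_zero lip[of 1 0]] by simp
qed (auto simp: monotone_on_def intro: order_trans[OF lip])

lemma lipschitz_derivative_le:
 fixes F :: "real => real"
 assumes lip: "!!x y. abs (F x - F y) <= L * abs (x - y)" and D: "(F has_real_derivative s) (at x)"
 shows "abs s <= L"
proof -
 have "((%y. abs ((F y - F x) / (y - x))) \<longlongrightarrow> abs s) (at x)" using D unfolding has_field_derivative_iff by (rule tendsto_rabs)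
 moreover have "\<forall>\<^sub>F y in at x. abs ((F y - F x) / (y - x)) <= L" unfolding eventually_at
 proof (intro exI[of _ 1] conjI ballI impI)
  fix y assume "y ~= x & dist y x < 1"
  thus "abs ((F y - F x) / (y - x)) <= L" using lip[of y x] by (simp add: field_simps)
 qed simp
 ultimately show ?thesis by (rule tendsto_upperbound) simp
qed

lemma indicator_has_integral_real:
 assumes "S : lmeasurable"
 shows "((%x. c * indicat_real S x) has_integral c * measure lebesgue S) UNIV" using assms by (intro has_integral_mult_right) (simp only: lmeasurable_iff_has_integral)

text \<open>
  The increments of a Lipschitz function that is constant outside \<open>[a, b]\<close> are integrals of its derivative; so
  the variation is the integral of the modulus of the derivative, which is at most three times the
  integral of the positive part if the total increment is dominated by the positive part.
\<close>

lemma lipschitz_constant_outside: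
 fixes F :: "real => real"
 assumes lip: "!!x y. abs (F x - F y) <= L * abs (x - y)" and ab: "a < b"
  and l: "ALL x<=a. F x = F a" and r: "ALL x>=b. F x = F b"
 shows "EX w N. negligible N & (ALL x. x ~: N --> (F has_real_derivative w x) (at x)) &
   (ALL x. abs (w x) <= L) & (ALL x. x ~: {a..b} --> w x = 0) & w absolutely_integrable_on UNIV & (ALL x y. x <= y --> (w has_integral F y - F x) {x..y})"
proof -
 have L: "L >= 0" using lip[of 1 0] by simp
 define N where "N = {x. ~ F differentiable (at x)} Un {a, b}"
 define w where "w x = (if x : N then 0 else deriv F x)" for x
 have N: "negligible N" unfolding N_def using lipschitz_differentiable_ae[OF lip] by (simp add: negligible_Un)
 have D: "(F has_real_derivative w x) (at x)" if "x ~: N" for x using that by (simp add: N_def w_def DERIV_deriv_iff_real_differentiable)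
 have wL: "abs (w x) <= L" for x using lipschitz_derivative_le[OF lip D] L by (cases "x : N") (auto simp: w_def)
 have w0: "w x = 0" if x: "x ~: {a..b}" for x
 proof (cases "x : N")
  case False
  have "(F has_real_derivative 0) (at x)"
  proof (cases "x < a")
   case True
   show ?thesis
   proof (rule has_field_derivative_transform_within_open[OF DERIV_const[of "F a"], of "{..<a}"])
    show "F a = F y" if "y : {..<a}" for y using l[rule_format, of y] that by simp
   qed (use True in auto)
  next
   case False
   hence "b < x" using x by auto
   show ?thesis
   proof (rule has_field_derivative_transform_within_open[OF DERIV_const[of "F b"], of "{b<..}"])
    show "F b = F y" if "y : {b<..}" for y using r[rule_format, of y] that by simp
   qed (use \<open>b < x\<close> in auto)
  qed
  thus ?thesis using D[OF False] DERIV_unique by blast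
 qed (simp add: w_def)
 have I: "(w has_integral F y - F x) {x..y}" if "x <= y" for x y
 proof (rule abs_continuous_has_integral[OF that abs_continuous_lipschitz[of F L]])
  show "norm (F x - F y) <= L * abs (x - y)" for x y using lip by simp
  show "AE t in lebesgue. t : {x..y} --> (F has_vderiv w t) (at t)" unfolding eventually_ae_filter
   using N D by (intro bexI[of _ N]) (auto simp: negligible_iff_null_sets has_real_derivative_iff_has_vector_derivative)
 qed
 have "w absolutely_integrable_on UNIV"
 proof (rule absolutely_integrable_integrable_bound[of _ _ "%x. if x : {a..b} then L else 0"])
  show "w integrable_on UNIV"
  proof (rule integrable_on_superset[of w "{a..b}"])
   show "w integrable_on {a..b}" using I[of a b] ab by (auto intro: has_integral_integrable)
  qed (use w0 in auto)
  show "(%x. if x : {a..b} then L else 0) integrable_on UNIV" unfolding integrable_restrict_UNIV by (rule integrable_const_ivl)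
 qed (use wL w0 in auto)
 thus ?thesis by (intro exI[of _ w] exI[of _ N] conjI allI impI N D wL w0 I)
qed

lemma variation_le_integral:
 fixes F :: "real => real"
 assumes w: "w absolutely_integrable_on UNIV"
   and I: "!!x y. x <= y ==> (w has_integral F y - F x) {x..y}"
 shows "variation_le F (integral UNIV (%x. abs (w x)))" unfolding variation_le_def
proof (intro allI impI)
 fix A :: "(real * real) set"
 assume A: "finite A" "ALL i:A. fst i <= snd i" "pairwise (%i j. disjnt {fst i..snd i} {fst j..snd j}) A"
 have wi: "(%x. abs (w x)) integrable_on UNIV" using w unfolding absolutely_integrable_on_def by simp
 have ws: "(%x. if x : {c..d} then abs (w x) else 0) integrable_on UNIV" for c d :: real
 proof -
  have "(%x. abs (w x)) integrable_on {c..d}" by (rule integrable_on_subinterval[OF wi]) simp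
  thus ?thesis unfolding integrable_restrict_UNIV .
 qed
 have "(SUM i:A. abs (F (snd i) - F (fst i))) <= (SUM i:A. integral UNIV (%x. if x : {fst i..snd i} then abs (w x) else 0))"
 proof (rule sum_mono)
  fix i assume "i : A"
  hence le: "fst i <= snd i" using A by blast
  have "abs (F (snd i) - F (fst i)) = norm (integral {fst i..snd i} w)" using integral_unique[OF I[OF le]] by simp
  also have "... <= integral {fst i..snd i} (%x. abs (w x))"
  proof (rule integral_norm_bound_integral)
   show "w integrable_on {fst i..snd i}" using I[OF le] by blast
   show "(%x. abs (w x)) integrable_on {fst i..snd i}" by (rule integrable_on_subinterval[OF wi]) simp
  qed simp
  also have "... = integral UNIV (%x. if x : {fst i..snd i} then abs (w x) else 0)" by (rule integral_restrict_UNIV[symmetric])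
  finally show "abs (F (snd i) - F (fst i)) <= integral UNIV (%x. if x : {fst i..snd i} then abs (w x) else 0)" .
 qed
 also have "... = integral UNIV (%x. SUM i:A. if x : {fst i..snd i} then abs (w x) else 0)" by (rule integral_sum[symmetric]) (use A ws in auto)
 also have "... <= integral UNIV (%x. abs (w x))"
 proof (rule integral_le)
  show "(%x. SUM i:A. if x : {fst i..snd i} then abs (w x) else 0) integrable_on UNIV" by (rule integrable_sum) (use A ws in auto)
  show "(SUM i:A. if x : {fst i..snd i} then abs (w x) else 0) <= abs (w x)" for x
  proof (cases "EX i:A. x : {fst i..snd i}")
   case True
   then obtain i where i: "i : A" "x : {fst i..snd i}" by blast
   have "(SUM j:A. if x : {fst j..snd j} then abs (w x) else 0) = (SUM j:A. if j = i then abs (w x) else 0)"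
   proof (rule sum.cong[OF refl])
    fix j assume "j : A"
    hence "j ~= i ==> x ~: {fst j..snd j}" using A(3) i unfolding pairwise_def disjnt_iff by blast
    thus "(if x : {fst j..snd j} then abs (w x) else 0) = (if j = i then abs (w x) else 0)" using i by auto
   qed
   thus ?thesis using A i by simp
  next
   case False
   hence "(SUM j:A. if x : {fst j..snd j} then abs (w x) else 0) = 0" by (intro sum.neutral) auto
   thus ?thesis by simp
  qed
 qed (rule wi)
 finally show "(SUM i:A. abs (F (snd i) - F (fst i))) <= integral UNIV (%x. abs (w x))" .
qed

text \<open>
  A quantitative mean value lemma: besides a large derivative \<open>s\<close> at \<open>tau\<close> it yields control of all the
  increments based at \<open>tau\<close> by \<open>sqrt s\<close>. Were there no such \<open>tau\<close>, the points with derivative about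
  \<open>L / 4 ^ j\<close> would be contained in a set on which the maximal function is at least of order
  \<open>L / 2 ^ j\<close>. By the weak-type inequality these sets would be too small for the positive part of the
  derivative to account for the increment.
\<close>

theorem mean_value_slope:
 fixes F :: "real => real"
 assumes lip: "!!x y. abs (F x - F y) <= L * abs (x - y)" and L: "L > 0" and ab: "a < b"
  and h: "h > 0" "abs (F b - F a) <= h" and cd: "a <= c" "c <= d" "d <= b" "h <= F d - F c"
  and S: "negligible S"
 shows "EX tau s. tau ~: S & h / (8 * (b - a)) <= s & (F has_real_derivative s) (at tau) & a + h / (16 * L) <= tau & tau <= b - h / (16 * L) &
   (ALL t. a <= tau + t --> tau + t <= b --> abs (F (tau + t) - F tau) <= 120 * sqrt (L * s) * abs t)"
proof (rule ccontr)
 assume contr: "~ ?thesis"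
 define G where "G x = F (max a (min b x))" for x
 have Glip: "abs (G x - G y) <= L * abs (x - y)" for x y
 proof -
  have "abs (G x - G y) <= L * abs (max a (min b x) - max a (min b y))" unfolding G_def by (rule lip)
  also have "... <= L * abs (x - y)" using L by (intro mult_left_mono) (auto simp: max_def min_def)
  finally show ?thesis .
 qed
 have GF: "G x = F x" if "a <= x" "x <= b" for x using that by (simp add: G_def)
 have G1: "ALL x<=a. G x = G a" using ab by (simp add: G_def)
 have G2: "ALL x>=b. G x = G b" using ab by (simp add: G_def)
 obtain w N where w: "negligible N" "ALL x. x ~: N --> (G has_real_derivative w x) (at x)"
   "ALL x. abs (w x) <= L" "ALL x. x ~: {a..b} --> w x = 0" "w absolutely_integrable_on UNIV"
   "ALL x y. x <= y --> (w has_integral G y - G x) {x..y}" using lipschitz_constant_outside[OF Glip ab G1 G2] by (elim exE conjE)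
 note w = w(1) w(2-4)[rule_format] w(5) w(6)[rule_format]
 define P where "P = integral UNIV (%x. max (w x) 0)"
 have wi: "w integrable_on UNIV" "(%x. abs (w x)) integrable_on UNIV" using w(5) unfolding absolutely_integrable_on_def by simp_all
 have pe: "max (w x) 0 = (w x + abs (w x)) / 2" for x by (simp add: max_def abs_if)
 have pi: "(%x. max (w x) 0) integrable_on UNIV" unfolding pe by (intro integrable_on_divide integrable_add wi)
 have wab: "integral UNIV w = F b - F a"
 proof -
  have "integral UNIV w = integral UNIV (%x. if x : {a..b} then w x else 0)" by (rule arg_cong[where f = "integral UNIV"]) (use w(4) in auto)
  also have "... = integral {a..b} w" by (rule integral_restrict_UNIV)
  also have "... = G b - G a" using w(6)[of a b] ab by (intro integral_unique) auto
  finally show ?thesis using ab by (simp add: GF)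
 qed
 have "2 * P = F b - F a + integral UNIV (%x. abs (w x))" unfolding P_def pe by (simp add: integral_add[OF wi] wab)
 moreover have Ph: "P >= h"
 proof -
  have "h <= G d - G c" using cd by (simp add: GF)
  also have "... = integral {c..d} w" using w(6)[OF cd(2)] by (simp add: integral_unique)
  also have "... <= integral {c..d} (%x. max (w x) 0)" by (rule integral_le) (use w(6)[OF cd(2)] integrable_on_subinterval[OF pi] in auto)
  also have "... <= P" unfolding P_def by (rule integral_subset_le) (use pi integrable_on_subinterval[OF pi] in auto)
  finally show ?thesis .
 qed
 ultimately have V3: "integral UNIV (%x. abs (w x)) <= 3 * P" using h by linarith
 have Gcont: "continuous_on UNIV G" by (rule lipschitz_on_continuous_on[of L]) (use Glip L in "auto intro!: lipschitz_onI simp: dist_real_def")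
 have V: "variation_le G (3 * P)" using variation_le_integral[OF w(5,6)] V3 unfolding variation_le_def by (meson order_trans)
 define U where "U j = steep_set G (60 * L / 2 ^ j)" for j :: nat
 have U: "U j : lmeasurable" "measure lebesgue (U j) <= P * 2 ^ j / (4 * L)" for j
 proof -
  have k: "60 * L / 2 ^ j > 0" using L by simp
  from measure_steep_set[OF V k]
  show "U j : lmeasurable" "measure lebesgue (U j) <= P * 2 ^ j / (4 * L)" using L by (auto simp: U_def field_simps)
 qed
 define s0 where "s0 = h / (8 * (b - a))"
 have s0: "s0 > 0" using h ab by (simp add: s0_def)
 define bt where "bt = h / (16 * L)"
 have bt: "bt > 0" using h L by (simp add: bt_def)
 obtain J where "L * (1/4) ^ J < s0" using real_arch_pow_inv[of "s0 / L" "1/4"] s0 L by (auto simp: field_simps)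
 hence J: "L / 4 ^ J < s0" by (simp add: power_one_over)
 define R where "R x = s0 * indicat_real {a..b} x + L * indicat_real {a..a+bt} x + L * indicat_real {b-bt..b} x + (SUM j<J. L / 4 ^ j * indicat_real (U j) x)" for x
 have Rn: "0 <= R x" for x unfolding R_def using s0 L by (intro add_nonneg_nonneg sum_nonneg mult_nonneg_nonneg) auto
 have bound: "max (w x) 0 <= R x" if x: "x ~: N" "x ~: S" for x
 proof (cases "x : {a..b} & w x > 0")
  case False
  hence "max (w x) 0 = 0" using w(4)[of x] by (auto simp: max_def)
  thus ?thesis using Rn by simp
 next
  case True
  hence xab: "a <= x" "x <= b" and wx: "w x > 0" by auto
  have sn: "(SUM j<J. L / 4 ^ j * indicat_real (U j) x) >= 0" using L by (intro sum_nonneg mult_nonneg_nonneg) auto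
  consider "w x <= s0" | "x <= a + bt | b - bt <= x" | "w x > s0" "a + bt < x" "x < b - bt" by linarith
  thus ?thesis
  proof cases
   case 1
   thus ?thesis using xab wx sn L s0 by (simp add: R_def indicator_def)
  next
   case 2
   thus ?thesis using xab wx sn L s0 abs_le_D1[OF w(3)[of x]] by (auto simp: R_def indicator_def)
  next
   case 3
   have DG: "(G has_real_derivative w x) (at x)" by (rule w(2)[OF x(1)])
   have D: "(F has_real_derivative w x) (at x)" by (rule has_field_derivative_transform_within_open[OF DG, of "{a<..<b}"])
     (use 3 bt in "auto simp: GF")
   have "EX t. a <= x + t & x + t <= b & ~ abs (F (x + t) - F x) <= 120 * sqrt (L * w x) * abs t" using contr D 3 x(2) unfolding s0_def bt_def by (meson less_imp_le)
   then obtain t where t: "a <= x + t" "x + t <= b" "120 * sqrt (L * w x) * abs t < abs (F (x + t) - F x)" by (auto simp: not_le)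
   define j where "j = (LEAST j. L / 4 ^ (Suc j) < w x)"
   have Jn: "J ~= 0" using J 3 abs_le_D1[OF w(3)[of x]] by (cases J) auto
   then obtain J' where J': "J = Suc J'" by (cases J) auto
   have exj: "L / 4 ^ Suc J' < w x" using J 3 J' by simp
   have j1: "L / 4 ^ (Suc j) < w x" unfolding j_def by (rule LeastI[of "%j. L / 4 ^ (Suc j) < w x", OF exj])
   have jJ: "j < J" using Least_le[of "%j. L / 4 ^ (Suc j) < w x", OF exj] J' by (simp add: j_def)
   have j2: "w x <= L / 4 ^ j"
   proof (cases j)
    case 0
    thus ?thesis using abs_le_D1[OF w(3)[of x]] by simp
   next
    case (Suc i)
    hence "i < (LEAST j. L / 4 ^ (Suc j) < w x)" by (simp add: j_def)
    from not_less_Least[OF this] show ?thesis using Suc by simp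
   qed
   have "60 * L / 2 ^ j <= 120 * sqrt (L * w x)"
   proof -
    have "(L / 2 ^ Suc j)^2 = L * (L / 4 ^ Suc j)" by (simp add: power2_eq_square power_mult_distrib[symmetric])
    also have "... <= L * w x" using j1 L by (intro mult_left_mono) auto
    finally have "L / 2 ^ Suc j <= sqrt (L * w x)" by (rule real_le_rsqrt)
    thus ?thesis by simp
   qed
   hence "60 * L / 2 ^ j * abs t <= 120 * sqrt (L * w x) * abs t" by (rule mult_right_mono) simp
   hence st: "60 * L / 2 ^ j * abs t < abs (G (x + t) - G x)" using t xab by (simp add: GF)
   hence t0: "t ~= 0" by auto
   have "x : U j"
   proof (cases "t > 0")
    case True
    thus ?thesis unfolding U_def by (intro mem_steep_setI[OF Gcont, of x "x + t"]) (use st in auto)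
   next
    case False
    thus ?thesis unfolding U_def using t0 by (intro mem_steep_setI[OF Gcont, of "x + t" x]) (use st in "auto simp: abs_minus_commute")
   qed
   hence "L / 4 ^ j = L / 4 ^ j * indicat_real (U j) x" by simp
   also have "... <= (SUM j<J. L / 4 ^ j * indicat_real (U j) x)" using L jJ by (intro member_le_sum) auto
   finally have "w x <= (SUM j<J. L / 4 ^ j * indicat_real (U j) x)" using j2 by linarith
   moreover have "0 <= s0 * indicat_real {a..b} x" "0 <= L * indicat_real {a..a+bt} x" "0 <= L * indicat_real {b-bt..b} x" using s0 L by auto
   ultimately show ?thesis using wx by (simp add: R_def)
  qed
 qed
 define IR where "IR = s0 * measure lebesgue {a..b} + L * measure lebesgue {a..a+bt} + L * measure lebesgue {b-bt..b} + (SUM j<J. L / 4 ^ j * measure lebesgue (U j))"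
 have RI: "(R has_integral IR) UNIV" unfolding R_def IR_def by (intro has_integral_add has_integral_sum indicator_has_integral_real U lmeasurable_interval finite_lessThan)
 have "P <= integral UNIV R" unfolding P_def
 proof -
  have NS: "negligible (N Un S)" using w(1) S by (rule negligible_Un)
  have e: "integral UNIV (%x. max (w x) 0) = integral UNIV (%x. if x : N Un S then 0 else max (w x) 0)" by (rule integral_spike[OF NS]) auto
  have i: "(%x. if x : N Un S then 0 else max (w x) 0) integrable_on UNIV" by (rule integrable_spike[OF pi NS]) auto
  show "integral UNIV (%x. max (w x) 0) <= integral UNIV R" unfolding e by (rule integral_le[OF i]) (use RI Rn bound in auto)
 qed
 also have "... = IR" using RI by (rule integral_unique)
 also have "... <= h / 8 + h / 16 + h / 16 + P / 2"
 proof -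
  have "s0 * measure lebesgue {a..b} = h / (8 * (b - a)) * (b - a)" using ab by (simp add: s0_def)
  moreover have "h / (8 * D) * D = h / 8" if "D ~= 0" for D using that by simp
  ultimately have "s0 * measure lebesgue {a..b} = h / 8" using ab by (metis diff_gt_0_iff_gt less_irrefl)
  moreover have "L * measure lebesgue {a..a+bt} = h / 16" "L * measure lebesgue {b-bt..b} = h / 16" using bt L by (simp_all add: bt_def)
  moreover have "(SUM j<J. L / 4 ^ j * measure lebesgue (U j)) <= P / 2"
  proof -
   have "(SUM j<J. L / 4 ^ j * measure lebesgue (U j)) <= (SUM j<J. P / 4 * (1/2) ^ j)"
   proof (rule sum_mono)
    fix j
    have "L / 4 ^ j * measure lebesgue (U j) <= L / 4 ^ j * (P * 2 ^ j / (4 * L))" using L U(2) by (intro mult_left_mono) auto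
    also have "... = P / 4 * (2 / 4) ^ j" unfolding power_divide using L by (simp add: field_simps)
    finally show "L / 4 ^ j * measure lebesgue (U j) <= P / 4 * (1/2) ^ j" by simp
   qed
   also have "... = P / 4 * (SUM j<J. (1/2) ^ j)" by (simp add: sum_distrib_left)
   also have "... <= P / 4 * 2" using Ph h by (intro mult_left_mono) (auto simp: sum_gp_strict)
   finally show ?thesis by simp
  qed
  ultimately show ?thesis by (simp add: IR_def)
 qed
 finally show False using Ph h by linarith
qed

section \<open>Preliminaries on smooth maps and differential equations\<close>

lemma C_k_derivative:
 assumes f: "smooth f" 
 shows "(f has_derivative frechet_derivative f (at x)) (at x)"
  and "smooth (%x. frechet_derivative f (at x) v)"
proof -
 have *: "C_k (Suc k) f" for k using f by (simp only: smooth_def)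
 have fd: "f' = (%x. frechet_derivative f (at x))" if "ALL x. (f has_derivative f' x) (at x)" for f' using that frechet_derivative_at by blast
 have ex: "EX f'. (ALL x. (f has_derivative f' x) (at x)) & (ALL v. C_k k (%x. f' x v))" for k using *[of k] by simp
 have **: "(ALL x. (f has_derivative frechet_derivative f (at x)) (at x)) & (ALL v. C_k k (%x. frechet_derivative f (at x) v))" for k
 proof -
  obtain f' where f': "ALL x. (f has_derivative f' x) (at x)" "ALL v. C_k k (%x. f' x v)" using ex[of k] by (elim exE conjE)
  have e: "f' = (%x. frechet_derivative f (at x))" by (rule fd) (rule f'(1))
  show ?thesis using f' unfolding e by blast
 qed
 show "(f has_derivative frechet_derivative f (at x)) (at x)" using ** by blast
 show "smooth (%x. frechet_derivative f (at x) v)" unfolding smooth_def using ** by blast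
qed

lemma smooth_continuous: "smooth f ==> continuous_on S f" unfolding smooth_def by (metis C_k.simps(1) continuous_on_subset subset_UNIV)

lemma linear_bound_by_Basis:
 fixes g :: "'a::euclidean_space => 'b::real_normed_vector"
 assumes g: "linear g"
 shows "norm (g w) <= norm w * (SUM b:Basis. norm (g b))"
proof -
 have "g w = g (SUM b:Basis. (w *. b) *R b)" by (simp add: euclidean_representation)
 also have "... = (SUM b:Basis. (w *. b) *R g b)" using g by (simp add: linear_sum linear_scale)
 also have "norm ... <= (SUM b:Basis. norm w * norm (g b))" by (intro order_trans[OF norm_sum] sum_mono) (auto intro!: mult_right_mono Basis_le_norm)
 finally show ?thesis by (simp add: sum_distrib_left)
qed

lemma smooth_lipschitz_on_cball:
 fixes f :: "'a::euclidean_space => 'b::euclidean_space"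
 assumes f: "smooth f"
 shows "EX K>=0. ALL x y. norm x <= R --> norm y <= R --> norm (f x - f y) <= K * norm (x - y)"
proof (cases "R >= 0")
 case True
 let ?f' = "%x. frechet_derivative f (at x)"
 have "continuous_on (cball 0 R) (%x. SUM b:Basis. norm (?f' x b))" by (intro continuous_intros smooth_continuous C_k_derivative f)
 hence "compact ((%x. SUM b:Basis. norm (?f' x b)) ` cball 0 R)" by (rule compact_continuous_image) simp
 hence "bounded ((%x. SUM b:Basis. norm (?f' x b)) ` cball 0 R)" by (rule compact_imp_bounded)
 then obtain K where "ALL x:cball 0 R. abs (SUM b:Basis. norm (?f' x b)) <= K" unfolding bounded_iff by auto
 hence K: "abs (SUM b:Basis. norm (?f' x b)) <= K" if "norm x <= R" for x using that by simp
 have K0: "K >= 0" using K[of 0] True by simp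
 have "norm (f x - f y) <= K * norm (x - y)" if "norm x <= R" "norm y <= R" for x y
 proof (rule differentiable_bound[of "cball 0 R" f ?f'])
  fix z :: 'a assume z: "z : cball 0 R"
  show "(f has_derivative ?f' z) (at z within cball 0 R)" using C_k_derivative(1)[OF f] has_derivative_at_withinI by blast
  show "onorm (?f' z) <= K"
  proof (rule onorm_le)
   fix w
   have "norm (?f' z w) <= norm w * (SUM b:Basis. norm (?f' z b))" by (rule linear_bound_by_Basis) (use C_k_derivative(1)[OF f] has_derivative_linear in blast)
   also have "... <= norm w * K" using K[of z] z by (intro mult_left_mono) auto
   finally show "norm (?f' z w) <= K * norm w" by (simp add: mult.commute)
  qed
 qed (use that in auto)
 thus ?thesis using K0 by blast
next
 case False
 show ?thesis
 proof (intro exI[of _ 0] conjI allI impI)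
  fix x y :: 'a assume "norm x <= R"
  thus "norm (f x - f y) <= 0 * norm (x - y)" using False norm_ge_zero[of x] by linarith
 qed simp
qed

lemma ode_unique:
 fixes y z :: "real => 'a::euclidean_space"
 assumes f: "!!R. EX K>=0. ALL x y. norm x <= R --> norm y <= R --> norm (f x - f y) <= K * norm (x - y)"
  and y: "!!t. (y has_vderiv f (y t)) (at t)"
  and z: "!!t. (z has_vderiv f (z t)) (at t)"
  and 0: "y 0 = z 0" and t: "t >= 0"
 shows "y t = z t"
proof -
 have cy: "continuous_on S y" and cz: "continuous_on S z" for S by (rule continuous_at_imp_continuous_on, rule ballI, rule has_vector_derivative_continuous, rule y,
    rule continuous_at_imp_continuous_on, rule ballI, rule has_vector_derivative_continuous, rule z)
 have "bounded (y ` {0..t})" "bounded (z ` {0..t})" by (intro compact_imp_bounded compact_continuous_image cy cz compact_Icc)+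
 then obtain R1 R2 where "ALL s:{0..t}. norm (y s) <= R1" "ALL s:{0..t}. norm (z s) <= R2" unfolding bounded_iff by auto
 hence R: "norm (y s) <= max R1 R2" "norm (z s) <= max R1 R2" if "s : {0..t}" for s using that by (simp_all add: max.coboundedI1 max.coboundedI2)
 obtain K where K: "K >= 0" "!!u v. norm u <= max R1 R2 ==> norm v <= max R1 R2 ==> norm (f u - f v) <= K * norm (u - v)" using f by metis
 define g where "g s = exp (- 2 * K * s) * ((y s - z s) *. (y s - z s))" for s
 have g': "(g has_real_derivative exp (- 2 * K * s) * (2 * ((y s - z s) *. (f (y s) - f (z s))) - 2 * K * ((y s - z s) *. (y s - z s)))) (at s)" for s
 proof -
  have d: "((%s. y s - z s) has_vderiv (f (y s) - f (z s))) (at s)" by (intro has_vector_derivative_diff y z)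
  have "((%s. (y s - z s) *. (y s - z s)) has_vderiv ((y s - z s) *. (f (y s) - f (z s)) + (f (y s) - f (z s)) *. (y s - z s))) (at s)"
   by (rule bounded_bilinear.has_vector_derivative[OF bounded_bilinear_inner d d])
  hence i: "((%s. (y s - z s) *. (y s - z s)) has_real_derivative (2 * ((y s - z s) *. (f (y s) - f (z s))))) (at s)"
   by (simp add: has_real_derivative_iff_has_vector_derivative inner_commute)
  show ?thesis unfolding g_def by (rule derivative_eq_intros i refl | simp)+ (simp add: algebra_simps)
 qed
 have "g t <= g 0"
 proof (rule DERIV_nonpos_imp_nonincreasing[OF t])
  fix s assume s: "0 <= s" "s <= t"
  have "(y s - z s) *. (f (y s) - f (z s)) <= norm (y s - z s) * norm (f (y s) - f (z s))" by (rule norm_cauchy_schwarz)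
  also have "... <= norm (y s - z s) * (K * norm (y s - z s))" by (intro mult_left_mono K(2) R) (use s in auto)
  also have "... = K * ((y s - z s) *. (y s - z s))" by (simp add: power2_norm_eq_inner[symmetric] power2_eq_square)
  finally have "exp (- 2 * K * s) * (2 * ((y s - z s) *. (f (y s) - f (z s))) - 2 * K * ((y s - z s) *. (y s - z s))) <= 0" by (intro mult_nonneg_nonpos) auto
  thus "EX D. (g has_real_derivative D) (at s) & D <= 0" using g' by blast
 qed
 moreover have "g 0 = 0" using 0 by (simp add: g_def)
 ultimately have "exp (- 2 * K * t) * ((y t - z t) *. (y t - z t)) <= 0" by (simp add: g_def)
 hence "(y t - z t) *. (y t - z t) <= 0" by (metis exp_gt_zero mult_le_0_iff not_le)
 hence "(y t - z t) *. (y t - z t) = 0" by (meson inner_ge_zero order_antisym)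
 thus ?thesis by simp
qed

lemma homogeneous_differentiable_imp_linear:
 fixes f :: "'a::real_normed_vector => 'b::real_normed_vector"
 assumes h: "!!t v. f (t *R v) = t *R f v" and D: "(f has_derivative f') (at 0)"
 shows "f = f'"
proof
 fix v
 have "((%t. f (t *R v)) has_derivative (%t. f' (t *R v))) (at 0)" by (rule has_derivative_compose[of "%t. t *R v" "%t. t *R v" 0 UNIV f f'])
   (auto intro!: derivative_eq_intros D)
 hence "((%t. t *R f v) has_derivative (%t. t *R f' v)) (at 0)" using linear_scale[OF has_derivative_linear[OF D]] by (simp add: h)
 moreover have "((%t. t *R f v) has_derivative (%t. t *R f v)) (at 0)" by (auto intro!: derivative_eq_intros)
 ultimately have "(%t::real. t *R f v) = (%t. t *R f' v)" by (rule has_derivative_unique[rotated])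
 hence "1 *R f v = 1 *R f' v" by meson
 thus "f v = f' v" by simp
qed

lemma shift_has_vderiv:
 assumes "((%h. f (t + h)) has_vderiv D) (at 0)"
 shows "(f has_vderiv D) (at t)"
proof -
 have "((%s. s - t) has_derivative (%h. h)) (at t)" by (auto intro!: derivative_eq_intros)
 from has_derivative_compose[OF this, of "%h. f (t + h)" "%h. h *R D"] show ?thesis using assms by (simp add: has_vector_derivative_def)
qed

section \<open>The Lie algebra in exponential coordinates\<close>

context carnot_group
begin

notation mult (infixl "**" 70)

definition dmult :: "'a => 'a => 'a => 'a => 'a" where
 "dmult x y u v = frechet_derivative (%(x, y). x ** y) (at (x, y)) (u, v)"

abbreviation lif :: "'a => 'a => 'a" where
 "lif x v \<equiv> left_inv_field (**) v x"

abbreviation br :: "'a => 'a => 'a" where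
 "br \<equiv> lie_bracket (**)"

definition conj :: "'a => 'a => 'a" where
 "conj g v = g ** v ** (- g)"

lemma mult_has_derivative:
 "((%z. fst z ** snd z) has_derivative (%h. dmult (fst z) (snd z) (fst h) (snd h))) (at z)"
proof -
 have "(%(x, y). x ** y) = (%z. fst z ** snd z)" by (simp add: fun_eq_iff)
 thus ?thesis using C_k_derivative(1)[OF smooth_mult, of z] by (simp add: dmult_def)
qed

lemma dmult_add: "dmult x y u v = dmult x y u 0 + dmult x y 0 v"
proof -
 have "linear (%h. dmult x y (fst h) (snd h))" using has_derivative_linear[OF mult_has_derivative[of "(x,y)"]] by simp
 from linear_add[OF this, of "(u,0)" "(0,v)"] show ?thesis by simp
qed

lemma mult_has_vderiv:
 assumes "(f has_vderiv u) (at t within S)" "(g has_vderiv v) (at t within S)"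
 shows "((%t. f t ** g t) has_vderiv dmult (f t) (g t) u v) (at t within S)"
proof -
 have P: "((%t. (f t, g t)) has_derivative (%h. (h *R u, h *R v))) (at t within S)" using assms unfolding has_vector_derivative_def by (rule has_derivative_Pair)
 have "((%t. f t ** g t) has_derivative (%h. dmult (f t) (g t) (h *R u) (h *R v))) (at t within S)" using has_derivative_compose[OF P mult_has_derivative] by simp
 moreover have "dmult (f t) (g t) (h *R u) (h *R v) = h *R dmult (f t) (g t) u v" for h
  using linear_scale[OF has_derivative_linear[OF mult_has_derivative[of "(f t, g t)"]], of h "(u,v)"] by simp
 ultimately show ?thesis by (simp add: has_vector_derivative_def)
qed

lemma mult_right_has_derivative: "((%y. x ** y) has_derivative dmult x y 0) (at y)"
proof -
 have P: "((%y. (x, y)) has_derivative (%h. (0, h))) (at y)" by (auto intro!: derivative_eq_intros)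
 show ?thesis using has_derivative_compose[OF P mult_has_derivative] by simp
qed

lemma lif_eq: "lif x v = dmult x 0 0 v" unfolding left_inv_field_def using frechet_derivative_at[OF mult_right_has_derivative[of x 0]] by simp
lemma linear_lif: "linear (lif x)" using has_derivative_linear[OF mult_right_has_derivative[of x 0]] by (simp add: lif_eq[abs_def])

lemma lif_has_derivative: "((%x. lif x v) has_derivative frechet_derivative (%x. lif x v) (at x)) (at x)"
proof -
 let ?f = "%z. frechet_derivative (%(x, y). x ** y) (at z) (0, v)"
 have "smooth ?f" by (rule C_k_derivative(2)[OF smooth_mult])
 note D = C_k_derivative(1)[OF this]
 have P: "((%x. (x, 0)) has_derivative (%h. (h, 0))) (at x)" by (auto intro!: derivative_eq_intros)
 have "(%x. lif x v) differentiable (at x)" using has_derivative_compose[OF P D] by (auto simp: lif_eq dmult_def differentiable_def)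
 thus ?thesis by (simp add: frechet_derivative_works)
qed

lemma lif_lipschitz:
 "EX K>=0. ALL x y. norm x <= R --> norm y <= R --> norm (lif x v - lif y v) <= K * norm (x - y)"
proof -
 let ?f = "%z. frechet_derivative (%(x, y). x ** y) (at z) (0, v)"
 have "smooth ?f" by (rule C_k_derivative(2)[OF smooth_mult])
 from smooth_lipschitz_on_cball[OF this, of R] obtain K where K: "K >= 0"
  "!!x y. norm x <= R ==> norm y <= R ==> norm (?f x - ?f y) <= K * norm (x - y)" by blast
 show ?thesis by (intro exI[of _ K] conjI K(1) allI impI) (use K(2)[of "(_, 0)" "(_, 0)"] in "simp add: lif_eq dmult_def norm_Pair")
qed

lemma mult_lipschitz:
 "EX K>=0. ALL x y x' y'. norm x <= R --> norm y <= R --> norm x' <= R --> norm y' <= R --> norm (x ** y - x' ** y') <= K * (norm (x - x') + norm (y - y'))"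
proof -
 from smooth_lipschitz_on_cball[OF smooth_mult, of "R + R"] obtain K where K: "K >= 0"
  "!!z w. norm z <= R + R ==> norm w <= R + R ==> norm ((%(x, y). x ** y) z - (%(x, y). x ** y) w) <= K * norm (z - w)" by blast
 have "norm (x ** y - x' ** y') <= K * (norm (x - x') + norm (y - y'))" if "norm x <= R" "norm y <= R" "norm x' <= R" "norm y' <= R" for x y x' y'
 proof -
  have "norm (x, y) <= R + R" "norm (x', y') <= R + R" using that norm_Pair_le[of x y] norm_Pair_le[of x' y'] by linarith+
  from K(2)[OF this] have "norm (x ** y - x' ** y') <= K * norm ((x, y) - (x', y'))" by simp
  also have "... <= K * (norm (x - x') + norm (y - y'))" using norm_Pair_le[of "x - x'" "y - y'"] K(1) by (intro mult_left_mono) auto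
  finally show ?thesis .
 qed
 thus ?thesis using K(1) by blast
qed

lemma inv_mult: "- (x ** y) = (- y) ** (- x)"
proof -
 have "(x ** y) ** ((- y) ** (- x)) = x ** (y ** (- y)) ** (- x)" by (simp only: assoc)
 also have "... = 0" using ginv_right by (simp add: ginv_def right_unit)
 finally have e: "(x ** y) ** ((- y) ** (- x)) = 0" .
 have "- (x ** y) = - (x ** y) ** ((x ** y) ** ((- y) ** (- x)))" by (simp add: e right_unit)
 also have "... = (- (x ** y) ** (x ** y)) ** ((- y) ** (- x))" by (simp only: assoc)
 also have "... = (- y) ** (- x)" using ginv_left[of "x ** y"] by (simp add: ginv_def left_unit)
 finally show ?thesis .
qed

lemma inv_r: "x ** (- x) = 0" and inv_l: "(- x) ** x = 0" using ginv_right ginv_left by (simp_all add: ginv_def)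

lemma inv_cancel: "(- x) ** (x ** y) = y" "x ** ((- x) ** y) = y" "y ** x ** (- x) = y" "y ** (- x) ** x = y"
proof -
 show "(- x) ** (x ** y) = y" using assoc[of "-x" x y] by (simp add: inv_l left_unit)
 show "x ** ((- x) ** y) = y" using assoc[of x "-x" y] by (simp add: inv_r left_unit)
 show "y ** x ** (- x) = y" by (simp add: assoc inv_r right_unit)
 show "y ** (- x) ** x = y" by (simp add: assoc inv_l right_unit)
qed

lemma lif_0: "lif 0 v = v"
proof -
 have "((%y. 0 ** y) has_derivative dmult 0 0 0) (at 0)" by (rule mult_right_has_derivative)
 moreover have "((%y. 0 ** y) has_derivative (%h. h)) (at 0)" by (simp add: left_unit)
 ultimately have "dmult 0 0 0 = (%h. h)" by (rule has_derivative_unique)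
 thus ?thesis by (simp add: lif_eq)
qed

lemma dmult_left_0: "dmult w 0 u 0 = u"
proof -
 have "((%h. (w + h *R u) ** 0) has_vderiv dmult (w + 0 *R u) 0 u 0) (at 0)"
  by (rule mult_has_vderiv[of "%h. w + h *R u" u 0 UNIV "%_. 0" 0]) (auto intro!: derivative_eq_intros)
 moreover have "((%h. (w + h *R u) ** 0) has_vderiv u) (at 0)" by (auto simp: right_unit intro!: derivative_eq_intros)
 ultimately show ?thesis by (simp add: vector_derivative_unique_at)
qed

lemma scale_has_vderiv: "((%t. t *R v) has_vderiv v) (at t within S)" by (auto intro!: derivative_eq_intros)

lemma lif_translate: "dmult x y 0 (lif y v) = lif (x ** y) v"
proof -
 have 1: "((%t. (x ** y) ** (t *R v)) has_vderiv dmult (x ** y) (0 *R v) 0 v) (at 0)"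
  by (intro mult_has_vderiv scale_has_vderiv) auto
 have y: "((%t. y ** (t *R v)) has_vderiv dmult y (0 *R v) 0 v) (at 0)" by (intro mult_has_vderiv scale_has_vderiv) auto
 have "((%t. x ** (y ** (t *R v))) has_vderiv dmult x (y ** (0 *R v)) 0 (dmult y (0 *R v) 0 v)) (at 0)"
  by (rule mult_has_vderiv[OF _ y]) auto
 hence "((%t. (x ** y) ** (t *R v)) has_vderiv dmult x y 0 (lif y v)) (at 0)" by (simp add: assoc right_unit lif_eq)
 from vector_derivative_unique_at[OF 1 this] show ?thesis by (simp add: lif_eq)
qed

lemma mult_curve_has_vderiv:
 "((%t. x ** (t *R v)) has_vderiv lif (x ** (t *R v)) v) (at t within S)"
proof -
 have "((%h. (x ** (t *R v)) ** (h *R v)) has_vderiv dmult (x ** (t *R v)) (0 *R v) 0 v) (at 0)"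
  by (intro mult_has_vderiv scale_has_vderiv) auto
 hence "((%h. (x ** ((t + h) *R v))) has_vderiv lif (x ** (t *R v)) v) (at 0)" by (simp add: assoc exp_coords lif_eq)
 hence "((%s. (x ** (s *R v))) has_vderiv lif (x ** (t *R v)) v) (at t)" by (rule shift_has_vderiv)
 thus ?thesis by (rule has_vector_derivative_at_within)
qed

text \<open>In exponential coordinates the power \<open>y\<^sup>n\<close> is \<open>n y\<close>, so a one-parameter subgroup is \<open>n phi(t/n)\<close>.\<close>

lemma one_parameter_subgroup:
 assumes hom: "!!s t. phi (s + t) = phi s ** phi t" and D: "(phi has_vderiv w) (at 0)"
 shows "phi t = t *R w"
proof -
 have phi0: "phi 0 = 0" using hom[of 0 0] inv_cancel(1)[of "phi 0" "phi 0"] by (simp add: inv_l)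
 have n: "phi (real n * s) = real n *R phi s" for n s
 proof (induction n)
  case (Suc n)
  thus ?case using hom[of "real n * s" s] exp_coords[of "real n" "phi s" 1] by (simp add: algebra_simps)
 qed (simp add: phi0)
 show ?thesis
 proof (cases "t = 0")
  case False
  have "((%h. norm (phi h - h *R w) / norm h) \<longlongrightarrow> 0) (at 0)" using D by (simp add: has_vector_derivative_def has_derivative_at phi0)
  hence "((%h. phi h /\<^sub>R h - w) \<longlongrightarrow> 0) (at 0)" unfolding tendsto_norm_zero_iff[of "%h. phi h /\<^sub>R h - w", symmetric]
  proof (rule Lim_transform_eventually)
   show "\<forall>\<^sub>F h in at 0. norm (phi h - h *R w) / norm h = norm (phi h /\<^sub>R h - w)" unfolding eventually_at
   proof (intro exI[of _ 1] conjI ballI impI)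
    fix h :: real assume "h ~= 0 & dist h 0 < 1"
    hence "phi h /\<^sub>R h - w = (phi h - h *R w) /\<^sub>R h" by (simp add: scaleR_diff_right)
    thus "norm (phi h - h *R w) / norm h = norm (phi h /\<^sub>R h - w)" by (simp add: divide_inverse)
   qed simp
  qed
  hence L: "((%h. phi h /\<^sub>R h) \<longlongrightarrow> w) (at 0)" by (simp add: LIM_zero_iff)
  have "filterlim (%n. t / real (Suc n)) (at 0) sequentially" unfolding filterlim_at
  proof
   show "(%n. t / real (Suc n)) ----> 0" using LIMSEQ_inverse_real_of_nat tendsto_mult_right_zero[of "%n. inverse (real (Suc n))" sequentially t]
    by (simp add: divide_inverse)
  qed (use False in auto)
  from filterlim_compose[OF L this] have "(%n. phi (t / real (Suc n)) /\<^sub>R (t / real (Suc n))) ----> w" .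
  moreover have "phi (t / real (Suc n)) /\<^sub>R (t / real (Suc n)) = (1/t) *R phi t" for n
  proof -
   have "phi t = real (Suc n) *R phi (t / real (Suc n))" using n[of "Suc n" "t / real (Suc n)"] by simp
   thus ?thesis by (simp add: divide_inverse)
  qed
  ultimately have "(1/t) *R phi t = w" by (simp add: LIMSEQ_const_iff)
  thus ?thesis using False by auto
 qed (simp add: phi0)
qed

lemma conj_hom: "conj g (x ** y) = conj g x ** conj g y" unfolding conj_def by (simp add: assoc inv_cancel)
lemma conj_mult: "conj (g ** h) v = conj g (conj h v)" unfolding conj_def by (simp add: assoc inv_mult)
lemma conj_0: "conj 0 v = v" by (simp add: conj_def left_unit right_unit)

lemma conj_has_derivative: "EX D. (conj g has_derivative D) (at v)"
proof -
 have "((%v. g ** v) has_derivative dmult g v 0) (at v)" by (rule mult_right_has_derivative)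
 hence P: "((%v. (g ** v, - g)) has_derivative (%h. (dmult g v 0 h, 0))) (at v)" by (intro has_derivative_Pair has_derivative_const)
 show ?thesis unfolding conj_def[abs_def] using has_derivative_compose[OF P mult_has_derivative] by auto
qed

lemma conj_scale: "conj g (t *R v) = t *R conj g v"
proof -
 obtain D where D: "(conj g has_derivative D) (at 0)" using conj_has_derivative by blast
 have "((%t. conj g (t *R v)) has_derivative (%t. D (t *R v))) (at 0)"
  by (rule has_derivative_compose[of "%t. t *R v" "%t. t *R v" 0 UNIV]) (auto intro!: derivative_eq_intros D)
 hence d: "((%t. conj g (t *R v)) has_vderiv D v) (at 0)" using linear_scale[OF has_derivative_linear[OF D]] by (simp add: has_vector_derivative_def)
 have "conj g ((s + t) *R v) = conj g (s *R v) ** conj g (t *R v)" for s t unfolding exp_coords[symmetric] by (rule conj_hom)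
 from one_parameter_subgroup[of "%t. conj g (t *R v)", OF this d]
 have "conj g (t *R v) = t *R D v" for t .
 from this[of t] this[of 1] show ?thesis by simp
qed

lemma linear_conj: "linear (conj g)"
proof -
 obtain D where D: "(conj g has_derivative D) (at 0)" using conj_has_derivative by blast
 have "conj g = D" by (rule homogeneous_differentiable_imp_linear[OF conj_scale D])
 thus ?thesis using has_derivative_linear[OF D] by simp
qed

definition beta :: "'a => 'a => 'a" where
 "beta v w = frechet_derivative (%x. lif x w) (at 0) v"

lemma beta_deriv: "((%x. lif x w) has_derivative (%v. beta v w)) (at 0)" unfolding beta_def by (rule lif_has_derivative)

lemma beta_curve: "((%t. lif (t *R v) w) has_vderiv beta v w) (at 0)"
proof -
 have "((%t. lif (t *R v) w) has_derivative (%t. beta (t *R v) w)) (at 0)"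
  by (rule has_derivative_compose[of "%t. t *R v" "%t. t *R v" 0 UNIV]) (auto intro!: derivative_eq_intros beta_deriv)
 thus ?thesis using linear_scale[OF has_derivative_linear[OF beta_deriv]] by (simp add: has_vector_derivative_def)
qed

lemma beta_linear1: "linear (%v. beta v w)" by (rule has_derivative_linear[OF beta_deriv])

lemma beta_add2: "beta v (w + w') = beta v w + beta v w'"
proof -
 have "((%t. lif (t *R v) (w + w')) has_vderiv beta v w + beta v w') (at 0)" unfolding linear_add[OF linear_lif] by (intro has_vector_derivative_add beta_curve)
 from vector_derivative_unique_at[OF this beta_curve] show ?thesis by simp
qed

lemma beta_same: "beta v v = 0"
proof -
 have "lif (t *R v) v = v" for t
 proof -
  have "((%s. 0 ** (s *R v)) has_vderiv lif (0 ** (t *R v)) v) (at t)" by (rule mult_curve_has_vderiv)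
  hence "((%s. s *R v) has_vderiv lif (t *R v) v) (at t)" by (simp add: left_unit)
  from vector_derivative_unique_at[OF this scale_has_vderiv] show ?thesis .
 qed
 hence "((%t. lif (t *R v) v) has_vderiv 0) (at 0)" by simp
 from vector_derivative_unique_at[OF beta_curve this] show ?thesis .
qed

lemma beta_antisym: "beta w v = - beta v w"
proof -
 have "0 = beta (v + w) (v + w)" by (simp add: beta_same)
 also have "... = beta v v + beta w v + (beta v w + beta w w)" by (simp add: beta_add2 linear_add[OF beta_linear1])
 finally show ?thesis by (simp add: beta_same eq_neg_iff_add_eq_0)
qed

lemma br_eq: "br v w = 2 *R beta v w"
proof -
 have "br v w = beta v w - beta w v" unfolding lie_bracket_def field_bracket_def beta_def by (simp add: lif_0)
 thus ?thesis by (simp add: beta_antisym[of w v] scaleR_2)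
qed

lemma br_antisym: "br w v = - br v w" by (simp add: br_eq beta_antisym[of w v])
lemma linear_br1: "linear (%v. br v w)" unfolding br_eq by (intro linear_compose_scale_right beta_linear1)

lemma linear_br2: "linear (br v)"
proof -
 have "br v = (%w. - br w v)" by (rule ext) (rule br_antisym)
 thus ?thesis using linear_compose_neg[OF linear_br1[of v]] by simp
qed

lemma bounded_bilinear_br: "bounded_bilinear br" using linear_br1 linear_br2 by (simp add: bilinear_conv_bounded_bilinear[symmetric] bilinear_def)

lemma conj_diff_curve: "EX D. ((%h. conj (h *R x) w) has_vderiv D) (at 0)"
proof -
 have "((%h. (h *R x) ** w ** (h *R (- x))) has_vderiv dmult ((0 *R x) ** w) (0 *R (- x)) (dmult (0 *R x) w x 0) (- x)) (at 0)"
  by (intro mult_has_vderiv scale_has_vderiv has_vector_derivative_const)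
 thus ?thesis by (auto simp: conj_def)
qed

text \<open>
  Differentiating \<open>conj g w ** g = g ** w\<close> at \<open>g = 0\<close>; the derivative of \<open>g ** w\<close> in \<open>g\<close> is found
  from left-invariant fields because inversion \<open>x \<mapsto> - x\<close> reverses products.
\<close>

lemma conj_derivative_0: "((%h. conj (h *R x) w) has_vderiv br x w) (at 0)"
proof -
 have *: "((%h. conj (h *R x) w) has_vderiv lif (- w) x - lif w x) (at 0)" for w
 proof -
  obtain D where D: "((%h. conj (h *R x) w) has_vderiv D) (at 0)" using conj_diff_curve by blast
  have "((%h. conj (h *R x) w ** (h *R x)) has_vderiv dmult (conj (0 *R x) w) (0 *R x) D x) (at 0)"
   by (intro mult_has_vderiv scale_has_vderiv D)
  hence 1: "((%h. (h *R x) ** w) has_vderiv D + lif w x) (at 0)"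
   using dmult_add[of w 0 D x] by (simp add: conj_def inv_cancel left_unit right_unit dmult_left_0 lif_eq)
  have "((%h. (- w) ** (h *R (- x))) has_vderiv lif ((- w) ** (0 *R (- x))) (- x)) (at 0)" by (rule mult_curve_has_vderiv)
  hence "((%h. - ((- w) ** (h *R (- x)))) has_vderiv - lif (- w) (- x)) (at 0)" by (intro has_vector_derivative_minus) (simp add: right_unit)
  hence "((%h. (h *R x) ** w) has_vderiv lif (- w) x) (at 0)" by (simp add: inv_mult linear_neg[OF linear_lif])
  from vector_derivative_unique_at[OF 1 this] D show ?thesis by (metis add_diff_cancel_right')
 qed
 define D where "D = lif (- w) x - lif w x"
 have e: "lif (- (eps *R w)) x - lif (eps *R w) x = eps *R D" for eps
 proof -
  have "((%h. eps *R conj (h *R x) w) has_vderiv eps *R D) (at 0)" using *[of w] unfolding D_def by (intro derivative_eq_intros) auto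
  hence "((%h. conj (h *R x) (eps *R w)) has_vderiv eps *R D) (at 0)" by (simp add: conj_scale)
  from vector_derivative_unique_at[OF *[of "eps *R w"] this] show ?thesis .
 qed
 have "((%eps. lif (eps *R (- w)) x - lif (eps *R w) x) has_vderiv beta (- w) x - beta w x) (at 0)" by (intro has_vector_derivative_diff beta_curve)
 hence "((%eps. eps *R D) has_vderiv beta (- w) x - beta w x) (at 0)" by (simp add: e)
 from vector_derivative_unique_at[OF this scale_has_vderiv]
 have "D = - beta w x - beta w x" by (simp add: linear_neg[OF beta_linear1])
 also have "... = br x w" by (simp add: br_eq beta_antisym[of w x] scaleR_2)
 finally show ?thesis using *[of w] unfolding D_def by simp
qed

lemma conj_derivative:
 "((%t. conj (t *R x) w) has_vderiv br x (conj (t *R x) w)) (at t)"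
proof (rule shift_has_vderiv)
 have "conj ((t + h) *R x) w = conj (h *R x) (conj (t *R x) w)" for h by (simp add: conj_mult[symmetric] exp_coords add.commute)
 thus "((%h. conj ((t + h) *R x) w) has_vderiv br x (conj (t *R x) w)) (at 0)" using conj_derivative_0 by simp
qed

lemma hom_br:
 assumes P: "linear P" and hom: "!!x y. P (x ** y) = P x ** P y"
 shows "P (br v w) = br (P v) (P w)"
proof -
 have c: "P (conj g x) = conj (P g) (P x)" for g x unfolding conj_def by (simp add: hom linear_neg[OF P])
 have "((%h. P (conj (h *R v) w)) has_vderiv P (br v w)) (at 0)"
  by (rule bounded_linear.has_vector_derivative[OF P[unfolded linear_conv_bounded_linear] conj_derivative_0])
 hence "((%h. conj (h *R P v) (P w)) has_vderiv P (br v w)) (at 0)" by (simp add: c linear_scale[OF P])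
 from vector_derivative_unique_at[OF this conj_derivative_0] show ?thesis .
qed

lemma jacobi: "br x (br v w) = br (br x v) w + br v (br x w)"
proof -
 have a: "conj g (br v w) = br (conj g v) (conj g w)" for g by (rule hom_br[OF linear_conj conj_hom])
 have 1: "((%h. conj (h *R x) (br v w)) has_vderiv br x (br v w)) (at 0)" by (rule conj_derivative_0)
 have "((%h. br (conj (h *R x) v) (conj (h *R x) w)) has_vderiv br (conj (0 *R x) v) (br x w) + br (br x v) (conj (0 *R x) w)) (at 0)"
  by (rule bounded_bilinear.has_vector_derivative[OF bounded_bilinear_br conj_derivative_0 conj_derivative_0])
 hence 2: "((%h. conj (h *R x) (br v w)) has_vderiv br v (br x w) + br (br x v) w) (at 0)" by (simp add: a conj_0)
 from vector_derivative_unique_at[OF 1 2] show ?thesis by (simp add: add.commute)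
qed

lemma br_lipschitz: "EX K>=0. ALL y z. norm y <= R --> norm z <= R --> norm ((v - br x y) - (v - br x z)) <= K * norm (y - z)"
proof -
 obtain K where K: "K > 0" "!!a b. norm (br a b) <= norm a * norm b * K" using bounded_bilinear.pos_bounded[OF bounded_bilinear_br] by blast
 have "norm ((v - br x y) - (v - br x z)) <= (norm x * K) * norm (y - z)" for y z
 proof -
  have "(v - br x y) - (v - br x z) = br x (z - y)" by (simp add: linear_diff[OF linear_br2])
  thus ?thesis using K(2)[of x "z - y"] by (simp add: algebra_simps norm_minus_commute)
 qed
 thus ?thesis using K(1) by (intro exI[of _ "norm x * K"]) auto
qed

text \<open>
  The logarithmic derivative of the exponential map: \<open>Y t = t \<partial>\<^sub>v((- t x) ** (t x))\<close> solves
  \<open>Y' = v - [x, Y]\<close>, so the bracket determines the left-invariant fields.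
\<close>

definition dlog :: "'a => 'a => real => 'a" where
 "dlog x v t = dmult (- (t *R x)) (t *R x) 0 (t *R v)"

lemma dlog_curve: "((%e. (- (t *R x)) ** (t *R (x + e *R v))) has_vderiv dlog x v t) (at 0)"
proof -
 have "((%e. t *R (x + e *R v)) has_vderiv t *R v) (at 0)" by (auto intro!: derivative_eq_intros)
 from mult_has_vderiv[OF has_vector_derivative_const[of "- (t *R x)"] this]
 show ?thesis by (simp add: dlog_def)
qed

lemma lif_dlog: "lif x (dlog x v 1) = v"
proof -
 have "((%e. x ** ((- x) ** (x + e *R v))) has_vderiv dmult x ((- x) ** (x + 0 *R v)) 0 (dlog x v 1)) (at 0)"
  using mult_has_vderiv[OF has_vector_derivative_const[of x] dlog_curve[of 1 x v]] by simp
 hence 1: "((%e. x + e *R v) has_vderiv lif x (dlog x v 1)) (at 0)" by (simp add: inv_cancel inv_l lif_eq)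
 have "((%e. x + e *R v) has_vderiv v) (at 0)" by (auto intro!: derivative_eq_intros)
 from vector_derivative_unique_at[OF 1 this] show ?thesis .
qed

lemma dlog_0: "dlog x v 0 = 0" using linear_0[OF linear_lif[of 0]] by (simp add: dlog_def lif_eq)

lemma dlog_ode: "(dlog x v has_vderiv (v - br x (dlog x v t))) (at t)"
proof -
 have add: "dlog x v (t + h) = conj (h *R (- x)) (dlog x v t) + dlog x v h" for t h
 proof -
  define u where "u e = (- (t *R x)) ** (t *R (x + e *R v))" for e
  define k where "k e = (- (h *R x)) ** (h *R (x + e *R v))" for e
  have u: "(u has_vderiv dlog x v t) (at 0)" and k: "(k has_vderiv dlog x v h) (at 0)" unfolding u_def[abs_def] k_def[abs_def] by (rule dlog_curve)+
  have u0: "u 0 = 0" "k 0 = 0" by (simp_all add: u_def k_def inv_l)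
  have eq: "(- ((t + h) *R x)) ** ((t + h) *R (x + e *R v)) = conj (h *R (- x)) (u e) ** k e" for e
  proof -
   have "- ((t + h) *R x) = (- (h *R x)) ** (- (t *R x))" by (simp add: inv_mult[symmetric] exp_coords)
   moreover have "(t + h) *R (x + e *R v) = t *R (x + e *R v) ** h *R (x + e *R v)" by (simp only: exp_coords)
   ultimately show ?thesis by (simp add: conj_def u_def k_def assoc inv_cancel)
  qed
  have cu: "((%e. conj (h *R (- x)) (u e)) has_vderiv conj (h *R (- x)) (dlog x v t)) (at 0)"
   by (rule bounded_linear.has_vector_derivative[OF linear_conj[unfolded linear_conv_bounded_linear] u])
  have "((%e. (- ((t + h) *R x)) ** ((t + h) *R (x + e *R v))) has_vector_derivative
    dmult (conj (h *R (- x)) (u 0)) (k 0) (conj (h *R (- x)) (dlog x v t)) (dlog x v h)) (at 0)" unfolding eq by (intro mult_has_vderiv cu k)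
  moreover have "conj g 0 = 0" for g using linear_0[OF linear_conj] by blast
  ultimately have "((%e. (- ((t + h) *R x)) ** ((t + h) *R (x + e *R v))) has_vderiv conj (h *R (- x)) (dlog x v t) + dlog x v h) (at 0)"
   using lif_0[of "dlog x v h"] by (subst (asm) dmult_add) (simp add: u0 dmult_left_0 lif_eq)
  from vector_derivative_unique_at[OF dlog_curve this] show ?thesis .
 qed
 have d0: "(dlog x v has_vderiv v) (at 0)"
 proof -
  let ?f = "%z. frechet_derivative (%(x, y). x ** y) (at z) (0, v)"
  have "smooth ?f" by (rule C_k_derivative(2)[OF smooth_mult])
  note D = C_k_derivative(1)[OF this]
  define k where "k t = ?f (- (t *R x), t *R x)" for t
  have P: "((%t. (- (t *R x), t *R x)) has_derivative (%h. (- (h *R x), h *R x))) (at 0)" by (auto intro!: derivative_eq_intros)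
  have "(k has_derivative (%h. frechet_derivative ?f (at (- (0 *R x), 0 *R x)) (- (h *R x), h *R x))) (at 0)" unfolding k_def[abs_def] by (rule has_derivative_compose[OF P D])
  hence "k differentiable (at 0)" by (rule differentiableI)
  then obtain k' where k': "(k has_vderiv k') (at 0)" using vector_derivative_works by blast
  have "dlog x v t = t *R k t" for t unfolding dlog_def k_def dmult_def
   using linear_scale[OF has_derivative_linear[OF mult_has_derivative[of "(- (t *R x), t *R x)"]], of t "(0, v)"] by (simp add: dmult_def)
  hence e: "dlog x v = (%t. t *R k t)" by (rule ext)
  have "((%t. t *R k t) has_vderiv (0 *R k' + 1 *R k 0)) (at 0)" by (rule has_vector_derivative_scaleR[OF _ k']) simp
  moreover have "k 0 = v" using lif_0[of v] by (simp add: k_def lif_eq dmult_def)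
  ultimately show ?thesis by (simp add: e)
 qed
 show ?thesis
 proof (rule shift_has_vderiv)
  have "((%h. conj (h *R (- x)) (dlog x v t) + dlog x v h) has_vderiv br (- x) (dlog x v t) + v) (at 0)" by (intro has_vector_derivative_add conj_derivative_0 d0)
  thus "((%h. dlog x v (t + h)) has_vderiv v - br x (dlog x v t)) (at 0)" by (simp add: add linear_neg[OF linear_br1])
 qed
qed

lemma dlog_hom:
 assumes P: "linear P" and br: "!!v w. P (br v w) = br (P v) (P w)"
 shows "P (dlog x v 1) = dlog (P x) (P v) 1"
proof (rule ode_unique[of "%y. P v - br (P x) y"])
 show "EX K>=0. ALL y z. norm y <= R --> norm z <= R --> norm ((P v - br (P x) y) - (P v - br (P x) z)) <= K * norm (y - z)" for R by (rule br_lipschitz)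
 have "((%t. P (dlog x v t)) has_vderiv P (v - br x (dlog x v t))) (at t)" for t
  by (rule bounded_linear.has_vector_derivative[OF P[unfolded linear_conv_bounded_linear] dlog_ode])
 thus "((%t. P (dlog x v t)) has_vderiv P v - br (P x) (P (dlog x v t))) (at t)" for t by (simp add: linear_diff[OF P] br)
qed (simp_all add: dlog_0 linear_0[OF P] dlog_ode)

lemma lif_inj: "lif x v = lif x w ==> v = w"
proof -
 assume a: "lif x v = lif x w"
 have e: "dmult (- x) x 0 (lif x v) = v" for v using lif_translate[of "-x" x v] by (simp add: inv_l lif_0)
 show ?thesis by (rule box_equals[OF arg_cong[OF a, of "dmult (- x) x 0"] e e])
qed

text \<open>
  Brackets determine \<open>dlog\<close>, so \<open>P\<close> maps the left-invariant field of \<open>w\<close> to that of \<open>P w\<close>. Hence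
  \<open>P (x ** (t *R y))\<close> and \<open>P x ** (t *R P y)\<close> are integral curves of the same field.
\<close>

theorem linear_br_hom_imp_group_hom:
 assumes P: "linear P" and br: "!!v w. P (br v w) = br (P v) (P w)"
 shows "P (x ** y) = P x ** P y"
proof -
 have lif: "P (lif z w) = lif (P z) (P w)" for z w
 proof -
  have "lif z (dlog z (lif z w) 1) = lif z w" by (rule lif_dlog)
  hence w: "dlog z (lif z w) 1 = w" by (rule lif_inj)
  have "dlog (P z) (P (lif z w)) 1 = P w" unfolding dlog_hom[OF P br, symmetric] w ..
  thus ?thesis using lif_dlog[of "P z" "P (lif z w)"] by simp
 qed
 have "P (x ** (1 *R y)) = P x ** (1 *R P y)"
 proof (rule ode_unique[of "%z. lif z (P y)" "%t. P (x ** (t *R y))" "%t. P x ** (t *R P y)"])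
  show "((%t. P (x ** (t *R y))) has_vderiv lif (P (x ** (t *R y))) (P y)) (at t)" for t unfolding lif[symmetric]
   by (rule bounded_linear.has_vector_derivative[OF P[unfolded linear_conv_bounded_linear] mult_curve_has_vderiv])
  show "((%t. P x ** (t *R P y)) has_vderiv lif (P x ** (t *R P y)) (P y)) (at t)" for t by (rule mult_curve_has_vderiv)
  show "EX K>=0. ALL u v. norm u <= R --> norm v <= R --> norm (lif u (P y) - lif v (P y)) <= K * norm (u - v)" for R by (rule lif_lipschitz)
 qed (simp_all add: right_unit)
 thus ?thesis by simp
qed

lemma linear_br_zero_imp_additive:
 assumes P: "linear (P :: 'a => 'a)" and br: "!!v w. P (br v w) = 0"
 shows "P (lif z w) = P w" "P (x ** y) = P x + P y"
proof -
 have lif: "P (lif z w) = P w" for z w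
 proof -
  have "lif z (dlog z (lif z w) 1) = lif z w" by (rule lif_dlog)
  hence w: "dlog z (lif z w) 1 = w" by (rule lif_inj)
  have "P (dlog z v 1) = 1 *R P v" for v
  proof (rule ode_unique[of "%_. P v" "%t. P (dlog z v t)" "%t. t *R P v"])
   have "((%t. P (dlog z v t)) has_vderiv P (v - br z (dlog z v t))) (at t)" for t
    by (rule bounded_linear.has_vector_derivative[OF P[unfolded linear_conv_bounded_linear] dlog_ode])
   thus "((%t. P (dlog z v t)) has_vderiv P v) (at t)" for t by (simp add: linear_diff[OF P] br)
   show "((%t. t *R P v) has_vderiv P v) (at t)" for t by (rule scale_has_vderiv)
  qed (auto simp: dlog_0 linear_0[OF P])
  from this[of "lif z w"] w show ?thesis by simp
 qed
 thus "P (lif z w) = P w" .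
 have "P (x ** (1 *R y)) = P x + 1 *R P y"
 proof (rule ode_unique[of "%_. P y" "%t. P (x ** (t *R y))" "%t. P x + t *R P y"])
  have "((%t. P (x ** (t *R y))) has_vderiv P (lif (x ** (t *R y)) y)) (at t)" for t
   by (rule bounded_linear.has_vector_derivative[OF P[unfolded linear_conv_bounded_linear] mult_curve_has_vderiv])
  thus "((%t. P (x ** (t *R y))) has_vderiv P y) (at t)" for t by (simp add: lif)
  show "((%t. P x + t *R P y) has_vderiv P y) (at t)" for t by (auto intro!: derivative_eq_intros)
 qed (auto simp: right_unit)
 thus "P (x ** y) = P x + P y" by simp
qed

section \<open>Grading, dilations and the horizontal projection\<close>

lemma B_Basis: "i : {1..s} ==> B i <= Basis" using layers_cover by blast
lemma finite_B: "i : {1..s} ==> finite (B i)" using B_Basis finite_subset finite_Basis by blast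
lemma B_ex: "b : Basis ==> EX i:{1..s}. b : B i" using layers_cover by blast
lemma B_unique: "i : {1..s} ==> j : {1..s} ==> b : B i ==> b : B j ==> i = j" using layers_disjoint unfolding disjoint_family_on_def by blast
lemma B_iff: "i : {1..s} ==> b : B i ==> j : {1..s} ==> b : B j \<longleftrightarrow> j = i" using B_unique[of j i b] by blast
lemma one_in: "1 : {1..s}" using step_pos by simp
lemma linear_layer_part: "linear (layer_part i)" unfolding layer_part_def by (intro linear_compose_sum ballI) (rule linearI; simp add: inner_add_left scaleR_add_left)

lemma layer_part_inner:
 assumes "i : {1..s}" "b : Basis"
 shows "layer_part i x *. b = (if b : B i then x *. b else 0)"
proof -
 have "layer_part i x *. b = (SUM c:B i. (x *. c) * (c *. b))" by (simp add: layer_part_def inner_sum_left)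
 also have "... = (SUM c:B i. if c = b then x *. b else 0)" by (rule sum.cong[OF refl]) (use B_Basis[OF assms(1)] assms(2) in "auto simp: inner_Basis")
 finally show ?thesis using finite_B[OF assms(1)] by simp
qed

lemma layer_part_in_layer: "layer_part i x : layer i" unfolding layer_part_def layer_def by (intro span_sum span_scale span_base)

lemma layer_inner: "v : layer i ==> i : {1..s} ==> b : Basis ==> b ~: B i ==> v *. b = 0"
proof -
 assume i: "i : {1..s}" and b: "b : Basis" "b ~: B i" and "v : layer i"
 hence "v : span (B i)" by (simp add: layer_def)
 thus ?thesis
 proof (induction rule: span_induct_alt)
  case (step c x y)
  hence "x *. b = 0" using B_Basis[OF i] b by (metis inner_not_same_Basis subsetD)
  thus ?case using step by (simp add: inner_add_left)
 qed simp
qed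

lemma layer_part_layer:
 assumes "v : layer i" "i : {1..s}" "j : {1..s}"
 shows "layer_part j v = (if i = j then v else 0)"
proof (rule euclidean_eqI)
 fix b :: 'a assume b: "b : Basis"
 show "layer_part j v *. b = (if i = j then v else 0) *. b"
  using layer_part_inner[OF assms(3) b, of v] layer_inner[OF assms(1,2) b] B_unique[OF assms(2,3)] by auto
qed

lemma sum_layer_part: "(SUM i=1..s. layer_part i x) = x"
proof (rule euclidean_eqI)
 fix b :: 'a assume b: "b : Basis"
 then obtain i where i: "i : {1..s}" "b : B i" using B_ex by blast
 have "(SUM i=1..s. layer_part i x) *. b = (SUM j=1..s. if j = i then x *. b else 0)" unfolding inner_sum_left
  by (rule sum.cong[OF refl]) (use b B_iff[OF i] in "auto simp: layer_part_inner simp del: One_nat_def")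
 thus "(SUM i=1..s. layer_part i x) *. b = x *. b" using i by simp
qed

lemma subspace_layer: "subspace (layer i)" unfolding layer_def by simp
lemma layer_scale: "v : layer i ==> c *R v : layer i" using subspace_layer subspace_scale by blast

lemma br_layer1:
 assumes x: "x : layer 1" and y: "y : layer j" and j: "j : {1..s}"
 shows "br x y : (if 1 + j <= s then layer (1 + j) else {0})"
proof (cases "1 + j <= s")
 case True
 have "br x y : span {br v w |v w. v : span (B 1) & w : span (B j)}" using x y by (intro span_base) (auto simp: layer_def)
 also have "... = layer (1 + j)" using layers_generated[of "1 + j"] True j by (simp add: layer_def)
 finally show ?thesis using True by simp
next
 case False
 hence "j = s" using j by auto
 thus ?thesis using last_layer_central x y False by (simp add: layer_def)
qed

lemma br_layer:
 assumes "i : {1..s}" "j : {1..s}" "x : layer i" "y : layer j"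
 shows "br x y : (if i + j <= s then layer (i + j) else {0})" using assms
proof (induction i arbitrary: j x y rule: less_induct)
 case (less i)
 let ?T = "%k. if k <= s then layer k else {0::'a}"
 have sub: "subspace (?T k)" for k using subspace_layer by (auto simp: subspace_def)
 show ?case
 proof (cases "i = 1")
  case True
  thus ?thesis using br_layer1[of x y j] less.prems unfolding True by blast
 next
  case False
  hence i: "i : {2..s}" "i - 1 : {1..s}" "i - 1 < i" using less by auto
  have gen: "br (br v w) y : ?T (i + j)" if v: "v : layer 1" and w: "w : layer (i - 1)" for v w
  proof -
   have "br (br v w) y = br v (br w y) - br w (br v y)" using jacobi[of v w y] by (simp add: algebra_simps)
   moreover have "br v (br w y) : ?T (i + j)"
   proof (cases "i - 1 + j <= s")
    case True
    hence "br w y : layer (i - 1 + j)" using less.IH[OF i(3) i(2) less.prems(2) w less.prems(4)] by simp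
    from br_layer1[OF v this] show ?thesis using True i by auto
   next
    case False
    hence "br w y = 0" using less.IH[OF i(3) i(2) less.prems(2) w less.prems(4)] by simp
    thus ?thesis using linear_0[OF linear_br2] subspace_0[OF sub] by simp
   qed
   moreover have "br w (br v y) : ?T (i + j)"
   proof (cases "1 + j <= s")
    case True
    hence "br v y : layer (1 + j)" using br_layer1[OF v less.prems(4,2)] by simp
    from less.IH[OF i(3) i(2) _ w this] show ?thesis using True i by auto
   next
    case False
    hence "br v y = 0" using br_layer1[OF v less.prems(4,2)] by simp
    thus ?thesis using linear_0[OF linear_br2] subspace_0[OF sub] by simp
   qed
   ultimately show ?thesis using subspace_diff[OF sub] by simp
  qed
  have "x : span {br v w |v w. v : span (B 1) & w : span (B (i - 1))}" using less.prems(3) layers_generated[OF i(1)] by (simp add: layer_def)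
  thus ?thesis
  proof (induction rule: span_induct)
   case base
   have "subspace {x. br x y : ?T (i + j)}" using linear_subspace_linear_preimage[OF linear_br1 sub] .
   thus ?case by simp
  next
   case (step a)
   thus ?case using gen by (auto simp: layer_def)
  qed
 qed
qed

lemma linear_dilation: "linear (dilation c)" unfolding dilation_def by (intro linear_compose_sum ballI linear_compose_scale_right linear_layer_part)

lemma dilation_layer: "v : layer i ==> i : {1..s} ==> dilation c v = c ^ i *R v"
proof -
 assume v: "v : layer i" and i: "i : {1..s}"
 have "dilation c v = (SUM j=1..s. if j = i then c ^ i *R v else 0)" unfolding dilation_def by (rule sum.cong[OF refl]) (use layer_part_layer[OF v i] in auto)
 thus ?thesis using i by simp
qed

lemma dilation_inner:
 assumes "i : {1..s}" "b : B i"
 shows "dilation c x *. b = c ^ i * (x *. b)"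
proof -
 have b: "b : Basis" using B_Basis assms by blast
 have "dilation c x *. b = (SUM j=1..s. if j = i then c ^ i * (x *. b) else 0)" unfolding dilation_def inner_sum_left
  by (rule sum.cong[OF refl]) (use b B_iff[OF assms] in "auto simp: layer_part_inner simp del: One_nat_def")
 thus ?thesis using assms by simp
qed

lemma dilation_br: "dilation c (br v w) = br (dilation c v) (dilation c w)"
proof -
 have "dilation c (br (layer_part i v) (layer_part j w)) = c ^ (i + j) *R br (layer_part i v) (layer_part j w)" if "i : {1..s}" "j : {1..s}" for i j
  using br_layer[OF that layer_part_in_layer layer_part_in_layer, of v w] that
   dilation_layer[of "br (layer_part i v) (layer_part j w)" "i + j" c] by (cases "i + j <= s") (auto simp: linear_0[OF linear_dilation])
 hence e: "dilation c (br (layer_part i v) (layer_part j w)) = br (c ^ i *R layer_part i v) (c ^ j *R layer_part j w)" if "i : {1..s}" "j : {1..s}" for i j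
  using that by (simp add: linear_scale[OF linear_br1] linear_scale[OF linear_br2] power_add mult.commute)
 have "br v w = (SUM i=1..s. SUM j=1..s. br (layer_part i v) (layer_part j w))" by (subst (1) sum_layer_part[of v, symmetric], subst (1) sum_layer_part[of w, symmetric])
   (simp only: linear_sum[OF linear_br1] linear_sum[OF linear_br2], rule sum.swap)
 hence "dilation c (br v w) = (SUM i=1..s. SUM j=1..s. dilation c (br (layer_part i v) (layer_part j w)))" by (simp only: linear_sum[OF linear_dilation])
 also have "... = (SUM i=1..s. SUM j=1..s. br (c ^ i *R layer_part i v) (c ^ j *R layer_part j w))" by (intro sum.cong refl e) auto
 also have "... = br (dilation c v) (dilation c w)" unfolding dilation_def by (simp only: linear_sum[OF linear_br1] linear_sum[OF linear_br2], rule sum.swap)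
 finally show ?thesis .
qed

lemma dilation_mult: "dilation c (x ** y) = dilation c x ** dilation c y" by (rule linear_br_hom_imp_group_hom[OF linear_dilation dilation_br])
lemma dilation_uminus: "dilation c (- x) = - dilation c x" by (rule linear_neg[OF linear_dilation])

lemma dilation_dilation: "dilation c (dilation c' x) = dilation (c * c') x"
proof (rule euclidean_eqI)
 fix b :: 'a assume "b : Basis"
 then obtain i where i: "i : {1..s}" "b : B i" using B_ex by blast
 show "dilation c (dilation c' x) *. b = dilation (c * c') x *. b" by (simp add: dilation_inner[OF i] power_mult_distrib)
qed

lemma dilation_1 [simp]: "dilation 1 x = x" using sum_layer_part[of x] by (simp add: dilation_def)
lemma dilation_0 [simp]: "dilation c 0 = 0" by (rule linear_0[OF linear_dilation])
lemma dilation_inverse: "c ~= 0 ==> dilation c (dilation (1 / c) x) = x" "c ~= 0 ==> dilation (1 / c) (dilation c x) = x" by (simp_all add: dilation_dilation)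
lemma dilation_layer1: "v : layer 1 ==> dilation c v = c *R v" using dilation_layer[OF _ one_in] by simp

lemma norm_dilation_le:
 assumes "!!i. i : {1..s} ==> abs c ^ i <= C" and C: "C >= 0"
 shows "norm (dilation c x) <= C * norm x"
proof -
 have "norm (dilation c x) <= norm (C *R x)"
 proof (rule norm_le_componentwise)
  fix b :: 'a assume "b : Basis"
  then obtain i where i: "i : {1..s}" "b : B i" using B_ex by blast
  have "abs (dilation c x *. b) = abs c ^ i * abs (x *. b)" by (simp add: dilation_inner[OF i] abs_mult power_abs)
  also have "... <= C * abs (x *. b)" by (intro mult_right_mono assms i) simp
  finally show "abs (dilation c x *. b) <= abs ((C *R x) *. b)" using C by (simp add: abs_mult)
 qed
 thus ?thesis using C by simp
qed

lemma norm_dilation_small: "0 <= c ==> c <= 1 ==> norm (dilation c x) <= c * norm x"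
proof (rule norm_dilation_le)
 fix i assume c: "0 <= c" "c <= 1" and "i : {1..s}"
 then obtain k where "i = Suc k" by (cases i) auto
 thus "abs c ^ i <= c" using c power_le_one[of c k] mult_left_mono[of "c ^ k" 1 c] by simp
qed

lemma norm_dilation_large: "1 <= c ==> norm (dilation c x) <= c ^ s * norm x" by (rule norm_dilation_le) (auto intro!: power_increasing)
lemma linear_p: "linear p" unfolding p_def[abs_def] by (rule linear_layer_part)
lemma p_layer1: "v : layer 1 ==> p v = v" using layer_part_layer[OF _ one_in one_in] by (simp add: p_def)
lemma p_in: "p x : layer 1" by (simp add: p_def layer_part_in_layer)

lemma p_br: "p (br v w) = 0"
proof -
 have z: "p (br (layer_part i v) (layer_part j w)) = 0" if "i : {1..s}" "j : {1..s}" for i j using br_layer[OF that layer_part_in_layer layer_part_in_layer, of v w] that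
   layer_part_layer[of "br (layer_part i v) (layer_part j w)" "i + j" 1] one_in by (cases "i + j <= s") (auto simp: p_def linear_0[OF linear_layer_part])
 have "br v w = (SUM i=1..s. SUM j=1..s. br (layer_part i v) (layer_part j w))" by (subst (1) sum_layer_part[of v, symmetric], subst (1) sum_layer_part[of w, symmetric])
   (simp only: linear_sum[OF linear_br1] linear_sum[OF linear_br2], rule sum.swap)
 hence "p (br v w) = (SUM i=1..s. SUM j=1..s. p (br (layer_part i v) (layer_part j w)))" by (simp only: linear_sum[OF linear_p])
 thus ?thesis using z by simp
qed

lemma p_lif: "p (lif z w) = p w" and p_mult: "p (x ** y) = p x + p y" using linear_br_zero_imp_additive[OF linear_p p_br] by blast+

lemma p_dilation: "p (dilation c x) = c *R p x"
proof (rule euclidean_eqI)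
 fix b :: 'a assume b: "b : Basis"
 then obtain i where i: "i : {1..s}" "b : B i" using B_ex by blast
 show "p (dilation c x) *. b = (c *R p x) *. b" unfolding p_def using layer_part_inner[OF one_in b] dilation_inner[OF i] B_unique[OF i(1) one_in i(2)] by auto
qed

lemma norm_p_le: "norm (p x) <= norm x" by (rule norm_le_componentwise) (auto simp: p_def layer_part_inner[OF one_in] simp del: One_nat_def)

lemma p_inner_layer1: "E : layer 1 ==> x *. E = p x *. E"
proof -
 assume E: "E : layer 1"
 show ?thesis unfolding euclidean_inner[of _ E]
  by (rule sum.cong[OF refl]) (use layer_inner[OF E one_in] in "auto simp: p_def layer_part_inner[OF one_in] simp del: One_nat_def")
qed

end

section \<open>Operations on horizontal curves\<close>

lemma abs_continuous_comp_mono: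
 fixes f :: "real => 'a::real_normed_vector"
 assumes f: "abs_continuous_curve a b f"
  and m: "!!x y. x <= y ==> phi x <= phi y & phi y - phi x <= y - x"
  and r: "!!x. x : {a'..b'} ==> phi x : {a..b}"
 shows "abs_continuous_curve a' b' (%t. f (phi t))" by (rule abs_continuous_dominated[OF f, of 1 _ _ phi]) (use m r in "auto simp: monotone_on_def")

lemma abs_continuous_reflect:
 fixes f :: "real => 'a::real_normed_vector"
 assumes f: "abs_continuous_curve a b f"
 shows "abs_continuous_curve (-b) (-a) (%t. f (- t))" by (rule abs_continuous_dominated[OF f, of 1 _ _ uminus]) (auto simp: monotone_on_def)

lemma abs_continuous_imp_continuous:
 fixes f :: "real => 'a::real_normed_vector"
 assumes f: "abs_continuous_curve a b f"
 shows "continuous_on {a..b} f" unfolding continuous_on_iff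
proof (intro ballI allI impI)
 fix x e :: real assume x: "x : {a..b}" and "e > 0"
 obtain delta where d: "delta > 0" and
  D: "!!(I::unit set) l r. interval_family a b delta I l r ==> (SUM i:I. norm (f (r i) - f (l i))) < e"
  using abs_continuousE[OF f \<open>e > 0\<close>, where 'i = unit] by metis
 have D': "norm (f r - f l) < e" if "a <= l" "l <= r" "r <= b" "r - l < delta" for l r using D[of UNIV "%_. l" "%_. r"] that by (simp add: interval_family_def)
 have "dist (f y) (f x) < e" if "y : {a..b}" "dist y x < delta" for y using D'[of x y] D'[of y x] x that by (cases "x <= y") (auto simp: dist_norm norm_minus_commute)
 thus "EX d>0. ALL x':{a..b}. dist x' x < d --> dist (f x') (f x) < e" using d by blast
qed

lemma abs_continuous_comp_lipschitz:
 fixes f :: "real => 'a::real_normed_vector" and g :: "'a => 'b::real_normed_vector"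
 assumes f: "abs_continuous_curve a b f" and K: "K >= 0"
  and lip: "!!s t. s : {a..b} ==> t : {a..b} ==> norm (g (f s) - g (f t)) <= K * norm (f s - f t)"
 shows "abs_continuous_curve a b (%t. g (f t))" by (rule abs_continuous_dominated[OF f K, of _ _ "%t. t"]) (use lip in "auto simp: monotone_on_def")

lemma abs_continuous_add:
 fixes f g :: "real => 'a::real_normed_vector"
 assumes f: "abs_continuous_curve a b f" and g: "abs_continuous_curve a b g"
 shows "abs_continuous_curve a b (%t. f t + g t)" unfolding abs_continuous_iff
proof (intro allI impI)
 fix e :: real assume "e > 0"
 hence e2: "e / 2 > 0" by simp
 obtain d1 where d1: "d1 > 0" and
  D1: "!!(I::nat set) l r. interval_family a b d1 I l r ==> (SUM i:I. norm (f (r i) - f (l i))) < e / 2" using abs_continuousE[OF f e2, where 'i = nat] by metis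
 obtain d2 where d2: "d2 > 0" and
  D2: "!!(I::nat set) l r. interval_family a b d2 I l r ==> (SUM i:I. norm (g (r i) - g (l i))) < e / 2" using abs_continuousE[OF g e2, where 'i = nat] by metis
 have "(SUM i<k. norm (f (r i) + g (r i) - (f (l i) + g (l i)))) < e" if A: "interval_family a b (min d1 d2) {..<k} l r" for k :: nat and l r
 proof -
  have "(SUM i<k. norm (f (r i) + g (r i) - (f (l i) + g (l i)))) <= (SUM i<k. norm (f (r i) - f (l i)) + norm (g (r i) - g (l i)))"
   unfolding add_diff_add by (intro sum_mono norm_triangle_ineq)
  also have "... = (SUM i<k. norm (f (r i) - f (l i))) + (SUM i<k. norm (g (r i) - g (l i)))" by (rule sum.distrib)
  also have "... < e / 2 + e / 2" by (intro add_strict_mono D1 D2) (use A in "auto simp: interval_family_def")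
  finally show ?thesis by simp
 qed
 thus "EX delta>0. ALL (m::nat) l r. interval_family a b delta {..<m} l r --> (SUM i<m. norm (f (r i) + g (r i) - (f (l i) + g (l i)))) < e"
  using d1 d2 by (intro exI[of _ "min d1 d2"]) auto
qed

lemma AE_lebesgue_negligible:
 "(AE t in lebesgue. P t) \<longleftrightarrow> negligible {t. ~ P t}" by (simp add: AE_iff_null_sets negligible_iff_null_sets[symmetric] eventually_ae_filter
   flip: null_sets_completion_iff) (metis (no_types, lifting) eventually_ae_filter negligible_iff_null_sets negligible_subset null_sets_completion_subset mem_Collect_eq order_refl)

context carnot_group
begin

abbreviation "controlled == horizontal_with_control"

lemmas control_def = horizontal_with_control_def

definition joined :: "'a => 'a => real => bool" where
 "joined x y l \<longleftrightarrow> (EX a b gamma u. a <= b & controlled a b gamma u & gamma a = x & gamma b = y & l = integral {a..b} (%t. norm (u t)))"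

lemma cc_dist_joined: "cc_dist x y = Inf {l. joined x y l}" unfolding cc_dist_def joined_def by (rule arg_cong[where f = Inf]) blast

lemma control_integrable:
 assumes "controlled a b gamma u"
 shows "u integrable_on {a..b}" "(%t. norm (u t)) integrable_on {a..b}" using assms unfolding control_def absolutely_integrable_on_def by auto

lemma joined_nonneg: "joined x y l ==> l >= 0" unfolding joined_def by (auto intro!: integral_nonneg dest!: control_integrable(2))

lemma abs_continuous_translate:
 assumes g: "abs_continuous_curve a b gamma"
 shows "abs_continuous_curve a b (%t. x ** gamma t)"
proof -
 have "bounded (gamma ` {a..b})" by (intro compact_imp_bounded compact_continuous_image abs_continuous_imp_continuous g compact_Icc)
 then obtain R0 where R0: "ALL t:{a..b}. norm (gamma t) <= R0" unfolding bounded_iff by auto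
 define R where "R = max R0 (norm x)"
 obtain K where K: "K >= 0" "ALL x y x' y'. norm x <= R --> norm y <= R --> norm x' <= R --> norm y' <= R -->
   norm (x ** y - x' ** y') <= K * (norm (x - x') + norm (y - y'))" using mult_lipschitz[of R] by blast
 show ?thesis
 proof (rule abs_continuous_comp_lipschitz[OF g K(1)])
  fix s t assume "s : {a..b}" "t : {a..b}"
  hence "norm (gamma s) <= R" "norm (gamma t) <= R" "norm x <= R" using R0 by (auto simp: R_def intro: max.coboundedI1)
  thus "norm (x ** gamma s - x ** gamma t) <= K * norm (gamma s - gamma t)" using K(2)[rule_format, of x "gamma s" x "gamma t"] by simp
 qed
qed

lemma horizontal_translate:
 assumes "controlled a b gamma u"
 shows "controlled a b (%t. x ** gamma t) u"
proof -
 have "((%t. x ** gamma t) has_vderiv lif (x ** gamma t) (u t)) (at t)" if "(gamma has_vderiv lif (gamma t) (u t)) (at t)" for t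
  using mult_has_vderiv[OF has_vector_derivative_const[of x] that] by (simp add: lif_translate)
 thus ?thesis using assms abs_continuous_translate unfolding control_def by (auto elim!: eventually_mono)
qed

lemma dilation_lif: "dilation c (lif x v) = lif (dilation c x) (dilation c v)"
proof -
 have bl: "bounded_linear (dilation c)" using linear_dilation linear_conv_bounded_linear by blast
 have "((%t. dilation c (x ** (t *R v))) has_vderiv dilation c (lif (x ** (0 *R v)) v)) (at 0)"
  by (rule bounded_linear.has_vector_derivative[OF bl mult_curve_has_vderiv])
 hence 1: "((%t. dilation c x ** (t *R dilation c v)) has_vderiv dilation c (lif x v)) (at 0)"
  by (simp add: dilation_mult linear_scale[OF linear_dilation] right_unit)
 have 2: "((%t. dilation c x ** (t *R dilation c v)) has_vderiv lif (dilation c x ** (0 *R dilation c v)) (dilation c v)) (at 0)"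
  by (rule mult_curve_has_vderiv)
 show ?thesis using vector_derivative_unique_at[OF 1 2] by (simp add: right_unit)
qed

lemma abs_continuous_linear:
 fixes gamma :: "real => 'a" and P :: "'a => 'b::euclidean_space"
 assumes P: "linear P" and g: "abs_continuous_curve a b gamma"
 shows "abs_continuous_curve a b (%t. P (gamma t))"
proof -
 obtain K where K: "K > 0" "ALL x. norm (P x) <= K * norm x" using linear_bounded_pos[OF P] by blast
 show ?thesis by (rule abs_continuous_comp_lipschitz[OF g, of K])
   (use K in "auto simp: linear_diff[OF P, symmetric]")
qed

lemma horizontal_dilate:
 assumes h: "controlled a b gamma u"
 shows "controlled a b (%t. dilation c (gamma t)) (%t. c *R u t)" unfolding control_def
proof (intro conjI ballI)
 have bl: "bounded_linear (dilation c)" using linear_dilation linear_conv_bounded_linear by blast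
 show "abs_continuous_curve a b (%t. dilation c (gamma t))" using abs_continuous_linear[OF linear_dilation] h by (auto simp: control_def)
 show "(%t. c *R u t) absolutely_integrable_on {a..b}" using h by (simp add: control_def absolutely_integrable_on_scaleR_iff)
 show "c *R u t : layer 1" if "t : {a..b}" for t using h that by (simp add: control_def layer_scale)
 have *: "((%t. dilation c (gamma t)) has_vderiv lif (dilation c (gamma t)) (c *R u t)) (at t)"
  if "t : {a..b}" "(gamma has_vderiv lif (gamma t) (u t)) (at t)" for t
 proof -
  have "u t : layer 1" using h that by (simp add: control_def)
  thus ?thesis using bounded_linear.has_vector_derivative[OF bl that(2)] by (simp add: dilation_lif dilation_layer1)
 qed
 have "AE t in lebesgue. t : {a..b} --> (gamma has_vderiv lif (gamma t) (u t)) (at t)" using h by (simp add: control_def)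
 thus "AE t in lebesgue. t : {a..b} --> ((%t. dilation c (gamma t)) has_vderiv lif (dilation c (gamma t)) (c *R u t)) (at t)" by eventually_elim (use * in blast)
qed

lemma horizontal_shift:
 assumes h: "controlled a b gamma u"
 shows "controlled (a + c) (b + c) (%t. gamma (t - c)) (%t. u (t - c))"
  "integral {a + c..b + c} (%t. norm (u (t - c))) = integral {a..b} (%t. norm (u t))"
proof -
 have I: "((%t. f (t - c)) has_integral integral {a..b} f) {a + c..b + c}" if f: "f integrable_on {a..b}" for f :: "real => 'b::euclidean_space"
  using has_integral_shift_Icc_real[of "%t. f (t - c)" c "integral {a..b} f" a b] integrable_integral[OF f] by (simp add: o_def)
 show "integral {a + c..b + c} (%t. norm (u (t - c))) = integral {a..b} (%t. norm (u t))" using I[OF control_integrable(2)[OF h]] by (rule integral_unique)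
 show "controlled (a + c) (b + c) (%t. gamma (t - c)) (%t. u (t - c))" unfolding control_def
 proof (intro conjI ballI)
  show "abs_continuous_curve (a + c) (b + c) (%t. gamma (t - c))" by (rule abs_continuous_comp_mono[of a b]) (use h in "auto simp: control_def")
  show "(%t. u (t - c)) absolutely_integrable_on {a + c..b + c}" unfolding absolutely_integrable_on_def
   using I[OF control_integrable(1)[OF h]] I[OF control_integrable(2)[OF h]] by blast
  show "u (t - c) : layer 1" if "t : {a + c..b + c}" for t using h that by (auto simp: control_def)
  let ?P = "%t. t : {a..b} --> (gamma has_vderiv lif (gamma t) (u t)) (at t)"
  have "negligible {t. ~ ?P t}" using h by (simp add: control_def AE_lebesgue_negligible)
  hence "negligible ((%t. c + t) ` {t. ~ ?P t})" by (rule negligible_translation)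
  thus "AE t in lebesgue. t : {a + c..b + c} --> ((%t. gamma (t - c)) has_vderiv lif (gamma (t - c)) (u (t - c))) (at t)" unfolding AE_lebesgue_negligible
  proof (rule negligible_subset, intro subsetI)
   fix t assume t: "t : {t. ~ (t : {a + c..b + c} --> ((%t. gamma (t - c)) has_vderiv lif (gamma (t - c)) (u (t - c))) (at t))}"
   have shf: "((%s. s - c) has_vderiv 1) (at t)" by (auto intro!: derivative_eq_intros)
   have "~ ?P (t - c)"
   proof
    assume "?P (t - c)"
    hence "(gamma has_vderiv lif (gamma (t - c)) (u (t - c))) (at (t - c))" using t by auto
    hence "((%s. gamma (s - c)) has_vderiv lif (gamma (t - c)) (u (t - c))) (at t)" using vector_diff_chain_at[OF shf, of gamma] by (simp add: o_def)
    thus False using t by simp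
   qed
   thus "t : (%t. c + t) ` {t. ~ ?P t}" by (intro image_eqI[of _ _ "t - c"]) auto
  qed
 qed
qed

lemma horizontal_reflect:
 assumes h: "controlled a b gamma u"
 shows "controlled (-b) (-a) (%t. gamma (- t)) (%t. - u (- t))" unfolding control_def
proof (intro conjI ballI)
 show "abs_continuous_curve (-b) (-a) (%t. gamma (- t))" using h abs_continuous_reflect by (auto simp: control_def)
 have "(%t. u (- t)) absolutely_integrable_on {-b..-a}" using h by (simp add: control_def)
 thus "(%t. - u (- t)) absolutely_integrable_on {-b..-a}" using absolutely_integrable_on_scaleR_iff[where c = "-1" and f = "%t. u (- t)"] by simp
 show "- u (- t) : layer 1" if "t : {-b..-a}" for t using h that subspace_neg[OF subspace_layer] by (auto simp: control_def)
 let ?P = "%t. t : {a..b} --> (gamma has_vderiv lif (gamma t) (u t)) (at t)"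
 have "negligible {t. ~ ?P t}" using h by (simp add: control_def AE_lebesgue_negligible)
 hence "negligible (uminus ` {t. ~ ?P t})" by (rule negligible_locally_Lipschitz_image[rotated], intro exI[of _ UNIV], intro exI[of _ 1]) (auto simp: abs_minus_commute)
 thus "AE t in lebesgue. t : {-b..-a} --> ((%t. gamma (- t)) has_vderiv lif (gamma (- t)) (- u (- t))) (at t)" unfolding AE_lebesgue_negligible
 proof (rule negligible_subset, intro subsetI)
  fix t assume t: "t : {t. ~ (t : {-b..-a} --> ((%t. gamma (- t)) has_vderiv lif (gamma (- t)) (- u (- t))) (at t))}"
  have "~ ?P (- t)"
  proof
   assume "?P (- t)"
   hence "(gamma has_vderiv lif (gamma (- t)) (u (- t))) (at (- t))" using t by auto
   moreover have "(uminus has_vderiv - 1) (at t)" by (auto intro!: derivative_eq_intros)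
   ultimately have "((%s. gamma (- s)) has_vderiv - lif (gamma (- t)) (u (- t))) (at t)" using vector_diff_chain_at[of uminus "-1" t gamma] by (simp add: o_def)
   thus False using t by (simp add: linear_neg[OF linear_lif])
  qed
  thus "t : uminus ` {t. ~ ?P t}" by (intro image_eqI[of _ _ "- t"]) auto
 qed
qed

lemma horizontal_concat:
 assumes h1: "controlled a b gamma u" and h2: "controlled b c eta v"
  and e: "gamma b = eta b" and ab: "a <= b" "b <= c"
 shows "controlled a c (%t. if t <= b then gamma t else eta t) (%t. if t <= b then u t else v t)"
  "integral {a..c} (%t. norm (if t <= b then u t else v t)) = integral {a..b} (%t. norm (u t)) + integral {b..c} (%t. norm (v t))"
proof -
 let ?w = "%t. if t <= b then u t else v t"
 have w1: "?w absolutely_integrable_on {a..b}" by (rule absolutely_integrable_spike[where f = u and S = "{}"]) (use h1 in "auto simp: control_def")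
 have w2: "?w absolutely_integrable_on {b..c}" by (rule absolutely_integrable_spike[where f = v and S = "{b}"]) (use h2 in "auto simp: control_def")
 have w: "?w absolutely_integrable_on {a..c}" by (rule absolutely_integrable_on_combine[OF w1 w2 ab])
 have "integral {a..c} (%t. norm (?w t)) = integral {a..b} (%t. norm (?w t)) + integral {b..c} (%t. norm (?w t))"
  by (rule Henstock_Kurzweil_Integration.integral_combine[OF ab, symmetric])
   (use w in "simp add: absolutely_integrable_on_def")
 also have "integral {a..b} (%t. norm (?w t)) = integral {a..b} (%t. norm (u t))" by (rule integral_cong) auto
 also have "integral {b..c} (%t. norm (?w t)) = integral {b..c} (%t. norm (v t))" by (rule integral_spike[of "{b}"]) auto
 finally show "integral {a..c} (%t. norm (?w t)) = integral {a..b} (%t. norm (u t)) + integral {b..c} (%t. norm (v t))" .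
 show "controlled a c (%t. if t <= b then gamma t else eta t) ?w" unfolding control_def
 proof (intro conjI ballI w)
  have "abs_continuous_curve a c (%t. gamma (min t b))" by (rule abs_continuous_comp_mono[of a b]) (use h1 ab in "auto simp: control_def min_def")
  moreover have "abs_continuous_curve a c (%t. eta (max t b))" by (rule abs_continuous_comp_mono[of b c]) (use h2 ab in "auto simp: control_def max_def")
  moreover have "abs_continuous_curve a c (%t. - eta b)" by (rule abs_continuous_lipschitz[of _ 0]) simp
  ultimately have "abs_continuous_curve a c (%t. gamma (min t b) + eta (max t b) + - eta b)" by (intro abs_continuous_add)
  moreover have "(%t. gamma (min t b) + eta (max t b) + - eta b) = (%t. if t <= b then gamma t else eta t)" by (rule ext) (auto simp: min_def max_def e)
  ultimately show "abs_continuous_curve a c (%t. if t <= b then gamma t else eta t)" by simp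
  show "?w t : layer 1" if "t : {a..c}" for t using h1 h2 that by (auto simp: control_def)
  have b: "AE t in lebesgue. t ~= b" by (simp add: AE_lebesgue_negligible)
  have "AE t in lebesgue. t : {a..b} --> (gamma has_vderiv lif (gamma t) (u t)) (at t)"
   "AE t in lebesgue. t : {b..c} --> (eta has_vderiv lif (eta t) (v t)) (at t)" using h1 h2 by (simp_all add: control_def)
  with b show "AE t in lebesgue. t : {a..c} --> ((%t. if t <= b then gamma t else eta t) has_vderiv lif (if t <= b then gamma t else eta t) (?w t)) (at t)"
  proof eventually_elim
   case (elim t)
   show ?case
   proof (intro impI)
    assume t: "t : {a..c}"
    show "((%t. if t <= b then gamma t else eta t) has_vderiv lif (if t <= b then gamma t else eta t) (?w t)) (at t)"
    proof (cases "t < b")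
     case True
     have "((%t. if t <= b then gamma t else eta t) has_vderiv lif (gamma t) (u t)) (at t)"
      by (rule has_vector_derivative_transform_within_open[of gamma _ _ "{..<b}"]) (use True t elim in auto)
     thus ?thesis using True by simp
    next
     case False
     hence tb: "t > b" using elim by simp
     have "((%t. if t <= b then gamma t else eta t) has_vderiv lif (eta t) (v t)) (at t)"
      by (rule has_vector_derivative_transform_within_open[of eta _ _ "{b<..}"]) (use tb t elim in auto)
     thus ?thesis using tb by simp
    qed
   qed
  qed
 qed
qed

lemma joined_translate: "joined x y l ==> joined (z ** x) (z ** y) l" unfolding joined_def using horizontal_translate by blast

lemma joined_trans: "joined x y l ==> joined y z k ==> joined x z (l + k)"
proof -
 assume "joined x y l" "joined y z k"
 then obtain a b gamma u c d eta v where A: "a <= b" "controlled a b gamma u" "gamma a = x" "gamma b = y"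
   "l = integral {a..b} (%t. norm (u t))"
   "c <= d" "controlled c d eta v" "eta c = y" "eta d = z" "k = integral {c..d} (%t. norm (v t))" unfolding joined_def by blast
 have S: "controlled b (d + b - c) (%t. eta (t - (b - c))) (%t. v (t - (b - c)))"
  "integral {b..d + b - c} (%t. norm (v (t - (b - c)))) = k" using horizontal_shift[OF A(7), of "b - c"] A(10) by (simp_all add: add_diff_eq)
 have C: "controlled a (d + b - c) (%t. if t <= b then gamma t else eta (t - (b - c))) (%t. if t <= b then u t else v (t - (b - c)))"
  "integral {a..d + b - c} (%t. norm (if t <= b then u t else v (t - (b - c)))) = l + k" using horizontal_concat[OF A(2) S(1)] S(2) A by simp_all
 show ?thesis unfolding joined_def by (intro exI[of _ a] exI[of _ "d + b - c"] exI[of _ "%t. if t <= b then gamma t else eta (t - (b - c))"]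
    exI[of _ "%t. if t <= b then u t else v (t - (b - c))"] conjI C(1)) (use A C(2) in auto)
qed

lemma joined_sym: "joined x y l ==> joined y x l"
proof -
 assume "joined x y l"
 then obtain a b gamma u where A: "a <= b" "controlled a b gamma u" "gamma a = x" "gamma b = y"
   "l = integral {a..b} (%t. norm (u t))" unfolding joined_def by blast
 have "integral {-b..-a} (%t. norm (- u (- t))) = l" using A(5) Henstock_Kurzweil_Integration.integral_reflect_real[of b a "%t. norm (u t)"] by simp
 thus ?thesis unfolding joined_def by (intro exI[of _ "-b"] exI[of _ "-a"] exI[of _ "%t. gamma (- t)"] exI[of _ "%t. - u (- t)"])
   (use A horizontal_reflect in auto)
qed

lemma joined_dilate: "joined x y l ==> joined (dilation c x) (dilation c y) (abs c * l)"
proof -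
 assume "joined x y l"
 then obtain a b gamma u where A: "a <= b" "controlled a b gamma u" "gamma a = x" "gamma b = y"
   "l = integral {a..b} (%t. norm (u t))" unfolding joined_def by blast
 show ?thesis unfolding joined_def by (intro exI[of _ a] exI[of _ b] exI[of _ "%t. dilation c (gamma t)"] exI[of _ "%t. c *R u t"])
   (use A horizontal_dilate in auto)
qed

lemma horizontal_line:
 assumes v: "v : layer 1"
 shows "controlled a b (%t. x ** (t *R v)) (%_. v)" unfolding control_def
proof (intro conjI ballI)
 have "abs_continuous_curve a b (%t. t *R v)" by (rule abs_continuous_lipschitz[of _ "norm v"]) (simp add: scaleR_diff_left[symmetric] mult.commute)
 thus "abs_continuous_curve a b (%t. x ** (t *R v))" by (rule abs_continuous_translate)
 show "(%_. v) absolutely_integrable_on {a..b}" by (simp add: absolutely_integrable_on_def integrable_const_ivl)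
qed (use v mult_curve_has_vderiv in auto)

lemma joined_line: "v : layer 1 ==> joined x (x ** v) (norm v)" unfolding joined_def
 by (intro exI[of _ 0] exI[of _ 1] exI[of _ "%t. x ** (t *R v)"] exI[of _ "%_. v"])
  (use horizontal_line right_unit in auto)

lemma joined_p: "joined x y l ==> norm (p y - p x) <= l"
proof -
 assume "joined x y l"
 then obtain a b gamma u where A: "a <= b" "controlled a b gamma u" "gamma a = x" "gamma b = y"
   "l = integral {a..b} (%t. norm (u t))" unfolding joined_def by blast
 have bl: "bounded_linear p" using linear_p linear_conv_bounded_linear by blast
 have "(u has_integral p (gamma b) - p (gamma a)) {a..b}"
 proof (rule abs_continuous_has_integral[OF A(1)])
  show "abs_continuous_curve a b (%t. p (gamma t))" using abs_continuous_linear[OF linear_p] A(2) by (simp add: control_def)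
  have *: "((%t. p (gamma t)) has_vderiv u t) (at t)" if "t : {a..b}" "(gamma has_vderiv lif (gamma t) (u t)) (at t)" for t
  proof -
   have "u t : layer 1" using A(2) that by (simp add: control_def)
   thus ?thesis using bounded_linear.has_vector_derivative[OF bl that(2)] by (simp add: p_lif p_layer1)
  qed
  have "AE t in lebesgue. t : {a..b} --> (gamma has_vderiv lif (gamma t) (u t)) (at t)" using A(2) by (simp add: control_def)
  thus "AE t in lebesgue. t : {a..b} --> ((%t. p (gamma t)) has_vderiv u t) (at t)" by eventually_elim (use * in blast)
 qed
 hence "p y - p x = integral {a..b} u" using A by (simp add: integral_unique)
 also have "norm ... <= l" unfolding A(5) by (rule integral_norm_bound_integral) (use control_integrable[OF A(2)] in auto)
 finally show ?thesis .
qed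

section \<open>The Carnot-Caratheodory distance\<close>

lemma lif_bound: "EX K>0. ALL x v. norm x <= 1 --> norm (lif x v) <= K * norm v"
proof -
 have "continuous_on (cball 0 1) (%x. SUM b:Basis. norm (lif x b))"
  by (intro continuous_intros continuous_at_imp_continuous_on ballI has_derivative_continuous[OF lif_has_derivative])
 hence "bounded ((%x. SUM b:Basis. norm (lif x b)) ` cball 0 1)" by (intro compact_imp_bounded compact_continuous_image) auto
 then obtain K where K: "ALL x:cball 0 1. norm (SUM b:Basis. norm (lif x b)) <= K" unfolding bounded_iff by auto
 have "norm (lif x v) <= (abs K + 1) * norm v" if "norm x <= 1" for x v
 proof -
  have "norm (lif x v) <= norm v * (SUM b:Basis. norm (lif x b))" by (rule linear_bound_by_Basis[OF linear_lif])
  also have "norm v * (SUM b:Basis. norm (lif x b)) <= norm v * (abs K + 1)"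
  proof (intro mult_left_mono norm_ge_zero)
   have "abs (SUM b:Basis. norm (lif x b)) <= K" using K that by simp
   thus "(SUM b:Basis. norm (lif x b)) <= abs K + 1" by linarith
  qed
  finally show ?thesis by (simp add: mult.commute)
 qed
 thus ?thesis by (intro exI[of _ "abs K + 1"]) auto
qed

text \<open>A curve of small length starting at \<open>0\<close> has no time to leave the unit ball.\<close>

lemma joined_norm_le: "EX K>0. ALL y l. joined 0 y l --> K * l < 1 --> norm y <= K * l"
proof -
 obtain K where K: "K > 0" "ALL x v. norm x <= 1 --> norm (lif x v) <= K * norm v" using lif_bound by blast
 have "norm y <= K * l" if j: "joined 0 y l" and Kl: "K * l < 1" for y l
 proof -
  obtain a b gamma u where A: "a <= b" "controlled a b gamma u" "gamma a = 0" "gamma b = y"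
   "l = integral {a..b} (%t. norm (u t))" using j unfolding joined_def by blast
  have ac: "abs_continuous_curve a b gamma" and
   der: "AE t in lebesgue. t : {a..b} --> (gamma has_vderiv lif (gamma t) (u t)) (at t)" using A(2) by (simp_all add: control_def)
  note ui = control_integrable(2)[OF A(2)]
  have est: "norm (gamma T) <= K * l" if T: "T : {a..b}" and small: "!!t. t : {a..T} ==> norm (gamma t) <= 1" for T
  proof -
   have acT: "abs_continuous_curve a T gamma" using T by (intro abs_continuous_comp_mono[OF ac, of "%t. t"]) auto
   have I: "((%t. lif (gamma t) (u t)) has_integral gamma T - gamma a) {a..T}" by (rule abs_continuous_has_integral[OF _ acT]) (use T in "auto intro: eventually_mono[OF der]")
   have uT: "(%t. norm (u t)) integrable_on {a..T}" by (rule integrable_on_subinterval[OF ui]) (use T in auto)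
   have "norm (gamma T) = norm (integral {a..T} (%t. lif (gamma t) (u t)))" using integral_unique[OF I] A(3) by simp
   also have "... <= integral {a..T} (%t. K * norm (u t))"
   proof (rule integral_norm_bound_integral)
    show "(%t. lif (gamma t) (u t)) integrable_on {a..T}" using I by blast
    show "(%t. K * norm (u t)) integrable_on {a..T}" by (rule integrable_on_mult_right[OF uT])
   qed (use K small in auto)
   also have "... = K * integral {a..T} (%t. norm (u t))" by simp
   also have "... <= K * integral {a..b} (%t. norm (u t))" using K T by (intro mult_left_mono integral_subset_le uT ui) auto
   finally show ?thesis using A(5) by simp
  qed
  have all: "norm (gamma t) < 1" if "t : {a..b}" for t
  proof (rule ccontr)
   assume "~ norm (gamma t) < 1"
   define S where "S = {t:{a..b}. 1 <= norm (gamma t)}"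
   have ne: "S ~= {}" using that \<open>~ norm (gamma t) < 1\<close> by (auto simp: S_def)
   have "closed S" unfolding S_def by (intro continuous_closed_preimage_constant continuous_on_closed_Collect_le continuous_on_const
      continuous_on_norm abs_continuous_imp_continuous ac closed_atLeastAtMost)
   moreover have bb: "bdd_below S" by (auto simp: S_def intro!: bdd_belowI[of _ a])
   ultimately have T: "Inf S : S" using ne closed_contains_Inf by blast
   have "Inf S ~= a" using T A(3) by (auto simp: S_def)
   hence aT: "a < Inf S" using T by (auto simp: S_def)
   have lt: "norm (gamma t) < 1" if "a <= t" "t < Inf S" for t
   proof (rule ccontr)
    assume "~ norm (gamma t) < 1"
    hence "t : S" using that T by (auto simp: S_def)
    thus False using cInf_lower[OF _ bb, of t] that by simp
   qed
   have c: "continuous_on {a..Inf S} (%t. norm (gamma t))" by (intro continuous_on_norm continuous_on_subset[OF abs_continuous_imp_continuous[OF ac]])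
     (use T in "auto simp: S_def")
   have cl: "closure {a..<Inf S} = {a..Inf S}" using aT by simp
   have c': "continuous_on (closure {a..<Inf S}) (%t. norm (gamma t))" unfolding cl by (rule c)
   have le1: "norm (gamma t) <= 1" if "t : {a..Inf S}" for t by (rule continuous_le_on_closure[OF c']) (use that cl lt in "auto intro: less_imp_le")
   have "Inf S : {a..b}" using T by (simp add: S_def)
   hence "norm (gamma (Inf S)) <= K * l" using le1 by (rule est)
   thus False using T Kl by (auto simp: S_def)
  qed
  show ?thesis using est[of b] all A by (auto intro: less_imp_le)
 qed
 thus ?thesis using K by blast
qed

subsection \<open>Horizontal curves reach every point\<close>

definition within_reach :: "real => 'a => bool" where
 "within_reach M x \<longleftrightarrow> (EX l<=M. joined 0 x l)"

lemma within_reach_mult: "within_reach M x ==> within_reach N y ==> within_reach (M + N) (x ** y)"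
proof -
 assume "within_reach M x" "within_reach N y"
 then obtain l k where "l <= M" "joined 0 x l" "k <= N" "joined 0 y k" unfolding within_reach_def by blast
 hence "joined 0 (x ** y) (l + k)" using joined_trans[of 0 x l "x ** y" k] joined_translate[of 0 y k x] by (simp add: right_unit)
 thus ?thesis using \<open>l <= M\<close> \<open>k <= N\<close> unfolding within_reach_def by (meson add_mono)
qed

lemma within_reach_inv: "within_reach M x ==> within_reach M (- x)"
proof -
 assume "within_reach M x"
 then obtain l where l: "l <= M" "joined 0 x l" unfolding within_reach_def by blast
 have "joined ((- x) ** x) ((- x) ** 0) l" using joined_translate[OF joined_sym[OF l(2)], of "- x"] by (auto dest: joined_sym)
 hence "joined 0 (- x) l" by (simp add: inv_l right_unit)
 thus ?thesis using l unfolding within_reach_def by blast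
qed

lemma within_reach_layer1: "v : layer 1 ==> within_reach (norm v) v" using joined_line[of v 0] by (auto simp: within_reach_def left_unit)

lemma within_reach_dilate: "within_reach M x ==> within_reach (abs c * M) (dilation c x)"
proof -
 assume "within_reach M x"
 then obtain l where l: "l <= M" "joined 0 x l" unfolding within_reach_def by blast
 have "abs c * l <= abs c * M" using l(1) by (rule mult_left_mono) simp
 thus ?thesis using joined_dilate[OF l(2), of c] unfolding within_reach_def by auto
qed

lemma within_reach_mono: "within_reach M x ==> M <= N ==> within_reach N x" unfolding within_reach_def by (meson order_trans)

text \<open>
  The argument applies to any notion of reaching a point at a certain cost that is compatible with the
  group operations and holds for horizontal vectors.
\<close>

context
 fixes R :: "real => 'a => bool"
 assumes R_mult: "!!M N x y. R M x ==> R N y ==> R (M + N) (x ** y)"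
  and R_inv: "!!M x. R M x ==> R M (- x)"
  and R_layer1: "!!v. v : layer 1 ==> R (norm v) v"
  and R_mono: "!!M N x. R M x ==> M <= N ==> R N x"
  and R_dilate: "!!M c x. R M x ==> R (abs c * M) (dilation c x)"
begin

lemma R_0: "R 0 0" using R_layer1[of 0] subspace_0[OF subspace_layer] by simp

lemma R_conj:
 assumes "R M g" "v : layer 1"
 shows "R (2 * M + abs t * norm v) (t *R conj g v)"
proof -
 have "R (M + abs t * norm v + M) (g ** (t *R v) ** (- g))" using R_layer1[OF layer_scale[OF assms(2)], of t] assms(1) by (intro R_mult R_inv) auto
 moreover have "t *R conj g v = g ** (t *R v) ** (- g)" by (metis conj_def conj_scale)
 moreover have "M + abs t * norm v + M = 2 * M + abs t * norm v" by simp
 ultimately show ?thesis by metis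
qed

text \<open>
  The span of the conjugates of horizontal vectors by reachable elements is invariant under these
  conjugations, hence, differentiating, under brackets with horizontal vectors; so it is everything.
\<close>

lemma span_conj_reachable: "span {conj g v |g v. (EX M. R M g) & v : layer 1} = UNIV"
proof -
 define W where "W = span {conj g v |g v. (EX M. R M g) & v : layer 1}"
 have sub: "subspace W" unfolding W_def by simp
 have inv: "conj h w : W" if h: "R M h" and w: "w : W" for h w M using w unfolding W_def
 proof (induction rule: span_induct)
  case base
  show ?case using linear_subspace_linear_preimage[OF linear_conj subspace_span] .
 next
  case (step x)
  then obtain g v N where gv: "x = conj g v" "R N g" "v : layer 1" by blast
  have "conj h x = conj (h ** g) v" by (simp add: gv conj_mult)
  thus ?case using R_mult[OF h gv(2)] gv(3) by (intro span_base) blast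
 qed
 have l1: "layer 1 <= W"
 proof
  fix v assume "v : layer 1"
  hence "conj 0 v : W" unfolding W_def using R_0 by (intro span_base) blast
  thus "v : W" by (simp add: conj_0)
 qed
 have br: "br x w : W" if x: "x : layer 1" and w: "w : W" for x w
 proof -
  have "((%h. norm (conj (h *R x) w - w - h *R br x w) / norm h) \<longlongrightarrow> 0) (at 0)"
   using conj_derivative_0[of x w] by (simp add: has_vector_derivative_def has_derivative_at conj_0)
  hence "((%h. (conj (h *R x) w - w) /\<^sub>R h - br x w) \<longlongrightarrow> 0) (at 0)"
   unfolding tendsto_norm_zero_iff[of "%h. (conj (h *R x) w - w) /\<^sub>R h - br x w", symmetric]
  proof (rule Lim_transform_eventually)
   show "\<forall>\<^sub>F h in at 0. norm (conj (h *R x) w - w - h *R br x w) / norm h = norm ((conj (h *R x) w - w) /\<^sub>R h - br x w)" unfolding eventually_at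
   proof (intro exI[of _ 1] conjI ballI impI)
    fix h :: real assume "h ~= 0 & dist h 0 < 1"
    hence "(conj (h *R x) w - w) /\<^sub>R h - br x w = (conj (h *R x) w - w - h *R br x w) /\<^sub>R h" by (simp add: scaleR_diff_right)
    thus "norm (conj (h *R x) w - w - h *R br x w) / norm h = norm ((conj (h *R x) w - w) /\<^sub>R h - br x w)" by (simp add: divide_inverse)
   qed simp
  qed
  hence L: "((%h. (conj (h *R x) w - w) /\<^sub>R h) \<longlongrightarrow> br x w) (at 0)" by (simp add: LIM_zero_iff)
  show ?thesis
  proof (rule Lim_in_closed_set[OF closed_subspace[OF sub] _ _ L])
   show "\<forall>\<^sub>F h in at 0. (conj (h *R x) w - w) /\<^sub>R h : W" using inv[OF R_layer1[OF layer_scale[OF x]] w] w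
    by (intro always_eventually allI subspace_scale[OF sub] subspace_diff[OF sub])
  qed simp
 qed
 have lay: "layer i <= W" if "i : {1..s}" for i using that
 proof (induction i rule: less_induct)
  case (less i)
  show ?case
  proof (cases "i = 1")
   case False
   hence i: "i : {2..s}" "i - 1 < i" "i - 1 : {1..s}" using less.prems by auto
   have "{br v w |v w. v : span (B 1) & w : span (B (i - 1))} <= W" using br less.IH[OF i(2,3)] by (auto simp: layer_def)
   thus ?thesis unfolding layer_def layers_generated[OF i(1)] using span_minimal sub by blast
  qed (use l1 in simp)
 qed
 have "x : W" for x by (subst sum_layer_part[symmetric]) (intro subspace_sum[OF sub], use lay layer_part_in_layer in blast)
 thus ?thesis by (auto simp: W_def)
qed

lemma mult_at_0_has_derivative:
 assumes "(f has_derivative f') (at 0)" "(g has_derivative g') (at 0)" "f 0 = 0" "g 0 = 0"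
 shows "((%x. f x ** g x) has_derivative (%h. f' h + g' h)) (at 0)"
proof -
 have P: "((%x. (f x, g x)) has_derivative (%h. (f' h, g' h))) (at 0)" using assms(1,2) by (rule has_derivative_Pair)
 have "((%x. f x ** g x) has_derivative (%h. dmult 0 0 (f' h) (g' h))) (at 0)" using has_derivative_compose[OF P mult_has_derivative] assms(3,4) by simp
 moreover have "dmult 0 0 u v = u + v" for u v using dmult_add[of 0 0 u v] lif_0[of v] by (simp add: dmult_left_0 lif_eq)
 ultimately show ?thesis by simp
qed

lemma continuous_mult:
 "continuous_on S f ==> continuous_on S g ==> continuous_on S (%x. f x ** g x)"
 using continuous_on_compose2[OF smooth_continuous[OF smooth_mult, of UNIV], of S "%x. (f x, g x)"] by (auto intro: continuous_on_Pair)

text \<open>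
  Chow's theorem. Choose a basis \<open>w b\<close> of conjugates of horizontal vectors: the product of the factors
  \<open>(x *. b) *R w b\<close>, as a function of \<open>x\<close>, has a surjective derivative at \<open>0\<close>, so it is open there.
\<close>

lemma reach_ball: "EX M r. r > 0 & M > 0 & (ALL x. norm x < r --> R M x)"
proof -
 let ?C = "{conj g v |g v. (EX M. R M g) & v : layer 1}"
 obtain B' where B': "B' <= ?C" "independent B'" "span B' = UNIV" "card B' = DIM('a)"
 proof -
  obtain B' where B: "B' <= ?C" "independent B'" "?C <= span B'" "card B' = dim ?C" by (rule basis_exists[of ?C])
  have "span ?C <= span B'" using B(3) by (intro span_minimal) auto
  hence "span B' = UNIV" unfolding span_conj_reachable by auto
  moreover have "dim ?C = DIM('a)" using span_conj_reachable dim_span[of ?C] by simp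
  ultimately show thesis using that B by simp
 qed
 have "finite B'" using B'(2) by (rule independent_imp_finite)
 then obtain w where w: "bij_betw w (Basis :: 'a set) B'" using B'(4) finite_same_card_bij[OF finite_Basis] by metis
 have "ALL b:Basis. EX N. ALL t. abs t <= 1 --> R N (t *R w b)"
 proof
  fix b :: 'a assume "b : Basis"
  hence "w b : ?C" using w B'(1) by (auto simp: bij_betw_def)
  then obtain g v M where g: "w b = conj g v" "R M g" "v : layer 1" by blast
  have "R (2 * M + norm v) (t *R w b)" if "abs t <= 1" for t unfolding g(1) using R_conj[OF g(2,3), of t] by (rule R_mono) (use that in "simp add: mult_left_le_one_le")
  thus "EX N. ALL t. abs t <= 1 --> R N (t *R w b)" by blast
 qed
 from bchoice[OF this] obtain N where N: "ALL b:Basis. ALL t. abs t <= 1 --> R (N b) (t *R w b)" ..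
 define Psi where "Psi bs x = foldr (%b y. ((x *. b) *R w b) ** y) bs 0" for bs and x :: 'a
 have Psi_Cons: "Psi (b # bs) x = ((x *. b) *R w b) ** Psi bs x" "Psi [] x = 0" for b bs x by (simp_all add: Psi_def)
 have Psi0: "Psi bs 0 = 0" for bs by (induction bs) (simp_all add: Psi_Cons left_unit)
 have cont: "continuous_on UNIV (Psi bs)" for bs
 proof (induction bs)
  case (Cons b bs)
  thus ?case unfolding Psi_Cons(1)[abs_def] by (intro continuous_mult continuous_intros)
 qed (simp add: Psi_def)
 have der: "(Psi bs has_derivative (%h. \<Sum>b\<leftarrow>bs. (h *. b) *R w b)) (at 0)" for bs
 proof (induction bs)
  case (Cons b bs)
  have "((%x. (x *. b) *R w b) has_derivative (%h. (h *. b) *R w b)) (at 0)" by (auto intro!: derivative_eq_intros)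
  from mult_at_0_has_derivative[OF this Cons] show ?case unfolding Psi_Cons(1)[abs_def] by (simp add: Psi0)
 qed (simp add: Psi_def)
 have reach: "R (\<Sum>b\<leftarrow>bs. N b) (Psi bs x)" if "norm x <= 1" "set bs <= Basis" for bs x using that(2)
 proof (induction bs)
  case Nil
  thus ?case using R_0 by (simp add: Psi_def)
 next
  case (Cons b bs)
  hence "abs (x *. b) <= 1" using Basis_le_norm[of b x] that(1) by simp
  thus ?case using Cons N unfolding Psi_Cons by (auto intro!: R_mult)
 qed
 obtain bs where bs: "set bs = (Basis :: 'a set)" "distinct bs" using finite_distinct_list[OF finite_Basis] by blast
 define L where "L h = (SUM b:Basis. (h *. b) *R w b)" for h :: 'a
 have Lder: "(Psi bs has_derivative L) (at 0)" using der[of bs] bs unfolding L_def[abs_def] by (simp add: sum_list_distinct_conv_sum_set)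
 have linL: "linear L" using has_derivative_linear[OF Lder] .
 have "B' <= range L"
 proof
  fix y assume "y : B'"
  then obtain b where b: "b : Basis" "y = w b" using w by (auto simp: bij_betw_def)
  have "L b = (SUM c:Basis. if c = b then w b else 0)" unfolding L_def by (rule sum.cong) (use b in "auto simp: inner_Basis")
  hence "L b = y" using b by simp
  thus "y : range L" by blast
 qed
 hence "span B' <= range L" by (rule span_minimal) (rule linear_subspace_image[OF linL subspace_UNIV])
 hence "surj L" using B'(3) by auto
 then obtain g where g: "linear g" "L o g = id" using linear_surjective_right_inverse[OF linL] by blast
 have "Psi bs 0 : interior (Psi bs ` ball 0 1)" by (rule sussmann_open_mapping[OF open_UNIV cont _ Lder _ g(2)])
   (use g(1) in "auto simp: linear_conv_bounded_linear interior_open")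
 then obtain r where r: "r > 0" "ball 0 r <= Psi bs ` ball 0 1" unfolding Psi0 mem_interior by blast
 have "R (abs (\<Sum>b\<leftarrow>bs. N b) + 1) x" if "norm x < r" for x
 proof -
  have "x : Psi bs ` ball 0 1" using r(2) that by auto
  then obtain z where z: "norm z < 1" "x = Psi bs z" by auto
  show ?thesis unfolding z(2) by (rule R_mono[OF reach]) (use z bs in auto)
 qed
 thus ?thesis using r(1) by (intro exI[of _ "abs (\<Sum>b\<leftarrow>bs. N b) + 1"] exI[of _ r]) auto
qed

lemma R_bounded: "EX M>0. ALL x. norm x <= r' --> R M x"
proof -
 obtain M r where M: "r > 0" "M > 0" "ALL x. norm x < r --> R M x" using reach_ball by blast
 define c where "c = max 1 ((abs r' + 1) / r)"
 have c: "c >= 1" "abs r' + 1 <= c * r" using M(1) by (auto simp: c_def field_simps max_def)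
 have "R (c * M) x" if x: "norm x <= r'" for x
 proof -
  have "norm (dilation (1 / c) x) <= (1 / c) * norm x" by (rule norm_dilation_small) (use c in auto)
  also have "... <= (1 / c) * r'" using x c by (intro mult_left_mono) auto
  also have "... < r" using c by (simp add: field_simps)
  finally have "R M (dilation (1 / c) x)" using M(3) by blast
  from R_dilate[OF this, of c] show ?thesis using c dilation_inverse(1)[of c x] by simp
 qed
 thus ?thesis using c M by (intro exI[of _ "c * M"]) auto
qed

end

lemma reach_bounded: "EX M>0. ALL x. norm x <= r --> within_reach M x"
proof (rule R_bounded[of within_reach])
qed (fact within_reach_mult within_reach_inv within_reach_layer1 within_reach_mono within_reach_dilate)+

lemma joined_ex: "EX l. joined x y l"
proof -
 obtain M where "within_reach M ((- x) ** y)" using reach_bounded by blast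
 then obtain l where "joined 0 ((- x) ** y) l" unfolding within_reach_def by blast
 from joined_translate[OF this, of x] show ?thesis by (auto simp: right_unit inv_cancel)
qed

subsection \<open>Metric properties\<close>

abbreviation d :: "'a => 'a => real" where "d \<equiv> cc_dist"

lemma joined_bdd: "bdd_below {l. joined x y l}" by (auto intro!: bdd_belowI[of _ 0] joined_nonneg)
lemma d_le_joined: "joined x y l ==> d x y <= l" unfolding cc_dist_joined by (rule cInf_lower) (auto simp: joined_bdd)
lemma d_approx: "e > 0 ==> EX l. joined x y l & l < d x y + e" using cInf_lessD[of "{l. joined x y l}" "d x y + e"] joined_ex[of x y] unfolding cc_dist_joined by auto
lemma d_ge: "(!!l. joined x y l ==> c <= l) ==> c <= d x y" unfolding cc_dist_joined using joined_ex[of x y] by (intro cInf_greatest) auto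
lemma d_nonneg [simp]: "0 <= d x y" by (rule d_ge) (rule joined_nonneg)

lemma d_sym: "d x y = d y x"
proof -
 have "{l. joined x y l} = {l. joined y x l}" using joined_sym by blast
 thus ?thesis unfolding cc_dist_joined by simp
qed

lemma d_triangle: "d x z <= d x y + d y z"
proof (rule field_le_epsilon)
 fix e :: real assume "e > 0"
 then obtain l k where lk: "joined x y l" "l < d x y + e / 2" "joined y z k" "k < d y z + e / 2" using d_approx[of "e / 2" x y] d_approx[of "e / 2" y z] by auto
 have "d x z <= l + k" by (rule d_le_joined[OF joined_trans[OF lk(1,3)]])
 thus "d x z <= d x y + d y z + e" using lk(2,4) by linarith
qed

lemma d_mult_left [simp]: "d (z ** x) (z ** y) = d x y"
proof -
 have "d (z ** x) (z ** y) <= d x y" for x y z by (rule d_ge) (rule d_le_joined[OF joined_translate])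
 from this[of z x y] this[of "- z" "z ** x" "z ** y"] show ?thesis by (simp add: inv_cancel)
qed

lemma d_eq_0: "d x y = d 0 ((- x) ** y)" using d_mult_left[of "- x" x y] by (simp add: inv_l)

lemma d_self [simp]: "d x x = 0"
proof -
 obtain l where l: "l <= 0" "joined 0 0 l" using within_reach_layer1[of 0] subspace_0[OF subspace_layer] unfolding norm_zero within_reach_def by blast
 have "d 0 0 <= l" by (rule d_le_joined[OF l(2)])
 hence "d 0 0 = 0" using l(1) d_nonneg[of 0 0] by linarith
 thus ?thesis using d_eq_0[of x x] by (simp add: inv_l)
qed

lemma d_dilation: "c >= 0 ==> d (dilation c x) (dilation c y) = c * d x y"
proof -
 have le: "d (dilation c x) (dilation c y) <= c * d x y" if c: "c > 0" for c x y
 proof -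
  have "d (dilation c x) (dilation c y) / c <= d x y"
  proof (rule d_ge)
   fix l assume "joined x y l"
   from d_le_joined[OF joined_dilate[OF this, of c]] show "d (dilation c x) (dilation c y) / c <= l" using c by (simp add: field_simps)
  qed
  thus ?thesis using c by (simp add: field_simps)
 qed
 assume "c >= 0"
 then consider "c = 0" | "c > 0" by linarith
 thus ?thesis
 proof cases
  case 1
  have "dilation 0 x = 0" for x unfolding dilation_def by (rule sum.neutral) auto
  hence "d (dilation 0 x) (dilation 0 y) = 0" by simp
  thus ?thesis using 1 by simp
 next
  case 2
  from le[OF 2, of x y] le[of "1 / c" "dilation c x" "dilation c y"] 2
  show ?thesis by (simp add: dilation_inverse field_simps)
 qed
qed

lemma d_0_dilation: "c >= 0 ==> d 0 (dilation c x) = c * d 0 x" using d_dilation[of c 0 x] by simp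
lemma norm_p_diff_le: "norm (p y - p x) <= d x y" by (rule d_ge) (rule joined_p)
lemma norm_p_le_d: "norm (p x) <= d 0 x" using norm_p_diff_le[of x 0] linear_0[OF linear_p] by simp

lemma d_layer1:
 assumes v: "v : layer 1"
 shows "d 0 v = norm v"
proof (rule antisym)
 obtain l where l: "l <= norm v" "joined 0 v l" using within_reach_layer1[OF v] unfolding within_reach_def by blast
 show "d 0 v <= norm v" using d_le_joined[OF l(2)] l(1) by linarith
 show "norm v <= d 0 v" using norm_p_le_d[of v] p_layer1[OF v] by simp
qed

lemma d_line: "v : layer 1 ==> d (q ** (a *R v)) (q ** (b *R v)) = abs (b - a) * norm v"
proof -
 assume v: "v : layer 1"
 have "d (q ** (a *R v)) (q ** (b *R v)) = d (a *R v) (b *R v)" by simp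
 also have "... = d 0 (((- a) *R v) ** (b *R v))" by (subst d_eq_0) simp
 also have "... = norm ((b - a) *R v)" unfolding exp_coords using d_layer1[OF layer_scale[OF v], of "- a + b"] by simp
 finally show ?thesis by simp
qed

lemma d_mult_le: "d 0 (x ** y) <= d 0 x + d 0 y" using d_triangle[of 0 "x ** y" x] d_mult_left[of x 0 y] by (simp add: right_unit)

text \<open>The distance and the norm control each other locally; the exponent comes from the dilations.\<close>

lemma d_le_norm_powr: "EX K>0. ALL z. norm z <= R --> d 0 z <= K * norm z powr (1 / s)"
proof -
 have s1: "real s >= 1" using step_pos by simp
 obtain M1 where M1: "M1 > 0" "ALL x. norm x <= 1 --> within_reach M1 x" using reach_bounded by blast
 obtain M2 where M2: "M2 > 0" "ALL x. norm x <= R --> within_reach M2 x" using reach_bounded by blast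
 have dr: "d 0 x <= M" if "within_reach M x" for x M using that d_le_joined unfolding within_reach_def by (meson order_trans)
 have "d 0 z <= (M1 + M2) * norm z powr (1 / s)" if z: "norm z <= R" for z
 proof (cases "norm z <= 1")
  case True
  show ?thesis
  proof (cases "z = 0")
   case False
   define c where "c = norm z powr (1 / s)"
   have c0: "c > 0" using False by (simp add: c_def)
   have c1: "c <= 1" using True False s1 by (simp add: c_def powr_le1)
   have cs: "c ^ s = norm z" using False s1 by (simp add: c_def powr_realpow[symmetric] powr_powr)
   have "norm (dilation (1 / c) z) <= (1 / c) ^ s * norm z" by (rule norm_dilation_large) (use c0 c1 in simp)
   also have "... = 1" using cs False by (simp add: power_one_over)
   finally have "d 0 (dilation (1 / c) z) <= M1" using dr M1 by blast
   hence "d 0 z <= M1 * c" using c0 by (simp add: d_0_dilation field_simps)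
   also have "... <= (M1 + M2) * c" using c0 M2 by simp
   finally show ?thesis by (simp add: c_def)
  qed simp
 next
  case False
  have "d 0 z <= M2" using dr M2 z by blast
  also have "... <= (M1 + M2) * 1" using M1 by simp
  also have "... <= (M1 + M2) * norm z powr (1 / s)" using False M1 M2 s1 by (intro mult_left_mono ge_one_powr_ge_zero) auto
  finally show ?thesis .
 qed
 thus ?thesis using M1 M2 by (intro exI[of _ "M1 + M2"]) auto
qed

lemma norm_le_d: "EX K>0. ALL z. d 0 z <= R --> norm z <= K * d 0 z"
proof -
 obtain K where K: "K > 0" "ALL y l. joined 0 y l --> K * l < 1 --> norm y <= K * l" using joined_norm_le by blast
 have small: "norm z <= K * d 0 z" if z: "K * d 0 z < 1" for z
 proof (rule field_le_epsilon)
  fix e :: real assume e: "e > 0"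
  define e' where "e' = min e (1 - K * d 0 z)"
  have "e' / K > 0" using e z K by (simp add: e'_def)
  then obtain l where l: "joined 0 z l" "l < d 0 z + e' / K" using d_approx by blast
  hence "K * l < K * d 0 z + e'" using K(1) by (simp add: field_simps)
  hence "K * l < 1" "K * l <= K * d 0 z + e" by (auto simp: e'_def)
  thus "norm z <= K * d 0 z + e" using K(2) l(1) by fastforce
 qed
 define c where "c = max 1 (K * abs R + 1)"
 have c: "c >= 1" "K * abs R < c" by (auto simp: c_def)
 have "norm z <= (c ^ s * K) * d 0 z" if z: "d 0 z <= R" for z
 proof -
  have e: "d 0 (dilation (1 / c) z) = d 0 z / c" using c by (simp add: d_0_dilation)
  have "K * d 0 z <= K * abs R" using z K(1) by (intro mult_left_mono) auto
  hence "K * d 0 z < c" using c by linarith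
  hence "K * d 0 z / c < 1" using c by simp
  hence "K * d 0 (dilation (1 / c) z) < 1" by (simp add: e)
  from small[OF this] have "norm (dilation (1 / c) z) <= K * d 0 z / c" using e by simp
  also have "... <= K * d 0 z" using c K(1) mult_left_mono[of 1 c "K * d 0 z"] by (simp add: divide_le_eq)
  finally have n: "norm (dilation (1 / c) z) <= K * d 0 z" .
  have "norm z = norm (dilation c (dilation (1 / c) z))" using c dilation_inverse(1)[of c z] by simp
  also have "... <= c ^ s * norm (dilation (1 / c) z)" by (rule norm_dilation_large[OF c(1)])
  also have "... <= c ^ s * (K * d 0 z)" using c n by (intro mult_left_mono) auto
  finally show ?thesis by (simp add: mult.assoc)
 qed
 thus ?thesis using c K by (intro exI[of _ "c ^ s * K"]) auto
qed

lemma d_eq_0_iff: "d x y = 0 \<longleftrightarrow> x = y"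
proof
 assume "d x y = 0"
 obtain K where "ALL z. d 0 z <= 0 --> norm z <= K * d 0 z" using norm_le_d by blast
 moreover have "d 0 ((- x) ** y) = 0" using \<open>d x y = 0\<close> d_eq_0[of x y] by simp
 ultimately have "norm ((- x) ** y) <= K * 0" by (metis order_refl)
 hence "(- x) ** y = 0" by simp
 hence "x ** ((- x) ** y) = x" by (simp add: right_unit)
 thus "x = y" by (simp add: inv_cancel)
qed simp

section \<open>Distance estimates for polygonal paths\<close>

lemma conj_dilation: "dilation c (conj g z) = conj (dilation c g) (dilation c z)" by (simp add: conj_def dilation_mult dilation_uminus)

lemma conj_estimate: "EX K>0. ALL g z. norm g <= R --> d 0 z <= R --> d 0 (conj g z) <= K * d 0 z powr (1 / s)"
proof -
 obtain K1 where K1: "K1 > 0" "ALL z. d 0 z <= R --> norm z <= K1 * d 0 z" using norm_le_d by blast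
 have "continuous_on (cball 0 R) (%g. SUM b:Basis. norm (conj g b))" unfolding conj_def by (intro continuous_intros continuous_mult)
 hence "bounded ((%g. SUM b:Basis. norm (conj g b)) ` cball 0 R)" by (intro compact_imp_bounded compact_continuous_image) auto
 then obtain K2 where K2: "ALL g:cball 0 R. norm (SUM b:Basis. norm (conj g b)) <= K2" unfolding bounded_iff by auto
 define K3 where "K3 = (abs K2 + 1) * K1"
 have K3: "K3 > 0" using K1 by (simp add: K3_def)
 have n: "norm (conj g z) <= K3 * d 0 z" if "norm g <= R" "d 0 z <= R" for g z
 proof -
  have "norm (SUM b:Basis. norm (conj g b)) <= K2" using K2 that by simp
  hence S: "(SUM b:Basis. norm (conj g b)) <= abs K2 + 1" unfolding real_norm_def by linarith
  have "norm (conj g z) <= norm z * (SUM b:Basis. norm (conj g b))" by (rule linear_bound_by_Basis[OF linear_conj])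
  also have "... <= (K1 * d 0 z) * (abs K2 + 1)" by (rule mult_mono) (use K1 that S in "auto intro!: sum_nonneg mult_nonneg_nonneg")
  finally show ?thesis by (simp add: K3_def algebra_simps)
 qed
 obtain K4 where K4: "K4 > 0" "ALL z. norm z <= K3 * abs R --> d 0 z <= K4 * norm z powr (1 / s)" using d_le_norm_powr by blast
 have "d 0 (conj g z) <= (K4 * K3 powr (1 / s)) * d 0 z powr (1 / s)" if g: "norm g <= R" "d 0 z <= R" for g z
 proof -
  have "K3 * d 0 z <= K3 * abs R" using K3 g by (intro mult_left_mono) auto
  hence "norm (conj g z) <= K3 * abs R" using n[OF g] by linarith
  hence "d 0 (conj g z) <= K4 * norm (conj g z) powr (1 / s)" using K4 by blast
  also have "... <= K4 * (K3 * d 0 z) powr (1 / s)" using n[OF g] K4 by (intro mult_left_mono powr_mono2) auto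
  also have "... = (K4 * K3 powr (1 / s)) * d 0 z powr (1 / s)" using K3 by (simp add: powr_mult)
  finally show ?thesis .
 qed
 thus ?thesis using K3 K4(1) by (intro exI[of _ "K4 * K3 powr (1 / s)"]) auto
qed

lemma d_le_norm_diff: "EX K>0. ALL x y. norm x <= R --> norm y <= R --> d x y <= K * norm (x - y) powr (1 / s)"
proof -
 obtain K1 where K1: "K1 >= 0" "ALL x y x' y'. norm x <= R --> norm y <= R --> norm x' <= R --> norm y' <= R -->
   norm (x ** y - x' ** y') <= K1 * (norm (x - x') + norm (y - y'))" using mult_lipschitz by blast
 obtain K2 where K2: "K2 > 0" "ALL z. norm z <= K1 * (2 * abs R) --> d 0 z <= K2 * norm z powr (1 / s)" using d_le_norm_powr by blast
 have "d x y <= (K2 * K1 powr (1 / s) + 1) * norm (x - y) powr (1 / s)" if xy: "norm x <= R" "norm y <= R" for x y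
 proof -
  have n: "norm ((- x) ** y) <= K1 * norm (x - y)" using K1(2)[rule_format, of "- x" y "- x" x] xy by (simp add: inv_l norm_minus_commute)
  have "norm (x - y) <= 2 * abs R" using norm_triangle_ineq4[of x y] xy by linarith
  hence "K1 * norm (x - y) <= K1 * (2 * abs R)" using K1(1) by (rule mult_left_mono)
  hence "d 0 ((- x) ** y) <= K2 * norm ((- x) ** y) powr (1 / s)" using n K2(2) by (meson order_trans)
  also have "... <= K2 * (K1 * norm (x - y)) powr (1 / s)" using n K2(1) by (intro mult_left_mono powr_mono2) auto
  also have "... = K2 * K1 powr (1 / s) * norm (x - y) powr (1 / s)" using K1(1) by (simp add: powr_mult)
  also have "... <= (K2 * K1 powr (1 / s) + 1) * norm (x - y) powr (1 / s)" by (simp add: algebra_simps)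
  finally show ?thesis by (simp add: d_eq_0[of x y])
 qed
 thus ?thesis using K2(1) by (intro exI[of _ "K2 * K1 powr (1 / s) + 1"]) (auto simp: add_nonneg_pos)
qed

lemma d_scale_layer1:
 assumes "v : layer 1" "w : layer 1"
 shows "d (t *R v) (t *R w) = abs t * d v w"
proof -
 have "d (abs t *R v) (abs t *R w) = abs t * d v w" using d_dilation[of "abs t" v w] assms by (simp add: dilation_layer1)
 moreover have "d (- x) (- y) = d x y" if "x = c *R v" "y = c *R w" for c x y
 proof -
  have neg: "d (- v) (- w) <= d v w" if vw: "v : layer 1" "w : layer 1" for v w
  proof (rule d_ge)
   fix l assume "joined v w l"
   from d_le_joined[OF joined_dilate[OF this, of "-1"]] show "d (- v) (- w) <= l" using vw by (simp add: dilation_layer1)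
  qed
  have "x : layer 1" "y : layer 1" using that assms by (simp_all add: layer_scale)
  thus ?thesis using neg[of x y] neg[of "- x" "- y"] layer_scale[of x 1 "-1"] layer_scale[of y 1 "-1"] by simp
 qed
 ultimately show ?thesis by (cases "t >= 0") (auto simp: abs_if)
qed

lemma conj_scaled_estimate:
 "EX K>0. ALL g z T. T > 0 --> norm g <= R --> g : layer 1 --> d 0 z <= R * T --> d 0 (conj (T *R g) z) <= K * T * (d 0 z / T) powr (1 / s)"
proof -
 obtain K where K: "K > 0" "ALL g z. norm g <= R --> d 0 z <= R --> d 0 (conj g z) <= K * d 0 z powr (1 / s)" using conj_estimate by blast
 have "d 0 (conj (T *R g) z) <= K * T * (d 0 z / T) powr (1 / s)" if T: "T > 0" and g: "norm g <= R" "g : layer 1" and z: "d 0 z <= R * T" for g z T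
 proof -
  define z' where "z' = dilation (1 / T) z"
  have z': "d 0 z' = d 0 z / T" using T by (simp add: z'_def d_0_dilation)
  moreover have "d 0 z / T <= R" using z T by (simp add: pos_divide_le_eq)
  ultimately have "d 0 z' <= R" by simp
  hence "d 0 (conj g z') <= K * (d 0 z / T) powr (1 / s)" using K(2) g z' by metis
  moreover have "dilation T (conj g z') = conj (T *R g) z" using T g by (simp add: conj_dilation dilation_layer1 z'_def dilation_inverse)
  ultimately show ?thesis using d_0_dilation[of T "conj g z'"] T by (metis less_imp_le mult.assoc mult.commute mult_left_mono)
 qed
 thus ?thesis using K(1) by blast
qed

lemma d_right_mult: "d (x ** g) (y ** g) = d 0 (conj (- g) ((- x) ** y))" by (subst d_eq_0) (simp add: conj_def inv_mult assoc)

definition pprod :: "(real * 'a) list => 'a" where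
 "pprod L = foldr (%(t, V) y. (t *R V) ** y) L 0"

definition duration :: "(real * 'a) list => real" where
 "duration L = (\<Sum>(t, V)\<leftarrow>L. t)"

lemma pprod_simps [simp]: "pprod [] = 0" "pprod ((t, V) # L) = (t *R V) ** pprod L" by (simp_all add: pprod_def)
lemma duration_simps [simp]: "duration [] = 0" "duration ((t, V) # L) = t + duration L" by (simp_all add: duration_def)
lemma pprod_append: "pprod (L @ L') = pprod L ** pprod L'" by (induction L) (auto simp: left_unit assoc)
lemma duration_append [simp]: "duration (L @ L') = duration L + duration L'" by (simp add: duration_def)

definition rev_path :: "(real * 'a) list => (real * 'a) list" where
 "rev_path L = rev (map (%(t, V). (t, - V)) L)"

lemma pprod_rev_path: "pprod (rev_path L) = - pprod L" by (induction L) (auto simp: rev_path_def pprod_append inv_mult right_unit)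
lemma duration_rev_path [simp]: "duration (rev_path L) = duration L" by (induction L) (auto simp: rev_path_def)

definition near_path :: "'a => real => (real * 'a) list => bool" where
 "near_path E delta L \<longleftrightarrow> (ALL (t, V):set L. t >= 0 & V : layer 1 & norm (V - E) <= delta)"

lemma near_path_simps [simp]:
 "near_path E delta []"
 "near_path E delta ((t, V) # L) \<longleftrightarrow> t >= 0 & V : layer 1 & norm (V - E) <= delta & near_path E delta L"
 "near_path E delta (L @ L') \<longleftrightarrow> near_path E delta L & near_path E delta L'" by (auto simp: near_path_def)

lemma near_path_rev: "near_path E delta L ==> near_path (- E) delta (rev_path L)" using layer_scale[of _ 1 "-1"] by (auto simp: near_path_def rev_path_def norm_minus_commute)
lemma near_path_duration: "near_path E delta L ==> duration L >= 0" by (induction L) auto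

text \<open>
  A path whose pieces have directions close to \<open>E\<close> ends, in scale, close to the line in direction \<open>E\<close>:
  the pieces are exchanged one at a time, at the price of a conjugation.
\<close>

lemma near_path_estimate:
 "EX K>0. ALL E L delta. E : layer 1 --> norm E = 1 --> 0 <= delta --> delta <= 1 --> near_path E delta L -->
   d (duration L *R E) (pprod L) <= real (length L) * duration L * (K * delta powr (1 / s^2))"
proof -
 obtain K1 where K1: "K1 > 0" "ALL x y. norm x <= 2 --> norm y <= 2 --> d x y <= K1 * norm (x - y) powr (1 / s)" using d_le_norm_diff by blast
 obtain K2 where K2: "K2 > 0" "ALL g z T. T > 0 --> norm g <= max 1 K1 --> g : layer 1 --> d 0 z <= max 1 K1 * T -->
   d 0 (conj (T *R g) z) <= K2 * T * (d 0 z / T) powr (1 / s)" using conj_scaled_estimate by blast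
 define K where "K = K2 * K1 powr (1 / s)"
 have K: "K > 0" using K1 K2 by (simp add: K_def)
 have *: "d (duration L *R E) (pprod L) <= real (length L) * T * (K * delta powr (1 / s^2))"
  if E: "E : layer 1" "norm E = 1" and delta: "0 <= delta" "delta <= 1" and L: "near_path E delta L" "duration L <= T" and T: "T > 0" for E L delta T using L
 proof (induction L)
  case (Cons tV L)
  obtain t V where tV: "tV = (t, V)" by fastforce
  have t: "t >= 0" and V: "V : layer 1" "norm (V - E) <= delta" and L: "near_path E delta L" using Cons.prems by (auto simp: tV)
  define u where "u = duration L"
  have u: "u >= 0" "t + u <= T" using near_path_duration[OF L] Cons.prems by (auto simp: u_def tV)
  have IH: "d (u *R E) (pprod L) <= real (length L) * T * (K * delta powr (1 / s^2))" using Cons.IH L u t by (simp add: u_def)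
  have nV: "norm V <= 2" using norm_triangle_sub[of V E] V E delta by linarith
  have dVE: "d V E <= K1 * delta powr (1 / s)"
  proof -
   have "d V E <= K1 * norm (V - E) powr (1 / s)" using K1 nV E by auto
   also have "... <= K1 * delta powr (1 / s)" using K1 V by (intro mult_left_mono powr_mono2) auto
   finally show ?thesis .
  qed
  have p1: "delta powr (1 / s) <= 1" using delta by (intro powr_le1) auto
  have "t * d V E <= T * (K1 * delta powr (1 / s))" by (rule mult_mono) (use t u dVE T K1 in auto)
  hence dz: "d (t *R V) (t *R E) <= T * (K1 * delta powr (1 / s))" using t V E by (simp add: d_scale_layer1)
  define z where "z = (- (t *R V)) ** (t *R E)"
  have z: "d 0 z <= T * (K1 * delta powr (1 / s))" using dz by (simp add: z_def d_eq_0[of "t *R V"])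
  have "K1 * delta powr (1 / s) <= max 1 K1" using K1(1) p1 mult_left_le[of "delta powr (1 / s)" K1] by linarith
  hence "T * (K1 * delta powr (1 / s)) <= max 1 K1 * T" using T by (simp add: mult.commute)
  hence zR: "d 0 z <= max 1 K1 * T" using z by linarith
  define g where "g = (- u / T) *R E"
  have g: "g : layer 1" "norm g <= max 1 K1" "T *R g = - (u *R E)" using E T u t layer_scale[OF E(1), of "- u / T"] by (auto simp: g_def le_max_iff_disj)
  have "d 0 (conj (T *R g) z) <= K2 * T * (d 0 z / T) powr (1 / s)" using K2(2) T g zR by blast
  also have "... <= K2 * T * (K1 * delta powr (1 / s)) powr (1 / s)" using z T K2(1) by (intro mult_left_mono powr_mono2) (auto simp: field_simps)
  also have "... = T * (K * delta powr (1 / s^2))" using K1(1) by (simp add: K_def powr_mult powr_powr power2_eq_square)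
  finally have c: "d ((t *R V) ** (u *R E)) ((t *R E) ** (u *R E)) <= T * (K * delta powr (1 / s^2))" unfolding d_right_mult g(3) z_def .
  have "d ((t + u) *R E) ((t *R V) ** pprod L) <= d ((t + u) *R E) ((t *R V) ** (u *R E)) + d ((t *R V) ** (u *R E)) ((t *R V) ** pprod L)"
   by (rule d_triangle)
  also have "d ((t + u) *R E) ((t *R V) ** (u *R E)) <= T * (K * delta powr (1 / s^2))" using c by (simp add: exp_coords d_sym)
  also have "d ((t *R V) ** (u *R E)) ((t *R V) ** pprod L) <= real (length L) * T * (K * delta powr (1 / s^2))" using IH by simp
  finally show ?case by (simp add: tV u_def algebra_simps)
 qed simp
 have "d (duration L *R E) (pprod L) <= real (length L) * duration L * (K * delta powr (1 / s^2))"
  if E: "E : layer 1" "norm E = 1" "0 <= delta" "delta <= 1" and L: "near_path E delta L" for E L delta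
 proof (cases "duration L > 0")
  case True
  thus ?thesis using *[OF E L order_refl] by simp
 next
  case False
  hence 0: "duration L = 0" using near_path_duration[OF L] by simp
  have "pprod L = 0" using L 0
  proof (induction L)
   case (Cons tV L)
   obtain t V where tV: "tV = (t, V)" by fastforce
   have "t >= 0" "near_path E delta L" "t + duration L = 0" using Cons.prems by (auto simp: tV)
   moreover have "duration L >= 0" using near_path_duration calculation by blast
   ultimately have "t = 0" "duration L = 0" "near_path E delta L" by auto
   thus ?case using Cons.IH by (simp add: tV left_unit)
  qed simp
  thus ?thesis using 0 by simp
 qed
 thus ?thesis using K by blast
qed

subsection \<open>Walking along a path\<close>

primrec walk :: "(real * 'a) list => real => 'a" where
 "walk [] tau = 0"
| "walk (tV # L) tau = (if tau <= fst tV then tau *R snd tV else (fst tV *R snd tV) ** walk L (tau - fst tV))"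

lemma walk_0: "near_path E delta L ==> walk L 0 = 0" by (cases L) auto

lemma walk_duration: "near_path E delta L ==> walk L (duration L) = pprod L"
proof (induction L)
 case (Cons tV L)
 obtain t V where tV: "tV = (t, V)" by fastforce
 have IH: "near_path E delta L" "walk L (duration L) = pprod L" using Cons by (auto simp: tV)
 show ?case
 proof (cases "duration L = 0")
  case True
  thus ?thesis using IH walk_0[OF IH(1)] by (simp add: tV right_unit)
 next
  case False
  hence "duration L > 0" using near_path_duration[OF IH(1)] by simp
  thus ?thesis using IH by (simp add: tV)
 qed
qed simp

lemma walk_append:
 "near_path E delta L ==> near_path E delta L' ==> tau >= duration L ==> walk (L @ L') tau = pprod L ** walk L' (tau - duration L)"
proof (induction L arbitrary: tau)
 case (Cons tV L)
 obtain t V where tV: "tV = (t, V)" by fastforce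
 have n: "near_path E delta L" using Cons by (auto simp: tV)
 have le: "tau - t >= duration L" "duration L >= 0" using Cons.prems near_path_duration[OF n] by (auto simp: tV)
 show ?case
 proof (cases "tau <= t")
  case True
  hence 0: "duration L = 0" "tau = t" using le by auto
  have "walk (L @ L') 0 = pprod L ** walk L' 0" using Cons.IH[OF n Cons.prems(2), of 0] 0 by simp
  moreover have "walk (L @ L') 0 = 0" using walk_0[of E delta "L @ L'"] n Cons.prems(2) by simp
  ultimately show ?thesis using 0 by (simp add: tV assoc right_unit)
 next
  case False
  thus ?thesis using Cons.IH[OF n Cons.prems(2) le(1)] by (simp add: tV assoc algebra_simps)
 qed
qed (simp add: left_unit)

lemma walk_append_first: "near_path E delta L ==> near_path E delta L' ==> tau <= duration L ==> L ~= [] ==> walk (L @ L') tau = walk L tau"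
proof (induction L arbitrary: tau)
 case (Cons tV L)
 obtain t V where tV: "tV = (t, V)" by fastforce
 show ?case
 proof (cases "L = []")
  case False
  thus ?thesis using Cons by (auto simp: tV)
 qed (use Cons.prems in "auto simp: tV")
qed simp

text \<open>Between two times the walk performs a path with at most as many pieces.\<close>

lemma walk_segment:
 assumes "near_path E delta L" "0 <= sg" "sg <= tau" "tau <= duration L"
 shows "EX L'. near_path E delta L' & length L' <= length L & duration L' = tau - sg & walk L tau = walk L sg ** pprod L' & snd ` set L' <= snd ` set L" using assms
proof (induction L arbitrary: sg tau)
 case Nil
 thus ?case by (intro exI[of _ "[]"]) (auto simp: right_unit)
next
 case (Cons tV L)
 obtain t V where tV: "tV = (t, V)" by fastforce
 have V: "t >= 0" "V : layer 1" "norm (V - E) <= delta" "near_path E delta L" using Cons.prems by (auto simp: tV)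
 have e: "(sg *R V) ** ((r - sg) *R V) = r *R V" for r by (simp add: exp_coords)
 consider "tau <= t" | "sg <= t" "t < tau" | "t < sg" by linarith
 thus ?case
 proof cases
  case 1
  thus ?thesis using Cons.prems V e by (intro exI[of _ "[(tau - sg, V)]"]) (auto simp: tV right_unit)
 next
  case 2
  obtain L' where L': "near_path E delta L'" "length L' <= length L" "duration L' = tau - t"
   "walk L (tau - t) = walk L 0 ** pprod L'" "snd ` set L' <= snd ` set L" using Cons.IH[OF V(4) order_refl, of "tau - t"] 2 Cons.prems by (auto simp: tV)
  have "(t *R V) ** pprod L' = (sg *R V) ** (((t - sg) *R V) ** pprod L')" unfolding assoc[symmetric] e ..
  thus ?thesis using 2 V L' walk_0[OF V(4)] by (intro exI[of _ "(t - sg, V) # L'"]) (auto simp: tV left_unit)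
 next
  case 3
  obtain L' where L': "near_path E delta L'" "length L' <= length L" "duration L' = (tau - t) - (sg - t)"
   "walk L (tau - t) = walk L (sg - t) ** pprod L'" "snd ` set L' <= snd ` set L" using Cons.IH[OF V(4), of "sg - t" "tau - t"] 3 Cons.prems by (auto simp: tV)
  thus ?thesis using 3 Cons.prems by (intro exI[of _ L']) (auto simp: tV assoc)
 qed
qed

lemma d_pprod_le:
 assumes "near_path E delta L" "!!V. V : snd ` set L ==> norm V <= B'"
 shows "d 0 (pprod L) <= B' * duration L" using assms
proof (induction L)
 case (Cons tV L)
 obtain t V where tV: "tV = (t, V)" by fastforce
 have "d 0 ((t *R V) ** pprod L) <= d 0 (t *R V) + d 0 (pprod L)" by (rule d_mult_le)
 moreover have "d 0 (pprod L) <= B' * duration L" using Cons by (auto simp: tV)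
 moreover have "d 0 (t *R V) = t * norm V" using Cons.prems d_layer1[of "t *R V"] by (auto simp: tV layer_scale)
 moreover have "t * norm V <= t * B'" using Cons.prems by (intro mult_left_mono) (auto simp: tV)
 ultimately show ?case by (simp add: tV algebra_simps)
qed simp

lemma walk_lipschitz:
 assumes L: "near_path E delta L" "!!V. V : snd ` set L ==> norm V <= B'"
  and st: "0 <= sg" "sg <= duration L" "0 <= tau" "tau <= duration L"
 shows "d (walk L sg) (walk L tau) <= B' * abs (sg - tau)"
proof -
 have *: "d (walk L sg) (walk L tau) <= B' * (tau - sg)" if st: "0 <= sg" "sg <= tau" "tau <= duration L" for sg tau
 proof -
  obtain L' where L': "near_path E delta L'" "duration L' = tau - sg" "walk L tau = walk L sg ** pprod L'"
   "snd ` set L' <= snd ` set L" using walk_segment[OF L(1) st] by blast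
  have "d (walk L sg) (walk L tau) = d 0 (pprod L')" unfolding L'(3) using d_mult_left[of "walk L sg" 0 "pprod L'"] by (simp add: right_unit)
  also have "... <= B' * duration L'" by (rule d_pprod_le[OF L'(1)]) (use L(2) L'(4) in blast)
  also have "... = B' * (tau - sg)" by (simp add: L'(2))
  finally show ?thesis .
 qed
 show ?thesis using *[of sg tau] *[of tau sg] st by (cases "sg <= tau") (auto simp: d_sym)
qed

lemma walk_locally_line:
 assumes "near_path E delta L" "0 < tau" "tau < duration L" "tau ~: (%k. duration (take k L)) ` {..length L}"
 shows "EX k<length L. EX u eta. eta > 0 & (ALL h. abs h < eta --> walk L (tau + h) = pprod (take k L) ** ((u + h) *R snd (L ! k)))" using assms
proof (induction L arbitrary: tau)
 case (Cons tV L)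
 obtain t V where tV: "tV = (t, V)" by fastforce
 have n: "near_path E delta L" using Cons.prems by (auto simp: tV)
 have "tau ~= t" using Cons.prems(4)[unfolded image_iff] by (auto simp: tV dest: bspec[of _ _ 1])
 then consider "tau < t" | "tau > t" by linarith
 thus ?case
 proof cases
  case 1
  thus ?thesis by (intro exI[of _ 0] conjI exI[of _ tau] exI[of _ "t - tau"]) (auto simp: tV left_unit)
 next
  case 2
  have "tau - t ~: (%k. duration (take k L)) ` {..length L}"
  proof
   assume "tau - t : (%k. duration (take k L)) ` {..length L}"
   then obtain k where "k <= length L" "tau = duration (take (Suc k) (tV # L))" by (auto simp: tV)
   hence "tau : (%k. duration (take k (tV # L))) ` {..length (tV # L)}" by (intro image_eqI[of _ _ "Suc k"]) auto
   thus False using Cons.prems(4) by blast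
  qed
  with Cons.IH[OF n, of "tau - t"] 2 Cons.prems obtain k u eta where k: "k < length L" "eta > 0"
   "ALL h. abs h < eta --> walk L (tau - t + h) = pprod (take k L) ** ((u + h) *R snd (L ! k))" by (auto simp: tV)
  have "walk (tV # L) (tau + h) = pprod (take (Suc k) (tV # L)) ** ((u + h) *R snd ((tV # L) ! Suc k))" if "abs h < min eta (tau - t)" for h
  proof -
   have "~ tau + h <= t" "abs h < eta" using that by auto
   moreover have "tau + h - t = tau - t + h" by simp
   ultimately have "walk L (tau + h - t) = pprod (take k L) ** ((u + h) *R snd (L ! k))" using k(3) by metis
   thus ?thesis using \<open>~ tau + h <= t\<close> by (simp add: tV assoc)
  qed
  thus ?thesis using k 2 by (intro exI[of _ "Suc k"] conjI exI[of _ u] exI[of _ "min eta (tau - t)"]) auto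
 qed
qed simp

section \<open>A variational principle for directional derivatives\<close>

definition S1 :: "'a set" where "S1 = {E : layer 1. norm E = 1}"

abbreviation inc :: "('a => real) => 'a => 'a => real => real" where
 "inc f x E t == f (x ** (t *R E)) - f x"

definition dir_deriv :: "('a => real) => 'a => 'a => real => bool" where
 "dir_deriv f x E v \<longleftrightarrow> ((%t. f (x ** (t *R E))) has_real_derivative v) (at 0)"

definition osc :: "('a => real) => 'a => 'a => 'a => real => bool" where
 "osc f E x y c \<longleftrightarrow> (ALL t. abs (inc f x E t - inc f y E t) <= c * abs t)"

lemma osc_refl: "osc f E x x 0" by (simp add: osc_def)
lemma osc_mono: "osc f E x y c ==> c <= c' ==> osc f E x y c'" unfolding osc_def by (meson abs_ge_zero mult_right_mono order_trans)

lemma dir_deriv_near: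
 assumes "dir_deriv f x E v" "e > 0"
 obtains r where "r > 0" "!!t. abs t <= r ==> abs (inc f x E t - v * t) <= e * abs t"
proof -
 have "((%t. f (x ** (t *R E))) has_derivative (%h. v * h)) (at 0)" using assms(1) by (simp add: dir_deriv_def has_field_derivative_def)
 then obtain r where r: "r > 0" "ALL t. norm (t - 0) < r --> norm (f (x ** (t *R E)) - f (x ** (0 *R E)) - v * (t - 0)) <= e * norm (t - 0)"
  using assms(2) unfolding has_derivative_at_alt by blast
 show thesis by (rule that[of "r / 2"]) (use r in "auto simp: right_unit")
qed

lemma dir_deriv_bound:
 assumes lip: "!!x y. abs (f x - f y) <= L * d x y" and E: "E : S1" and v: "dir_deriv f x E v"
 shows "abs v <= L"
proof (rule lipschitz_derivative_le[OF _ v[unfolded dir_deriv_def]])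
 fix a b :: real
 have "abs (f (x ** (a *R E)) - f (x ** (b *R E))) <= L * d (x ** (a *R E)) (x ** (b *R E))" by (rule lip)
 thus "abs (f (x ** (a *R E)) - f (x ** (b *R E))) <= L * abs (a - b)" using E d_line[of E x a b] by (auto simp: S1_def abs_minus_commute)
qed

lemma far_estimate:
 "EX K>0. ALL x y E t. E : S1 --> t ~= 0 --> d x y <= abs t --> d (x ** (t *R E)) (y ** (t *R E)) <= K * abs t * (d x y / abs t) powr (1 / s)"
proof -
 obtain K where K: "K > 0" "ALL g z T. T > 0 --> norm g <= 1 --> g : layer 1 --> d 0 z <= 1 * T --> d 0 (conj (T *R g) z) <= K * T * (d 0 z / T) powr (1 / s)"
  using conj_scaled_estimate[of 1] by blast
 have "d (x ** (t *R E)) (y ** (t *R E)) <= K * abs t * (d x y / abs t) powr (1 / s)" if E: "E : S1" and t: "t ~= 0" "d x y <= abs t" for x y E t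
 proof -
  define g where "g = (- sgn t) *R E"
  have g: "g : layer 1" "norm g <= 1" "abs t *R g = - (t *R E)" using E t layer_scale[of E 1 "- sgn t"] by (auto simp: g_def S1_def sgn_if)
  have "d 0 (conj (abs t *R g) ((- x) ** y)) <= K * abs t * (d 0 ((- x) ** y) / abs t) powr (1 / s)"
   by (rule K(2)[rule_format]) (use t g in "auto simp: d_eq_0[of x y]")
  thus ?thesis by (simp add: d_right_mult g(3) d_eq_0[of x y])
 qed
 thus ?thesis using K(1) by blast
qed

text \<open>
  Closeness of increments passes from \<open>(x', y)\<close> to \<open>(x, y)\<close> if \<open>y\<close> is close to \<open>x'\<close>: at small scales by
  comparing the derivatives at \<open>x\<close> and \<open>x'\<close>, at the other scales by the closeness of \<open>x'\<close> and \<open>y\<close>.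
\<close>

lemma osc_transfer:
 assumes lip: "!!x y. abs (f x - f y) <= L * d x y" and L: "L > 0" and E: "E : S1" "E' : S1"
  and v: "dir_deriv f x E v" "dir_deriv f x' E' v'" and sg: "sg > 0" and a: "a >= 0"
  and osc: "osc f E x x' c" "c < sg + omega a" and vv: "abs (v - v') <= a + sg / 8" and dE: "L * d E E' <= sg / 8"
  and W: "!!a b. 0 <= a ==> 0 <= b ==> a + omega b <= omega (a + b)"
 shows "EX delta>0. EX eps>0. ALL y b. d x' y < delta --> b >= 0 --> osc f E' x' y (sg / 8 + omega b) --> osc f E x y (sg - eps + omega (a + b))"
proof -
 have s1: "real s >= 1" using step_pos by simp
 define theta where "theta = (sg + omega a - c) / 2"
 have theta: "theta > 0" using osc(2) by (simp add: theta_def)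
 have s8: "sg / 8 > 0" using sg by simp
 obtain r1 where r1: "r1 > 0" "!!t. abs t <= r1 ==> abs (inc f x E t - v * t) <= sg / 8 * abs t" using dir_deriv_near[OF v(1) s8] by blast
 obtain r2 where r2: "r2 > 0" "!!t. abs t <= r2 ==> abs (inc f x' E' t - v' * t) <= sg / 8 * abs t" using dir_deriv_near[OF v(2) s8] by blast
 define r where "r = min r1 r2"
 have r: "r > 0" using r1 r2 by (simp add: r_def)
 obtain K where K: "K > 0" "ALL x y E t. E : S1 --> t ~= 0 --> d x y <= abs t -->
   d (x ** (t *R E)) (y ** (t *R E)) <= K * abs t * (d x y / abs t) powr (1 / s)" using far_estimate by blast
 define tau where "tau = min 1 (min ((theta / (2 * L * K)) powr s) (theta / (2 * L)))"
 have tau: "tau > 0" "tau <= 1" "L * tau <= theta / 2" "L * (K * tau powr (1 / s)) <= theta / 2"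
 proof -
  show "tau > 0" "tau <= 1" using theta L K by (auto simp: tau_def)
  have "L * tau <= L * (theta / (2 * L))" using L by (intro mult_left_mono) (auto simp: tau_def)
  thus "L * tau <= theta / 2" using L by simp
  have "tau powr (1 / s) <= ((theta / (2 * L * K)) powr s) powr (1 / s)" using \<open>tau > 0\<close> by (intro powr_mono2) (auto simp: tau_def)
  also have "... = theta / (2 * L * K)" using theta L K s1 by (simp add: powr_powr)
  finally have "L * (K * tau powr (1 / s)) <= L * (K * (theta / (2 * L * K)))" using L K by (intro mult_left_mono) auto
  thus "L * (K * tau powr (1 / s)) <= theta / 2" using L K by simp
 qed
 define eps where "eps = min theta (3 * sg / 8)"
 have eps: "eps > 0" using theta sg by (simp add: eps_def)
 have "osc f E x y (sg - eps + omega (a + b))" if y: "d x' y < tau * r" and b: "b >= 0" and o: "osc f E' x' y (sg / 8 + omega b)" for y b unfolding osc_def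
 proof
  fix t :: real
  have Wab: "a + omega b <= omega (a + b)" "omega a + b <= omega (a + b)" using W[OF a b] W[OF b a] by (simp_all add: add.commute)
  show "abs (inc f x E t - inc f y E t) <= (sg - eps + omega (a + b)) * abs t"
  proof (cases "abs t <= r")
   case True
   have 1: "abs (inc f x E t - v * t) <= sg / 8 * abs t" using r1(2) True by (simp add: r_def)
   have 2: "abs (inc f x' E' t - v' * t) <= sg / 8 * abs t" using r2(2) True by (simp add: r_def)
   have 3: "abs (inc f x' E' t - inc f y E' t) <= (sg / 8 + omega b) * abs t" using o by (simp add: osc_def)
   have "abs (f (y ** (t *R E)) - f (y ** (t *R E'))) <= L * d (y ** (t *R E)) (y ** (t *R E'))" by (rule lip)
   also have "... = (L * d E E') * abs t" using E by (simp add: S1_def d_scale_layer1)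
   also have "... <= sg / 8 * abs t" using dE by (rule mult_right_mono) simp
   finally have 4: "abs (f (y ** (t *R E)) - f (y ** (t *R E'))) <= sg / 8 * abs t" .
   have "abs (v * t - v' * t) = abs (v - v') * abs t" by (simp add: abs_mult left_diff_distrib[symmetric])
   also have "... <= (a + sg / 8) * abs t" using vv by (rule mult_right_mono) simp
   finally have 5: "abs (v * t - v' * t) <= (a + sg / 8) * abs t" .
   have "abs (inc f x E t - inc f y E t) <=
     sg / 8 * abs t + sg / 8 * abs t + (sg / 8 + omega b) * abs t + sg / 8 * abs t + (a + sg / 8) * abs t" using 1 2 3 4 5 by linarith
   also have "... = (5 * sg / 8 + (a + omega b)) * abs t" by (simp add: algebra_simps)
   also have "... <= (sg - eps + omega (a + b)) * abs t" using Wab(1) by (intro mult_right_mono) (auto simp: eps_def)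
   finally show ?thesis .
  next
   case False
   hence t: "abs t > r" "t ~= 0" using r by auto
   have dt: "d x' y <= tau * abs t" using y t tau(1) mult_left_mono[of r "abs t" tau] by linarith
   hence dt1: "d x' y <= abs t" "d x' y / abs t <= tau"
   proof -
    have "tau * abs t <= 1 * abs t" by (rule mult_right_mono[OF tau(2)]) simp
    thus "d x' y <= abs t" using dt by linarith
    show "d x' y / abs t <= tau" using dt t(2) by (simp add: pos_divide_le_eq)
   qed
   have "abs (f (x' ** (t *R E)) - f (y ** (t *R E))) <= L * d (x' ** (t *R E)) (y ** (t *R E))" by (rule lip)
   also have "... <= L * (K * abs t * (d x' y / abs t) powr (1 / s))" using K(2) E(1) t(2) dt1(1) L by (intro mult_left_mono) auto
   also have "... <= L * (K * abs t * tau powr (1 / s))" using dt1(2) L K(1) by (intro mult_left_mono powr_mono2) auto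
   also have "... = L * (K * tau powr (1 / s)) * abs t" by simp
   also have "... <= theta / 2 * abs t" using tau(4) by (rule mult_right_mono) simp
   finally have 1: "abs (f (x' ** (t *R E)) - f (y ** (t *R E))) <= theta / 2 * abs t" .
   have "abs (f x' - f y) <= L * d x' y" by (rule lip)
   also have "... <= L * (tau * abs t)" using dt L by (intro mult_left_mono) auto
   also have "... = (L * tau) * abs t" by simp
   also have "... <= theta / 2 * abs t" using tau(3) by (rule mult_right_mono) simp
   finally have 2: "abs (f x' - f y) <= theta / 2 * abs t" .
   have 3: "abs (inc f x E t - inc f x' E t) <= c * abs t" using osc(1) by (simp add: osc_def)
   have "abs (inc f x E t - inc f y E t) <= c * abs t + theta / 2 * abs t + theta / 2 * abs t" using 1 2 3 by linarith
   also have "... = (c + theta) * abs t" by (simp add: algebra_simps)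
   also have "c + theta = sg + omega a - theta" by (simp add: theta_def field_simps)
   also have "(sg + omega a - theta) * abs t <= (sg - eps + omega (a + b)) * abs t" using Wab(2) b by (intro mult_right_mono) (auto simp: eps_def)
   finally show ?thesis .
  qed
 qed
 thus ?thesis using eps tau(1) r by (intro exI[of _ "tau * r"] conjI exI[of _ eps]) auto
qed

lemma unit_dist_sq: "E : S1 ==> F : S1 ==> (norm (E - F))^2 = 2 * (1 - E *. F)"
 by (simp add: S1_def power2_norm_eq_inner inner_diff_left inner_diff_right inner_commute)
  (simp add: norm_eq_1)

lemma S1_inner_le: "E : S1 ==> F : S1 ==> E *. F <= 1" using norm_cauchy_schwarz[of E F] by (simp add: S1_def)

lemma d_complete:
 assumes C: "!!m n. m <= n ==> d (x m) (x n) <= r m" and r: "r ----> 0"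
 shows "EX y. ALL m. d (x m) y <= r m"
proof -
 obtain K where K: "K > 0" "ALL z. d 0 z <= r 0 --> norm z <= K * d 0 z" using norm_le_d by blast
 define z where "z n = (- x 0) ** x n" for n
 have dz: "d (z m) (z n) = d (x m) (x n)" for m n by (simp add: z_def)
 have "norm (z n) <= K * r 0" for n
 proof -
  have "d 0 (z n) <= r 0" using C[of 0 n] by (simp add: z_def d_eq_0[of "x 0"])
  moreover from this have "norm (z n) <= K * d 0 (z n)" using K by blast
  ultimately show ?thesis using K(1) mult_left_mono[of "d 0 (z n)" "r 0" K] by linarith
 qed
 hence "ALL n. z n : cball 0 (K * r 0)" by simp
 then obtain w phi where w: "strict_mono (phi :: nat => nat)" "(z o phi) ----> w" using compact_cball[of "0::'a" "K * r 0"] unfolding compact_def by blast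
 obtain R where R: "!!n. norm (z (phi n)) <= R" "norm w <= R"
 proof -
  have "norm (z (phi n)) <= max (K * r 0) (norm w)" for n using \<open>ALL n. z n : cball 0 (K * r 0)\<close> by (simp add: le_max_iff_disj)
  thus thesis using that[of "max (K * r 0) (norm w)"] by simp
 qed
 obtain K2 where K2: "ALL x y. norm x <= R --> norm y <= R --> d x y <= K2 * norm (x - y) powr (1 / s)" using d_le_norm_diff by blast
 have "(%n. norm (z (phi n) - w)) ----> 0" using w(2) by (simp add: o_def tendsto_norm_zero_iff LIM_zero)
 hence "(%n. norm (z (phi n) - w) powr (1 / s)) ----> 0"
  using step_pos by (intro tendsto_zero_powrI[where b = "1 / s"] tendsto_const) (auto simp: always_eventually)
 hence lim0: "(%n. K2 * norm (z (phi n) - w) powr (1 / s)) ----> 0" by (rule tendsto_mult_right_zero)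
 have "d (x m) (x 0 ** w) <= r m" for m
 proof -
  have "d (x m) (x 0 ** w) = d (z m) w" using d_mult_left[of "- x 0" "x m" "x 0 ** w"] by (simp add: z_def inv_cancel)
  also have "... <= r m"
  proof (rule tendsto_lowerbound[where F = sequentially])
   show "(%n. r m + K2 * norm (z (phi n) - w) powr (1 / s)) ----> r m" using tendsto_add[OF tendsto_const[of "r m"] lim0] by simp
   show "\<forall>\<^sub>F n in sequentially. d (z m) w <= r m + K2 * norm (z (phi n) - w) powr (1 / s)" unfolding eventually_sequentially
   proof (intro exI[of _ m] allI impI)
    fix n assume "m <= n"
    hence "m <= phi n" using seq_suble[OF w(1), of n] by linarith
    hence "d (z m) (z (phi n)) <= r m" using C dz by simp
    moreover have "d (z (phi n)) w <= K2 * norm (z (phi n) - w) powr (1 / s)" using K2 R by blast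
    ultimately show "d (z m) w <= r m + K2 * norm (z (phi n) - w) powr (1 / s)" using d_triangle[of "z m" w "z (phi n)"] by linarith
   qed
  qed simp
  finally show ?thesis .
 qed
 thus ?thesis by blast
qed

text \<open>
  The triples \<open>(y, F, w)\<close> consist of a point, a direction and the derivative there. \<open>gain e\<close> is the
  derivative of the function perturbed by the linear function with gradient \<open>e\<close>.
\<close>

definition gain :: "'a => 'a * 'a * real => real" where
 "gain e z = snd (snd z) + e *. fst (snd z)"

definition dir_triples :: "('a => real) => 'a set => ('a * 'a * real) set" where
 "dir_triples f N = {(y, F, w). y : N & F : S1 & dir_deriv f y F w}"

text \<open>
  The competitors of \<open>z\<close>: the tolerance for the difference of the increments grows with the gain. The strict
  inequality leaves room for passing to a limit.
\<close>

definition admissible ::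
 "('a => real) => 'a set => (real => real) => real => 'a * 'a * real => 'a => real => ('a * 'a * real) set" where
 "admissible f N omega sg z e delta = {z' : dir_triples f N. d (fst z) (fst z') < delta & gain e z <= gain e z' &
   (EX c<sg + omega (gain e z' - gain e z). osc f (fst (snd z)) (fst z) (fst z') c)}"

text \<open>
  The state of the iteration consists of the current triple \<open>z\<close>, the gradient \<open>e\<close> accumulated so far
  and a radius \<open>delta\<close>. A step adds \<open>(1/2) ^ n\<close> times the current direction to the gradient and then
  chooses a nearly best competitor. The slack \<open>eps\<close> in \<open>vnext\<close> keeps the competitors of the
  following steps, and the limit, admissible for the present one.
\<close>

definition vinv ::
 "('a => real) => 'a set => (nat => 'a set) => (real => real) => (nat => real) => 'a => real => nat => ('a * 'a * real) * 'a * real => bool" where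
 "vinv f N U omega lm e0 m0 n = (%(z, e, delta). z : dir_triples f N & 0 < delta & delta <= (1/2) ^ n &
   (ALL y. d (fst z) y < 2 * delta --> y : U n) & norm (e - e0) <= 2 - 2 * (1/2) ^ n & m0 + (2 - 2 * (1/2) ^ n) <= gain e z &
   (ALL z':admissible f N omega ((1/8) ^ n) z (e + (1/2) ^ n *R fst (snd z)) delta. gain e z' <= gain e z + lm n))"

definition vnext ::
 "('a => real) => 'a set => (real => real) => nat =>
   ('a * 'a * real) * 'a * real => ('a * 'a * real) * 'a * real => bool" where
 "vnext f N omega n = (%(z, e, delta) (z', e', delta'). e' = e + (1/2) ^ n *R fst (snd z) &
   z' : admissible f N omega ((1/8) ^ n) z e' delta & d (fst z) (fst z') + delta' < delta & admissible f N omega ((1/8) ^ Suc n) z' (e' + (1/2) ^ Suc n *R fst (snd z')) delta'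
    <= admissible f N omega ((1/8) ^ n) z e' delta & (EX eps>0. ALL y b. d (fst z') y < delta' --> 0 <= b --> osc f (fst (snd z')) (fst z') y ((1/8) ^ Suc n + omega b) -->
    osc f (fst (snd z)) (fst z) y ((1/8) ^ n - eps + omega (gain e' z' - gain e' z + b))))"

lemma gain_add: "gain (e + c *R E) z = gain e z + c * (E *. fst (snd z))" by (simp add: gain_def inner_add_left)

lemma gain_bounded:
 assumes lip: "!!x y. abs (f x - f y) <= L * d x y" and z: "z : dir_triples f N"
 shows "abs (gain e z) <= L + norm e"
proof -
 obtain y F w where zz: "z = (y, F, w)" by (cases z) auto
 have "F : S1" "abs w <= L" using z dir_deriv_bound[OF lip] by (auto simp: zz dir_triples_def)
 moreover have "abs (e *. F) <= norm e" using Cauchy_Schwarz_ineq2[of e F] \<open>F : S1\<close> by (simp add: S1_def)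
 ultimately show ?thesis by (simp add: gain_def zz)
qed

lemma near_maximal:
 assumes lip: "!!x y. abs (f x - f y) <= L * d x y" and A: "A <= dir_triples f N" "A ~= {}" and l: "l > 0"
 shows "EX z:A. ALL z':A. gain e z' <= gain e z + l"
proof -
 have bdd: "bdd_above (gain e ` A)" using gain_bounded[OF lip, of _ N e] A(1) by (intro bdd_aboveI[of _ "L + norm e"]) (auto dest!: abs_le_D1)
 have "Sup (gain e ` A) - l < Sup (gain e ` A)" using l by simp
 then obtain g where "g : gain e ` A" "Sup (gain e ` A) - l < g" using less_cSupD[of "gain e ` A"] A(2) by blast
 then obtain z where z: "z : A" "Sup (gain e ` A) - l < gain e z" by blast
 have "gain e z' <= gain e z + l" if "z' : A" for z' using cSup_upper[OF _ bdd, of "gain e z'"] that z(2) by auto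
 thus ?thesis using z(1) by blast
qed

lemma admissible_self:
 assumes "z : dir_triples f N" "delta > 0" "sg > 0" "omega 0 >= 0"
 shows "z : admissible f N omega sg z e delta" using assms unfolding admissible_def by (auto intro!: exI[of _ 0] osc_refl)

text \<open>
  Without the term \<open>(1/2) ^ n *R fst (snd z)\<close> a competitor gains at most \<open>lm n\<close>; so this term cannot
  cost it more than that, which bounds the angle between the directions.
\<close>

lemma vinv_close:
 assumes I: "vinv f N U omega lm e0 m0 n (z, e, delta)" and lm: "lm n = (1/2) ^ n * (rho n)^2 / 2" and rho: "rho n > 0"
  and z': "z' : admissible f N omega ((1/8) ^ n) z (e + (1/2) ^ n *R fst (snd z)) delta"
 shows "norm (fst (snd z) - fst (snd z')) <= rho n"
proof -
 define t where "t = (1/2 :: real) ^ n"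
 have t: "t > 0" by (simp add: t_def)
 have S: "fst (snd z) : S1" "fst (snd z') : S1" using I z' by (auto simp: vinv_def admissible_def dir_triples_def)
 hence EE: "fst (snd z) *. fst (snd z) = 1" by (simp add: S1_def norm_eq_1)
 have "gain e z' <= gain e z + lm n" using I z' by (simp add: vinv_def)
 moreover have "gain e z + t <= gain e z' + t * (fst (snd z) *. fst (snd z'))" using z' by (simp add: admissible_def gain_add EE t_def)
 ultimately have "t * (1 - fst (snd z) *. fst (snd z')) <= lm n" by (simp add: algebra_simps)
 hence "t * (1 - fst (snd z) *. fst (snd z')) <= t * ((rho n)^2 / 2)" by (simp add: lm t_def)
 hence "1 - fst (snd z) *. fst (snd z') <= (rho n)^2 / 2" using t by simp
 hence "(norm (fst (snd z) - fst (snd z')))^2 <= (rho n)^2" using unit_dist_sq[OF S] by simp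
 thus ?thesis using rho by (meson less_imp_le norm_ge_zero power2_le_imp_le)
qed

lemma variational_step:
 assumes lip: "!!x y. abs (f x - f y) <= L * d x y" and L: "L > 0"
  and W: "!!a b. 0 <= a ==> 0 <= b ==> a + omega b <= omega (a + b)" "omega 0 = 0"
  and U: "!!n x. x : N ==> EX r>0. ALL y. d x y < r --> y : U n"
  and rho: "!!n. rho n > 0" "!!n E F. E : S1 ==> F : S1 ==> norm (E - F) <= rho n ==> L * d E F <= (1/8) ^ n / 8 & (norm e0 + 2) * norm (E - F) <= (1/8) ^ n / 8"
  and lm: "!!n. lm n = (1/2) ^ n * (rho n)^2 / 2"
  and I: "vinv f N U omega lm e0 m0 n st"
 shows "EX st'. vinv f N U omega lm e0 m0 (Suc n) st' & vnext f N omega n st st'"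
proof -
 obtain x E v e delta where st: "st = ((x, E, v), e, delta)" by (cases st) auto
 define t where "t = (1/2 :: real) ^ n"
 define sg where "sg = (1/8 :: real) ^ n"
 define z where "z = (x, E, v)"
 define e' where "e' = e + t *R E"
 define A where "A = admissible f N omega sg z e' delta"
 have t: "t > 0" "t <= 1" by (auto simp: t_def power_le_one)
 have sg: "sg > 0" by (simp add: sg_def)
 have P: "z : dir_triples f N" "delta > 0" "norm (e - e0) <= 2 - 2 * t"
  "m0 + (2 - 2 * t) <= gain e z" "!!z'. z' : A ==> gain e z' <= gain e z + lm n" using I by (auto simp: vinv_def st z_def t_def A_def sg_def e'_def)
 have E: "E : S1" "x : N" "dir_deriv f x E v" using P(1) by (auto simp: z_def dir_triples_def)
 have EE: "E *. E = 1" using E(1) by (simp add: S1_def norm_eq_1)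
 have AD: "A <= dir_triples f N" by (auto simp: A_def admissible_def)
 have zA: "z : A" unfolding A_def by (rule admissible_self) (use P sg W in auto)
 have g0: "0 <= lm (Suc n)" "0 < lm (Suc n)" using zero_less_power[OF rho(1)[of "Suc n"], of 2] by (simp_all add: lm)
 obtain z' where z': "z' : A" "!!y. y : A ==> gain e' y <= gain e' z' + lm (Suc n)" using near_maximal[OF lip AD _ g0(2), of e'] zA by blast
 obtain x' E' v' where zz': "z' = (x', E', v')" by (cases z') auto
 have E': "E' : S1" "x' : N" "dir_deriv f x' E' v'" using z'(1) AD by (auto simp: zz' dir_triples_def)
 have EE': "E' *. E' = 1" using E'(1) by (simp add: S1_def norm_eq_1)
 have xx': "d x x' < delta" using z'(1) by (simp add: A_def admissible_def z_def zz')
 define a where "a = gain e' z' - gain e' z"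
 obtain c where a: "a >= 0" and c: "c < sg + omega a" "osc f E x x' c" using z'(1) by (auto simp: A_def admissible_def z_def zz' a_def)
 have close: "norm (E - E') <= rho n" using vinv_close[OF I[unfolded st], of rho z'] lm rho(1) z'(1) by (simp add: A_def sg_def e'_def t_def z_def zz')
 have ne': "norm (e' - e0) <= 2 - t" using norm_triangle_ineq[of "e - e0" "t *R E"] P(3) t E(1) by (simp add: e'_def S1_def algebra_simps)
 have vv: "abs (v - v') <= a + sg / 8"
 proof -
  have "v' - v = a - e' *. (E' - E)" by (simp add: a_def gain_def z_def zz' inner_diff_right)
  moreover have "abs (e' *. (E' - E)) <= sg / 8"
  proof -
   have "abs (e' *. (E' - E)) <= norm e' * norm (E' - E)" by (rule Cauchy_Schwarz_ineq2)
   also have "... <= (norm e0 + 2) * norm (E' - E)" using norm_triangle_sub[of e' e0] ne' t by (intro mult_right_mono) auto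
   also have "... <= sg / 8" using rho(2)[OF E(1) E'(1) close] by (simp add: sg_def norm_minus_commute)
   finally show ?thesis .
  qed
  ultimately show ?thesis using a by linarith
 qed
 have dE: "L * d E E' <= sg / 8" using rho(2)[OF E(1) E'(1) close] by (simp add: sg_def)
 obtain delta1 eps where tr: "delta1 > 0" "eps > 0" "!!y b. d x' y < delta1 ==> b >= 0 ==> osc f E' x' y (sg / 8 + omega b) ==> osc f E x y (sg - eps + omega (a + b))"
  using osc_transfer[OF lip L E(1) E'(1) E(3) E'(3) sg a c(2,1) vv dE W(1)] by blast
 obtain r where r: "r > 0" "!!y. d x' y < r ==> y : U (Suc n)" using U[OF E'(2), of "Suc n"] by blast
 define delta' where "delta' = min (min delta1 (r / 2)) (min ((delta - d x x') / 2) ((1/2) ^ Suc n))"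
 have delta': "delta' > 0" "delta' <= delta1" "2 * delta' <= r" "d x x' + delta' < delta" "delta' <= (1/2) ^ Suc n"
 proof -
  have "delta' <= (delta - d x x') / 2" unfolding delta'_def by (meson min.cobounded1 min.cobounded2 order_trans)
  thus "d x x' + delta' < delta" using xx' by (simp add: field_simps)
  show "delta' > 0" "delta' <= delta1" "delta' <= (1/2) ^ Suc n" using tr(1) r(1) xx' by (auto simp: delta'_def simp del: power_Suc)
  have "delta' <= r / 2" by (simp add: delta'_def min_le_iff_disj)
  thus "2 * delta' <= r" by simp
 qed
 define A' where "A' = admissible f N omega ((1/8) ^ Suc n) z' (e' + (1/2) ^ Suc n *R E') delta'"
 have wmono: "omega b <= omega b'" if "0 <= b" "b <= b'" for b b' using W(1)[of "b' - b" b] that by simp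
 have A': "y : A" if y: "y : A'" for y
 proof -
  obtain u F w where yy: "y = (u, F, w)" by (cases y) auto
  have yD: "y : dir_triples f N" "d x' u < delta'" using y by (auto simp: A'_def admissible_def zz' yy)
  have F: "F : S1" using yD by (simp add: yy dir_triples_def)
  define q where "q = (1/2 :: real) ^ Suc n"
  define b where "b = gain e' y - gain e' z'"
  have q: "q * (E' *. F) <= q" using S1_inner_le[OF E'(1) F] by (simp add: q_def)
  have le: "gain e' z' + q <= gain e' y + q * (E' *. F)" using y by (simp add: A'_def admissible_def gain_add q_def[symmetric] zz' yy EE' del: power_Suc)
  hence b: "b >= 0" using q by (simp add: b_def)
  obtain c' where c': "c' < (1/8) ^ Suc n + omega (gain e' y + q * (E' *. F) - (gain e' z' + q))" "osc f E' x' u c'"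
   using y by (auto simp: A'_def admissible_def gain_add q_def[symmetric] zz' yy EE' simp del: power_Suc)
  have "omega (gain e' y + q * (E' *. F) - (gain e' z' + q)) <= omega b" by (rule wmono) (use le q in "auto simp: b_def")
  hence "c' <= sg / 8 + omega b" using c'(1) by (simp add: sg_def)
  hence "osc f E' x' u (sg / 8 + omega b)" using osc_mono c'(2) by blast
  hence o: "osc f E x u (sg - eps + omega (a + b))" using tr(3) yD(2) delta'(2) b by simp
  have ab: "a + b = gain e' y - gain e' z" by (simp add: a_def b_def)
  have "d x u < delta" using d_triangle[of x u x'] yD(2) delta'(4) by linarith
  thus "y : A" unfolding A_def admissible_def using yD o ab a b tr(2) by (auto simp: z_def yy intro!: exI[of _ "sg - eps + omega (a + b)"])
 qed
 have half: "(1/2 :: real) ^ Suc n = t / 2" by (simp add: t_def)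
 have "gain e' z' >= gain e' z" using a by (simp add: a_def)
 moreover have "gain e' z = gain e z + t" using EE by (simp add: e'_def gain_add) (simp add: z_def)
 ultimately have g: "m0 + (2 - t) <= gain e' z'" using P(4) by linarith
 have "vinv f N U omega lm e0 m0 (Suc n) (z', e', delta')" unfolding vinv_def split
 proof (intro conjI allI impI ballI)
  show "gain e' y <= gain e' z' + lm (Suc n)" if "y : admissible f N omega ((1/8) ^ Suc n) z' (e' + (1/2) ^ Suc n *R fst (snd z')) delta'" for y
   using that A' z'(2) by (simp add: A'_def zz')
 qed (use z'(1) AD delta' r ne' g half in "auto simp: zz'")
 moreover have "vnext f N omega n (z, e, delta) (z', e', delta')" unfolding vnext_def split
 proof (intro conjI exI[of _ eps] allI impI)
  show "e' = e + (1/2) ^ n *R fst (snd z)" by (simp add: e'_def z_def t_def)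
  show "admissible f N omega ((1/8) ^ Suc n) z' (e' + (1/2) ^ Suc n *R fst (snd z')) delta' <= admissible f N omega ((1/8) ^ n) z e' delta"
   using A' by (auto simp: A'_def A_def sg_def zz' simp del: power_Suc)
  fix y b assume "d (fst z') y < delta'" "0 <= b" "osc f (fst (snd z')) (fst z') y ((1/8) ^ Suc n + omega b)"
  thus "osc f (fst (snd z)) (fst z) y ((1/8) ^ n - eps + omega (gain e' z' - gain e' z + b))" using tr(3)[of y b] delta'(2) by (simp add: sg_def z_def a_def zz')
 qed (use z'(1) delta' tr(2) in "auto simp: A_def sg_def z_def zz'")
 ultimately show ?thesis unfolding st z_def by blast
qed

end

lemma geometric_convergent:
 fixes a :: "nat => 'a::euclidean_space"
 assumes "!!n. norm (a (Suc n) - a n) <= (1/2) ^ n"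
 shows "convergent a"
proof -
 have "summable (%n. a (Suc n) - a n)" by (rule summable_comparison_test'[of "%n. (1/2) ^ n" 0]) (use assms in auto)
 hence "convergent (%n. SUM k<n. a (Suc k) - a k)" by (simp add: summable_iff_convergent)
 hence "convergent (%n. (SUM k<n. a (Suc k) - a k) + a 0)" by (intro convergent_add convergent_const)
 thus ?thesis by (simp add: sum_lessThan_telescope)
qed

context carnot_group
begin

lemma d_right_mult_tendsto:
 assumes "(%m. d (x m) y) ----> 0"
 shows "(%m. d (x m ** g) (y ** g)) ----> 0"
proof -
 obtain K where K: "ALL h z. norm h <= max 1 (norm g) --> d 0 z <= max 1 (norm g) --> d 0 (conj h z) <= K * d 0 z powr (1 / s)" using conj_estimate by blast
 have "(%m. d (x m) y powr (1 / s)) ----> 0"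
  using step_pos assms by (intro tendsto_zero_powrI[where b = "1 / s"] tendsto_const) (auto simp: always_eventually)
 hence l: "(%m. K * d (x m) y powr (1 / s)) ----> 0" by (rule tendsto_mult_right_zero)
 have ev: "\<forall>\<^sub>F m in sequentially. d (x m) y < 1" using order_tendstoD(2)[OF assms] by simp
 show ?thesis
 proof (rule tendsto_sandwich[OF _ _ tendsto_const l])
  show "\<forall>\<^sub>F m in sequentially. d (x m ** g) (y ** g) <= K * d (x m) y powr (1 / s)" using ev
  proof eventually_elim
   case (elim m)
   thus ?case using K[rule_format, of "- g" "(- x m) ** y"] by (simp add: d_right_mult d_eq_0[of "x m" y])
  qed
 qed simp
qed

lemma dir_derivI:
 assumes "!!e. e > 0 ==> EX r>0. ALL t. abs t < r --> abs (inc f x E t - v * t) <= e * abs t"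
 shows "dir_deriv f x E v"
proof -
 have "((%t. f (x ** (t *R E))) has_derivative (%h. v * h)) (at 0)" unfolding has_derivative_at_alt
 proof (intro conjI allI impI)
  show "bounded_linear (%h. v * h)" by (rule bounded_linear_mult_right)
  fix e :: real assume "e > 0"
  from assms[OF this] show "EX r>0. ALL t. norm (t - 0) < r --> norm (f (x ** (t *R E)) - f (x ** (0 *R E)) - v * (t - 0)) <= e * norm (t - 0)"
   by (simp add: right_unit)
 qed
 thus ?thesis by (simp add: dir_deriv_def has_field_derivative_def)
qed

lemma f_tendsto:
 assumes lip: "!!x y. abs (f x - f y) <= L * d x y" and "(%m. d (x m) y) ----> 0"
 shows "(%m. f (x m)) ----> f y"
proof (rule LIM_zero_cancel, rule tendsto_rabs_zero_cancel, rule tendsto_sandwich[OF _ _ tendsto_const])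
 show "(%m. L * d (x m) y) ----> 0" using assms(2) by (rule tendsto_mult_right_zero)
qed (use lip in auto)

abbreviation nearly_maximal ::
  "('a => real) => 'a set => (real => real) => 'a => 'a => 'a => real => real => real => bool" where
 "nearly_maximal f N omega x E e m delta eps \<equiv> ALL y F w. y : N --> F : S1 --> dir_deriv f y F w --> d x y < delta --> m <= w + e *. F -->
   osc f E x y (omega (w + e *. F - m)) --> w + e *. F <= m + eps"

text \<open>
  Starting from a direction \<open>E0\<close> and maximising repeatedly, each time with an additional linear term
  that penalises leaving the current direction, one arrives at a point and a direction at which, up to
  a linear function with gradient \<open>e\<close>, the directional derivative is nearly maximal among nearby points
  at which the increments of \<open>f\<close> are suitably close.
\<close>

theorem variational_principle:
 fixes U :: "nat => 'a set"
 assumes lip: "!!x y. abs (f x - f y) <= L * d x y" and L: "L > 0"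
  and W: "!!a b. 0 <= a ==> 0 <= b ==> a + omega b <= omega (a + b)" "omega 0 = 0" "continuous_on {0..} omega"
  and U: "!!n x. x : N ==> EX r>0. ALL y. d x y < r --> y : U n" and N: "(\<Inter>n. U n) <= N"
  and E0: "E0 : S1" "x0 : N" "dir_deriv f x0 E0 v0" and M: "M >= 2 * L + 1"
 shows "EX x E v e. x : N & E : S1 & dir_deriv f x E v & norm e <= M + 2 & (norm (E - E0))^2 <= 2 * (2 * L + 1) / M & 0 <= v + e *. E &
  (ALL eps>0. EX delta>0. nearly_maximal f N omega x E e (v + e *. E) delta eps)"
proof -
 have s1: "real s >= 1" using step_pos by simp
 have E00: "E0 *. E0 = 1" using E0(1) by (simp add: S1_def norm_eq_1)
 define e0 where "e0 = M *R E0"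
 have ne0: "norm e0 = M" using M L E0(1) by (simp add: e0_def S1_def)
 obtain K where K: "K > 0" "ALL x y. norm x <= 1 --> norm y <= 1 --> d x y <= K * norm (x - y) powr (1 / s)" using d_le_norm_diff by blast
 \<comment> \<open>At distance \<open>rho n\<close> directions have increments and gains within \<open>(1/8) ^ n / 8\<close> of each other.\<close>
 define rho where "rho n = min ((1/8) ^ n / (16 * (M + 2))) (((1/8) ^ n / (8 * L * K)) powr s)" for n :: nat
 have M2: "M + 2 >= 1" using M L by simp
 have rho0: "rho n > 0" for n using M L K by (auto simp: rho_def)
 have rho1: "(M + 2) * rho n <= (1/8) ^ n / 16" for n
 proof -
  have "(M + 2) * rho n <= (M + 2) * ((1/8) ^ n / (16 * (M + 2)))" using M2 by (intro mult_left_mono) (auto simp: rho_def)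
  also have "... = (1/8) ^ n / 16"
  proof -
   have "c * (q / (16 * c)) = q / 16" if "c ~= 0" for c q :: real using that by simp
   from this[of "M + 2"] show ?thesis using M2 by simp
  qed
  finally show ?thesis .
 qed
 have rho2: "rho n <= (1/8) ^ n / 16" for n using rho1[of n] mult_right_mono[OF M2 less_imp_le[OF rho0[of n]]] by linarith
 have rhod: "L * d E F <= (1/8) ^ n / 8" if EF: "E : S1" "F : S1" "norm (E - F) <= rho n" for n E F
 proof -
  have "d E F <= K * norm (E - F) powr (1 / s)" using K(2) EF by (auto simp: S1_def)
  also have "... <= K * (((1/8) ^ n / (8 * L * K)) powr s) powr (1 / s)" using EF(3) K(1) by (intro mult_left_mono powr_mono2) (auto simp: rho_def)
  also have "... = (1/8) ^ n / (8 * L)" using K(1) L s1 by (simp add: powr_powr)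
  finally show ?thesis using L by (simp add: field_simps)
 qed
 have rho3: "L * d E F <= (1/8) ^ n / 8 & (norm e0 + 2) * norm (E - F) <= (1/8) ^ n / 8" if EF: "E : S1" "F : S1" "norm (E - F) <= rho n" for n E F
 proof -
  have "(norm e0 + 2) * norm (E - F) <= (M + 2) * rho n" unfolding ne0 using EF M2 by (intro mult_left_mono) auto
  also have "... <= (1/8) ^ n / 8" using rho1[of n] zero_less_power[of "1/8::real" n] by linarith
  finally show ?thesis using rhod[OF EF] by blast
 qed
 \<comment> \<open>With this accuracy later directions stay within \<open>rho n\<close> of the current one.\<close>
 define lm where "lm n = (1/2) ^ n * (rho n)^2 / 2" for n
 have lm0: "0 < lm n" for n using rho0[of n] by (simp add: lm_def)
 have lmle: "lm n <= (1/2) ^ n" for n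
 proof -
  have "rho n <= 1" using rho2[of n] power_le_one[of "1/8::real" n] by simp
  hence "(rho n)^2 <= 1" using rho0[of n] by (simp add: power_le_one)
  hence "(1/2) ^ n * (rho n)^2 <= (1/2) ^ n * (1 :: real)" by (intro mult_left_mono) auto
  moreover have "(1/2 :: real) ^ n > 0" by simp
  ultimately show ?thesis unfolding lm_def by linarith
 qed
 define m0 where "m0 = M - L - 1"
 let ?I = "vinv f N U omega lm e0 m0"
 let ?Q = "vnext f N omega"
 obtain st where st: "!!n. ?I n (st n) & ?Q n (st n) (st (Suc n))"
 proof (rule dependent_nat_choice[of ?I ?Q, THEN exE])
  have z0: "(x0, E0, v0) : dir_triples f N" using E0 by (simp add: dir_triples_def)
  obtain z where z: "z : dir_triples f N" "!!z'. z' : dir_triples f N ==> gain e0 z' <= gain e0 z + lm 0"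
   using near_maximal[OF lip order_refl _ lm0[of 0], of N e0] z0 by blast
  have "gain e0 (x0, E0, v0) >= M - L" using dir_deriv_bound[OF lip E0(1,3)] E00 by (simp add: gain_def e0_def)
  hence "m0 <= gain e0 z" using z(2)[OF z0] lmle[of 0] by (simp add: m0_def)
  moreover obtain r where r: "r > 0" "!!y. d (fst z) y < r ==> y : U 0" using U[of "fst z" 0] z(1) by (auto simp: dir_triples_def)
  ultimately have "?I 0 (z, e0, min 1 (r / 2))" using z by (auto simp: vinv_def admissible_def)
  thus "EX st. ?I 0 st" by blast
  show "EX st'. ?I (Suc n) st' & ?Q n st st'" if "?I n st" for st n by (rule variational_step[OF lip L W(1,2) U rho0 rho3 lm_def that])
 qed blast
 define z where "z n = fst (st n)" for n
 define x where "x n = fst (z n)" for n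
 define E where "E n = fst (snd (z n))" for n
 define v where "v n = snd (snd (z n))" for n
 define e where "e n = fst (snd (st n))" for n
 define delta where "delta n = snd (snd (st n))" for n
 define sg where "sg n = (1/8 :: real) ^ n" for n
 have stn: "st n = (z n, e n, delta n)" for n by (simp add: z_def e_def delta_def)
 define A where "A n = admissible f N omega (sg n) (z n) (e n + (1/2) ^ n *R E n) (delta n)" for n
 have I: "z n : dir_triples f N" "0 < delta n" "delta n <= (1/2) ^ n" "!!y. d (x n) y < 2 * delta n ==> y : U n"
   "norm (e n - e0) <= 2 - 2 * (1/2) ^ n" "m0 + (2 - 2 * (1/2) ^ n) <= gain (e n) (z n)"
   "!!z'. z' : A n ==> gain (e n) z' <= gain (e n) (z n) + lm n" for n using st[of n] unfolding stn by (auto simp: vinv_def A_def sg_def E_def x_def)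
 have Q: "e (Suc n) = e n + (1/2) ^ n *R E n" "z (Suc n) : A n" "d (x n) (x (Suc n)) + delta (Suc n) < delta n"
   "A (Suc n) <= A n"
   "EX eps>0. ALL y b. d (x (Suc n)) y < delta (Suc n) --> 0 <= b --> osc f (E (Suc n)) (x (Suc n)) y (sg (Suc n) + omega b) -->
    osc f (E n) (x n) y (sg n - eps + omega (gain (e (Suc n)) (z (Suc n)) - gain (e (Suc n)) (z n) + b))" for n
  using st[of n] unfolding stn vnext_def split by (auto simp: A_def sg_def E_def x_def simp del: power_Suc)
 obtain eps where eps: "!!n. eps n > 0" "!!n y b. d (x (Suc n)) y < delta (Suc n) ==> 0 <= b ==> osc f (E (Suc n)) (x (Suc n)) y (sg (Suc n) + omega b) ==>
    osc f (E n) (x n) y (sg n - eps n + omega (gain (e (Suc n)) (z (Suc n)) - gain (e (Suc n)) (z n) + b))" using Q(5) by metis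
 have zn: "z n = (x n, E n, v n)" for n by (simp add: x_def E_def v_def)
 have z: "x n : N" "E n : S1" "dir_deriv f (x n) (E n) (v n)" for n using I(1)[of n] by (auto simp: zn dir_triples_def)
 have EE: "E n *. E n = 1" for n using z(2) by (simp add: S1_def norm_eq_1)
 have Amono: "A m <= A n" if "n <= m" for n m using that by (induction m rule: dec_induct) (use Q(4) in blast)+
 have zA: "z m : A n" if "n <= m" for n m
 proof -
  have "z m : A m" unfolding A_def by (rule admissible_self) (use I W sg_def in auto)
  thus ?thesis using Amono[OF that] by blast
 qed
 have close: "norm (E n - fst (snd y)) <= rho n" if "y : A n" for n y using vinv_close[of f N U omega lm e0 m0 n "z n" "e n" "delta n" rho y] st[of n] that rho0 lm_def
  by (simp add: stn A_def sg_def E_def)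
 have closeE: "norm (E n - E m) <= rho n" if "n <= m" for n m using close[OF zA[OF that]] by (simp add: E_def)
 have dmono: "d (x n) (x m) + delta m <= delta n" if "n <= m" for n m using that
 proof (induction m rule: dec_induct)
  case (step m)
  thus ?case using d_triangle[of "x n" "x (Suc m)" "x m"] Q(3)[of m] by linarith
 qed simp
 have delta0: "delta ----> 0" by (rule tendsto_sandwich[of "%_. 0" _ _ "%n. (1/2) ^ n"])
   (use I(2,3) in "auto intro!: always_eventually less_imp_le LIMSEQ_realpow_zero")
 have "d (x n) (x m) <= delta n" if "n <= m" for n m using dmono[OF that] I(2)[of m] by linarith
 from d_complete[of x delta, OF this delta0] obtain xs where xs: "!!n. d (x n) xs <= delta n" by blast
 have xs': "d (x n) xs < delta n" for n using xs[of "Suc n"] d_triangle[of "x n" xs "x (Suc n)"] Q(3)[of n] by linarith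
 have "xs : U n" for n using I(4)[of n xs] xs'[of n] I(2)[of n] by linarith
 hence xsN: "xs : N" using N by blast
 have p82: "(1/8 :: real) ^ n <= (1/2) ^ n" for n by (rule power_mono) auto
 have "convergent E"
 proof (rule geometric_convergent)
  fix n
  show "norm (E (Suc n) - E n) <= (1/2) ^ n"
  proof -
   have "0 < (1/8 :: real) ^ n" by simp
   hence "rho n <= (1/2) ^ n" using rho2[of n] p82[of n] by linarith
   thus ?thesis using closeE[of n "Suc n"] by (simp add: norm_minus_commute)
  qed
 qed
 then obtain Es where Es: "E ----> Es" by (auto simp: convergent_def)
 have EsS: "Es : S1"
 proof -
  have "Es : layer 1" by (rule closed_sequentially[OF closed_subspace[OF subspace_layer] _ Es]) (use z(2) in "auto simp: S1_def")
  moreover have "(%n. norm (E n)) ----> norm Es" using Es by (rule tendsto_norm)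
  hence "norm Es = 1" using z(2) by (simp add: S1_def LIMSEQ_const_iff)
  ultimately show ?thesis by (simp add: S1_def)
 qed
 have EsEs: "Es *. Es = 1" using EsS by (simp add: S1_def norm_eq_1)
 have closeEs: "norm (E n - Es) <= rho n" for n
 proof (rule tendsto_upperbound[where F = sequentially])
  show "(%m. norm (E n - E m)) ----> norm (E n - Es)" by (intro tendsto_intros Es)
  show "\<forall>\<^sub>F m in sequentially. norm (E n - E m) <= rho n" using eventually_ge_at_top[of n] by eventually_elim (rule closeE)
 qed simp
 have "convergent e" by (rule geometric_convergent) (use z(2) in "auto simp: Q(1) S1_def")
 then obtain es where es: "e ----> es" by (auto simp: convergent_def)
 have half: "(1/2 :: real) ^ Suc n * 2 = (1/2) ^ n" for n by simp
 have p0: "(%m. 2 * (1/2 :: real) ^ m) ----> 0" by (rule tendsto_mult_right_zero) (simp add: LIMSEQ_realpow_zero)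
 have ebound: "norm (e m - e (Suc n) - ((1/2) ^ n - 2 * (1/2) ^ m) *R Es) <= ((1/2) ^ n - 2 * (1/2) ^ m) * (sg n / 16) & norm (e m - e (Suc n)) <= (1/2) ^ n - 2 * (1/2) ^ m"
  if "Suc n <= m" for n m using that
 proof (induction m rule: dec_induct)
  case (step m)
  define q where "q = (1/2 :: real) ^ m"
  have q: "q > 0" by (simp add: q_def)
  have "(1/8 :: real) ^ m <= (1/8) ^ n" by (rule power_decreasing) (use step.hyps in auto)
  hence "rho m <= sg n / 16" using rho2[of m] unfolding sg_def by linarith
  hence "norm (E m - Es) <= sg n / 16" using closeEs[of m] by linarith
  hence 1: "norm (q *R (E m - Es)) <= q * (sg n / 16)" using q by simp
  have e: "e (Suc m) = e m + q *R E m" "(1/2 :: real) ^ Suc m = q / 2" by (simp_all add: Q(1) q_def)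
  have "((1/2) ^ n - q) *R Es = ((1/2) ^ n - 2 * q) *R Es + q *R Es" by (simp add: scaleR_add_left[symmetric])
  hence "e (Suc m) - e (Suc n) - ((1/2) ^ n - 2 * (q / 2)) *R Es = (e m - e (Suc n) - ((1/2) ^ n - 2 * q) *R Es) + q *R (E m - Es)" by (simp add: e scaleR_diff_right)
  also have "norm ... <= ((1/2) ^ n - 2 * q) * (sg n / 16) + q * (sg n / 16)" using step.IH 1 unfolding q_def by (intro norm_triangle_mono) auto
  also have "... = ((1/2) ^ n - 2 * (q / 2)) * (sg n / 16)" by (simp add: algebra_simps)
  finally have A: "norm (e (Suc m) - e (Suc n) - ((1/2) ^ n - 2 * (q / 2)) *R Es) <= ((1/2) ^ n - 2 * (q / 2)) * (sg n / 16)" .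
  have "norm (e (Suc m) - e (Suc n)) = norm ((e m - e (Suc n)) + q *R E m)" by (simp add: e algebra_simps)
  also have "... <= ((1/2) ^ n - 2 * q) + q" using step.IH q z(2)[of m] unfolding q_def[symmetric] by (intro norm_triangle_mono) (auto simp: S1_def)
  finally show ?case using A unfolding e(2) by simp
 qed (simp add: half)
 have eslim: "norm (es - e (Suc n) - (1/2) ^ n *R Es) <= sg n / 16" "norm (es - e (Suc n)) <= (1/2) ^ n" for n
 proof -
  have "norm (es - e (Suc n) - ((1/2) ^ n - 0) *R Es) <= ((1/2) ^ n - 0) * (sg n / 16)"
  proof (rule tendsto_le[OF sequentially_bot])
   show "(%m. ((1/2) ^ n - 2 * (1/2) ^ m) * (sg n / 16)) ----> ((1/2) ^ n - 0) * (sg n / 16)" by (intro tendsto_intros p0)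
   show "(%m. norm (e m - e (Suc n) - ((1/2) ^ n - 2 * (1/2) ^ m) *R Es)) ----> norm (es - e (Suc n) - ((1/2) ^ n - 0) *R Es)"
    by (intro tendsto_intros p0 es)
   show "\<forall>\<^sub>F m in sequentially. norm (e m - e (Suc n) - ((1/2) ^ n - 2 * (1/2) ^ m) *R Es) <= ((1/2) ^ n - 2 * (1/2) ^ m) * (sg n / 16)"
    using eventually_ge_at_top[of "Suc n"] by eventually_elim (use ebound in blast)
  qed
  also have "... <= 1 * (sg n / 16)" by (intro mult_right_mono) (auto simp: sg_def power_le_one)
  finally show "norm (es - e (Suc n) - (1/2) ^ n *R Es) <= sg n / 16" by simp
  show "norm (es - e (Suc n)) <= (1/2) ^ n"
  proof (rule tendsto_upperbound[where F = sequentially])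
   show "(%m. norm (e m - e (Suc n))) ----> norm (es - e (Suc n))" by (intro tendsto_intros es)
   show "\<forall>\<^sub>F m in sequentially. norm (e m - e (Suc n)) <= (1/2) ^ n" using eventually_ge_at_top[of "Suc n"]
   proof eventually_elim
    case (elim m)
    have "0 < (1/2 :: real) ^ m" by simp
    thus ?case using ebound[OF elim] by linarith
   qed
  qed simp
 qed
 have nes: "norm (e n) <= M + 2" for n
 proof -
  have "0 < (1/2 :: real) ^ n" by simp
  thus ?thesis using norm_triangle_sub[of "e n" e0] I(5)[of n] ne0 by linarith
 qed
 define G where "G n = gain (e n) (z n)" for n
 have Geq: "G n = v n + e n *. E n" for n by (simp add: G_def gain_def zn)
 have H: "gain (e (Suc n)) (z n) = G n + (1/2) ^ n" for n by (simp add: Q(1) gain_add G_def) (simp add: zn EE)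
 have Gstep: "G n + (1/2) ^ n <= G (Suc n)" for n using Q(2)[of n] unfolding A_def admissible_def Q(1)[symmetric] by (simp add: H G_def)
 have Gmono: "G n + 2 * (1/2) ^ n <= G m + 2 * (1/2) ^ m" if "n <= m" for n m using that
 proof (induction m rule: dec_induct)
  case (step m)
  thus ?case using Gstep[of m] half[of m] by simp
 qed simp
 have "incseq G"
 proof (rule incseq_SucI)
  fix n
  have "0 < (1/2 :: real) ^ n" by simp
  thus "G n <= G (Suc n)" using Gstep[of n] by linarith
 qed
 moreover have "G n <= L + (M + 2)" for n using gain_bounded[OF lip I(1)[of n], of "e n"] nes[of n] by (simp add: G_def)
 ultimately obtain mm where mm: "G ----> mm" using incseq_convergent by blast
 define Phi where "Phi n = G n + 2 * (1/2) ^ n" for n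
 have Phimono: "Phi n <= Phi m" if "n <= m" for n m using Gmono[OF that] by (simp add: Phi_def)
 have Philim: "Phi ----> mm" unfolding Phi_def using tendsto_add[OF mm p0] by simp
 have Phile: "Phi n <= mm" for n using incseq_le[OF _ Philim] Phimono by (auto simp: incseq_def)
 have aPhi: "gain (e (Suc n)) (z (Suc n)) - gain (e (Suc n)) (z n) = Phi (Suc n) - Phi n" for n using half[of n] by (simp add: H G_def[symmetric] Phi_def)
 have "(%n. G n - e n *. E n) ----> mm - es *. Es" by (intro tendsto_intros mm es Es)
 hence vlim: "v ----> mm - es *. Es" by (simp add: Geq)
 define vs where "vs = mm - es *. Es"
 have chain: "osc f (E n) (x n) y (sg n - eps n + omega (Phi m - Phi n + b))" if "Suc n <= m" "d (x m) y < delta m" "0 <= b" "osc f (E m) (x m) y (sg m + omega b)" for n m y b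
  using that
 proof (induction m arbitrary: b rule: dec_induct)
  case base
  thus ?case using eps(2)[of n y b] by (simp add: aPhi)
 next
  case (step m)
  define b' where "b' = Phi (Suc m) - Phi m + b"
  have b': "b' >= 0" using step.prems Phimono[of m "Suc m"] by (simp add: b'_def)
  have "osc f (E m) (x m) y (sg m - eps m + omega b')" using eps(2)[of m y b] step.prems by (simp add: aPhi b'_def)
  hence "osc f (E m) (x m) y (sg m + omega b')" by (rule osc_mono) (use eps(1)[of m] in simp)
  moreover have "d (x m) y < delta m" using d_triangle[of "x m" y "x (Suc m)"] Q(3)[of m] step.prems(1) by linarith
  ultimately have "osc f (E n) (x n) y (sg n - eps n + omega (Phi m - Phi n + b'))" using step.IH b' by blast
  thus ?case by (simp add: b'_def algebra_simps)
 qed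
 have xlim: "(%m. d (x m) xs) ----> 0" by (rule tendsto_sandwich[OF _ _ tendsto_const delta0]) (use xs in auto)
 have oscs: "osc f (E n) (x n) xs (sg n - eps n + omega (mm - Phi n))" for n unfolding osc_def
 proof
  fix t
  show "abs (inc f (x n) (E n) t - inc f xs (E n) t) <= (sg n - eps n + omega (mm - Phi n)) * abs t"
  proof (rule tendsto_le[OF sequentially_bot])
   show "(%m. abs (inc f (x n) (E n) t - inc f (x m) (E n) t)) ---->
     abs (inc f (x n) (E n) t - inc f xs (E n) t)" by (intro tendsto_intros f_tendsto[OF lip] d_right_mult_tendsto xlim)
   have "(%m. omega (Phi (m + n) - Phi n)) ----> omega (mm - Phi n)" by (rule continuous_on_tendsto_compose[OF W(3)])
     (use Phile Phimono in "auto intro!: tendsto_intros LIMSEQ_ignore_initial_segment[OF Philim] always_eventually")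
   hence "(%m. omega (Phi m - Phi n)) ----> omega (mm - Phi n)" by (rule LIMSEQ_offset)
   thus "(%m. (sg n - eps n + omega (Phi m - Phi n)) * abs t) ----> (sg n - eps n + omega (mm - Phi n)) * abs t" by (intro tendsto_intros)
   show "\<forall>\<^sub>F m in sequentially. abs (inc f (x n) (E n) t - inc f (x m) (E n) t)
     <= (sg n - eps n + omega (Phi m - Phi n)) * abs t" using eventually_ge_at_top[of "Suc n"]
   proof eventually_elim
    case (elim m)
    have "osc f (E m) (x m) (x m) (sg m + omega 0)" by (rule osc_mono[OF osc_refl]) (simp add: W sg_def)
    hence "osc f (E n) (x n) (x m) (sg n - eps n + omega (Phi m - Phi n + 0))" using elim I(2)[of m] by (intro chain) auto
    thus ?case by (simp add: osc_def)
   qed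
  qed
 qed
 have sglim: "sg ----> 0" unfolding sg_def by (rule LIMSEQ_realpow_zero) auto
 have alim: "(%n. omega (mm - Phi n)) ----> omega 0"
 proof (rule continuous_on_tendsto_compose[OF W(3)])
  show "(%n. mm - Phi n) ----> 0" using tendsto_diff[OF tendsto_const[of mm] Philim] by simp
 qed (use Phile in auto)
 have dEs: "L * d (E n) Es <= sg n / 8" for n using rhod[OF z(2) EsS closeEs] by (simp add: sg_def)
 have Ds: "dir_deriv f xs Es vs"
 proof (rule dir_derivI)
  fix eta :: real assume eta: "eta > 0"
  have "(%n. sg n + omega (mm - Phi n) + abs (v n - vs) + sg n / 8) ----> 0 + omega 0 + abs ((mm - es *. Es) - vs) + 0 / 8"
   by (intro tendsto_intros sglim alim vlim) simp
  hence "(%n. sg n + omega (mm - Phi n) + abs (v n - vs) + sg n / 8) ----> 0" by (simp add: W vs_def)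
  hence "\<forall>\<^sub>F n in sequentially. sg n + omega (mm - Phi n) + abs (v n - vs) + sg n / 8 < eta / 2" using eta by (intro order_tendstoD(2)) auto
  then obtain n where n: "sg n + omega (mm - Phi n) + abs (v n - vs) + sg n / 8 < eta / 2" using eventually_happens'[OF sequentially_bot] by blast
  obtain r where r: "r > 0" "!!t. abs t <= r ==> abs (inc f (x n) (E n) t - v n * t) <= eta / 2 * abs t"
   using dir_deriv_near[OF z(3)[of n], of "eta / 2"] eta by auto
  have "abs (inc f xs Es t - vs * t) <= eta * abs t" if t: "abs t < r" for t
  proof -
   have 1: "abs (inc f (x n) (E n) t - v n * t) <= eta / 2 * abs t" using r t by simp
   have "abs (inc f (x n) (E n) t - inc f xs (E n) t) <= (sg n - eps n + omega (mm - Phi n)) * abs t"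
    using oscs[of n] by (simp add: osc_def)
   also have "... <= (sg n + omega (mm - Phi n)) * abs t" using eps(1)[of n] by (intro mult_right_mono) auto
   finally have 2: "abs (inc f (x n) (E n) t - inc f xs (E n) t) <= (sg n + omega (mm - Phi n)) * abs t" .
   have "abs (f (xs ** (t *R E n)) - f (xs ** (t *R Es))) <= L * d (xs ** (t *R E n)) (xs ** (t *R Es))" by (rule lip)
   also have "... = (L * d (E n) Es) * abs t" using z(2) EsS by (simp add: S1_def d_scale_layer1)
   also have "... <= sg n / 8 * abs t" using dEs by (rule mult_right_mono) simp
   finally have 3: "abs (f (xs ** (t *R E n)) - f (xs ** (t *R Es))) <= sg n / 8 * abs t" .
   have 4: "abs (v n * t - vs * t) = abs (v n - vs) * abs t" by (simp add: abs_mult left_diff_distrib[symmetric])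
   have "abs (inc f xs Es t - vs * t) <= eta / 2 * abs t + (sg n + omega (mm - Phi n)) * abs t + sg n / 8 * abs t + abs (v n - vs) * abs t"
    using 1 2 3 4 by linarith
   also have "... = (eta / 2 + (sg n + omega (mm - Phi n) + abs (v n - vs) + sg n / 8)) * abs t" by (simp add: algebra_simps)
   also have "... <= eta * abs t" using n by (intro mult_right_mono) auto
   finally show ?thesis .
  qed
  thus "EX r>0. ALL t. abs t < r --> abs (inc f xs Es t - vs * t) <= eta * abs t" using r(1) by blast
 qed
 have vse: "vs + es *. Es = mm" by (simp add: vs_def)
 have almost: "EX delta>0. nearly_maximal f N omega xs Es es mm delta eta" if eta: "eta > 0" for eta
 proof -
  have "(%n. norm (es - e n)) ----> norm (es - es)" by (intro tendsto_intros es)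
  hence "\<forall>\<^sub>F n in sequentially. norm (es - e n) < eta" using eta by (intro order_tendstoD(2)) auto
  then obtain n where n: "norm (es - e n) < eta" using eventually_happens'[OF sequentially_bot] by blast
  define a where "a = mm - Phi n"
  have a: "a >= 0" using Phile by (simp add: a_def)
  have sg0: "sg n > 0" by (simp add: sg_def)
  have vv: "abs (v n - vs) <= a + sg n / 8"
  proof -
   have "vs - v n = a - (es - e (Suc n) - (1/2) ^ n *R Es) *. Es + e (Suc n) *. (E n - Es)"
    using EE[of n] EsEs by (simp add: vs_def a_def Phi_def Geq Q(1) inner_diff_left inner_diff_right inner_add_left)
   moreover have "abs ((es - e (Suc n) - (1/2) ^ n *R Es) *. Es) <= sg n / 16"
    using Cauchy_Schwarz_ineq2[of "es - e (Suc n) - (1/2) ^ n *R Es" Es] eslim(1)[of n] EsS by (simp add: S1_def)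
   moreover have "abs (e (Suc n) *. (E n - Es)) <= sg n / 16"
   proof -
    have "abs (e (Suc n) *. (E n - Es)) <= norm (e (Suc n)) * norm (E n - Es)" by (rule Cauchy_Schwarz_ineq2)
    also have "... <= (M + 2) * rho n" using nes closeEs M2 by (intro mult_mono) auto
    also have "... <= sg n / 16" using rho1 by (simp add: sg_def)
    finally show ?thesis .
   qed
   ultimately show ?thesis using a by linarith
  qed
  obtain delta1 eps1 where tr: "delta1 > 0" "eps1 > 0" "!!y b. d xs y < delta1 ==> b >= 0 ==> osc f Es xs y (sg n / 8 + omega b) ==>
   osc f (E n) (x n) y (sg n - eps1 + omega (a + b))" using osc_transfer[OF lip L z(2) EsS z(3) Ds sg0 a oscs[of n, folded a_def] _ vv dEs W(1)] eps(1)[of n] by auto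
  have "w + es *. F <= mm + eta" if y: "y : N" "F : S1" "dir_deriv f y F w" "d xs y < min delta1 (delta n - d (x n) xs)" and w: "mm <= w + es *. F"
    and o: "osc f Es xs y (omega (w + es *. F - mm))" for y F w
  proof -
   define b where "b = w + es *. F - mm"
   have b: "b >= 0" using w by (simp add: b_def)
   have "osc f Es xs y (sg n / 8 + omega b)" by (rule osc_mono[OF o]) (use sg0 in "simp add: b_def")
   hence o1: "osc f (E n) (x n) y (sg n - eps1 + omega (a + b))" using tr(3) b y(4) by simp
   have CS: "abs (u *. F) <= norm u" for u using Cauchy_Schwarz_ineq2[of u F] y(2) by (simp add: S1_def)
   have gy: "gain u (y, F, w) = w + u *. F" for u by (simp add: gain_def)
   have "(es - e (Suc n)) *. F <= (1/2) ^ n" using CS[of "es - e (Suc n)"] eslim(2)[of n] by linarith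
   hence ge: "a + b <= gain (e (Suc n)) (y, F, w) - gain (e (Suc n)) (z n)" unfolding H gy by (simp add: a_def b_def Phi_def inner_diff_left)
   have "omega (a + b) <= omega (gain (e (Suc n)) (y, F, w) - gain (e (Suc n)) (z n))"
    using W(1)[of "gain (e (Suc n)) (y, F, w) - gain (e (Suc n)) (z n) - (a + b)" "a + b"] ge a b by simp
   moreover have "d (x n) y < delta n" using d_triangle[of "x n" y xs] y(4) by linarith
   ultimately have "(y, F, w) : A n" unfolding A_def admissible_def Q(1)[symmetric] mem_Collect_eq using y(1-3) ge a b o1 tr(2)
    by (auto simp: dir_triples_def x_def[symmetric] E_def[symmetric] intro!: exI[of _ "sg n - eps1 + omega (a + b)"])
   from I(7)[OF this] have "w + e n *. F <= G n + lm n" unfolding gy G_def .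
   moreover have "G n + lm n <= mm" proof -
    have "0 < (1/2 :: real) ^ n" by simp
    thus ?thesis using Phile[of n] lmle[of n] unfolding Phi_def by linarith
   qed
   moreover have "(es - e n) *. F <= eta" using CS[of "es - e n"] n by linarith
   ultimately show ?thesis by (simp add: inner_diff_left)
  qed
  thus ?thesis using tr(1) xs'[of n] by (intro exI[of _ "min delta1 (delta n - d (x n) xs)"]) auto
 qed
 have mm0: "0 <= mm"
 proof -
  have "m0 <= G 0" using I(6)[of 0] by (simp add: G_def)
  moreover have "m0 >= 0" using M L by (simp add: m0_def)
  ultimately show ?thesis using Phile[of 0] by (simp add: Phi_def)
 qed
 have nE: "(norm (Es - E0))^2 <= 2 * (2 * L + 1) / M"
 proof -
  have "M - 2 * L - 1 <= e0 *. E n" for n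
  proof -
   have "abs ((e n - e0) *. E n) <= 2 - 2 * (1/2) ^ n" using Cauchy_Schwarz_ineq2[of "e n - e0" "E n"] I(5)[of n] z(2)[of n] by (simp add: S1_def)
   moreover have "m0 + (2 - 2 * (1/2) ^ n) <= v n + e n *. E n" using I(6)[of n] by (simp add: Geq[symmetric] G_def)
   moreover have "abs (v n) <= L" using dir_deriv_bound[OF lip z(2,3)] .
   ultimately show ?thesis by (simp add: m0_def inner_diff_left)
  qed
  moreover have "(%n. e0 *. E n) ----> e0 *. Es" by (intro tendsto_intros Es)
  ultimately have "M - 2 * L - 1 <= e0 *. Es" by (intro LIMSEQ_le_const) auto
  hence "M * (1 - E0 *. Es) <= 2 * L + 1" by (simp add: e0_def algebra_simps)
  hence "1 - E0 *. Es <= (2 * L + 1) / M" using M L by (simp add: pos_le_divide_eq mult.commute)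
  hence "2 * (1 - Es *. E0) <= 2 * ((2 * L + 1) / M)" by (intro mult_left_mono) (simp_all add: inner_commute)
  thus ?thesis unfolding unit_dist_sq[OF EsS E0(1)] by simp
 qed
 have "norm es <= M + 2" by (rule LIMSEQ_le_const2[OF tendsto_norm[OF es]]) (use nes in auto)
 thus ?thesis using xsN EsS Ds nE mm0 almost by (intro exI[of _ xs] exI[of _ Es] exI[of _ vs] exI[of _ es]) (auto simp: vse)
qed

section \<open>Polygonal paths from deformations\<close>

definition runs_along :: "(real => 'a) => 'a => real => real => bool" where
 "runs_along g V a b \<longleftrightarrow> V : layer 1 & (EX c e q. a <= c & c < e & e <= b & (ALL tau. c < tau --> tau < e --> g tau = q ** (tau *R V)))"

abbreviation performs :: "(real => 'a) => real => real => nat => (real * 'a) list => bool" where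
 "performs g a b k L == length L <= k & duration L = b - a & g b = g a ** pprod L & (ALL (t, V):set L. 0 < t & runs_along g V a b)"

lemma runs_along_mono: "runs_along g V a b ==> b <= b' ==> runs_along g V a b'" unfolding runs_along_def by (meson order_trans)

lemma line_closure:
 assumes g: "!!a b. d (g a) (g b) <= C * abs (a - b)" and V: "V : layer 1" and cb: "c < b"
  and line: "!!tau. c < tau ==> tau < b ==> g tau = q ** (tau *R V)" and sg: "c <= sg" "sg <= b"
 shows "g sg = q ** (sg *R V)"
proof -
 have C: "C >= 0" using order_trans[OF d_nonneg[of "g 0" "g 1"] g[of 0 1]] by simp
 have "d (g sg) (q ** (sg *R V)) <= 0"
 proof (rule field_le_epsilon)
  fix e :: real assume e: "e > 0"
  define h where "h = min ((b - c) / 2) (e / (C + norm V + 1))"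
  have h: "h > 0" using e cb C by (auto simp: h_def add_nonneg_pos)
  have h2: "h <= (b - c) / 2" "h <= e / (C + norm V + 1)" unfolding h_def by (rule min.cobounded1, rule min.cobounded2)
  define tau where "tau = (if sg <= (b + c) / 2 then sg + h / 2 else sg - h / 2)"
  have tau: "c < tau" "tau < b" "abs (sg - tau) <= h" using h h2(1) sg cb by (auto simp: tau_def field_simps)
  have "d (g sg) (q ** (sg *R V)) <= d (g sg) (g tau) + d (g tau) (q ** (sg *R V))" by (rule d_triangle)
  also have "... <= C * abs (sg - tau) + abs (sg - tau) * norm V" unfolding line[OF tau(1,2)] d_line[OF V] using g[of sg tau] line[OF tau(1,2)] by simp
  also have "... = (C + norm V) * abs (sg - tau)" by (simp add: algebra_simps)
  also have "... <= (C + norm V + 1) * (e / (C + norm V + 1))" by (rule mult_mono) (use tau(3) h h2(2) C in auto)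
  also have "... = e" using C by (simp add: add_nonneg_pos order_less_imp_not_eq2)
  finally show "d (g sg) (q ** (sg *R V)) <= 0 + e" by simp
 qed
 hence "d (g sg) (q ** (sg *R V)) = 0" using d_nonneg by (meson order_antisym)
 thus ?thesis by (simp add: d_eq_0_iff)
qed

lemma joined_lines_path:
 assumes g: "!!a b. d (g a) (g b) <= C * abs (a - b)"
  and I: "!!i. i < k ==> is_horizontal_line_on (I i) g"
  and ord: "!!i j x y. i < j ==> j < k ==> x : I i ==> y : I j ==> x <= y"
  and ab: "a <= b" "{a<..<b} <= (UN i<k. I i)"
 shows "EX L. performs g a b k L" using I ord ab
proof (induction k arbitrary: b)
 case 0
 have "a = b"
 proof (rule ccontr)
  assume "a ~= b"
  hence "(a + b) / 2 : {a<..<b}" using 0 by auto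
  thus False using 0 by blast
 qed
 thus ?case by (intro exI[of _ "[]"]) (auto simp: right_unit)
next
 case (Suc k)
 define J where "J = I k Int {a<..<b}"
 have cov: "y : I k | (EX i<k. y : I i)" if "a < y" "y < b" for y
  proof -
  have "y : (UN i<Suc k. I i)" using that by (intro subsetD[OF Suc.prems(4)]) simp
  thus ?thesis by (auto simp: less_Suc_eq)
 qed
 show ?case
 proof (cases "J = {}")
  case True
  hence "{a<..<b} <= (UN i<k. I i)" using cov by (fastforce simp: J_def)
  hence "EX L. performs g a b k L"
   using Suc.IH[OF Suc.prems(1) Suc.prems(2) Suc.prems(3)] by simp
  thus ?thesis using le_SucI by blast
 next
  case False
  define c where "c = Inf J"
  have bdd: "bdd_below J" by (auto simp: J_def intro!: bdd_belowI[of _ a])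
  have ac: "a <= c" unfolding c_def using False by (intro cInf_greatest) (auto simp: J_def)
  obtain y0 where y0: "y0 : J" using False by blast
  have cb: "c < b" using cInf_lower[OF y0 bdd] y0 by (auto simp: c_def J_def)
  have inI: "tau : I k" if tau: "c < tau" "tau < b" for tau
  proof (rule ccontr)
   assume "tau ~: I k"
   then obtain i where i: "i < k" "tau : I i" using cov[of tau] tau ac by auto
   obtain y where "y : J" "y < tau" using cInf_lessD[OF False] tau(1) by (auto simp: c_def)
   thus False using Suc.prems(2)[of i k tau y] i by (auto simp: J_def)
  qed
  obtain q V where qV: "V : layer 1" "!!t. t : I k ==> g t = q ** (t *R V)" using Suc.prems(1)[of k] unfolding is_horizontal_line_on_def by auto
  have gl: "g sg = q ** (sg *R V)" if "c <= sg" "sg <= b" for sg by (rule line_closure[OF g qV(1) cb _ that]) (use qV(2) inI in auto)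
  have "{a<..<c} <= (UN i<k. I i)"
  proof
   fix y assume y: "y : {a<..<c}"
   hence "y ~: J" using cInf_lower[OF _ bdd, of y] by (auto simp: c_def)
   thus "y : (UN i<k. I i)" using cov[of y] y cb by (auto simp: J_def)
  qed
  hence "EX L. performs g a c k L"
   using Suc.IH[OF Suc.prems(1) Suc.prems(2) ac] by simp
  then obtain L where L: "length L <= k" "duration L = c - a" "g c = g a ** pprod L"
   "ALL (t, V):set L. 0 < t & runs_along g V a c" by (elim exE conjE)
  have "g b = (q ** (c *R V)) ** ((b - c) *R V)" using gl[of b] cb by (simp add: assoc exp_coords)
  also have "q ** (c *R V) = g a ** pprod L" using gl[of c] L(3) cb by simp
  finally have "g b = g a ** pprod (L @ [(b - c, V)])" by (simp add: pprod_append assoc right_unit)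
  moreover have "runs_along g V a b" unfolding runs_along_def using qV(1) cb ac gl by (intro conjI exI[of _ c] exI[of _ b] exI[of _ q]) auto
  hence "ALL (t, V'):set (L @ [(b - c, V)]). 0 < t & runs_along g V' a b" using L(4) cb runs_along_mono[of g _ a c b] by (fastforce simp: case_prod_beta)
  ultimately show ?thesis using L(1,2) by (intro exI[of _ "L @ [(b - c, V)]"]) auto
 qed
qed

text \<open>
  The deformation before and after the prescribed point; its Lipschitz constant bounds the lengths of the
  directions, and the derivative of \<open>p o g\<close> their distance from \<open>E\<close>.
\<close>

lemma deformable_paths:
 assumes D: "deformable_with E C N DeltaE" and l: "0 < l" "l < 1" and eta: "0 < eta" and Delta: "0 < Delta" "Delta < DeltaE eta" "Delta < 1"
  and u: "d u 0 <= 1" and z: "z = dilation (Delta * l) u"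
 shows "EX L1 L2. length L1 <= N & length L2 <= N & near_path E (C * Delta) (L1 @ L2) &
   (ALL (t, V):set (L1 @ L2). 0 < t & norm V <= 1 + eta * Delta) & duration L1 = z *. E + l & duration L2 = l - z *. E &
   pprod L1 = (l *R E) ** z & z ** pprod L2 = l *R E & abs (z *. E) <= Delta * l"
proof -
 have E: "E : layer 1" "norm E = 1" using D by (auto simp: deformable_with_def)
 obtain g F where g: "Lipschitz_wrt dist d g" "joins_horizontal_lines N g" "ALL t. l <= abs t --> g t = t *R E"
  "g (z *. E) = z" "Lip_const dist d g <= 1 + eta * Delta" and F: "finite F"
  "ALL t. t ~: F --> (EX D. ((p o g) has_vderiv D) (at t) & norm (D - p E) <= C * Delta)"
 proof -
  have "EX g. Lipschitz_wrt dist d g & horizontal_on_line g & joins_horizontal_lines N g &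
      (ALL t. abs t >= l --> g t = t *R E) & g (z *. E) = z & Lip_const dist d g <= 1 + eta * Delta & (EX F. finite F & (ALL t. t ~: F -->
       (EX D. ((p o g) has_vderiv D) (at t) & norm (D - p E) <= C * Delta)))"
  proof -
   have H: "0 < l & l < 1 & 0 < eta & 0 < Delta & Delta < DeltaE eta & d u 0 <= 1" using l eta Delta u by simp
   show ?thesis unfolding z by (rule D[unfolded deformable_with_def, THEN conjunct2, THEN conjunct2, THEN conjunct2, THEN conjunct2, THEN conjunct2,
     THEN spec, THEN spec, THEN spec, THEN spec, THEN mp, OF H])
  qed
  thus thesis by (elim exE conjE) (rule that)
 qed
 obtain C' where C': "!!a b. d (g a) (g b) <= C' * abs (a - b)" "C' >= 0" using g(1) unfolding Lipschitz_wrt_def by (auto simp: dist_real_def)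
 obtain k I where k0: "k <= N" "(UN i<k. I i) = UNIV" "ALL i<k. is_interval (I i) & is_horizontal_line_on (I i) g"
  "ALL i j. i < j & j < k --> (ALL x:I i. ALL y:I j. x <= y)" using g(2) unfolding joins_horizontal_lines_def by (elim exE conjE)
 have k: "k <= N" "(UN i<k. I i) = UNIV" "!!i. i < k ==> is_horizontal_line_on (I i) g"
  "!!i j x y. i < j ==> j < k ==> x : I i ==> y : I j ==> x <= y" using k0 by simp_all
 have zeta: "abs (z *. E) <= Delta * l"
 proof -
  have "abs (z *. E) <= norm (p z)" using Cauchy_Schwarz_ineq2[of "p z" E] E by (simp add: p_inner_layer1[of E z])
  also have "... <= d 0 z" by (rule norm_p_le_d)
  also have "... <= Delta * l" using u l Delta by (simp add: z d_0_dilation d_sym[of u] mult_left_le)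
  finally show ?thesis .
 qed
 have "Delta * l < l" using Delta l by simp
 hence zetal: "- l < z *. E" "z *. E < l" using zeta by auto
 have dir: "norm V <= 1 + eta * Delta & norm (V - E) <= C * Delta" if r: "runs_along g V a' b'" for V a' b'
 proof
  have V: "V : layer 1" using r by (simp add: runs_along_def)
  obtain c e q where ce: "c < e" and line: "ALL tau. c < tau --> tau < e --> g tau = q ** (tau *R V)" using r unfolding runs_along_def by (elim exE conjE)
  have "norm V <= Lip_const dist d g" unfolding Lip_const_def
  proof (rule cInf_greatest)
   show "{L. 0 <= L & (ALL x y. d (g x) (g y) <= L * dist x y)} ~= {}" using C' by (auto simp: dist_real_def)
   fix K assume "K : {L. 0 <= L & (ALL x y. d (g x) (g y) <= L * dist x y)}"
   moreover define a where "a = c + (e - c) / 3"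
   moreover define b where "b = c + 2 * (e - c) / 3"
   ultimately have Kab: "d (g a) (g b) <= K * abs (a - b)" unfolding mem_Collect_eq dist_real_def by (elim conjE allE)
   have ab: "c < a" "a < b" "b < e" using ce by (auto simp: a_def b_def field_simps)
   have "(b - a) * norm V <= (b - a) * K" using Kab line ab d_line[OF V, of q a b] by (simp add: mult.commute)
   thus "norm V <= K" using ab by simp
  qed
  thus "norm V <= 1 + eta * Delta" using g(5) by simp
  have "EX tau. tau : {c<..<e} - F" using F(1) infinite_Ioo[OF ce] by (metis Diff_empty Diff_eq_empty_iff equals0I finite_subset)
  then obtain tau where tau: "c < tau" "tau < e" "tau ~: F" by auto
  then obtain D where D: "((p o g) has_vderiv D) (at tau)" "norm (D - p E) <= C * Delta" using F(2)[rule_format, OF tau(3)] by (elim exE conjE)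
  have "((%sg. p q + sg *R V) has_vderiv V) (at tau)" by (auto intro!: derivative_eq_intros)
  hence "((p o g) has_vderiv V) (at tau)" by (rule has_vector_derivative_transform_within_open[of _ _ _ "{c<..<e}"])
    (use tau line V in "auto simp: p_mult p_layer1 layer_scale")
  hence "D = V" using D(1) vector_derivative_unique_at by blast
  thus "norm (V - E) <= C * Delta" using D(2) E by (simp add: p_layer1)
 qed
 have path: "EX L. performs g a b k L" if "a <= b" for a b
  by (rule joined_lines_path[where I = I and C = C']) (use C' k that in auto)
 obtain L1 where L1: "length L1 <= k" "duration L1 = z *. E - (- l)" "g (z *. E) = g (- l) ** pprod L1"
   "ALL (t, V):set L1. 0 < t & runs_along g V (- l) (z *. E)" using path[of "- l" "z *. E"] zetal by auto
 obtain L2 where L2: "length L2 <= k" "duration L2 = l - z *. E" "g l = g (z *. E) ** pprod L2"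
   "ALL (t, V):set L2. 0 < t & runs_along g V (z *. E) l" using path[of "z *. E" l] zetal by auto
 have all: "0 < t & V : layer 1 & norm V <= 1 + eta * Delta & norm (V - E) <= C * Delta" if "(t, V) : set (L1 @ L2)" for t V
 proof -
  have "0 < t & (runs_along g V (- l) (z *. E) | runs_along g V (z *. E) l)" using that L1(4) L2(4) by auto
  moreover from this have "V : layer 1" unfolding runs_along_def by (elim conjE disjE)
  ultimately show ?thesis using dir[of V "- l" "z *. E"] dir[of V "z *. E" l] by argo
 qed
 have near: "near_path E (C * Delta) (L1 @ L2)" unfolding near_path_def using all less_imp_le by blast
 have gl: "g (- l) = - (l *R E)" "g l = l *R E" using g(3)[rule_format, of "-l"] g(3)[rule_format, of l] l by auto
 have "pprod L1 = (l *R E) ** z" using L1(3) by (simp add: gl g(4) inv_cancel)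
 moreover have "z ** pprod L2 = l *R E" using L2(3) by (simp add: gl g(4))
 moreover have "ALL (t, V):set (L1 @ L2). 0 < t & norm V <= 1 + eta * Delta" using all by blast
 ultimately show ?thesis using L1(1,2) L2(1,2) k(1) near zeta by (intro exI[of _ L1] exI[of _ L2] conjI) auto
qed

section \<open>Rational paths\<close>

definition rat_vec :: "'a set" where
 "rat_vec = {v : layer 1. ALL b:Basis. v *. b : \<rat>}"

definition rat_pts :: "'a set" where
 "rat_pts = (%Ws. foldr (**) Ws 0) ` lists rat_vec"

definition rat_lines :: "'a set" where
 "rat_lines = (UN q:rat_pts. UN W:rat_vec. range (%t. q ** (t *R W)))"

lemma countable_rat_vec: "countable rat_vec"
proof -
 have "rat_vec <= (%c. SUM b:Basis. c b *R b) ` (Basis \<rightarrow>\<^sub>E \<rat>)"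
 proof
  fix v assume "v : rat_vec"
  hence "v = (SUM b:Basis. restrict (%b. v *. b) Basis b *R b)" "restrict (%b. v *. b) Basis : Basis \<rightarrow>\<^sub>E \<rat>"
   by (auto simp: rat_vec_def euclidean_representation)
  thus "v : (%c. SUM b:Basis. c b *R b) ` (Basis \<rightarrow>\<^sub>E \<rat>)" by blast
 qed
 thus ?thesis by (rule countable_subset) (intro countable_image countable_PiE finite_Basis countable_rat)
qed

lemma countable_rat_pts: "countable rat_pts" unfolding rat_pts_def by (intro countable_image countable_lists countable_rat_vec)

lemma rat_vec_dense:
 assumes v: "v : layer 1" and e: "e > 0"
 shows "EX w:rat_vec. norm (w - v) < e"
proof -
 have "v : closure (UN f: Basis \<rightarrow> \<rat>. {SUM i:Basis. f i *R i})" by (simp add: closure_rational_coordinates)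
 then obtain f where f: "f : Basis \<rightarrow> \<rat>" "dist (SUM i:Basis. f i *R i) v < e" using e unfolding closure_approachable by blast
 define x where "x = (SUM i:Basis. f i *R i)"
 have x: "ALL i:Basis. x *. i : \<rat>" "dist x v < e" using f by (auto simp: x_def)
 have "p x *. b : \<rat>" if b: "b : Basis" for b
 proof (cases "b : B 1")
  case True
  hence "b : layer 1" by (simp add: layer_def span_base)
  thus ?thesis using x(1) b by (simp add: p_inner_layer1[OF \<open>b : layer 1\<close>, symmetric])
 next
  case False
  have "p x *. b = (SUM b':B 1. (x *. b') * (b' *. b))" by (simp add: p_def layer_part_def inner_sum_left)
  also have "... = 0"
  proof (intro sum.neutral ballI)
   fix b' assume b': "b' : B 1"
   hence "b' : Basis" using layers_cover step_pos by auto
   thus "x *. b' * (b' *. b) = 0" using b b' False by (auto simp: inner_Basis)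
  qed
  finally show ?thesis by simp
 qed
 hence "p x : rat_vec" using p_in by (simp add: rat_vec_def del: One_nat_def)
 moreover have "norm (p x - v) <= norm (x - v)" using norm_p_le[of "x - v"] v linear_diff[OF linear_p] by (simp add: p_layer1)
 ultimately show ?thesis using x(2) by (intro bexI[of _ "p x"]) (auto simp: dist_norm)
qed

lemma rat_pts_mult: "q : rat_pts ==> W : rat_vec ==> q ** W : rat_pts"
proof -
 assume "q : rat_pts" and W: "W : rat_vec"
 then obtain Ws where Ws: "q = foldr (**) Ws 0" "Ws : lists rat_vec" by (auto simp: rat_pts_def)
 have "foldr (**) (Ws @ [W]) 0 = foldr (**) Ws 0 ** W" by (induction Ws) (auto simp: assoc left_unit right_unit)
 moreover have "Ws @ [W] : lists rat_vec" using Ws(2) W by simp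
 ultimately show ?thesis unfolding rat_pts_def Ws(1) by (metis image_eqI)
qed

lemma zero_rat_pts: "0 : rat_pts" unfolding rat_pts_def by (rule image_eqI[of _ _ "[]"]) auto

lemma rat_pts_pprod:
 "q : rat_pts ==> ALL (t, V):set L. t *R V : rat_vec ==> q ** pprod L : rat_pts"
proof (induction L arbitrary: q)
 case (Cons tV L)
 obtain t V where tV: "tV = (t, V)" by fastforce
 have "(q ** (t *R V)) ** pprod L : rat_pts" using Cons.prems by (intro Cons.IH rat_pts_mult) (auto simp: tV)
 thus ?case by (simp add: tV assoc)
qed (simp add: right_unit)

definition approximates :: "real => (real * 'a) list => (real * 'a) list => bool" where
 "approximates nu L' L \<longleftrightarrow> list_all2 (%(t', V') (t, V). t' = t & V' : layer 1 & norm (V' - V) < nu & t *R V' : rat_vec) L' L"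

lemma approximates_mono: "approximates nu L' L ==> nu <= nu' ==> approximates nu' L' L" unfolding approximates_def by (erule list_all2_mono) auto

lemma approximates_near: "approximates nu L' L ==> near_path E delta L ==> near_path E (delta + nu) L'" unfolding approximates_def
proof (induction rule: list_all2_induct)
 case (Cons tV' L' tV L)
 obtain t V t' V' where tV: "tV = (t, V)" "tV' = (t', V')" by fastforce
 have "norm (V' - E) <= norm (V' - V) + norm (V - E)" using norm_triangle_ineq[of "V' - V" "V - E"] by simp
 thus ?case using Cons by (auto simp: tV)
qed simp

lemma approximates_duration: "approximates nu L' L ==> duration L' = duration L" unfolding approximates_def by (induction rule: list_all2_induct) auto
lemma approximates_rat: "approximates nu L' L ==> ALL (t, V):set L'. t *R V : rat_vec" unfolding approximates_def by (induction rule: list_all2_induct) auto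

text \<open>
  The pieces are approximated one after the other: right translation by a bounded element is
  uniformly continuous on bounded sets, so an error made at one piece stays small later on.
\<close>

lemma rational_approximation:
 assumes "near_path E delta L" and "ALL (t, V):set L. 0 < t" and dense: "!!nu. nu > 0 ==> EX q:rat_pts. d q b < nu" and "nu > 0"
 shows "EX q:rat_pts. EX L'. approximates nu L' L & (ALL tau. 0 <= tau --> tau <= duration L --> d (q ** walk L' tau) (b ** walk L tau) < nu)" using assms(1,2,4)
proof (induction L arbitrary: nu rule: rev_induct)
 case Nil
 obtain q where q: "q : rat_pts" "d q b < nu" using dense[OF Nil(3)] by blast
 thus ?case by (intro bexI[OF _ q(1)] exI[of _ "[]"]) (auto simp: approximates_def right_unit)
next
 case (snoc tV L)
 obtain t V where tV: "tV = (t, V)" by fastforce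
 have V: "V : layer 1" "t > 0" "norm (V - E) <= delta" and nL: "near_path E delta L" and posL: "ALL (t, V):set L. 0 < t" using snoc.prems by (auto simp: tV)
 have s1: "real s >= 1" using step_pos by simp
 define R where "R = max 1 (t * norm V)"
 obtain K where K: "K > 0" "ALL g z. norm g <= R --> d 0 z <= R --> d 0 (conj g z) <= K * d 0 z powr (1 / s)" using conj_estimate by blast
 obtain K2 where K2: "K2 > 0" "ALL x y. norm x <= norm V + 1 --> norm y <= norm V + 1 --> d x y <= K2 * norm (x - y) powr (1 / s)" using d_le_norm_diff by blast
 have small: "EX mu>0. mu <= 1 & mu <= nu & A * mu powr (1 / s) < nu / 2" if A: "A > 0" for A
 proof -
  define mu where "mu = min (min 1 nu) ((nu / (4 * A)) powr s)"
  have mu: "mu > 0" "mu <= 1" "mu <= nu" "mu <= (nu / (4 * A)) powr s" using snoc.prems(3) A by (auto simp: mu_def)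
  have "mu powr (1 / s) <= ((nu / (4 * A)) powr s) powr (1 / s)" using mu by (intro powr_mono2) auto
  also have "... = nu / (4 * A)" using s1 A snoc.prems(3) by (simp add: powr_powr)
  finally have "A * mu powr (1 / s) <= A * (nu / (4 * A))" using A by (intro mult_left_mono) auto
  hence "A * mu powr (1 / s) < nu / 2" using A snoc.prems(3) by simp
  thus ?thesis using mu by blast
 qed
 obtain mu where mu: "mu > 0" "mu <= 1" "mu <= nu" "K * mu powr (1 / s) < nu / 2" using small[OF K(1)] by (elim exE conjE)
 obtain mu2 where mu2: "mu2 > 0" "mu2 <= 1" "mu2 <= nu" "(t * K2) * mu2 powr (1 / s) < nu / 2" using small[of "t * K2"] V(2) K2(1) by (auto simp del: times_divide_eq_right)
 obtain q L' where qL: "q : rat_pts" "approximates mu L' L"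
  "!!tau. 0 <= tau ==> tau <= duration L ==> d (q ** walk L' tau) (b ** walk L tau) < mu" using snoc.IH[OF nL posL mu(1)] by blast
 obtain W where W: "W : rat_vec" "norm (W - t *R V) < t * mu2" using rat_vec_dense[of "t *R V" "t * mu2"] V mu2(1) by (auto simp: layer_scale)
 define V' where "V' = (1 / t) *R W"
 have tV': "t *R V' = W" using V(2) by (simp add: V'_def)
 have V': "V' : layer 1" using W(1) by (simp add: V'_def rat_vec_def layer_scale)
 have "t * norm (V' - V) = norm (t *R (V' - V))" using V(2) by simp
 also have "... = norm (W - t *R V)" by (simp add: tV' scaleR_diff_right)
 finally have "t * norm (V' - V) < t * mu2" using W(2) by simp
 hence VV: "norm (V' - V) < mu2" using V(2) by simp
 have dV: "t * d V' V < nu / 2"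
 proof -
  have "norm V' <= norm V + 1" using VV mu2(2) norm_triangle_ineq[of "V' - V" V] by simp
  hence "d V' V <= K2 * norm (V' - V) powr (1 / s)" using K2(2) by simp
  also have "... <= K2 * mu2 powr (1 / s)" using VV K2(1) by (intro mult_left_mono powr_mono2) auto
  finally have "t * d V' V <= t * (K2 * mu2 powr (1 / s))" using V(2) by (intro mult_left_mono) auto
  thus ?thesis using mu2(4) by simp
 qed
 have nL': "near_path E (delta + nu) L'" by (rule approximates_near[OF approximates_mono[OF qL(2) mu(3)] nL])
 have nV': "near_path E (delta + nu) [(t, V')]" using norm_triangle_ineq[of "V' - V" "V - E"] V V' VV mu2(3) by simp
 have dur: "duration L' = duration L" by (rule approximates_duration[OF qL(2)])
 have dn: "duration L >= 0" by (rule near_path_duration[OF nL])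
 have app: "approximates nu (L' @ [(t, V')]) (L @ [tV])" using approximates_mono[OF qL(2) mu(3)] V' VV mu2(3) tV' W(1)
  unfolding approximates_def by (intro list_all2_appendI) (auto simp: tV)
 have "d (q ** walk (L' @ [(t, V')]) tau) (b ** walk (L @ [tV]) tau) < nu" if tau: "0 <= tau" "tau <= duration (L @ [tV])" for tau
 proof (cases "tau < duration L")
  case True
  hence "L ~= []" using tau by auto
  moreover from this have "L' ~= []" using qL(2) by (auto simp: approximates_def)
  ultimately have "walk (L @ [tV]) tau = walk L tau" "walk (L' @ [(t, V')]) tau = walk L' tau"
   using walk_append_first[OF nL, of "[tV]" tau] walk_append_first[OF nL' nV', of tau] True dur V by (auto simp: tV)
  thus ?thesis using qL(3)[of tau] True tau mu(3) by simp
 next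
  case False
  define sg where "sg = tau - duration L"
  have sg: "0 <= sg" "sg <= t" using False tau by (auto simp: sg_def tV)
  have w1: "walk (L @ [(t, V)]) tau = pprod L ** (sg *R V)" using walk_append[OF nL, of "[(t, V)]" tau] False V sg by (simp add: sg_def[symmetric])
  have w2: "walk (L' @ [(t, V')]) tau = pprod L' ** (sg *R V')" using walk_append[OF nL' nV', of tau] False sg dur by (simp add: sg_def[symmetric])
  define q' b' where "q' = q ** pprod L'" and "b' = b ** pprod L"
  have qb: "d q' b' < mu" using qL(3)[of "duration L"] dn walk_duration[OF nL] walk_duration[OF nL'] by (simp add: dur q'_def b'_def)
  have "d (q' ** (sg *R V')) (b' ** (sg *R V)) <= d (q' ** (sg *R V')) (q' ** (sg *R V)) + d (q' ** (sg *R V)) (b' ** (sg *R V))"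
   by (rule d_triangle)
  moreover have "d (q' ** (sg *R V')) (q' ** (sg *R V)) < nu / 2"
  proof -
   have "d (q' ** (sg *R V')) (q' ** (sg *R V)) = sg * d V' V" using V V' sg by (simp add: d_scale_layer1)
   also have "... <= t * d V' V" using sg d_nonneg by (intro mult_right_mono) auto
   finally show ?thesis using dV by simp
  qed
  moreover have "d (q' ** (sg *R V)) (b' ** (sg *R V)) < nu / 2"
  proof -
   have "sg * norm V <= t * norm V" using sg by (intro mult_right_mono) auto
   hence g: "norm (- (sg *R V)) <= R" using sg by (simp add: R_def)
   have z: "d 0 ((- q') ** b') = d q' b'" by (simp add: d_eq_0[of q'])
   have "d (q' ** (sg *R V)) (b' ** (sg *R V)) <= K * d 0 ((- q') ** b') powr (1 / s)"
    unfolding d_right_mult using qb mu(2) by (intro K(2)[rule_format] g) (simp add: z R_def)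
   also have "... <= K * mu powr (1 / s)" unfolding z using qb K(1) d_nonneg by (intro mult_left_mono powr_mono2) auto
   finally show ?thesis using mu(4) by simp
  qed
  ultimately show ?thesis by (simp add: w1 w2 tV q'_def b'_def assoc)
 qed
 thus ?case using qL(1) app by blast
qed

lemma pprod_surj: "EX L. (ALL (t, V):set L. 0 < t & V : layer 1) & x = pprod L"
proof -
 define R where "R = (%(M::real) x. EX L. (ALL (t, V):set L. 0 < t & V : layer 1) & x = pprod L)"
 have "EX M>0. ALL y. norm y <= norm x --> R M y"
 proof (rule R_bounded)
  fix M x M' y assume "R M x" "R M' y"
  then obtain L L' where "ALL (t, V):set L. 0 < t & V : layer 1" "x = pprod L"
   "ALL (t, V):set L'. 0 < t & V : layer 1" "y = pprod L'" unfolding R_def by (elim exE conjE)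
  thus "R (M + M') (x ** y)" unfolding R_def by (intro exI[of _ "L @ L'"]) (auto simp: pprod_append)
 next
  fix M x assume "R M x"
  then obtain L where "ALL (t, V):set L. 0 < t & V : layer 1" "x = pprod L" unfolding R_def by (elim exE conjE)
  thus "R M (- x)" unfolding R_def using layer_scale[of _ 1 "-1"] by (intro exI[of _ "rev_path L"]) (auto simp: pprod_rev_path, auto simp: rev_path_def)
 next
  fix v assume "v : layer 1"
  thus "R (norm v) v" unfolding R_def by (intro exI[of _ "[(1, v)]"]) (auto simp: right_unit)
 next
  fix M M' x assume "R M x" thus "R M' x" by (simp add: R_def)
 next
  fix M c x assume "R M x"
  then obtain L where L: "ALL (t, V):set L. 0 < t & V : layer 1" "x = pprod L" unfolding R_def by (elim exE conjE)
  have "dilation c (pprod L) = pprod (map (%(t, V). (t, c *R V)) L)" using L(1) by (induction L) (auto simp: dilation_mult dilation_layer1 layer_scale mult.commute)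
  thus "R (abs c * M) (dilation c x)" unfolding R_def using L by (intro exI[of _ "map (%(t, V). (t, c *R V)) L"]) (auto simp: layer_scale)
 qed
 thus ?thesis by (auto simp: R_def)
qed

lemma rat_pts_dense:
 assumes "nu > 0"
 shows "EX q:rat_pts. d q x < nu"
proof -
 obtain L where L: "ALL (t, V):set L. 0 < t & V : layer 1" "x = pprod L" using pprod_surj by blast
 define M where "M = (\<Sum>tV\<leftarrow>L. norm (snd tV))"
 have "norm V <= M" if "(t, V) : set L" for t V unfolding M_def using that by (intro member_le_sum_list) force+
 hence nL: "near_path 0 M L" using L(1) by (fastforce simp: near_path_def)
 have "EX q:rat_pts. EX L'. approximates nu L' L & (ALL tau. 0 <= tau --> tau <= duration L --> d (q ** walk L' tau) (0 ** walk L tau) < nu)"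
  by (rule rational_approximation[OF nL _ _ assms]) (use L(1) zero_rat_pts in "auto intro!: bexI[of _ 0] simp: d_self")
 then obtain q L' where q: "q : rat_pts" "approximates nu L' L"
  "d (q ** walk L' (duration L)) (0 ** walk L (duration L)) < nu" using near_path_duration[OF nL] by blast
 hence "d (q ** pprod L') x < nu" using walk_duration[OF nL] walk_duration[OF approximates_near[OF q(2) nL]] by (simp add: approximates_duration[OF q(2)] L(2) left_unit)
 thus ?thesis using rat_pts_pprod[OF q(1) approximates_rat[OF q(2)]] by blast
qed

section \<open>Almost maximal derivatives in deformable directions\<close>

lemma near_path_mono: "near_path E delta L ==> delta <= delta' ==> near_path E delta' L" unfolding near_path_def by fastforce

text \<open>
  The two paths of a deformation are continued along the line in direction \<open>E\<close> and translated to \<open>x\<close>;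
  a rational approximation costs at most a factor of two in the constants.
\<close>

lemma rational_deformation:
 assumes D: "deformable_with E C N DeltaE" and l: "0 < l" "l < 1" and eta: "0 < eta" and Delta: "0 < Delta" "Delta < DeltaE eta" "Delta < 1"
  and z: "d 0 z = Delta * l" and R: "R > 1" and nu: "nu > 0"
 shows "EX c S. finite S & d (c (z *. E)) (x ** z) < nu & (ALL t. l <= abs t --> abs t <= R * l --> d (c t) (x ** (t *R E)) < nu) &
   (ALL sg t. - (R * l) <= sg --> sg <= t --> t <= R * l --> d (c sg) (c t) <= (1 + 2 * eta * Delta) * (t - sg) &
    (EX L. near_path E (2 * C * Delta) L & length L <= 2 * N + 2 & duration L = t - sg & c t = c sg ** pprod L)) &
   (ALL tau. abs tau < R * l --> tau ~: S --> (EX V. V : layer 1 & norm (V - E) <= 2 * C * Delta & norm V <= 1 + 2 * eta * Delta &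
    c tau : rat_lines & (EX kappa>0. ALL sg. abs sg < kappa --> c (tau + sg) = c tau ** (sg *R V))))"
proof -
 have E: "E : layer 1" "norm E = 1" and C: "C > 0" using D by (auto simp: deformable_with_def)
 define u where "u = dilation (1 / (Delta * l)) z"
 have Deltal: "Delta * l > 0" using Delta l by simp
 have zu: "z = dilation (Delta * l) u" unfolding u_def using Deltal by (intro dilation_inverse(1)[symmetric]) linarith
 have u1: "d u 0 <= 1" using Deltal z by (simp add: u_def d_sym[of _ 0] d_0_dilation)
 obtain L1 L2 where L: "length L1 <= N" "length L2 <= N" "near_path E (C * Delta) (L1 @ L2)"
   "ALL (t, V):set (L1 @ L2). 0 < t & norm V <= 1 + eta * Delta" "duration L1 = z *. E + l" "duration L2 = l - z *. E"
   "pprod L1 = (l *R E) ** z" "z ** pprod L2 = l *R E" "abs (z *. E) <= Delta * l" using deformable_paths[OF D l eta Delta u1 zu] by (elim exE conjE)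
 define P where "P = [((R - 1) * l, E)]"
 define L where "L = P @ L1 @ L2 @ P"
 have Rl: "(R - 1) * l > 0" using R l by simp
 have nP: "near_path E (C * Delta) P" using Rl E C Delta by (simp add: P_def)
 have nn: "near_path E (C * Delta) L1" "near_path E (C * Delta) L2" using L(3) by auto
 have nL: "near_path E (C * Delta) L" using L(3) nP by (simp add: L_def)
 have pos: "ALL (t, V):set L. 0 < t" using L(4) Rl by (auto simp: L_def P_def)
 have nV: "ALL (t, V):set L. norm V <= 1 + eta * Delta" using L(4) E eta Delta by (auto simp: L_def P_def)
 have durP: "duration P = (R - 1) * l" "pprod P = ((R - 1) * l) *R E" by (simp_all add: P_def right_unit)
 have durL: "duration L = 2 * (R * l)" by (simp add: L_def durP L(5,6) algebra_simps)
 define mu where "mu = min nu (min (C * Delta) (eta * Delta))"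
 have mu: "mu > 0" "mu <= nu" "mu <= C * Delta" "mu <= eta * Delta" using nu C Delta eta by (auto simp: mu_def)
 define b where "b = x ** (- ((R * l) *R E))"
 have "EX q:rat_pts. EX L'. approximates mu L' L & (ALL tau. 0 <= tau --> tau <= duration L --> d (q ** walk L' tau) (b ** walk L tau) < mu)"
  by (rule rational_approximation[OF nL pos _ mu(1)]) (rule rat_pts_dense)
 then obtain q L' where q: "q : rat_pts" and L': "approximates mu L' L"
  "ALL tau. 0 <= tau --> tau <= duration L --> d (q ** walk L' tau) (b ** walk L tau) < mu" by (elim bexE exE conjE)
 have nL': "near_path E (2 * C * Delta) L'" by (rule near_path_mono[OF approximates_near[OF L'(1) nL]]) (use mu(3) in auto)
 have durL': "duration L' = 2 * (R * l)" using approximates_duration[OF L'(1)] durL by simp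
 have len: "length L' = length L" using L'(1) by (simp add: approximates_def list_all2_lengthD)
 have nV': "norm V <= 1 + 2 * eta * Delta" if V: "V : snd ` set L'" for V
 proof -
  obtain k where k: "k < length L'" "V = snd (L' ! k)" proof -
   obtain tV where "tV : set L'" "V = snd tV" using V by (elim imageE)
   moreover from this obtain k where "k < length L'" "L' ! k = tV" by (auto simp: in_set_conv_nth)
   ultimately show thesis using that by simp
  qed
  hence "norm (V - snd (L ! k)) < mu" using list_all2_nthD[OF L'(1)[unfolded approximates_def] k(1)] by (auto simp: case_prod_beta)
  moreover have "norm (snd (L ! k)) <= 1 + eta * Delta" using nV k(1) len nth_mem[of k L] by (auto simp: case_prod_beta)
  ultimately show ?thesis using norm_triangle_ineq[of "V - snd (L ! k)" "snd (L ! k)"] mu(4) by simp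
 qed
 define c where "c t = q ** walk L' (t + R * l)" for t
 have base: "d (c t) (b ** walk L (t + R * l)) < nu" if "abs t <= R * l" for t
 proof -
  have "0 <= t + R * l" "t + R * l <= duration L" using that durL by auto
  hence "d (q ** walk L' (t + R * l)) (b ** walk L (t + R * l)) < mu" using L'(2) by blast
  thus ?thesis using mu(2) by (simp add: c_def)
 qed
 have "(- (R * l)) *R E ** (((R - 1) * l) *R E) = (- l) *R E" unfolding exp_coords by (simp add: left_diff_distrib)
 hence bP: "b ** pprod P = x ** (- (l *R E))" unfolding b_def durP assoc by simp
 have bP1: "b ** pprod (P @ L1) = x ** z" by (simp add: pprod_append assoc[symmetric] bP L(7)) (simp add: assoc inv_cancel)
 have "b ** pprod (P @ L1 @ L2) = (b ** pprod (P @ L1)) ** pprod L2" by (simp add: pprod_append assoc)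
 hence bP2: "b ** pprod (P @ L1 @ L2) = x ** (l *R E)" unfolding bP1 by (simp add: assoc L(8))
 have "d (c (z *. E)) (x ** z) < nu"
 proof -
  have "Delta * l <= R * l" using Delta R l by (intro mult_right_mono) auto
  hence "abs (z *. E) <= R * l" using L(9) by linarith
  moreover have "walk L (z *. E + R * l) = pprod (P @ L1)"
  proof -
   have "walk ((P @ L1) @ (L2 @ P)) (z *. E + R * l) = pprod (P @ L1) ** walk (L2 @ P) (z *. E + R * l - duration (P @ L1))"
    by (rule walk_append) (use nn nP L(5) durP in "auto simp: algebra_simps")
   moreover have "z *. E + R * l - duration (P @ L1) = 0" by (simp add: durP L(5) algebra_simps)
   moreover have "walk (L2 @ P) 0 = 0" by (rule walk_0[of E "C * Delta"]) (use nn nP in auto)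
   ultimately show ?thesis by (simp add: L_def right_unit)
  qed
  ultimately show ?thesis using base[of "z *. E"] bP1 by simp
 qed
 moreover have "d (c t) (x ** (t *R E)) < nu" if t: "l <= abs t" "abs t <= R * l" for t
 proof (cases "t >= 0")
  case True
  have "walk ((P @ L1 @ L2) @ P) (t + R * l) = pprod (P @ L1 @ L2) ** walk P (t + R * l - duration (P @ L1 @ L2))"
   by (rule walk_append) (use nn nP L(5,6) durP t True in "auto simp: algebra_simps")
  moreover have tl: "t + R * l - duration (P @ L1 @ L2) = t - l" by (simp add: durP L(5,6) algebra_simps)
  moreover have "walk P (t - l) = (t - l) *R E" using t True by (simp add: P_def algebra_simps)
  ultimately have "b ** walk L (t + R * l) = (b ** pprod (P @ L1 @ L2)) ** ((t - l) *R E)" unfolding tl by (simp add: L_def assoc)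
  also have "... = x ** (t *R E)" unfolding bP2 by (simp add: assoc exp_coords)
  finally show ?thesis using base[of t] t by simp
 next
  case False
  hence "walk L (t + R * l) = (t + R * l) *R E" using t by (simp add: L_def P_def algebra_simps)
  hence "b ** walk L (t + R * l) = x ** ((- (R * l)) *R E ** ((t + R * l) *R E))" by (simp add: b_def assoc)
  also have "... = x ** (t *R E)" unfolding exp_coords by simp
  finally show ?thesis using base[of t] t by simp
 qed
 moreover have "d (c sg) (c t) <= (1 + 2 * eta * Delta) * (t - sg)" if st: "- (R * l) <= sg" "sg <= t" "t <= R * l" for sg t
  using walk_lipschitz[OF nL' nV', of "sg + R * l" "t + R * l"] st durL' by (simp add: c_def)
 moreover have "EX L. near_path E (2 * C * Delta) L & length L <= 2 * N + 2 & duration L = t - sg & c t = c sg ** pprod L"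
  if st: "- (R * l) <= sg" "sg <= t" "t <= R * l" for sg t
 proof -
  have "EX L. near_path E (2 * C * Delta) L & length L <= length L' & duration L = (t + R * l) - (sg + R * l) &
    walk L' (t + R * l) = walk L' (sg + R * l) ** pprod L & snd ` set L <= snd ` set L'" using walk_segment[OF nL', of "sg + R * l" "t + R * l"] st durL' by simp
  then obtain L'' where "near_path E (2 * C * Delta) L''" "length L'' <= length L'" "duration L'' = (t + R * l) - (sg + R * l)"
    "walk L' (t + R * l) = walk L' (sg + R * l) ** pprod L''" by (elim exE conjE)
  moreover have "length L' <= 2 * N + 2" using L(1,2) by (simp add: len L_def P_def)
  ultimately show ?thesis by (intro exI[of _ L'']) (auto simp: c_def assoc)
 qed
 moreover define S where "S = (%sg. sg - R * l) ` (%k. duration (take k L')) ` {..length L'}"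
 have "finite S" by (simp add: S_def)
 moreover have "EX V. V : layer 1 & norm (V - E) <= 2 * C * Delta & norm V <= 1 + 2 * eta * Delta &
    c tau : rat_lines & (EX kappa>0. ALL sg. abs sg < kappa --> c (tau + sg) = c tau ** (sg *R V))" if tau: "abs tau < R * l" "tau ~: S" for tau
 proof -
  have "tau + R * l ~: (%k. duration (take k L')) ` {..length L'}" using tau(2) unfolding S_def by (metis add_diff_cancel image_eqI)
  hence "EX k<length L'. EX u eta. eta > 0 & (ALL h. abs h < eta --> walk L' ((tau + R * l) + h) = pprod (take k L') ** ((u + h) *R snd (L' ! k)))"
   using tau(1) durL' by (intro walk_locally_line[OF nL']) auto
  then obtain k u kappa where k: "k < length L'" "kappa > 0"
    "ALL h. abs h < kappa --> walk L' ((tau + R * l) + h) = pprod (take k L') ** ((u + h) *R snd (L' ! k))" by (elim exE conjE)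
  obtain t V where tV: "L' ! k = (t, V)" by fastforce
  have inL: "(t, V) : set L'" using k(1) tV nth_mem by metis
  have V: "V : layer 1" "norm (V - E) <= 2 * C * Delta" using nL' inL by (auto simp: near_path_def)
  have tW: "t *R V : rat_vec" using approximates_rat[OF L'(1)] inL by auto
  have tpos: "t > 0" using list_all2_nthD[OF L'(1)[unfolded approximates_def] k(1)] pos nth_mem[of k L] k(1) len tV by (auto simp: case_prod_beta)
  define q' where "q' = q ** pprod (take k L')"
  have q': "q' : rat_pts" unfolding q'_def by (rule rat_pts_pprod[OF q]) (use approximates_rat[OF L'(1)] in "auto dest: in_set_takeD")
  have ch: "c (tau + h) = q' ** ((u + h) *R V)" if "abs h < kappa" for h using k(3)[rule_format, OF that] tV by (simp add: c_def q'_def assoc add_ac)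
  have c0: "c tau = q' ** (u *R V)" using ch[of 0] k(2) by simp
  have "c (tau + h) = c tau ** (h *R V)" if "abs h < kappa" for h unfolding ch[OF that] c0 by (simp add: assoc exp_coords)
  moreover have "c tau = q' ** ((u / t) *R (t *R V))" using tpos c0 by simp
  hence "c tau : rat_lines" unfolding rat_lines_def using q' tW by blast
  moreover have "norm V <= 1 + 2 * eta * Delta" using nV' inL by force
  ultimately show ?thesis using V k(2) by blast
 qed
 ultimately show ?thesis by blast
qed

text \<open>
  Three ranges of \<open>t\<close>: \<open>far\<close> concerns large times; \<open>slope\<close> is used as long as \<open>c (tau + t)\<close> is
  on the detour; otherwise \<open>c (tau + t)\<close> is close to the line through \<open>x\<close>, and the errors, which do not tend
  to \<open>0\<close> with \<open>t\<close>, are at most \<open>b * abs t\<close> because \<open>tau\<close> is not close to the ends of the detour.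
\<close>

lemma osc_along_deformation:
 assumes lip: "!!x y. abs (h x - h y) <= Lam * d x y" and Lam: "Lam > 0" and l: "l > 0" and R: "R > 1"
  and near: "!!F L. F = E | F = - E ==> near_path F delta L ==> length L <= n ==> d (duration L *R F) (pprod L) <= kappa * duration L"
  and segs: "!!sg t. - (R * l) <= sg ==> sg <= t ==> t <= R * l ==> EX L. near_path E delta L & length L <= n & duration L = t - sg & c t = c sg ** pprod L"
  and line: "!!t. abs t <= R * l ==> abs (inc h x E t - m * t) <= theta * abs t" and theta: "theta >= 0"
  and close: "!!t. l <= abs t ==> abs t <= R * l ==> d (c t) (x ** (t *R E)) < nu"
  and slope: "!!t. - l <= tau + t ==> tau + t <= l ==> abs (h (c (tau + t)) - h (c tau) - m * t) <= A * abs t" and A: "A >= 0"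
  and ends: "- l + rho <= tau" "tau <= l - rho" "rho > 0" "2 * (Lam * nu + theta * (R * l)) <= b * rho" and b: "b >= 0"
  and far: "!!t. (R - 1) * l <= abs t ==> abs (inc h x E t - inc h (c tau) E t) <= G * abs t"
  and Q: "theta + Lam * kappa + A + b <= Q" "G <= Q"
 shows "osc h E x (c tau) Q" unfolding osc_def
proof
 fix t :: real
 show "abs (inc h x E t - inc h (c tau) E t) <= Q * abs t"
 proof (cases "(R - 1) * l <= abs t")
  case True
  have "G * abs t <= Q * abs t" using Q(2) by (rule mult_right_mono) simp
  thus ?thesis using far[OF True] by linarith
 next
  case False
  have lR: "l <= R * l" using R l by simp
  have t: "abs t <= R * l - l" using False by (simp add: left_diff_distrib)
  have range: "- (R * l) <= tau + t" "tau + t <= R * l" "- (R * l) <= tau" "tau <= R * l" using t ends lR by auto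
  have 1: "d (c tau ** (t *R E)) (c (tau + t)) <= kappa * abs t"
  proof (cases "t >= 0")
   case True
   obtain L where L: "near_path E delta L" "length L <= n" "duration L = tau + t - tau" "c (tau + t) = c tau ** pprod L" using segs[OF range(3) _ range(2)] True by auto
   thus ?thesis using near[OF _ L(1,2)] True by simp
  next
   case False
   obtain L where L: "near_path E delta L" "length L <= n" "duration L = tau - (tau + t)" "c tau = c (tau + t) ** pprod L"
    using segs[OF range(1) _ range(4)] False by auto
   have "c (tau + t) = c tau ** pprod (rev_path L)" unfolding L(4) pprod_rev_path by (simp add: assoc inv_r right_unit)
   hence "d (c tau ** (t *R E)) (c (tau + t)) = d (t *R E) (pprod (rev_path L))" by simp
   moreover have "d (duration (rev_path L) *R (- E)) (pprod (rev_path L)) <= kappa * duration (rev_path L)"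
    by (rule near[OF _ near_path_rev[OF L(1)]]) (use L(2) in "auto simp: rev_path_def")
   ultimately show ?thesis using False L(3) by simp
  qed
  have "abs (h (c tau ** (t *R E)) - h (c (tau + t))) <= Lam * (kappa * abs t)"
   using lip[of "c tau ** (t *R E)" "c (tau + t)"] mult_left_mono[OF 1, of Lam] Lam by linarith
  hence 2: "abs (h (c tau ** (t *R E)) - h (c (tau + t))) <= (Lam * kappa) * abs t" by simp
  have 3: "abs (inc h x E t - m * t) <= theta * abs t" using line t l by simp
  have on_line: "abs (h (c u) - h x - m * u) <= Lam * nu + theta * (R * l)" if u: "l <= abs u" "abs u <= R * l" for u
  proof -
   have "abs (h (c u) - h (x ** (u *R E))) <= Lam * nu"
    using lip[of "c u" "x ** (u *R E)"] mult_left_mono[of "d (c u) (x ** (u *R E))" nu Lam] close[OF u] Lam by linarith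
   moreover have "theta * abs u <= theta * (R * l)" using u theta by (intro mult_left_mono)
   ultimately show ?thesis using line[OF u(2)] by linarith
  qed
  have exit: "abs (h (c (tau + t)) - h (c tau) - m * t) <= (A + b) * abs t" if e: "e = l | e = - l" "abs (e - tau) <= abs t" "l <= abs (tau + t)" for e
  proof -
   have r: "rho <= abs (e - tau)" using e(1) ends by auto
   have "abs (h (c e) - h (c tau) - m * (e - tau)) <= A * abs (e - tau)" using slope[of "e - tau"] e(1) l by auto
   also have "... <= A * abs t" using e(2) A by (rule mult_left_mono)
   finally have "abs (h (c e) - h (c tau) - m * (e - tau)) <= A * abs t" .
   moreover have "abs (h (c e) - h x - m * e) <= Lam * nu + theta * (R * l)" using on_line[of e] e(1) l lR by auto
   moreover have "abs (h (c (tau + t)) - h x - m * (tau + t)) <= Lam * nu + theta * (R * l)" using on_line[OF e(3)] range by auto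
   moreover have "b * rho <= b * abs t" using r e(2) b by (intro mult_left_mono) auto
   ultimately have "abs (h (c (tau + t)) - h (c tau) - m * t) <= A * abs t + b * abs t" using ends(4) by (simp add: right_diff_distrib distrib_left abs_le_iff)
   thus ?thesis by (simp add: distrib_right)
  qed
  have 4: "abs (h (c (tau + t)) - h (c tau) - m * t) <= (A + b) * abs t"
  proof -
   consider "abs (tau + t) <= l" | "tau + t > l" | "tau + t < - l" by linarith
   thus ?thesis
   proof cases
    case 1
    hence "abs (h (c (tau + t)) - h (c tau) - m * t) <= A * abs t" by (intro slope) auto
    also have "... <= (A + b) * abs t" using b by (intro mult_right_mono) auto
    finally show ?thesis .
   next
    case 2 thus ?thesis using ends by (intro exit[of l]) auto
   next
    case 3 thus ?thesis using ends by (intro exit[of "- l"]) auto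
   qed
  qed
  have "abs (inc h x E t - inc h (c tau) E t) <= theta * abs t + (Lam * kappa) * abs t + (A + b) * abs t" using 2 3 4 by linarith
  also have "... = (theta + Lam * kappa + A + b) * abs t" by (simp add: algebra_simps)
  also have "... <= Q * abs t" using Q(1) by (rule mult_right_mono) simp
  finally show ?thesis .
 qed
qed

text \<open>At times \<open>t\<close> much larger than \<open>d x y\<close> the lines through \<open>x\<close> and \<open>y\<close> are close relative to \<open>t\<close>.\<close>

lemma far_osc:
 assumes lip: "!!x y. abs (h x - h y) <= Lam * d x y" and Lam: "Lam > 0" and b: "b > 0"
 shows "EX R>=7. ALL x y E l t. E : S1 --> l > 0 --> d x y <= 6 * l --> (R - 1) * l <= abs t -->
   abs (inc h x E t - inc h y E t) <= b * abs t"
proof -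
 have s1: "real s >= 1" using step_pos by simp
 obtain K where K: "K > 0" "ALL x y E t. E : S1 --> t ~= 0 --> d x y <= abs t -->
   d (x ** (t *R E)) (y ** (t *R E)) <= K * abs t * (d x y / abs t) powr (1 / s)" using far_estimate by blast
 define X where "X = min 1 ((b / (Lam * (K + 1))) powr s)"
 have X: "X > 0" "X <= 1" using b Lam K(1) by (auto simp: X_def)
 have Xb: "Lam * (K * X powr (1 / s) + X) <= b"
 proof -
  have "X powr 1 <= X powr (1 / s)" by (rule powr_mono') (use X s1 in auto)
  hence "Lam * (K * X powr (1 / s) + X) <= Lam * (K * X powr (1 / s) + X powr (1 / s))" using X Lam by (intro mult_left_mono) auto
  also have "... = Lam * (K + 1) * X powr (1 / s)" by (simp add: algebra_simps)
  also have "... <= Lam * (K + 1) * ((b / (Lam * (K + 1))) powr s) powr (1 / s)" using X Lam K(1) by (intro mult_left_mono powr_mono2) (auto simp: X_def)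
  also have "... = b" using s1 b Lam K(1) by (simp add: powr_powr)
  finally show ?thesis .
 qed
 have "abs (inc h x E t - inc h y E t) <= b * abs t"
  if a: "E : S1" "l > 0" "d x y <= 6 * l" "((1 + 6 / X) - 1) * l <= abs t" for x y E l t
 proof -
  have t: "abs t > 0" using a(2,4) X(1) by (smt (verit) divide_pos_pos mult_pos_pos)
  have "6 * l <= X * abs t" using a(4) X(1) by (simp add: field_simps)
  hence dX: "d x y <= X * abs t" using a(3) by linarith
  have "X * abs t <= 1 * abs t" using X(2) by (rule mult_right_mono) simp
  hence d1: "d x y <= abs t" using dX by linarith
  have dX': "d x y / abs t <= X" using dX t by (simp add: pos_divide_le_eq)
  have "d (x ** (t *R E)) (y ** (t *R E)) <= K * abs t * (d x y / abs t) powr (1 / s)" using K(2) a(1) d1 t by simp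
  also have "... <= K * abs t * X powr (1 / s)" using K(1) dX' by (intro mult_left_mono powr_mono2) auto
  finally have "Lam * (d (x ** (t *R E)) (y ** (t *R E)) + d x y) <= Lam * (K * abs t * X powr (1 / s) + X * abs t)" using dX Lam by (intro mult_left_mono) auto
  also have "... = Lam * (K * X powr (1 / s) + X) * abs t" by (simp add: algebra_simps)
  also have "... <= b * abs t" using Xb by (rule mult_right_mono) simp
  finally show ?thesis using lip[of "x ** (t *R E)" "y ** (t *R E)"] lip[of x y] by (simp add: distrib_left)
 qed
 moreover have "1 + 6 / X >= 7" using X by (simp add: field_simps)
 ultimately show ?thesis by blast
qed

text \<open>
  The deviation of a path from a line is of order \<open>Delta powr (1 / s\<^sup>2)\<close>, which is small compared with the
  modulus \<open>(eps * Delta) powr (1 / (4 * s\<^sup>2))\<close>; this determines the exponent in \<open>omega\<close>.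
\<close>

lemma deformation_scale:
 assumes Lam: "Lam > 0" and e: "eps > 0" and C: "C > 0" and K: "K > 0" and D: "D > 0" and eta: "eta > 0"
 shows "EX Delta>0. Delta < 1 & Delta < D & 2 * C * Delta <= 1 / 2 & eta * Delta <= 1 / 4 & K * (2 * C * Delta) powr (1 / s^2) <= (eps * Delta) powr (1 / (4 * s^2)) / 2"
proof -
 define a where "a = 1 / real (s^2)"
 have a: "a > 0" using step_pos by (simp add: a_def)
 define q where "q = eps powr (a / 4) / (2 * K * (2 * C) powr a)"
 have q: "q > 0" using e K C by (simp add: q_def)
 define Delta where "Delta = min (min (1 / 2) (D / 2)) (min (min (1 / (4 * C)) (1 / (4 * eta))) (q powr (4 / (3 * a))))"
 have Delta: "Delta > 0" "Delta <= 1 / 2" "Delta <= D / 2" "Delta <= 1 / (4 * C)" "Delta <= 1 / (4 * eta)" "Delta <= q powr (4 / (3 * a))"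
  using D C eta q by (auto simp: Delta_def)
 have "Delta powr (3 * a / 4) <= (q powr (4 / (3 * a))) powr (3 * a / 4)" using Delta a by (intro powr_mono2) auto
 also have "... = q" using a q by (simp add: powr_powr)
 finally have "Delta powr (3 * a / 4) * (2 * K * (2 * C) powr a) <= eps powr (a / 4)" using K C by (simp add: q_def pos_le_divide_eq)
 hence "Delta powr (a / 4) * (Delta powr (3 * a / 4) * (2 * K * (2 * C) powr a)) <= Delta powr (a / 4) * eps powr (a / 4)" by (rule mult_left_mono) simp
 moreover have "Delta powr (a / 4) * Delta powr (3 * a / 4) = Delta powr a" by (simp add: powr_add[symmetric])
 ultimately have "2 * K * ((2 * C) powr a * Delta powr a) <= eps powr (a / 4) * Delta powr (a / 4)" by (metis mult.assoc mult.commute)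
 hence "K * (2 * C * Delta) powr a <= (eps * Delta) powr (a / 4) / 2" using C Delta e by (simp add: powr_mult)
 moreover have "2 * C * Delta <= 1 / 2" "eta * Delta <= 1 / 4" using Delta(4,5) C eta by (simp_all add: field_simps)
 ultimately show ?thesis using Delta D by (intro exI[of _ Delta]) (auto simp: a_def mult.commute)
qed

text \<open>
  If the estimate fails at \<open>z\<close>, take a detour \<open>c\<close> of length \<open>2 * l\<close> through a point close to \<open>x ** z\<close>,
  where \<open>d 0 z = Delta * l\<close>. On it \<open>h (c t) - m * t\<close> increases by \<open>h0 = eps * Delta * l / 2\<close>, although it
  changes little between the ends. The mean value lemma gives a slope \<open>sg >= h0 / (16 * l) = s0\<close>; normalising the
  direction costs at most \<open>2 * Lam * eta * Delta = s0 / 4\<close>, so the derivative exceeds \<open>m\<close> by more than the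
  almost maximality admits.
\<close>

lemma almost_maximal_estimate:
 assumes lip: "!!x y. abs (h x - h y) <= Lam * d x y" and Lam: "Lam > 0" and hx: "dir_deriv h x E m" and m: "m >= 0"
  and D: "deformable_with E C N DeltaE"
  and om: "!!u. u >= 0 ==> 120 * sqrt (6 * Lam * u) + 4 * u powr (1 / (4 * s^2)) <= omega u"
  and max: "!!eps. eps > 0 ==> EX delta>0. ALL y F w. y : rat_lines --> F : S1 --> dir_deriv h y F w --> d x y < delta --> m <= w -->
    osc h E x y (omega (w - m)) --> w <= m + eps"
  and eps: "eps > 0"
 shows "EX r>0. ALL z. 0 < d 0 z --> d 0 z < r --> abs (h (x ** z) - h x - m * (z *. E)) <= eps * d 0 z"
proof -
 have E: "E : layer 1" "norm E = 1" and C: "C > 0" and D\<^sub>E: "!!eta. eta > 0 ==> DeltaE eta > 0" using D by (auto simp: deformable_with_def)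
 have ES: "E : S1" using E by (simp add: S1_def)
 have s1: "real s >= 1" using step_pos by simp
 have mLam: "m <= Lam" using dir_deriv_bound[OF lip ES hx] by simp
 \<comment> \<open>Two paths of a deformation and the two pieces of the line.\<close>
 define n where "n = 2 * N + 2"
 obtain K3 where K3: "K3 > 0" "ALL E L delta. E : layer 1 --> norm E = 1 --> 0 <= delta --> delta <= 1 --> near_path E delta L -->
   d (duration L *R E) (pprod L) <= real (length L) * duration L * (K3 * delta powr (1 / s^2))" using near_path_estimate by blast
 define eta where "eta = eps / (256 * Lam)"
 have eta: "eta > 0" using eps Lam by (simp add: eta_def)
 have "Lam * (real n * K3) > 0" using Lam K3(1) by (simp add: n_def)
 then obtain Delta where Delta: "Delta > 0" "Delta < 1" "Delta < DeltaE eta" "2 * C * Delta <= 1 / 2" "eta * Delta <= 1 / 4"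
   "Lam * (real n * K3) * (2 * C * Delta) powr (1 / s^2) <= (eps / 32 * Delta) powr (1 / (4 * s^2)) / 2"
  using deformation_scale[OF Lam _ C _ D\<^sub>E[OF eta] eta, of "eps / 32" "Lam * (real n * K3)"] eps by auto
 define s0 where "s0 = eps / 32 * Delta"
 define b where "b = s0 powr (1 / (4 * s^2))"
 have s0: "s0 > 0" and b: "b > 0" using eps Delta by (auto simp: s0_def b_def)
 obtain R where R: "R >= 7" "ALL x y E l t. E : S1 --> l > 0 --> d x y <= 6 * l --> (R - 1) * l <= abs t -->
   abs (inc h x E t - inc h y E t) <= b * abs t" using far_osc[OF lip Lam b] by blast
 have R1: "R > 1" using R(1) by simp
 \<comment> \<open>Chosen such that \<open>b / 2 * rho = 2 * (kappa0 * l)\<close> for the distance \<open>rho\<close> of \<open>tau\<close> to the ends.\<close>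
 define kappa0 where "kappa0 = b * (eps * Delta) / (384 * Lam)"
 have kappa0: "kappa0 > 0" using b eps Delta Lam by (simp add: kappa0_def)
 define theta where "theta = min (min (kappa0 / (2 * R)) (b / 2)) (eps * Delta / 16)"
 have theta: "theta > 0" "theta <= kappa0 / (2 * R)" "theta <= b / 2" "theta <= eps * Delta / 16" using kappa0 R(1) b eps Delta by (auto simp: theta_def)
 obtain r1 where r1: "r1 > 0" "!!t. abs t <= r1 ==> abs (inc h x E t - m * t) <= theta * abs t" using dir_deriv_near[OF hx theta(1)] by blast
 have s04: "s0 / 4 > 0" using s0 by simp
 obtain delta where delta: "delta > 0" "ALL y F w. y : rat_lines --> F : S1 --> dir_deriv h y F w --> d x y < delta --> m <= w -->
    osc h E x y (omega (w - m)) --> w <= m + s0 / 4" using max[OF s04] by blast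
 define r where "r = Delta * min 1 (min (r1 / R) (delta / 7))"
 have "r > 0" using Delta r1(1) delta(1) R(1) by (simp add: r_def)
 moreover have "abs (h (x ** z) - h x - m * (z *. E)) <= eps * d 0 z" if z: "0 < d 0 z" "d 0 z < r" for z
 proof (rule ccontr)
  assume contr: "~ abs (h (x ** z) - h x - m * (z *. E)) <= eps * d 0 z"
  define l where "l = d 0 z / Delta"
  have zl: "d 0 z = Delta * l" using Delta by (simp add: l_def)
  have l0: "l > 0" using z Delta by (simp add: l_def)
  have "l < min 1 (min (r1 / R) (delta / 7))" using z(2) Delta by (simp add: zl r_def)
  hence l: "l < 1" "R * l <= r1" "7 * l < delta" using R(1) by (auto simp: field_simps)
  have lR: "l <= R * l" using R(1) l0 by simp
  define nu where "nu = min (min (kappa0 * l / (2 * Lam)) (eps * Delta * l / (16 * Lam))) l"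
  have nu: "nu > 0" "nu <= kappa0 * l / (2 * Lam)" "nu <= eps * Delta * l / (16 * Lam)" "nu <= l" using kappa0 l0 Lam eps Delta by (auto simp: nu_def)
  obtain c S where c: "finite S" "d (c (z *. E)) (x ** z) < nu"
   "ALL t. l <= abs t --> abs t <= R * l --> d (c t) (x ** (t *R E)) < nu"
   "ALL sg t. - (R * l) <= sg --> sg <= t --> t <= R * l --> d (c sg) (c t) <= (1 + 2 * eta * Delta) * (t - sg) &
    (EX L. near_path E (2 * C * Delta) L & length L <= 2 * N + 2 & duration L = t - sg & c t = c sg ** pprod L)"
   "ALL tau. abs tau < R * l --> tau ~: S --> (EX V. V : layer 1 & norm (V - E) <= 2 * C * Delta & norm V <= 1 + 2 * eta * Delta &
    c tau : rat_lines & (EX kappa>0. ALL sg. abs sg < kappa --> c (tau + sg) = c tau ** (sg *R V)))"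
   using rational_deformation[OF D l0 l(1) eta Delta(1,3,2) zl R1 nu(1), of x] by (elim exE conjE)
  have speed: "1 + 2 * eta * Delta <= 2" using Delta(5) by simp
  have clip: "d (c sg) (c t) <= 2 * abs (t - sg)" if "abs sg <= l" "abs t <= l" for sg t
  proof -
   have *: "d (c sg) (c t) <= 2 * (t - sg)" if "abs sg <= l" "abs t <= l" "sg <= t" for sg t
   proof -
    have "d (c sg) (c t) <= (1 + 2 * eta * Delta) * (t - sg)" using c(4)[rule_format, of sg t] that lR by auto
    also have "... <= 2 * (t - sg)" using speed that by (intro mult_right_mono) auto
    finally show ?thesis .
   qed
   show ?thesis using *[of sg t] *[of t sg] that by (cases "sg <= t") (auto simp: d_sym)
  qed
  \<comment> \<open>Clipping the parameter makes \<open>Phi\<close> Lipschitz on the whole real line.\<close>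
  define cl where "cl t = max (- l) (min l t)" for t
  have cl: "abs (cl t) <= l" "abs (cl t - cl t') <= abs (t - t')" for t t' using l0 by (auto simp: cl_def)
  have cl_id: "cl t = t" if "- l <= t" "t <= l" for t using that by (simp add: cl_def)
  define Phi where "Phi t = h (c (cl t)) - m * t" for t
  have Philip: "abs (Phi a - Phi t) <= 3 * Lam * abs (a - t)" for a t
  proof -
   have "abs (h (c (cl a)) - h (c (cl t))) <= Lam * d (c (cl a)) (c (cl t))" by (rule lip)
   also have "... <= Lam * (2 * abs (cl t - cl a))" using clip[OF cl(1) cl(1)] Lam by (intro mult_left_mono) auto
   also have "... <= Lam * (2 * abs (t - a))" using cl(2) Lam by (intro mult_left_mono) auto
   finally have "abs (h (c (cl a)) - h (c (cl t))) <= 2 * Lam * abs (a - t)" by (simp add: abs_minus_commute)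
   moreover have "abs (m * a - m * t) = m * abs (a - t)" using m by (simp add: abs_mult right_diff_distrib[symmetric])
   moreover have "m * abs (a - t) <= Lam * abs (a - t)" using mLam by (rule mult_right_mono) simp
   ultimately show ?thesis unfolding Phi_def by linarith
  qed
  define h0 where "h0 = eps * Delta * l / 2"
  have h0: "h0 > 0" using eps Delta l0 by (simp add: h0_def)
  have Lamnu: "Lam * nu <= h0 / 8" "Lam * nu <= kappa0 * l / 2"
  proof -
   have "Lam * nu <= Lam * (eps * Delta * l / (16 * Lam))" "Lam * nu <= Lam * (kappa0 * l / (2 * Lam))"
    by (rule mult_left_mono[OF nu(3)], use Lam in simp, rule mult_left_mono[OF nu(2)], use Lam in simp)
   thus "Lam * nu <= h0 / 8" "Lam * nu <= kappa0 * l / 2" using Lam by (simp_all add: h0_def)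
  qed
  have thetal: "theta * l <= h0 / 8" "theta * (R * l) <= kappa0 * l / 2"
  proof -
   have "theta * l <= (eps * Delta / 16) * l" using theta(4) l0 by (intro mult_right_mono) auto
   thus "theta * l <= h0 / 8" by (simp add: h0_def)
   have "theta * (R * l) <= (kappa0 / (2 * R)) * (R * l)" using theta(2) l0 R(1) by (intro mult_right_mono) auto
   thus "theta * (R * l) <= kappa0 * l / 2" using R(1) by simp
  qed
  have ends: "abs (Phi t - h x) <= h0 / 4" if "t = l | t = - l" for t
  proof -
   have t: "abs t = l" using that l0 by auto
   have "abs (h (c t) - h (x ** (t *R E))) <= Lam * nu"
    using lip[of "c t" "x ** (t *R E)"] c(3)[rule_format, of t] t lR mult_left_mono[of "d (c t) (x ** (t *R E))" nu Lam] Lam by linarith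
   moreover have "abs (inc h x E t - m * t) <= theta * l" using r1(2)[of t] t lR l(2) by simp
   moreover have "cl t = t" using that l0 by (intro cl_id) auto
   hence "Phi t = h (c t) - m * t" by (simp add: Phi_def)
   ultimately show ?thesis using Lamnu(1) thetal(1) by linarith
  qed
  have zeta: "abs (z *. E) <= l"
  proof -
   have "abs (z *. E) <= norm (p z)" using Cauchy_Schwarz_ineq2[of "p z" E] E by (simp add: p_inner_layer1[of E z])
   also have "... <= d 0 z" by (rule norm_p_le_d)
   also have "... <= l" using Delta(1,2) l0 by (simp add: zl)
   finally show ?thesis .
  qed
  have Phizeta: "abs (Phi (z *. E) - (h (x ** z) - m * (z *. E))) <= h0 / 8"
  proof -
   have "abs (h (c (z *. E)) - h (x ** z)) <= Lam * nu"
    using lip[of "c (z *. E)" "x ** z"] c(2) mult_left_mono[of "d (c (z *. E)) (x ** z)" nu Lam] Lam by linarith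
   moreover have "cl (z *. E) = z *. E" using zeta by (intro cl_id) auto
   ultimately show ?thesis using Lamnu(1) by (simp add: Phi_def)
  qed
  have big: "abs (h (x ** z) - h x - m * (z *. E)) > 2 * h0" using contr by (simp add: zl h0_def)
  have "EX a e. - l <= a & a <= e & e <= l & h0 <= Phi e - Phi a"
  proof (cases "h (x ** z) - h x - m * (z *. E) > 0")
   case True
   hence "h0 <= Phi (z *. E) - Phi (- l)" using big Phizeta ends[of "- l"] h0 by linarith
   thus ?thesis using zeta by (intro exI[of _ "- l"] exI[of _ "z *. E"]) auto
  next
   case False
   hence "h0 <= Phi l - Phi (z *. E)" using big Phizeta ends[of l] h0 by linarith
   thus ?thesis using zeta by (intro exI[of _ "z *. E"] exI[of _ l]) auto
  qed
  then obtain a e where ae: "- l <= a" "a <= e" "e <= l" "h0 <= Phi e - Phi a" by blast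
  have Phill: "abs (Phi l - Phi (- l)) <= h0" using ends[OF disjI1[OF refl]] ends[OF disjI2[OF refl]] h0 by linarith
  have "3 * Lam > 0" "- l < l" using Lam l0 by auto
  from mean_value_slope[OF Philip this h0 Phill ae negligible_finite[OF c(1)]]
  obtain tau sg where tau: "tau ~: S" "h0 / (8 * (l - - l)) <= sg" "(Phi has_real_derivative sg) (at tau)"
   "- l + h0 / (16 * (3 * Lam)) <= tau" "tau <= l - h0 / (16 * (3 * Lam))"
   "ALL t. - l <= tau + t --> tau + t <= l --> abs (Phi (tau + t) - Phi tau) <= 120 * sqrt (3 * Lam * sg) * abs t" by (elim exE conjE)
  have sg: "s0 <= sg" using tau(2) l0 by (simp add: h0_def s0_def)
  define rho where "rho = h0 / (16 * (3 * Lam))"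
  have rho: "rho > 0" using h0 Lam by (simp add: rho_def)
  have taul: "- l < tau" "tau < l" using tau(4,5) rho by (auto simp: rho_def)
  hence "abs tau < R * l" using lR by linarith
  from c(5)[THEN spec, THEN mp, THEN mp, OF this tau(1)] obtain V kappa where V: "V : layer 1" "norm (V - E) <= 2 * C * Delta" "norm V <= 1 + 2 * eta * Delta" "c tau : rat_lines"
    and kappa: "kappa > 0" "ALL t. abs t < kappa --> c (tau + t) = c tau ** (t *R V)" by (elim exE conjE)
  have V0: "norm V >= 1 / 2" using norm_triangle_ineq[of "E - V" V] V(2) E Delta(4) by (simp add: norm_minus_commute)
  define F where "F = (1 / norm V) *R V"
  have F: "F : S1" using V(1) V0 by (auto simp: F_def S1_def layer_scale)
  define w where "w = (m + sg) / norm V"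
  have wF: "dir_deriv h (c tau) F w"
  proof -
   have "((%t. Phi (tau + t) + m * (tau + t)) has_real_derivative (sg + m)) (at 0)"
   proof (rule DERIV_add)
    show "((%t. Phi (tau + t)) has_real_derivative sg) (at 0)" using tau(3) DERIV_shift[of Phi sg 0 tau] by (simp add: add.commute)
    show "((%t. m * (tau + t)) has_real_derivative m) (at 0)" by (auto intro!: derivative_eq_intros)
   qed
   hence 1: "((%t. h (c tau ** (t *R V))) has_real_derivative (sg + m)) (at 0)"
   proof (rule has_field_derivative_transform_within_open[of _ _ _ "{- min kappa (min (l - tau) (l + tau))<..<min kappa (min (l - tau) (l + tau))}"])
    fix t assume t: "t : {- min kappa (min (l - tau) (l + tau))<..<min kappa (min (l - tau) (l + tau))}"
    hence "abs t < kappa" "cl (tau + t) = tau + t" by (auto intro!: cl_id)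
    thus "Phi (tau + t) + m * (tau + t) = h (c tau ** (t *R V))" using kappa(2) by (simp add: Phi_def)
   qed (use kappa(1) taul in auto)
   have "((%t. h (c tau ** ((t / norm V) *R V))) has_real_derivative (sg + m) * (1 / norm V)) (at 0)"
    by (rule DERIV_chain2[where f = "%t. h (c tau ** (t *R V))" and g = "%t. t / norm V"])
     (use 1 V0 in "auto intro!: derivative_eq_intros")
   thus ?thesis by (simp add: dir_deriv_def F_def w_def add.commute)
  qed
  have w: "w - m >= sg / 2"
  proof -
   have V1: "norm V > 0" using V0 by linarith
   have w0: "w >= 0" using m sg s0 by (simp add: w_def)
   have wLam: "w <= Lam" using dir_deriv_bound[OF lip F wF] by simp
   have "m + sg = w * norm V" using V1 by (simp add: w_def)
   also have "... <= w * (1 + 2 * eta * Delta)" using V(3) w0 by (intro mult_left_mono)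
   also have "... = w + w * (2 * eta * Delta)" by (simp add: algebra_simps)
   also have "w * (2 * eta * Delta) <= Lam * (2 * eta * Delta)" using wLam eta Delta by (intro mult_right_mono) auto
   also have "Lam * (2 * eta * Delta) = s0 / 4" using Lam by (simp add: eta_def s0_def)
   finally show ?thesis using sg s0 by linarith
  qed
  have y: "d x (c tau) <= 6 * l"
  proof -
   have "d x (c tau) <= d x (x ** ((- l) *R E)) + d (x ** ((- l) *R E)) (c tau)" by (rule d_triangle)
   moreover have "d (x ** ((- l) *R E)) (c tau) <= d (x ** ((- l) *R E)) (c (- l)) + d (c (- l)) (c tau)" by (rule d_triangle)
   moreover have "d x (x ** ((- l) *R E)) = l" using d_line[OF E(1), of x 0 "- l"] E(2) l0 by (simp add: right_unit)
   moreover have "d (x ** ((- l) *R E)) (c (- l)) <= nu" using c(3)[rule_format, of "- l"] lR l0 by (simp add: d_sym)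
   moreover have "d (c (- l)) (c tau) <= 2 * abs (tau - - l)" by (rule clip) (use taul l0 in auto)
   moreover have "2 * abs (tau - - l) <= 4 * l" using taul by auto
   ultimately show ?thesis using nu(4) by linarith
  qed
  have omegab: "120 * sqrt (3 * Lam * sg) + 2 * b <= omega (w - m)"
  proof -
   have "sqrt (3 * Lam * sg) <= sqrt (6 * Lam * (w - m))" using mult_left_mono[OF w, of "6 * Lam"] Lam by simp
   moreover have "b / 2 <= (w - m) powr (1 / (4 * s^2))"
   proof -
    have "1 / (4 * s^2) <= (1::real)" using one_le_power[OF s1, of 2] by (simp add: divide_le_eq)
    hence "(1 / 2) powr 1 <= (1 / 2 :: real) powr (1 / (4 * s^2))" by (intro powr_mono') auto
    hence "b * (1 / 2) <= b * (1 / 2) powr (1 / (4 * s^2))" using b by (intro mult_left_mono) auto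
    also have "... = (s0 * (1 / 2)) powr (1 / (4 * s^2))" unfolding b_def by (rule powr_mult[symmetric])
    also have "... <= (w - m) powr (1 / (4 * s^2))" using s0 sg w by (intro powr_mono2) auto
    finally show ?thesis by simp
   qed
   ultimately show ?thesis using om[of "w - m"] w sg s0 by linarith
  qed
  have "osc h E x (c tau) (omega (w - m))"
  proof (rule osc_along_deformation[where n = n and delta = "2 * C * Delta" and l = l and R = R and b = "b / 2" and G = b and rho = rho and
     A = "120 * sqrt (3 * Lam * sg)" and theta = theta and nu = nu and m = m and kappa = "real n * (K3 * (2 * C * Delta) powr (1 / s^2))"])
   fix F' L assume FL: "F' = E | F' = - E" "near_path F' (2 * C * Delta) L" "length L <= n"
   have "- E : layer 1" using layer_scale[OF E(1), of "-1"] by simp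
   hence "F' : layer 1" "norm F' = 1" using FL(1) E by auto
   hence "d (duration L *R F') (pprod L) <= real (length L) * duration L * (K3 * (2 * C * Delta) powr (1 / s^2))" using K3(2) FL(2) C Delta(1,4) by simp
   also have "... <= real n * duration L * (K3 * (2 * C * Delta) powr (1 / s^2))" using FL(3) near_path_duration[OF FL(2)] K3(1) by (intro mult_right_mono) auto
   finally show "d (duration L *R F') (pprod L) <= real n * (K3 * (2 * C * Delta) powr (1 / s^2)) * duration L" by (simp add: mult_ac)
  next
   fix u t assume "- (R * l) <= u" "u <= t" "t <= R * l"
   thus "EX L. near_path E (2 * C * Delta) L & length L <= n & duration L = t - u & c t = c u ** pprod L" using c(4) by (simp add: n_def)
  next
   fix t assume "abs t <= R * l"
   thus "abs (inc h x E t - m * t) <= theta * abs t" using r1(2) l(2) by simp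
  next
   fix t assume "l <= abs t" "abs t <= R * l"
   thus "d (c t) (x ** (t *R E)) < nu" using c(3) by simp
  next
   fix t assume t: "- l <= tau + t" "tau + t <= l"
   hence "abs (Phi (tau + t) - Phi tau) <= 120 * sqrt (3 * Lam * sg) * abs t" using tau(6) by simp
   thus "abs (h (c (tau + t)) - h (c tau) - m * t) <= 120 * sqrt (3 * Lam * sg) * abs t"
    unfolding Phi_def cl_id[OF t] cl_id[OF less_imp_le[OF taul(1)] less_imp_le[OF taul(2)]] by (simp add: distrib_left)
  next
   fix t assume "(R - 1) * l <= abs t"
   thus "abs (inc h x E t - inc h (c tau) E t) <= b * abs t" using R(2) ES l0 y by simp
  next
   have "b / 2 * rho = 2 * (kappa0 * l)" by (simp add: rho_def h0_def kappa0_def)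
   moreover have "2 * (u + v) <= 2 * k" if "u <= k / 2" "v <= k / 2" for u v k :: real using that by simp
   ultimately show "2 * (Lam * nu + theta * (R * l)) <= b / 2 * rho" using Lamnu(2) thetal(2) by presburger
  next
   have "Lam * (real n * (K3 * (2 * C * Delta) powr (1 / s^2))) <= b / 2" using Delta(6) unfolding b_def s0_def by (simp only: mult.assoc)
   thus "theta + Lam * (real n * (K3 * (2 * C * Delta) powr (1 / s^2))) + 120 * sqrt (3 * Lam * sg) + b / 2 <= omega (w - m)" using omegab theta(3) b by linarith
   show "b <= omega (w - m)" using omegab b sg s0 Lam by (smt (verit) mult_nonneg_nonneg real_sqrt_ge_zero)
  qed (use lip Lam l0 R(1) theta(1) b sg s0 tau(4,5) rho in "auto simp: rho_def")
  hence "w <= m + s0 / 4" using delta(2)[rule_format, OF V(4) F wF] y l(3) w sg s0 l0 by auto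
  thus False using w sg s0 by linarith
 qed
 ultimately show ?thesis by blast
qed

lemma pansu_differentiable_if_estimate:
 assumes E: "E : layer 1"
  and est: "!!eps. eps > 0 ==> EX r>0. ALL z. 0 < d 0 z --> d 0 z < r -->
   abs ((f (x ** z) + e *. p (x ** z)) - (f x + e *. p x) - m * (z *. E)) <= eps * d 0 z"
 shows "pansu_differentiable_at f x"
proof -
 define L where "L z = m * (p z *. E) - e *. p z" for z
 have zE: "z *. E = p z *. E" for z by (rule p_inner_layer1[OF E])
 have "G_linear L" unfolding G_linear_def L_def by (simp add: p_mult p_dilation inner_add_left inner_add_right algebra_simps)
 moreover have "((%y. abs (f y - f x - L (ginv x ** y)) / d x y) \<longlongrightarrow> 0) (at x)" unfolding tendsto_iff eventually_at
 proof (intro allI impI)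
  fix eps :: real assume eps: "eps > 0"
  then obtain r where r: "r > 0" "ALL z. 0 < d 0 z --> d 0 z < r -->
   abs ((f (x ** z) + e *. p (x ** z)) - (f x + e *. p x) - m * (z *. E)) <= eps / 2 * d 0 z" using est[of "eps / 2"] by auto
  obtain K where K: "K > 0" "ALL y y'. norm y <= norm x + 1 --> norm y' <= norm x + 1 --> d y y' <= K * norm (y - y') powr (1 / s)" using d_le_norm_diff by blast
  have s1: "real s >= 1" using step_pos by simp
  define delta where "delta = min 1 ((r / (2 * K)) powr s)"
  have delta: "delta > 0" "delta <= 1" using r(1) K(1) by (auto simp: delta_def)
  have "dist (abs (f y - f x - L (ginv x ** y)) / d x y) 0 < eps" if y: "y ~= x" "dist y x < delta" for y
  proof -
   define z where "z = (- x) ** y"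
   have yz: "y = x ** z" by (simp add: z_def inv_cancel)
   have dz: "d 0 z = d x y" by (simp add: z_def d_eq_0[of x])
   have pos: "d x y > 0" using y(1) d_nonneg[of x y] d_eq_0_iff[of x y] by (auto simp: less_le)
   have "norm y <= norm x + 1" using y(2) delta(2) norm_triangle_ineq[of x "y - x"] by (simp add: dist_norm)
   hence "d x y <= K * norm (x - y) powr (1 / s)" using K(2) by simp
   also have "... <= K * ((r / (2 * K)) powr s) powr (1 / s)" using y(2) K(1) by (intro mult_left_mono powr_mono2) (auto simp: delta_def dist_norm norm_minus_commute)
   also have "... = r / 2" using s1 r(1) K(1) by (simp add: powr_powr)
   finally have "d 0 z < r" using r(1) dz by simp
   hence "abs ((f (x ** z) + e *. p (x ** z)) - (f x + e *. p x) - m * (z *. E)) <= eps / 2 * d 0 z" using r(2)[rule_format, of z] pos dz by argo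
   hence "abs (f y - f x - L z) <= eps / 2 * d x y" by (simp add: dz yz[symmetric] L_def zE[symmetric]) (simp add: yz p_mult inner_add_right algebra_simps)
   also have "... < eps * d x y" using pos eps by simp
   finally show ?thesis using pos by (simp add: z_def ginv_def pos_divide_less_eq)
  qed
  thus "EX delta>0. ALL y:UNIV. y ~= x & dist y x < delta --> dist (abs (f y - f x - L (ginv x ** y)) / d x y) 0 < eps" using delta(1) by blast
 qed
 ultimately show ?thesis unfolding pansu_differentiable_at_def by blast
qed

lemma dir_deriv_add_linear:
 assumes "F : layer 1"
 shows "dir_deriv (%y. f y + e *. p y) y F w \<longleftrightarrow> dir_deriv f y F (w - e *. F)"
proof -
 have eq: "(%t. f (y ** (t *R F)) + e *. p (y ** (t *R F))) = (%t. f (y ** (t *R F)) + (e *. p y + t * (e *. F)))"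
  using assms by (simp add: p_mult p_layer1 layer_scale inner_add_right)
 have lin: "((%t. c * (e *. p y + t * (e *. F))) has_real_derivative c * (e *. F)) (at 0)" for c by (auto intro!: derivative_eq_intros)
 show ?thesis unfolding dir_deriv_def eq
 proof
  assume "((%t. f (y ** (t *R F)) + (e *. p y + t * (e *. F))) has_real_derivative w) (at 0)"
  from DERIV_add[OF this lin[of "-1"]] show "((%t. f (y ** (t *R F))) has_real_derivative w - e *. F) (at 0)" by simp
 next
  assume "((%t. f (y ** (t *R F))) has_real_derivative w - e *. F) (at 0)"
  from DERIV_add[OF this lin[of 1]]
  show "((%t. f (y ** (t *R F)) + (e *. p y + t * (e *. F))) has_real_derivative w) (at 0)" by simp
 qed
qed

lemma osc_add_linear:
 assumes "E : layer 1"
 shows "osc (%y. f y + e *. p y) E x y c \<longleftrightarrow> osc f E x y c"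
 using assms by (simp add: osc_def p_mult p_layer1 layer_scale inner_add_right algebra_simps)

text \<open>
  A Lipschitz function has a directional derivative somewhere on a line with rational direction in the ball
  of deformable directions. The variational principle produces from it a point and a direction in the
  ball at which a linear perturbation of the function has an almost maximal derivative.
\<close>

theorem universal_differentiability_set_if_deformable:
 fixes U :: "nat => 'a set"
 assumes ball: "!!E. E : layer 1 ==> E : ball Ec rho ==> norm E = 1 ==> deformable_with E C n DeltaB"
  and E1: "E1 : layer 1" "E1 : ball Ec rho" "norm E1 = 1"
  and N: "rat_lines <= N" "(\<Inter>k. U k) <= N" and U: "!!k x. x : N ==> EX r>0. ALL y. d x y < r --> y : U k"
 shows "universal_differentiability_set N" unfolding universal_differentiability_set_def
proof (intro allI impI)
 fix f :: "'a => real"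
 assume "Lipschitz_wrt d dist f"
 then obtain L0 where L0: "!!x y. abs (f x - f y) <= L0 * d x y" by (auto simp: Lipschitz_wrt_def dist_real_def)
 define L where "L = max 1 L0"
 have L: "L > 0" by (simp add: L_def)
 have lip: "abs (f x - f y) <= L * d x y" for x y using L0[of x y] mult_right_mono[of L0 L "d x y"] d_nonneg[of x y] by (simp add: L_def)
 define nu where "nu = min (1 / 2) ((rho - dist Ec E1) / 3)"
 have nu: "nu > 0" "nu <= 1 / 2" "3 * nu <= rho - dist Ec E1" using E1(2) by (auto simp: nu_def min_def)
 obtain W where W: "W : rat_vec" "norm (W - E1) < nu" using rat_vec_dense[OF E1(1) nu(1)] by blast
 have W1: "abs (norm W - 1) < nu" using W(2) E1(3) norm_triangle_ineq3[of W E1] by simp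
 hence W0: "norm W > 0" using nu(2) by linarith
 define E0 where "E0 = (1 / norm W) *R W"
 have E0S: "E0 : S1" using W(1) W0 by (auto simp: E0_def S1_def rat_vec_def layer_scale)
 have "E0 - W = ((1 - norm W) / norm W) *R W" using W0 by (simp add: E0_def diff_divide_distrib scaleR_diff_left)
 hence "norm (E0 - W) = abs (norm W - 1)" using W0 by (simp add: abs_minus_commute)
 hence "norm (E0 - E1) < 2 * nu" using W(2) W1 norm_triangle_ineq[of "E0 - W" "W - E1"] by simp
 hence E0b: "dist Ec E0 < rho" using nu dist_triangle[of Ec E0 E1] by (simp add: dist_norm norm_minus_commute)
 define rho' where "rho' = rho - dist Ec E0"
 have rho': "rho' > 0" using E0b by (simp add: rho'_def)
 \<comment> \<open>A large initial gradient keeps the direction within \<open>rho'\<close> of \<open>E0\<close>, hence in the ball.\<close>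
 define M where "M = max (2 * L + 1) (4 * (2 * L + 1) / rho'^2)"
 have M: "M >= 2 * L + 1" "M >= 4 * (2 * L + 1) / rho'^2" by (auto simp: M_def)
 have Mrho: "2 * (2 * L + 1) / M < rho'^2"
 proof -
  have M0: "M > 0" using M(1) L by linarith
  have "4 * (2 * L + 1) <= M * rho'^2" using M(2) rho' by (simp add: pos_divide_le_eq)
  hence "2 * (2 * L + 1) < rho'^2 * M" using L by (simp add: mult.commute)
  thus ?thesis using M0 by (simp add: pos_divide_less_eq)
 qed
 have "EX t0. (%t. f (t *R E0)) differentiable at t0"
 proof -
  have "abs (f (a *R E0) - f (b *R E0)) <= L * abs (a - b)" for a b using lip[of "0 ** (a *R E0)" "0 ** (b *R E0)"] E0S d_line[of E0 0 a b]
   by (simp add: S1_def left_unit abs_minus_commute)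
  hence "negligible {t. ~ (%t. f (t *R E0)) differentiable at t}" by (rule lipschitz_differentiable_ae)
  thus ?thesis using non_negligible_UNIV[where 'a = real] by (metis (mono_tags, lifting) UNIV_eq_I mem_Collect_eq)
 qed
 then obtain t0 v0 where v0: "((%t. f (t *R E0)) has_real_derivative v0) (at t0)" using real_differentiable_def by blast
 define x0 where "x0 = t0 *R E0"
 have "x0 = 0 ** ((t0 / norm W) *R W)" by (simp add: x0_def E0_def left_unit)
 hence "x0 : rat_lines" unfolding rat_lines_def using zero_rat_pts W(1) by blast
 hence x0N: "x0 : N" using N(1) by blast
 have dd0: "dir_deriv f x0 E0 v0" using v0 DERIV_shift[of "%t. f (t *R E0)" v0 0 t0] by (simp add: dir_deriv_def x0_def exp_coords add.commute)
 define Lam where "Lam = L + (M + 2)"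
 have Lam: "Lam > 0" using L M(1) by (simp add: Lam_def)
 define bt where "bt = 1 / (4 * real (s^2))"
 have bt: "bt > 0" using step_pos by (simp add: bt_def)
 \<comment> \<open>The summand \<open>u\<close> gives \<open>a + omega b <= omega (a + b)\<close>; the others are the increments allowed on a detour.\<close>
 define omega where "omega u = u + (120 * sqrt (6 * Lam * u) + 4 * u powr bt)" for u
 have omega1: "a + omega b <= omega (a + b)" if "0 <= a" "0 <= b" for a b
 proof -
  have "sqrt (6 * Lam * b) <= sqrt (6 * Lam * (a + b))" using that Lam by simp
  moreover have "b powr bt <= (a + b) powr bt" using that bt by (intro powr_mono2) auto
  ultimately show ?thesis unfolding omega_def by linarith
 qed
 have omega2: "omega 0 = 0" by (simp add: omega_def)
 have omega3: "continuous_on {0..} omega" unfolding omega_def using bt by (intro continuous_intros continuous_on_powr') auto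
 have "EX x E v e. x : N & E : S1 & dir_deriv f x E v & norm e <= M + 2 & (norm (E - E0))^2 <= 2 * (2 * L + 1) / M & 0 <= v + e *. E &
  (ALL eps>0. EX delta>0. nearly_maximal f N omega x E e (v + e *. E) delta eps)"
  by (rule variational_principle[OF lip L _ omega2 omega3 _ N(2) E0S x0N dd0 M(1)]) (erule (1) omega1, erule U)
 then obtain x E v e where xE: "x : N" "E : S1" "dir_deriv f x E v" "norm e <= M + 2" "(norm (E - E0))^2 <= 2 * (2 * L + 1) / M"
  "0 <= v + e *. E" and max: "ALL eps>0. EX delta>0. nearly_maximal f N omega x E e (v + e *. E) delta eps" by (elim exE conjE)
 have "(norm (E - E0))^2 < rho'^2" using xE(5) Mrho by linarith
 hence "norm (E - E0) < rho'" using rho' by (simp add: power2_less_imp_less)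
 hence "E : ball Ec rho" using dist_triangle[of Ec E E0] by (simp add: rho'_def dist_norm norm_minus_commute)
 hence D: "deformable_with E C n DeltaB" using ball xE(2) by (simp add: S1_def)
 have El: "E : layer 1" using xE(2) by (simp add: S1_def)
 define h where "h = (%y. f y + e *. p y)"
 have hlip: "abs (h a - h b) <= Lam * d a b" for a b
 proof -
  have "abs (e *. (p a - p b)) <= norm e * norm (p a - p b)" by (rule Cauchy_Schwarz_ineq2)
  also have "... <= (M + 2) * d a b" using xE(4) norm_p_diff_le[of b a] order_trans[OF norm_ge_zero xE(4)] by (intro mult_mono) (simp_all add: norm_minus_commute d_sym)
  finally have "abs (e *. p a - e *. p b) <= (M + 2) * d a b" by (simp add: inner_diff_right)
  thus ?thesis using lip[of a b] by (simp add: h_def Lam_def distrib_right)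
 qed
 have hx: "dir_deriv h x E (v + e *. E)" using xE(3) El by (simp add: h_def dir_deriv_add_linear)
 have om: "120 * sqrt (6 * Lam * u) + 4 * u powr (1 / (4 * s^2)) <= omega u" if "u >= 0" for u using that by (simp add: omega_def bt_def)
 have hmax: "EX delta>0. ALL y F w. y : rat_lines --> F : S1 --> dir_deriv h y F w --> d x y < delta --> v + e *. E <= w -->
    osc h E x y (omega (w - (v + e *. E))) --> w <= v + e *. E + eps" if eps: "eps > 0" for eps
 proof -
  obtain delta where delta: "delta > 0" "nearly_maximal f N omega x E e (v + e *. E) delta eps" using max eps by (elim allE[of _ eps] impE exE conjE) auto
  have "w <= v + e *. E + eps" if "y : rat_lines" "F : S1" "dir_deriv h y F w" "d x y < delta" "v + e *. E <= w"
    "osc h E x y (omega (w - (v + e *. E)))" for y F w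
   using delta(2)[rule_format, of y F "w - e *. F"] that N(1) El by (auto simp: h_def dir_deriv_add_linear osc_add_linear S1_def)
  thus ?thesis using delta(1) by blast
 qed
 have "pansu_differentiable_at f x"
 proof (rule pansu_differentiable_if_estimate[OF El, of f x e "v + e *. E"])
  fix eps :: real assume "eps > 0"
  from almost_maximal_estimate[OF hlip Lam hx xE(6) D om hmax this]
  show "EX r>0. ALL z. 0 < d 0 z --> d 0 z < r -->
   abs ((f (x ** z) + e *. p (x ** z)) - (f x + e *. p x) - (v + e *. E) * (z *. E)) <= eps * d 0 z" by (simp add: h_def)
 qed
 thus "EX x:N. pansu_differentiable_at f x" using xE(1) by blast
qed

section \<open>A set of dimension one\<close>

definition dball :: "'a => real => 'a set" where
 "dball c r = {y. d c y < r}"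

lemma open_dball: "open (dball c r)" unfolding open_contains_ball
proof
 fix y assume y: "y : dball c r"
 define e where "e = r - d c y"
 have e: "e > 0" using y by (simp add: e_def dball_def)
 have s1: "real s >= 1" using step_pos by simp
 obtain K where K: "K > 0" "ALL x z. norm x <= norm y + 1 --> norm z <= norm y + 1 --> d x z <= K * norm (x - z) powr (1 / s)" using d_le_norm_diff by blast
 define delta where "delta = min 1 ((e / (2 * K)) powr s)"
 have "z : dball c r" if z: "z : ball y delta" for z
 proof -
  have "norm z <= norm y + 1" using z norm_triangle_ineq[of y "z - y"] by (simp add: delta_def dist_norm norm_minus_commute)
  hence "d y z <= K * norm (y - z) powr (1 / s)" using K(2) by simp
  also have "... <= K * ((e / (2 * K)) powr s) powr (1 / s)" using z K(1) by (intro mult_left_mono powr_mono2) (auto simp: delta_def dist_norm)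
  also have "... < e" using s1 e K(1) by (simp add: powr_powr)
  finally show ?thesis using d_triangle[of c z y] by (simp add: dball_def e_def)
 qed
 moreover have "delta > 0" using e K(1) by (simp add: delta_def)
 ultimately show "EX e>0. ball y e <= dball c r" by blast
qed

text \<open>A segment is covered by \<open>k\<close> balls of radius \<open>A / k\<close>, and \<open>k * (A / k) powr (1 + eps)\<close> tends to \<open>0\<close>.\<close>

lemma rat_lines_cover:
 assumes eps: "eps > 0"
 shows "EX c (k :: nat => nat) r. (ALL i. 0 < r i & r i <= eps & real (k i) * r i powr (1 + eps) <= eps * (1 / 2) ^ Suc i) &
   rat_lines <= (UN i. UN b<k i. dball (c i b) (r i))"
proof -
 define T where "T = rat_pts \<times> rat_vec \<times> (UNIV :: int set)"
 have "0 : rat_vec" by (simp add: rat_vec_def layer_def span_zero)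
 hence T: "countable T" "T ~= {}" unfolding T_def using countable_rat_pts countable_rat_vec zero_rat_pts by (auto intro!: countable_SIGMA)
 have count: "EX k>0. A / real k <= eps & real k * (A / real k) powr (1 + eps) <= e" if A: "A > 0" and e: "e > 0" for A e
 proof -
  define M where "M = max (A / eps) ((A powr (1 + eps) / e) powr (1 / eps))"
  obtain k where k: "real k > M" using reals_Archimedean2 by blast
  have "M > 0" using A eps by (simp add: M_def less_max_iff_disj)
  hence k0: "real k > 0" using k by linarith
  have "A / eps < real k" using k by (simp add: M_def)
  hence 1: "A / real k <= eps" using k0 eps by (simp add: field_simps)
  have "A powr (1 + eps) / e = ((A powr (1 + eps) / e) powr (1 / eps)) powr eps" using eps A e by (simp add: powr_powr)
  also have "... <= real k powr eps" using k eps by (intro powr_mono2) (auto simp: M_def)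
  finally have 2: "A powr (1 + eps) <= e * real k powr eps" using e by (simp add: field_simps)
  have "real k * (A / real k) powr (1 + eps) = A powr (1 + eps) / real k powr eps" using k0 A by (simp add: powr_divide powr_add)
  also have "... <= e" using 2 k0 by (simp add: field_simps)
  finally show ?thesis using 1 k0 by (intro exI[of _ k]) auto
 qed
 define seg where "seg = from_nat_into T"
 have seg: "range seg = T" using T by (simp add: seg_def range_from_nat_into)
 define W where "W i = fst (snd (seg i))" for i
 have "ALL i. EX k>0. (norm (W i) + 1) / real k <= eps & real k * ((norm (W i) + 1) / real k) powr (1 + eps) <= eps * (1 / 2) ^ Suc i"
  using eps by (intro allI count) (auto simp: add_nonneg_pos)
 then obtain k where k: "ALL i. k i > 0 & (norm (W i) + 1) / real (k i) <= eps & real (k i) * ((norm (W i) + 1) / real (k i)) powr (1 + eps) <= eps * (1 / 2) ^ Suc i" by metis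
 define r where "r i = (norm (W i) + 1) / real (k i)" for i
 define c where "c i b = fst (seg i) ** ((of_int (snd (snd (seg i))) + real b / real (k i)) *R W i)" for i b
 have "rat_lines <= (UN i. UN b<k i. dball (c i b) (r i))"
 proof
  fix y assume "y : rat_lines"
  then obtain q V t where y: "q : rat_pts" "V : rat_vec" "y = q ** (t *R V)" unfolding rat_lines_def by blast
  have "(q, V, \<lfloor>t\<rfloor>) : range seg" unfolding seg using y by (simp add: T_def)
  then obtain i where i: "seg i = (q, V, \<lfloor>t\<rfloor>)" by (metis imageE)
  have k0: "real (k i) > 0" using k by simp
  define b where "b = nat \<lfloor>frac t * real (k i)\<rfloor>"
  have fr: "0 <= frac t" "frac t < 1" by (simp_all add: frac_lt_1)
  have b: "real b <= frac t * real (k i)" "frac t * real (k i) < real b + 1" using fr k0 by (auto simp: b_def)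
  hence "real b < real (k i)" using mult_strict_right_mono[OF fr(2) k0] by simp
  hence bk: "b < k i" by simp
  have "abs (frac t - real b / real (k i)) <= 1 / real (k i)" 
  proof -
   have "real b / real (k i) <= frac t" "frac t < real b / real (k i) + 1 / real (k i)"
    using b k0 by (simp_all add: pos_divide_le_eq pos_less_divide_eq add_divide_distrib[symmetric])
   thus ?thesis by linarith
  qed
  hence "abs (t - (of_int \<lfloor>t\<rfloor> + real b / real (k i))) <= 1 / real (k i)" by (simp add: frac_def algebra_simps)
  hence "abs (t - (of_int \<lfloor>t\<rfloor> + real b / real (k i))) * norm V <= 1 / real (k i) * norm V" by (rule mult_right_mono) simp
  also have "... < r i" using k0 by (simp add: r_def W_def i divide_strict_right_mono)
  finally have "abs (t - (of_int \<lfloor>t\<rfloor> + real b / real (k i))) * norm V < r i" .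
  hence "d (c i b) y < r i"
  proof -
   have Vl: "V : layer 1" using y(2) by (simp add: rat_vec_def)
   assume "abs (t - (of_int \<lfloor>t\<rfloor> + real b / real (k i))) * norm V < r i"
   thus ?thesis unfolding c_def y(3) W_def i fst_conv snd_conv d_line[OF Vl] .
  qed
  thus "y : (UN i. UN b<k i. dball (c i b) (r i))" using bk by (auto simp: dball_def)
 qed
 moreover have "0 < r i" for i using k by (auto simp: r_def intro!: divide_pos_pos add_nonneg_pos)
 ultimately show ?thesis using k by (intro exI[of _ c] exI[of _ k] exI[of _ r]) (simp add: r_def)
qed

lemma suminf_half: "(\<Sum>i. ennreal (A * (1 / 2) ^ Suc i)) = ennreal A" if "A >= 0"
 using that by (intro sums_unique[symmetric] sums_ennreal[THEN iffD2]) (auto intro!: sums_mult[OF power_half_series, of A, simplified])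

text \<open>A countable family of finite families of balls, rearranged to a sequence of sets.\<close>

lemma ball_family_sequence:
 fixes c :: "nat => nat => 'a" and k :: "nat => nat" and r :: "nat => real" and phi :: "'a set => ennreal"
 assumes phi: "phi {} = 0" "!!i b. phi (dball (c i b) (r i)) <= ennreal (C * r i powr bt)" and C: "C >= 0" and A: "A >= 0"
  and r: "!!i. real (k i) * r i powr bt <= A * (1 / 2) ^ Suc i"
 shows "EX V :: nat => 'a set. (UN i. UN b<k i. dball (c i b) (r i)) = (UN n. V n) &
   (ALL n. V n = {} | (EX i b. V n = dball (c i b) (r i))) & (\<Sum>n. phi (V n)) <= ennreal (C * A)"
proof -
 define W where "W = (%(i, b). if b < k i then dball (c i b) (r i) else {})"
 have "(\<Sum>n. phi (W (prod_decode n))) = (\<Sum>i. \<Sum>b. phi (W (i, b)))" by (rule suminf_ennreal_2dimen[of "%i. \<Sum>b. phi (W (i, b))" "%x. phi (W x)"]) simp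
 also have "... <= (\<Sum>i. ennreal ((C * A) * (1 / 2) ^ Suc i))"
 proof (rule suminf_le[OF _ summableI summableI])
  fix i
  have "(\<Sum>b. phi (W (i, b))) = (SUM b<k i. phi (W (i, b)))" by (rule suminf_finite) (auto simp: W_def phi(1))
  also have "... <= (SUM b<k i. ennreal (C * r i powr bt))" by (intro sum_mono) (auto simp: W_def phi)
  also have "... = ennreal (C * (real (k i) * r i powr bt))" using C by (simp add: ennreal_of_nat_eq_real_of_nat ennreal_mult[symmetric] mult_ac)
  also have "... <= ennreal ((C * A) * (1 / 2) ^ Suc i)" using mult_left_mono[OF r C] by (intro ennreal_leI) (simp add: mult.assoc)
  finally show "(\<Sum>b. phi (W (i, b))) <= ennreal ((C * A) * (1 / 2) ^ Suc i)" .
 qed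
 also have "... = ennreal (C * A)" using C A by (intro suminf_half) simp
 finally have 1: "(\<Sum>n. phi (W (prod_decode n))) <= ennreal (C * A)" .
 have "(UN n. W (prod_decode n)) = (UN x. W x)" using surj_prod_decode by (metis image_image)
 also have "... = (UN i. UN b. W (i, b))" by auto
 also have "... = (UN i. UN b<k i. dball (c i b) (r i))"
 proof -
  have "(UN b. W (i, b)) = (UN b<k i. dball (c i b) (r i))" for i by (auto simp: W_def split: if_splits)
  thus ?thesis by simp
 qed
 finally show ?thesis using 1 by (intro exI[of _ "%n. W (prod_decode n)"]) (auto simp: W_def split: prod.split)
qed

lemma ediam_dball: "ediam d (dball c r) <= ennreal (2 * r)" unfolding ediam_def dball_def
proof (intro SUP_least ennreal_leI)
 fix x y assume "x : {y. d c y < r}" "y : {y. d c y < r}"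
 thus "d x y <= 2 * r" using d_triangle[of x y c] d_sym[of c x] by auto
qed

lemma Hausdorff_measure_zero:
 assumes cover: "!!eps. 0 < eps ==> eps <= 1 ==> EX c (k :: nat => nat) r kappa. 0 < kappa & kappa <= eps &
   (ALL i. 0 < r i & r i <= kappa & real (k i) * r i powr (1 + kappa) <= kappa * (1 / 2) ^ Suc i) & N <= (UN i. UN b<k i. dball (c i b) (r i))"
  and alpha: "alpha > 1"
 shows "Hausdorff_measure d alpha N = 0"
proof -
 have "Hausdorff_premeasure d alpha delta N <= 0" if delta: "delta > 0" for delta
 proof (rule ennreal_le_epsilon)
  fix e :: real assume e: "e > 0"
  define eps where "eps = min (min 1 (alpha - 1)) (min (delta / 2) (e / 2 powr alpha))"
  have eps: "0 < eps" "eps <= 1" "eps <= alpha - 1" "eps <= e / 2 powr alpha" using alpha delta e by (auto simp: eps_def)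
  have epsdelta: "eps <= delta / 2" unfolding eps_def by (rule min.coboundedI2, rule min.cobounded1)
  obtain c k r kappa where c: "0 < kappa" "kappa <= eps" "ALL i. 0 < r i & r i <= kappa & real (k i :: nat) * r i powr (1 + kappa) <= kappa * (1 / 2) ^ Suc i"
   "N <= (UN i. UN b<k i. dball (c i b) (r i))" using cover[OF eps(1,2)] by (elim exE conjE)
  define phi where "phi U = ennreal (enn2real (ediam d U) powr alpha)" for U
  have "EX V :: nat => 'a set. (UN i. UN b<k i. dball (c i b) (r i)) = (UN n. V n) &
   (ALL n. V n = {} | (EX i b. V n = dball (c i b) (r i))) & (\<Sum>n. phi (V n)) <= ennreal (2 powr alpha * kappa)"
  proof (rule ball_family_sequence[where bt = "1 + kappa"])
   show "phi {} = 0" by (simp add: phi_def ediam_def bot_ennreal)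
   fix i b
   have r: "0 < r i" "r i <= 1" using c(3)[rule_format, of i] c(2) eps(2) by auto
   have "enn2real (ediam d (dball (c i b) (r i))) <= 2 * r i" using ediam_dball r by (intro enn2real_leI) auto
   hence "enn2real (ediam d (dball (c i b) (r i))) powr alpha <= (2 * r i) powr alpha" using alpha by (intro powr_mono2) auto
   also have "... = 2 powr alpha * r i powr alpha" using r by (simp add: powr_mult)
   also have "... <= 2 powr alpha * r i powr (1 + kappa)" using r c(2) eps(3) by (intro mult_left_mono powr_mono') auto
   finally show "phi (dball (c i b) (r i)) <= ennreal (2 powr alpha * r i powr (1 + kappa))" unfolding phi_def by (rule ennreal_leI)
  qed (use c in auto)
  then obtain V :: "nat => 'a set" where V: "(UN i. UN b<k i. dball (c i b) (r i)) = (UN n. V n)"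
   "ALL n. V n = {} | (EX i b. V n = dball (c i b) (r i))" "(\<Sum>n. phi (V n)) <= ennreal (2 powr alpha * kappa)" by (elim exE conjE)
  have "ediam d (V n) <= ennreal delta" for n
  proof (cases "V n = {}")
   case False
   then obtain i b where "V n = dball (c i b) (r i)" using V(2) by blast
   moreover have "2 * r i <= delta" using c(3)[rule_format, of i] c(2) epsdelta by linarith
   ultimately show ?thesis using ediam_dball[of "c i b" "r i"] ennreal_leI order_trans by metis
  qed (simp add: ediam_def bot_ennreal)
  hence "Hausdorff_premeasure d alpha delta N <= (\<Sum>n. phi (V n))" unfolding Hausdorff_premeasure_def phi_def using c(4) V(1) by (intro INF_lower) auto
  also have "... <= ennreal (2 powr alpha * kappa)" by (rule V(3))
  also have "... <= ennreal e"
  proof (rule ennreal_leI)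
   have "kappa <= e / 2 powr alpha" using c(2) eps(4) by linarith
   thus "2 powr alpha * kappa <= e" by (simp add: pos_le_divide_eq mult.commute)
  qed
  finally show "Hausdorff_premeasure d alpha delta N <= 0 + ennreal e" by simp
 qed
 thus ?thesis unfolding Hausdorff_measure_def by (intro antisym SUP_least) auto
qed

text \<open>The projection to a horizontal line does not increase distances, so a set containing a segment of this line is at least one-dimensional.\<close>

lemma Hausdorff_measure_nonzero:
 assumes W: "W : layer 1" "W ~= 0" and N: "!!t. t *R W : N" and alpha: "0 < alpha" "alpha < 1"
 shows "Hausdorff_measure d alpha N ~= 0"
proof -
 define phi where "phi x = p x *. W / norm W" for x
 have phi: "abs (phi x - phi y) <= d x y" for x y
 proof -
  have "abs ((p y - p x) *. W) <= d x y * norm W" using Cauchy_Schwarz_ineq2[of "p y - p x" W] mult_right_mono[OF norm_p_diff_le[of y x], of "norm W"] by simp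
  thus ?thesis using W(2) by (simp add: phi_def inner_diff_left diff_divide_distrib[symmetric] abs_minus_commute divide_le_eq)
 qed
 have "1 <= Hausdorff_premeasure d alpha 1 N" unfolding Hausdorff_premeasure_def
 proof (rule INF_greatest)
  fix U :: "nat => 'a set" assume "U : {U. N <= (UN i. U i) & (ALL i. ediam d (U i) <= ennreal 1)}"
  hence U: "N <= (UN i. U i)" "!!i. ediam d (U i) <= ennreal 1" by auto
  define D where "D i = enn2real (ediam d (U i))" for i
  have D: "0 <= D i" "D i <= 1" for i using U(2) by (auto simp: D_def intro: enn2real_leI)
  have dD: "d x y <= D i" if "x : U i" "y : U i" for x y i
  proof -
   have "ennreal (d x y) <= ediam d (U i)" unfolding ediam_def using that by (meson SUP_upper2 order_refl)
   moreover have "ediam d (U i) = ennreal (D i)" unfolding D_def by (rule ennreal_enn2real[symmetric], rule order_le_less_trans[OF U(2) ennreal_less_top])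
   ultimately show ?thesis using D(1) by (simp add: ennreal_le_iff)
  qed
  define a where "a i = phi (SOME x. x : U i)" for i
  define J where "J i = (if U i = {} then {} else {a i - D i .. a i + D i})" for i
  have inJ: "phi x : J i" if "x : U i" for x i using dD[OF that someI[of "%x. x : U i", OF that]] phi[of x "SOME x. x : U i"] that by (auto simp: J_def a_def abs_le_iff)
  have "{0..2} <= (UN i. J i)"
  proof
   fix t :: real assume "t : {0..2}"
   define x where "x = (t / norm W) *R W"
   obtain i where "x : U i" using N U(1) by (auto simp: x_def)
   moreover have "phi x = t" using W by (simp add: phi_def x_def p_layer1 layer_scale power2_norm_eq_inner[symmetric] power2_eq_square)
   ultimately show "t : (UN i. J i)" using inJ by blast
  qed
  hence "emeasure lborel {0..2::real} <= emeasure lborel (UN i. J i)" by (intro emeasure_mono) (auto simp: J_def)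
  also have "... <= (\<Sum>i. emeasure lborel (J i))" by (rule emeasure_subadditive_countably) (auto simp: J_def)
  also have "... <= (\<Sum>i. 2 * ennreal (D i powr alpha))"
  proof (rule suminf_le[OF _ summableI summableI])
   fix i
   have "D i <= D i powr alpha" using powr_mono'[of alpha 1 "D i"] D[of i] alpha by (cases "D i = 0") auto
   hence "ennreal (2 * D i) <= ennreal (2 * D i powr alpha)" by (intro ennreal_leI) simp
   thus "emeasure lborel (J i) <= 2 * ennreal (D i powr alpha)" using D[of i] by (auto simp: J_def ennreal_mult)
  qed
  finally have "2 * 1 <= 2 * (\<Sum>i. ennreal (D i powr alpha))" by simp
  hence "1 <= (\<Sum>i. ennreal (D i powr alpha))" by (subst (asm) ennreal_mult_le_mult_iff) auto
  thus "1 <= (\<Sum>i. ennreal (enn2real (ediam d (U i)) powr alpha))" by (simp add: D_def)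
 qed
 also have "... <= Hausdorff_measure d alpha N" unfolding Hausdorff_measure_def by (rule SUP_upper) simp
 finally show ?thesis by auto
qed

lemma Hausdorff_dim_one:
 assumes "!!alpha. alpha > 1 ==> Hausdorff_measure d' alpha N = 0" "!!alpha. 0 < alpha ==> alpha < 1 ==> Hausdorff_measure d' alpha N ~= 0"
 shows "Hausdorff_dim d' N = 1"
proof (rule antisym)
 show "Hausdorff_dim d' N <= 1"
 proof (rule ereal_le_epsilon2)
  fix e :: real assume "0 < e"
  hence "Hausdorff_dim d' N <= ereal (1 + e)" unfolding Hausdorff_dim_def by (intro INF_lower) (simp add: assms(1))
  thus "Hausdorff_dim d' N <= 1 + ereal e" by (simp add: one_ereal_def)
 qed
 show "1 <= Hausdorff_dim d' N" unfolding Hausdorff_dim_def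
 proof (rule INF_greatest)
  fix alpha assume "alpha : {alpha. 0 < alpha & Hausdorff_measure d' alpha N = 0}"
  thus "1 <= ereal alpha" using assms(2)[of alpha] by (cases "alpha < 1") auto
 qed
qed

lemma rank_ge_2:
 assumes "DIM('a) ~= 1"
 shows "EX b1:B 1. EX b2:B 1. b1 ~= b2"
proof (rule ccontr)
 assume "~ ?thesis"
 hence one: "!!b c. b : B 1 ==> c : B 1 ==> b = c" by blast
 have br0: "br v w = 0" if vw: "v : span (B 1)" "w : span (B 1)" for v w
 proof (cases "B 1 = {}")
  case True
  thus ?thesis using vw linear_0[OF linear_br2] by simp
 next
  case False
  then obtain b where "b : B 1" by blast
  hence "B 1 = {b}" using one by blast
  then obtain x y where "v = x *R b" "w = y *R b" using vw by (auto simp: span_singleton)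
  moreover have "2 *R br b b = 0" using br_antisym[of b b] by (simp add: scaleR_2 eq_neg_iff_add_eq_0)
  ultimately show ?thesis by (simp add: linear_scale[OF linear_br1] linear_scale[OF linear_br2])
 qed
 have empty: "B i = {}" if i: "i : {2..s}" for i using i
 proof (induction i rule: less_induct)
  case (less i)
  have "lie_bracket (**) v w = 0" if "v : span (B 1)" "w : span (B (i - 1))" for v w
  proof (cases "i = 2")
   case False
   hence "B (i - 1) = {}" using less by auto
   thus ?thesis using that linear_0[OF linear_br2] by simp
  qed (use br0 that in simp)
  hence "{lie_bracket (**) v w |v w. v : span (B 1) & w : span (B (i - 1))} <= {0}" by auto
  hence "span (B i) <= {0}" unfolding layers_generated[OF less.prems] by (rule subset_trans[OF span_mono]) simp
  hence "B i <= {0}" using span_superset[of "B i"] by blast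
  moreover have "0 ~: B i" using B_Basis[of i] less.prems by auto
  ultimately show ?case by blast
 qed
 have sub: "Basis <= B 1"
 proof
  fix b :: 'a assume "b : Basis"
  then obtain i where i: "i : {1..s}" "b : B i" using B_ex by blast
  hence "i = 1" using empty[of i] by (cases "i = 1") auto
  thus "b : B 1" using i by simp
 qed
 obtain b :: 'a where b: "b : Basis" using nonempty_Basis by blast
 hence "(Basis :: 'a set) = {b}" using sub one by blast
 hence "DIM('a) = card {b}" by (rule arg_cong)
 thus False using assms by simp
qed

text \<open>
  Disjoint translates of a ball of radius \<open>r\<close>, with centres projecting to a grid in a horizontal plane,
  fit into a fixed ball; there are at least about \<open>1/r\<^sup>2\<close> of them.
\<close>

lemma haar_dball:
 assumes H: "haar_measure mu" and dim: "DIM('a) ~= 1"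
 shows "EX C>=0. ALL c r. 0 < r --> r <= 1 / 6 --> emeasure mu (dball c r) <= ennreal (C * r powr 2)"
proof -
 have sets: "sets mu = sets borel" and inv: "!!g A. A : sets borel ==> emeasure mu ((%x. g ** x) ` A) = emeasure mu A"
  and fin: "!!K. compact K ==> emeasure mu K < \<infinity>" using H by (auto simp: haar_measure_def)
 have bm: "dball c r : sets borel" for c r by (rule borel_open[OF open_dball])
 have dm: "dball c r : sets mu" for c r using bm sets by simp
 have trans: "(%x. g ** x) ` dball c r = dball (g ** c) r" for g c r
 proof
  show "dball (g ** c) r <= (%x. g ** x) ` dball c r"
  proof
   fix y assume y: "y : dball (g ** c) r"
   have "y = g ** ((- g) ** y)" by (simp add: inv_cancel)
   moreover have "d c ((- g) ** y) = d (g ** c) y" using d_mult_left[of g c "(- g) ** y"] by (simp add: inv_cancel)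
   ultimately show "y : (%x. g ** x) ` dball c r" using y unfolding dball_def by (metis (mono_tags, lifting) image_eqI mem_Collect_eq)
  qed
 qed (auto simp: dball_def)
 have eq: "emeasure mu (dball c r) = emeasure mu (dball 0 r)" for c r using inv[OF bm, of c 0 r] by (simp add: trans right_unit)
 obtain K where K: "ALL z. d 0 z <= 3 --> norm z <= K * d 0 z" "K > 0" using norm_le_d by blast
 have "dball 0 3 <= cball 0 (3 * K)"
 proof
  fix z assume "z : dball 0 3"
  hence "d 0 z <= 3" by (simp add: dball_def)
  hence "norm z <= K * d 0 z" "K * d 0 z <= K * 3" using K by auto
  thus "z : cball 0 (3 * K)" by simp
 qed
 hence "emeasure mu (dball 0 3) <= emeasure mu (cball 0 (3 * K))" by (intro emeasure_mono) (simp_all add: sets)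
 also have "... < \<infinity>" by (rule fin) simp
 finally obtain A where A: "A >= 0" "emeasure mu (dball 0 3) = ennreal A" by (cases "emeasure mu (dball 0 3)") auto
 obtain b1 b2 where b: "b1 : B 1" "b2 : B 1" "b1 ~= b2" using rank_ge_2[OF dim] by blast
 have bB: "b1 : Basis" "b2 : Basis" using b B_Basis[OF one_in] by auto
 have bl: "b1 : layer 1" "b2 : layer 1" using b by (auto simp: layer_def span_base)
 have "emeasure mu (dball c r) <= ennreal (36 * A * r powr 2)" if r: "0 < r" "r <= 1 / 6" for c r
 proof -
  define n where "n = nat \<lfloor>1 / (3 * r)\<rfloor>"
  have n: "real n <= 1 / (3 * r)" "1 / (3 * r) < real n + 1" using r by (simp_all add: n_def)
  have "1 / (3 * r) >= 2" using r by (simp add: field_simps)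
  hence n6: "1 / (6 * r) <= real n" using n by simp
  define g where "g = (%(i, j). ((3 * r * real i) *R b1) ** ((3 * r * real j) *R b2))"
  define I where "I = {..<n} \<times> {..<n}"
  have pg: "p (g (i, j)) = (3 * r * real i) *R b1 + (3 * r * real j) *R b2" for i j using bl by (simp add: g_def p_mult p_layer1 layer_scale)
  have le1: "3 * r * real i <= 1" if "i < n" for i
  proof -
   have "real i <= 1 / (3 * r)" using that n(1) by linarith
   thus ?thesis using r by (simp add: field_simps)
  qed
  have sub: "dball (g x) r <= dball 0 3" if "x : I" for x
  proof
   fix y assume y: "y : dball (g x) r"
   obtain i j where x: "x = (i, j)" by fastforce
   have ij: "i < n" "j < n" using that by (auto simp: I_def x)
   have "d 0 (g x) <= d 0 ((3 * r * real i) *R b1) + d 0 ((3 * r * real j) *R b2)" unfolding g_def x prod.case by (rule d_mult_le)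
   also have "... = 3 * r * real i + 3 * r * real j" using bl bB r by (simp add: d_layer1 layer_scale)
   also have "... <= 2" using le1[OF ij(1)] le1[OF ij(2)] by simp
   finally show "y : dball 0 3" using d_triangle[of 0 y "g x"] y r by (simp add: dball_def)
  qed
  have disj: "disjoint_family_on (%x. dball (g x) r) I" unfolding disjoint_family_on_def
  proof (intro ballI impI)
   fix x y assume xy: "x : I" "y : I" "x ~= y"
   obtain i j i' j' where ij: "x = (i, j)" "y = (i', j')" by fastforce
   have sep: "3 * r <= abs (3 * r * real a - 3 * r * real a')" if "a ~= a'" for a a' :: nat
   proof -
    have "1 <= abs (real a - real a')" using that by linarith
    hence "3 * r * 1 <= 3 * r * abs (real a - real a')" using r by (intro mult_left_mono) auto
    thus ?thesis using r by (simp add: abs_mult right_diff_distrib[symmetric])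
   qed
   have big: "3 * r <= norm (p (g y) - p (g x))"
   proof (cases "i = i'")
    case False
    have "abs ((p (g y) - p (g x)) *. b1) <= norm (p (g y) - p (g x))" using Basis_le_norm[OF bB(1)] by simp
    thus ?thesis using sep[of i' i] False b(3) bB by (simp add: ij pg inner_diff_left inner_add_left inner_Basis)
   next
    case True
    hence "j ~= j'" using xy ij by auto
    have "abs ((p (g y) - p (g x)) *. b2) <= norm (p (g y) - p (g x))" using Basis_le_norm[OF bB(2)] by simp
    thus ?thesis using sep[of j' j] \<open>j ~= j'\<close> b(3) bB by (simp add: ij pg inner_diff_left inner_add_left inner_Basis)
   qed
   show "dball (g x) r Int dball (g y) r = {}"
   proof (rule ccontr)
    assume "dball (g x) r Int dball (g y) r ~= {}"
    then obtain w where "d (g x) w < r" "d (g y) w < r" by (auto simp: dball_def)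
    hence "d (g x) (g y) < 2 * r" using d_triangle[of "g x" "g y" w] d_sym[of w "g y"] by linarith
    thus False using norm_p_diff_le[of "g y" "g x"] big r by linarith
   qed
  qed
  have finI: "finite I" "card I = n * n" by (simp_all add: I_def)
  have "of_nat (n * n) * emeasure mu (dball 0 r) = (SUM x:I. emeasure mu (dball 0 r))" using finI by simp
  also have "... = (SUM x:I. emeasure mu (dball (g x) r))" by (intro sum.cong refl eq[symmetric])
  also have "... = emeasure mu (UN x:I. dball (g x) r)" by (rule sum_emeasure[OF _ disj finI(1)]) (use dm in auto)
  also have "... <= emeasure mu (dball 0 3)" using sub dm by (intro emeasure_mono) auto
  finally have main: "of_nat (n * n) * emeasure mu (dball 0 r) <= ennreal A" by (simp add: A)
  have "emeasure mu (dball 0 r) <= emeasure mu (dball 0 3)" using r dm by (intro emeasure_mono) (auto simp: dball_def)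
  hence "emeasure mu (dball 0 r) < \<infinity>" using A by (simp add: order_le_less_trans)
  then obtain a where a: "a >= 0" "emeasure mu (dball 0 r) = ennreal a" by (cases "emeasure mu (dball 0 r)") auto
  have "ennreal (real n * real n * a) <= ennreal A" using main a by (simp add: ennreal_of_nat_eq_real_of_nat ennreal_mult[symmetric] flip: of_nat_mult)
  hence nA: "real n * real n * a <= A" using A(1) a by simp
  have "(1 / (6 * r)) * (1 / (6 * r)) * a <= real n * real n * a" using n6 a(1) r by (intro mult_right_mono mult_mono) auto
  hence "(1 / (6 * r)) * (1 / (6 * r)) * a <= A" using nA by linarith
  hence "a <= 36 * A * r powr 2" 
  proof -
   assume A': "(1 / (6 * r)) * (1 / (6 * r)) * a <= A"
   have "a = 36 * r^2 * ((1 / (6 * r)) * (1 / (6 * r)) * a)" using r by (simp add: power2_eq_square)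
   also have "... <= 36 * r^2 * A" using A' by (rule mult_left_mono) simp
   finally show ?thesis using r by (simp add: powr_numeral mult_ac)
  qed
  thus ?thesis using a(2) eq[of c r] by (simp add: ennreal_leI)
 qed
 thus ?thesis using A(1) by (intro exI[of _ "36 * A"]) auto
qed

text \<open>
  \<open>N\<close> is the intersection of the covers of \<open>rat_lines\<close> that belong to the exponents \<open>1 + kappa j\<close>, with
  \<open>kappa j\<close> tending to \<open>0\<close>.
\<close>

theorem small_universal_differentiability_set:
 assumes "admits_ball_of_uniformly_deformable_directions"
 shows "EX N. universal_differentiability_set N & Hausdorff_dim d N = 1 & (DIM('a) ~= 1 --> (ALL mu. haar_measure mu --> N : null_sets (completion mu)))"
proof -
 obtain Ec rho C n DeltaB E1 where E1': "E1 : layer 1 Int ball Ec rho" "norm E1 = 1" and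
  ball: "ALL E:layer 1 Int ball Ec rho. norm E = 1 --> deformable_with E C n DeltaB"
  using assms unfolding admits_ball_of_uniformly_deformable_directions_def by (elim bexE exE conjE)
 hence E1: "E1 : layer 1" "E1 : ball Ec rho" "norm E1 = 1" by simp_all
 define kappa where "kappa j = 1 / real (Suc j)" for j
 have kappa: "kappa j > 0" for j by (simp add: kappa_def)
 have "ALL j. EX c (k :: nat => nat) r. (ALL i. 0 < r i & r i <= kappa j & real (k i) * r i powr (1 + kappa j) <= kappa j * (1 / 2) ^ Suc i) &
   rat_lines <= (UN i. UN b<k i. dball (c i b) (r i))" using rat_lines_cover[OF kappa] by blast
 then obtain c k r where ckr: "ALL j. (ALL i. 0 < r j i & r j i <= kappa j & real ((k j :: nat => nat) i) * r j i powr (1 + kappa j) <= kappa j * (1 / 2) ^ Suc i) &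
   rat_lines <= (UN i. UN b<k j i. dball (c j i b) (r j i))" unfolding choice_iff by (elim exE)
 define U where "U j = (UN i. UN b<k j i. dball (c j i b) (r j i))" for j
 define N where "N = (\<Inter>j. U j)"
 have RN: "rat_lines <= N" using ckr by (auto simp: N_def U_def)
 have "EX e>0. ALL y. d x y < e --> y : U j" if "x : N" for j x
 proof -
  obtain i b where ib: "b < k j i" "d (c j i b) x < r j i" 
  proof -
   have "x : U j" using \<open>x : N\<close> by (simp add: N_def)
   thus thesis using that by (auto simp: U_def dball_def)
  qed
  have "y : U j" if "d x y < r j i - d (c j i b) x" for y using d_triangle[of "c j i b" y x] that ib(1) by (auto simp: U_def dball_def intro!: exI[of _ i] bexI[of _ b])
  thus ?thesis using ib(2) by (intro exI[of _ "r j i - d (c j i b) x"]) auto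
 qed
 hence uds: "universal_differentiability_set N"
  using ball by (intro universal_differentiability_set_if_deformable[OF _ E1 RN, where U = U and C = C and n = n and DeltaB = DeltaB]) (auto simp: N_def)
 have cover: "EX j. kappa j <= eps" if "eps > 0" for eps using reals_Archimedean[OF that] by (auto simp: kappa_def inverse_eq_divide intro: less_imp_le)
 have "Hausdorff_measure d alpha N = 0" if "alpha > 1" for alpha
 proof (rule Hausdorff_measure_zero[OF _ that])
  fix eps :: real assume "0 < eps"
  then obtain j where "kappa j <= eps" using cover by blast
  thus "EX c (k :: nat => nat) r kappa. 0 < kappa & kappa <= eps &
   (ALL i. 0 < r i & r i <= kappa & real (k i) * r i powr (1 + kappa) <= kappa * (1 / 2) ^ Suc i) & N <= (UN i. UN b<k i. dball (c i b) (r i))"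
   using ckr kappa[of j] by (intro exI[of _ "c j"] exI[of _ "k j"] exI[of _ "r j"] exI[of _ "kappa j"]) (auto simp: N_def U_def)
 qed
 moreover have "Hausdorff_measure d alpha N ~= 0" if "0 < alpha" "alpha < 1" for alpha
 proof -
  obtain W where W: "W : rat_vec" "norm (W - E1) < 1" using rat_vec_dense[OF E1(1), of 1] by auto
  show ?thesis
  proof (rule Hausdorff_measure_nonzero[of W, OF _ _ _ that])
   show "W : layer 1" using W(1) by (simp add: rat_vec_def)
   show "W ~= 0" using W(2) E1(3) by auto
   fix t have "t *R W = 0 ** (t *R W)" by (simp add: left_unit)
   hence "t *R W : rat_lines" unfolding rat_lines_def using zero_rat_pts W(1) by blast
   thus "t *R W : N" using RN by blast
  qed
 qed
 ultimately have dim1: "Hausdorff_dim d N = 1" by (rule Hausdorff_dim_one)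
 have "N : null_sets (completion mu)" if dim: "DIM('a) ~= 1" and H: "haar_measure mu" for mu
 proof -
  have sets: "sets mu = sets borel" using H by (simp add: haar_measure_def)
  have UM: "U j : sets mu" for j unfolding sets U_def by (intro borel_open open_UN open_dball ballI)
  hence NM: "N : sets mu" unfolding N_def by (intro sets.countable_INT) auto
  obtain A where A: "A >= 0" "ALL c r. 0 < r --> r <= 1 / 6 --> emeasure mu (dball c r) <= ennreal (A * r powr 2)" using haar_dball[OF H dim] by blast
  have "emeasure mu N <= 0"
  proof (rule ennreal_le_epsilon)
   fix e :: real assume e: "e > 0"
   obtain j where j: "kappa j <= min (1 / 6) (e / (A + 1))" using cover[of "min (1 / 6) (e / (A + 1))"] e A(1) by auto
   have j': "kappa j <= 1 / 6" "A * kappa j <= e"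
   proof -
    show "kappa j <= 1 / 6" using j by simp
    have "A * kappa j <= (A + 1) * (e / (A + 1))" using j A(1) kappa[of j] by (intro mult_mono) auto
    thus "A * kappa j <= e" using A(1) by simp
   qed
   have "EX V :: nat => 'a set. (UN i. UN b<k j i. dball (c j i b) (r j i)) = (UN n. V n) &
    (ALL n. V n = {} | (EX i b. V n = dball (c j i b) (r j i))) & (\<Sum>n. emeasure mu (V n)) <= ennreal (A * kappa j)"
   proof (rule ball_family_sequence[where bt = "1 + kappa j"])
    fix i b
    have r: "0 < r j i" "r j i <= 1 / 6" using ckr j'(1) order_trans by blast+
    have "emeasure mu (dball (c j i b) (r j i)) <= ennreal (A * r j i powr 2)" using A(2) r by blast
    also have "... <= ennreal (A * r j i powr (1 + kappa j))" using A(1) r j'(1) by (intro ennreal_leI mult_left_mono powr_mono') auto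
    finally show "emeasure mu (dball (c j i b) (r j i)) <= ennreal (A * r j i powr (1 + kappa j))" .
   qed (use A(1) kappa[of j] ckr in auto)
   then obtain V :: "nat => 'a set" where V: "U j = (UN n. V n)" "ALL n. V n = {} | (EX i b. V n = dball (c j i b) (r j i))"
    "(\<Sum>n. emeasure mu (V n)) <= ennreal (A * kappa j)" unfolding U_def by (elim exE conjE)
   have "V n : sets mu" for n using V(2)[rule_format, of n] open_dball sets by auto
   hence Vs: "range V <= sets mu" by auto
   have "emeasure mu N <= emeasure mu (U j)" using UM by (intro emeasure_mono) (auto simp: N_def)
   also have "... <= (\<Sum>n. emeasure mu (V n))" unfolding V(1) by (rule emeasure_subadditive_countably[OF Vs])
   also have "... <= ennreal (A * kappa j)" by (rule V(3))
   also have "... <= ennreal e" using j'(2) by (rule ennreal_leI)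
   finally show "emeasure mu N <= 0 + ennreal e" by simp
  qed
  hence "N : null_sets mu" using NM by (simp add: null_sets_def)
  thus ?thesis by (rule null_sets_completionI)
 qed
 thus ?thesis using uds dim1 by blast
qed

end

section \<open>Model filiform groups\<close>

locale filiform = carnot_group mult "filiform_layer X" "n - 1" for mult :: "'a::euclidean_space => 'a => 'a" (infixl "**" 70) and X :: "nat => 'a" and n :: nat +
 assumes n2: "n >= 2" and bij: "bij_betw X {1..n} Basis"
  and bracket: "i : {1..n} ==> j : {1..n} ==> lie_bracket mult (X i) (X j) = (if 1 < i & i < n & j = 1 then X (i + 1) else if i = 1 & 1 < j & j < n then - X (j + 1) else 0)"
begin

declare One_nat_def [simp del]

lemma X_inner: "i : {1..n} ==> j : {1..n} ==> X i *. X j = (if i = j then 1 else 0)"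
proof -
 assume ij: "i : {1..n}" "j : {1..n}"
 hence "X i : Basis" "X j : Basis" using bij by (auto simp: bij_betw_def)
 moreover have "X i = X j \<longleftrightarrow> i = j" using bij ij by (intro inj_on_eq_iff[of X "{1..n}"]) (auto simp: bij_betw_def)
 ultimately show ?thesis by (simp add: inner_Basis)
qed

lemma X_sum: "v = (SUM i=1..n. (v *. X i) *R X i)"
proof -
 have "(SUM i=1..n. (v *. X i) *R X i) = (SUM b:Basis. (v *. b) *R b)" by (rule sum.reindex_bij_betw[OF bij, of "%b. (v *. b) *R b"])
 thus ?thesis by (simp add: euclidean_representation)
qed

lemma X12: "X 1 : layer 1" "X 2 : layer 1" "X 1 *. X 1 = 1" "X 2 *. X 2 = 1" "X 1 *. X 2 = 0" "X 2 *. X 1 = 0"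
 using n2 X_inner by (auto simp: layer_def filiform_layer_def span_base)

lemma norm_X: "norm (X 1) = 1" "norm (X 2) = 1" using X12 by (simp_all add: norm_eq_1)

lemma p_eq: "p v = (v *. X 1) *R X 1 + (v *. X 2) *R X 2"
proof -
 have "X 1 ~= X 2" using X12 by auto
 thus ?thesis by (simp add: p_def layer_part_def filiform_layer_def)
qed

lemma layer1_eq: "v : layer 1 ==> v = (v *. X 1) *R X 1 + (v *. X 2) *R X 2" using p_layer1[of v] p_eq[of v] by simp

lemma mult_X1: "(x ** y) *. X 1 = x *. X 1 + y *. X 1" and mult_X2: "(x ** y) *. X 2 = x *. X 2 + y *. X 2"
proof -
 have "(x ** y) *. b = x *. b + y *. b" if "b : layer 1" for b
  unfolding p_inner_layer1[OF that, of "x ** y"] p_inner_layer1[OF that, of x] p_inner_layer1[OF that, of y] p_mult inner_add_left ..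
 thus "(x ** y) *. X 1 = x *. X 1 + y *. X 1" "(x ** y) *. X 2 = x *. X 2 + y *. X 2" using X12 by blast+
qed

lemma br_expand: "br v w = (SUM i=1..n. SUM j=1..n. ((v *. X i) * (w *. X j)) *R br (X i) (X j))"
proof -
 have 1: "br v w = (SUM i=1..n. (v *. X i) *R br (X i) w)"
  using arg_cong[OF X_sum[of v], of "%v. br v w"] by (simp add: linear_sum[OF linear_br1] linear_scale[OF linear_br1])
 have 2: "br x w = (SUM j=1..n. (w *. X j) *R br x (X j))" for x
  using arg_cong[OF X_sum[of w], of "br x"] by (simp add: linear_sum[OF linear_br2] linear_scale[OF linear_br2])
 show ?thesis unfolding 1 by (subst 2) (simp add: scaleR_sum_right)
qed

lemma br_zero: "br v w = 0" if "v *. X 1 = 0" "w *. X 1 = 0"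
proof -
 have "((v *. X i) * (w *. X j)) *R br (X i) (X j) = 0" if "i : {1..n}" "j : {1..n}" for i j
  using bracket[OF that] \<open>v *. X 1 = 0\<close> \<open>w *. X 1 = 0\<close> by auto
 thus ?thesis unfolding br_expand[of v w] by (intro sum.neutral ballI)
qed

lemma br_X1_coord: "br (X 1) v *. X k = (if 3 <= k then - (v *. X (k - 1)) else 0)" if k: "k : {1..n}"
proof -
 have one: "1 : {1..n}" using n2 by simp
 have "br (X 1) v = (SUM j=1..n. (v *. X j) *R br (X 1) (X j))"
  using arg_cong[OF X_sum[of v], of "br (X 1)"] by (simp add: linear_sum[OF linear_br2] linear_scale[OF linear_br2])
 hence "br (X 1) v *. X k = (SUM j=1..n. (v *. X j) * (br (X 1) (X j) *. X k))" by (simp add: inner_sum_left)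
 also have "... = (SUM j=1..n. if j = k - 1 then (if 3 <= k then - (v *. X (k - 1)) else 0) else 0)"
 proof (rule sum.cong[OF refl])
  fix j assume j: "j : {1..n}"
  have "j + 1 : {1..n}" if "j < n" using that by auto
  thus "(v *. X j) * (br (X 1) (X j) *. X k) = (if j = k - 1 then (if 3 <= k then - (v *. X (k - 1)) else 0) else 0)"
   unfolding bracket[OF one j] using j k X_inner[of "j + 1" k] by auto
 qed
 also have "... = (if 3 <= k then - (v *. X (k - 1)) else 0)" using k by (auto simp: sum.delta)
 finally show ?thesis .
qed

lemma br_decompose: "br v w = (w *. X 1) *R br v (X 1) + (v *. X 1) *R br (X 1) w"
proof -
 define v' w' where "v' = v - (v *. X 1) *R X 1" and "w' = w - (w *. X 1) *R X 1"
 have "br v' w' = 0" by (rule br_zero) (simp_all add: v'_def w'_def inner_diff_left X12)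
 moreover have "br (X 1) (X 1) = 0" using n2 bracket[of 1 1] by simp
 ultimately show ?thesis by (simp add: v'_def w'_def linear_diff[OF linear_br1] linear_diff[OF linear_br2] linear_scale[OF linear_br1] linear_scale[OF linear_br2]
    scaleR_diff_right algebra_simps)
qed

lemma conj_commute: "br v w = 0 ==> conj (t *R v) w = w"
proof -
 assume "br v w = 0"
 have *: "conj (t *R v) w = w" if "br v w = 0" "t >= 0" for v t
 proof (rule ode_unique[where f = "br v" and z = "%_. w", OF _ _ _ _ that(2)])
  obtain K where K: "K > 0" "ALL x. norm (br v x) <= K * norm x" using linear_bounded_pos[OF linear_br2] by blast
  thus "EX K>=0. ALL x y. norm x <= R --> norm y <= R --> norm (br v x - br v y) <= K * norm (x - y)" for R
   by (intro exI[of _ K]) (auto simp: linear_diff[OF linear_br2, symmetric])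
  show "((%t. conj (t *R v) w) has_vderiv br v (conj (t *R v) w)) (at t)" for t by (rule conj_derivative)
 qed (simp_all add: that(1) conj_0)
 have "br (- v) w = 0" using \<open>br v w = 0\<close> by (simp add: linear_neg[OF linear_br1])
 thus ?thesis using *[of v t] *[of "- v" "- t"] \<open>br v w = 0\<close> by (cases "t >= 0") auto
qed

text \<open>On the abelian ideal spanned by \<open>X 2, \<dots>, X n\<close> the group law is addition.\<close>

lemma ideal_mult: "v ** w = v + w" if "v *. X 1 = 0" "w *. X 1 = 0"
proof -
 have c: "(a *R v) ** (b *R w) = (b *R w) ** (a *R v)" for a b
 proof -
  have "conj (a *R v) (b *R w) = b *R w" using conj_commute[OF br_zero[OF that], of a] by (simp add: conj_scale)
  hence "conj (a *R v) (b *R w) ** (a *R v) = (b *R w) ** (a *R v)" by simp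
  thus ?thesis by (simp add: conj_def inv_cancel)
 qed
 have "(1 *R v) ** (1 *R w) = 1 *R (v + w)"
 proof (rule one_parameter_subgroup[of "%t. (t *R v) ** (t *R w)"])
  fix a b :: real
  have "((a + b) *R v) ** ((a + b) *R w) = (a *R v) ** ((b *R v) ** (a *R w)) ** (b *R w)" by (simp add: exp_coords[symmetric] assoc)
  thus "((a + b) *R v) ** ((a + b) *R w) = (a *R v) ** (a *R w) ** ((b *R v) ** (b *R w))" unfolding c[of b a] by (simp add: assoc)
 next
  have "((%t. (t *R v) ** (t *R w)) has_vderiv dmult (0 *R v) (0 *R w) v w) (at 0)" by (intro mult_has_vderiv scale_has_vderiv)
  moreover have "dmult 0 0 v w = v + w" using dmult_add[of 0 0 v w] lif_0[of w] by (simp add: dmult_left_0 lif_eq)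
  ultimately show "((%t. (t *R v) ** (t *R w)) has_vderiv v + w) (at 0)" by simp
 qed
 thus ?thesis by simp
qed

definition w1 :: 'a where "w1 = (X 1 + X 2) ** (- X 1)"

lemma w1_coord: "w1 *. X 1 = 0" "w1 *. X 2 = 1" by (simp_all add: w1_def mult_X1 mult_X2 inner_add_left X12)

text \<open>The linear map that fixes \<open>X 1\<close> and multiplies the ideal by \<open>sg\<close> is a homomorphism.\<close>

lemma slope_step: "X 1 + sg *R X 2 = (sg *R w1) ** X 1"
proof -
 define T where "T v = sg *R v + ((1 - sg) * (v *. X 1)) *R X 1" for v
 have lT: "linear T" unfolding T_def by (rule linearI) (simp_all add: inner_add_left algebra_simps)
 have brX1: "br v w *. X 1 = 0" for v w
 proof -
  have one: "1 : {1..n}" using n2 by simp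
  have "br v (X 1) *. X 1 = 0" using br_X1_coord[OF one, of v] br_antisym[of v "X 1"] by simp
  thus ?thesis unfolding br_decompose[of v w] using br_X1_coord[OF one, of w] by (simp add: inner_add_left)
 qed
 have bX: "br (X 1) (X 1) = 0" using n2 bracket[of 1 1] by simp
 have "T (br v w) = br (T v) (T w)" for v w
 proof -
  have "br (T v) (T w) = sg *R br v (T w) + ((1 - sg) * (v *. X 1)) *R br (X 1) (T w)" by (simp only: T_def[of v] linear_add[OF linear_br1] linear_scale[OF linear_br1])
  also have "br v (T w) = sg *R br v w + ((1 - sg) * (w *. X 1)) *R br v (X 1)" by (simp only: T_def linear_add[OF linear_br2] linear_scale[OF linear_br2])
  also have "br (X 1) (T w) = sg *R br (X 1) w" by (simp add: T_def linear_add[OF linear_br2] linear_scale[OF linear_br2] bX)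
  finally have "br (T v) (T w) = (sg * sg) *R br v w + (sg * (1 - sg)) *R ((w *. X 1) *R br v (X 1) + (v *. X 1) *R br (X 1) w)"
   by (simp add: scaleR_add_right mult_ac)
  also have "... = (sg * sg) *R br v w + (sg * (1 - sg)) *R br v w" by (simp only: br_decompose[of v w, symmetric])
  also have "... = sg *R br v w" unfolding scaleR_add_left[symmetric] by (simp add: right_diff_distrib)
  also have "... = T (br v w)" by (simp add: T_def brX1)
  finally show ?thesis by simp
 qed
 hence "T (x ** y) = T x ** T y" for x y by (intro linear_br_hom_imp_group_hom lT)
 from this[of "X 1 + X 2" "- X 1"] have "T w1 = (X 1 + sg *R X 2) ** (- X 1)" by (simp add: w1_def T_def inner_add_left X12 algebra_simps)
 moreover have "T w1 = sg *R w1" by (simp add: T_def w1_coord)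
 ultimately show ?thesis by (simp add: inv_cancel)
qed

lemma conj_X1_coord:
 assumes v: "!!k. k : {1..n} ==> k < j ==> v *. X k = 0" and j: "2 <= j"
 shows "k : {1..n} ==> k < j ==> conj (t *R X 1) v *. X k = 0"
  and "j <= n ==> conj (t *R X 1) v *. X j = v *. X j"
  and "j + 1 <= n ==> conj (t *R X 1) v *. X (j + 1) = v *. X (j + 1) - t * (v *. X j)"
proof -
 define c where "c k t = conj (t *R X 1) v *. X k" for k t
 have D: "(c k has_real_derivative (if 3 <= k then - c (k - 1) t else 0)) (at t)" if "k : {1..n}" for k t
 proof -
  have "(c k has_vderiv br (X 1) (conj (t *R X 1) v) *. X k) (at t)"
   unfolding c_def by (rule bounded_linear.has_vector_derivative[OF bounded_linear_inner_left conj_derivative])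
  thus ?thesis using br_X1_coord[OF that] by (cases "3 <= k") (simp_all add: has_real_derivative_iff_has_vector_derivative c_def)
 qed
 have c0: "c k 0 = v *. X k" for k by (simp add: c_def conj_0)
 have const: "c k t = c k 0" if "!!t. (c k has_real_derivative 0) (at t)" for k t using DERIV_isconst_all[of "c k" t 0] that by blast
 have low: "c k t = 0" if "k : {1..n}" "k < j" for k t using that
 proof (induction k arbitrary: t)
  case (Suc k)
  have "(if 3 <= Suc k then - c (Suc k - 1) t else 0) = 0" for t using Suc by auto
  hence "(c (Suc k) has_real_derivative 0) (at t)" for t using D[OF Suc.prems(1), of t] by simp
  hence "c (Suc k) t = c (Suc k) 0" by (rule const)
  thus ?case using v[OF Suc.prems] by (simp add: c0)
 qed simp
 have at_j: "c j t = v *. X j" if "j <= n" for t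
 proof -
  have "(if 3 <= j then - c (j - 1) t else 0) = 0" for t using low[of "j - 1" t] j that by (cases "3 <= j") auto
  hence "(c j has_real_derivative 0) (at t)" for t using D[of j t] j that by simp
  thus ?thesis using const[of j t] by (simp add: c0)
 qed
 show "k : {1..n} ==> k < j ==> conj (t *R X 1) v *. X k = 0" using low by (simp add: c_def)
 show "j <= n ==> conj (t *R X 1) v *. X j = v *. X j" using at_j by (simp add: c_def)
 assume jn: "j + 1 <= n"
 have "((%t. c (j + 1) t + t * (v *. X j)) has_real_derivative 0) (at t)" for t
 proof -
  have "(c (j + 1) has_real_derivative - (v *. X j)) (at t)" using D[of "j + 1" t] j jn at_j by simp
  thus ?thesis by (auto intro!: derivative_eq_intros)
 qed
 hence "c (j + 1) t + t * (v *. X j) = c (j + 1) 0 + 0 * (v *. X j)" by (rule DERIV_isconst_all[rule_format])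
 thus "conj (t *R X 1) v *. X (j + 1) = v *. X (j + 1) - t * (v *. X j)" using c0[of "j + 1"] by (simp add: c_def)
qed

definition e :: "nat => 'a" where "e i = conj (real i *R X 1) w1"

lemma lt_2: "k : {1..n} ==> k < 2 ==> k = 1" by auto

lemma e_ideal: "e i *. X 1 = 0"
proof -
 have "w1 *. X k = 0" if "k : {1..n}" "k < 2" for k unfolding lt_2[OF that] by (rule w1_coord)
 from conj_X1_coord(1)[OF this, where j = 2] show ?thesis unfolding e_def using n2 by simp
qed

lemma e_Suc: "e (Suc i) = conj (X 1) (e i)"
proof -
 have "real (Suc i) *R X 1 = X 1 ** (real i *R X 1)" using exp_coords[of 1 "X 1" "real i"] by simp
 thus ?thesis unfolding e_def by (simp only: conj_mult)
qed

text \<open>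
  The differences \<open>(conj (X 1) - 1)\<^sup>i w1\<close> have leading coordinate \<open>\<plusminus>1\<close> in position \<open>i + 2\<close>, so that the first
  \<open>n - 1\<close> of the vectors \<open>e i\<close> span the ideal.
\<close>

lemma difference_vectors:
 assumes "i + 2 <= n"
 shows "EX D : span (e ` {..i}). (ALL k:{1..n}. k < i + 2 --> D *. X k = 0) & D *. X (i + 2) ~= 0" using assms
proof (induction i)
 case 0
 have "w1 *. X k = 0" if "k : {1..n}" "k < 2" for k using lt_2[OF that] w1_coord(1) by simp
 moreover have "w1 : span (e ` {..0})" by (rule span_base) (simp add: e_def conj_0)
 ultimately show ?case using w1_coord(2) by (intro bexI[of _ w1]) (auto simp: numeral_2_eq_2)
next
 case (Suc i)
 then obtain D where D: "D : span (e ` {..i})" "ALL k:{1..n}. k < i + 2 --> D *. X k = 0" "D *. X (i + 2) ~= 0" by auto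
 have "conj (X 1) D : conj (X 1) ` span (e ` {..i})" using D(1) by blast
 also have "... = span (conj (X 1) ` e ` {..i})" by (rule linear_span_image[OF linear_conj, symmetric])
 also have "... <= span (e ` {..Suc i})" unfolding image_image e_Suc[symmetric] by (intro span_mono) auto
 finally have "conj (X 1) D - D : span (e ` {..Suc i})" using subsetD[OF span_mono[OF image_mono] D(1), of "{..Suc i}"] by (intro span_diff) auto
 moreover note c = conj_X1_coord[where v = D and j = "i + 2" and t = 1]
 have "(conj (X 1) D - D) *. X k = 0" if k: "k : {1..n}" "k < Suc i + 2" for k
 proof (cases "k < i + 2")
  case True
  thus ?thesis using c(1)[of k] D(2) k by (simp add: inner_diff_left)
 next
  case False
  hence "k = i + 2" using k by simp
  thus ?thesis using c(2) D(2) k by (simp add: inner_diff_left)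
 qed
 moreover have "(conj (X 1) D - D) *. X (Suc i + 2) = - (D *. X (i + 2))" using c(3) D(2) Suc.prems by (simp add: inner_diff_left One_nat_def)
 ultimately show ?case using D(3) by (intro bexI[of _ "conj (X 1) D - D"]) auto
qed

lemma ideal_span:
 assumes "v *. X 1 = 0"
 shows "v : span (e ` {..<n - 1})"
proof -
 have "v : span (e ` {..<n - 1})" if "i <= n - 1" "!!k. k : {1..n} ==> k < i + 2 ==> v *. X k = 0" for i v using that
 proof (induction "n - 1 - i" arbitrary: i v)
  case 0
  hence "v *. X k = 0" if "k : {1..n}" for k using that n2 by auto
  hence "v = 0" by (subst X_sum) simp
  thus ?case by (simp add: span_zero)
 next
  case (Suc m)
  hence i: "i + 2 <= n" by simp
  obtain D where D: "D : span (e ` {..i})" "ALL k:{1..n}. k < i + 2 --> D *. X k = 0" "D *. X (i + 2) ~= 0" using difference_vectors[OF i] by blast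
  define a where "a = (v *. X (i + 2)) / (D *. X (i + 2))"
  have "v - a *R D : span (e ` {..<n - 1})"
  proof (rule Suc.hyps(1)[of "Suc i"])
   fix k assume k: "k : {1..n}" "k < Suc i + 2"
   show "(v - a *R D) *. X k = 0"
   proof (cases "k < i + 2")
    case True
    thus ?thesis using Suc.prems(2)[OF k(1)] D(2) k(1) by (simp add: inner_diff_left)
   next
    case False
    hence "k = i + 2" using k by simp
    thus ?thesis using D(3) by (simp add: inner_diff_left a_def)
   qed
  qed (use Suc in auto)
  moreover have "D : span (e ` {..<n - 1})" using i by (intro subsetD[OF span_mono[OF image_mono] D(1)]) auto
  ultimately have "(v - a *R D) + a *R D : span (e ` {..<n - 1})" by (intro span_add span_scale)
  thus ?case by simp
 qed
 moreover have "v *. X k = 0" if k: "k : {1..n}" "k < 0 + 2" for k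
 proof -
  have "k = 1" using k by auto
  thus ?thesis using assms by simp
 qed
 ultimately show ?thesis by blast
qed

lemma ideal_coefficients:
 "EX K>=0. ALL v. v *. X 1 = 0 --> (EX c. v = (SUM i<n - 1. c i *R e i) & (ALL i. abs (c i) <= K * norm v))"
proof -
 define Y where "Y j = X j - (X j *. X 1) *R X 1" for j
 have "EX c. x = (SUM i<n - 1. c i *R e i)" if "x : span (e ` {..<n - 1})" for x
 proof -
  have "span (e ` {..<n - 1}) <= range (%c. SUM i<n - 1. c i *R e i)"
  proof (rule span_minimal)
   show "e ` {..<n - 1} <= range (%c. SUM i<n - 1. c i *R e i)"
   proof
    fix y assume "y : e ` {..<n - 1}"
    then obtain j where "j < n - 1" "y = e j" by auto
    hence "y = (SUM i<n - 1. (if i = j then 1 else 0) *R e i)" by (simp add: if_distrib[of "%c. c *R _"] sum.delta cong: if_cong)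
    thus "y : range (%c. SUM i<n - 1. c i *R e i)" by (rule range_eqI[of _ _ "%i. if i = j then 1 else 0"])
   qed
   show "subspace (range (%c. SUM i<n - 1. c i *R e i))" unfolding subspace_def
   proof (intro conjI ballI allI)
    show "0 : range (%c. SUM i<n - 1. c i *R e i)" by (rule range_eqI[of _ _ "%_. 0"]) simp
    fix x assume "x : range (%c. SUM i<n - 1. c i *R e i)"
    then obtain c where x: "x = (SUM i<n - 1. c i *R e i)" by blast
    show "a *R x : range (%c. SUM i<n - 1. c i *R e i)" for a by (rule range_eqI[of _ _ "%i. a * c i"]) (simp add: x scaleR_sum_right)
    fix y assume "y : range (%c. SUM i<n - 1. c i *R e i)"
    then obtain c' where y: "y = (SUM i<n - 1. c' i *R e i)" by blast
    show "x + y : range (%c. SUM i<n - 1. c i *R e i)" by (rule range_eqI[of _ _ "%i. c i + c' i"]) (simp add: x y scaleR_add_left sum.distrib)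
   qed
  qed
  thus ?thesis using that by blast
 qed
 moreover have "Y j : span (e ` {..<n - 1})" for j by (rule ideal_span) (simp add: Y_def inner_diff_left X12)
 ultimately have "ALL j. EX c. Y j = (SUM i<n - 1. c i *R e i)" by blast
 then obtain C where C: "ALL j. Y j = (SUM i<n - 1. C j i *R e i)" unfolding choice_iff by (elim exE)
 define K where "K = (SUM j=1..n. SUM i<n - 1. abs (C j i))"
 have "EX c. v = (SUM i<n - 1. c i *R e i) & (ALL i. abs (c i) <= K * norm v)" if v: "v *. X 1 = 0" for v
 proof -
  define c where "c i = (if i < n - 1 then SUM j=1..n. (v *. X j) * C j i else 0)" for i
  have "v = v - (v *. X 1) *R X 1" using v by simp
  also have "... = (SUM j=1..n. (v *. X j) *R Y j)"
  proof -
   have "v *. X 1 = (SUM j=1..n. (v *. X j) * (X j *. X 1))" by (subst X_sum[of v]) (simp add: inner_sum_left)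
   thus ?thesis using X_sum[of v] by (simp add: Y_def scaleR_diff_right sum_subtractf scaleR_sum_left[symmetric])
  qed
  also have "... = (SUM j=1..n. SUM i<n - 1. ((v *. X j) * C j i) *R e i)" using C by (simp add: scaleR_sum_right)
  also have "... = (SUM i<n - 1. SUM j=1..n. ((v *. X j) * C j i) *R e i)" by (rule sum.swap)
  also have "... = (SUM i<n - 1. c i *R e i)" by (simp add: c_def scaleR_sum_left)
  finally have 1: "v = (SUM i<n - 1. c i *R e i)" .
  have "abs (c i) <= K * norm v" for i
  proof (cases "i < n - 1")
   case True
   have "abs (c i) <= (SUM j=1..n. abs ((v *. X j) * C j i))" using True by (simp add: c_def sum_abs)
   also have "... <= (SUM j=1..n. (SUM i<n - 1. abs (C j i)) * norm v)"
   proof (rule sum_mono)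
    fix j assume "j : {1..n}"
    hence "X j : Basis" using bij unfolding bij_betw_def by blast
    hence "abs (v *. X j) <= norm v" by (rule Basis_le_norm)
    moreover have "abs (C j i) <= (SUM i<n - 1. abs (C j i))" using True by (intro member_le_sum) auto
    ultimately have "abs (v *. X j) * abs (C j i) <= norm v * (SUM i<n - 1. abs (C j i))" by (intro mult_mono) auto
    thus "abs ((v *. X j) * C j i) <= (SUM i<n - 1. abs (C j i)) * norm v" by (simp add: abs_mult mult.commute)
   qed
   finally show ?thesis by (simp add: K_def sum_distrib_right)
  qed (auto simp: c_def K_def sum_nonneg)
  thus ?thesis using 1 by blast
 qed
 thus ?thesis by (intro exI[of _ K]) (auto simp: K_def sum_nonneg)
qed

text \<open>Moving all factors \<open>X 1\<close> to the right conjugates the elements \<open>sg i *R w1\<close> by multiples of \<open>X 1\<close>.\<close>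

lemma pprod_slopes: "pprod (map (%i. (1, X 1 + sg i *R X 2)) [0..<k]) = (SUM i<k. sg i *R e i) ** (real k *R X 1)"
proof (induction k)
 case (Suc k)
 have "(real k *R X 1) ** (X 1 + sg k *R X 2) = conj (real k *R X 1) (sg k *R w1) ** ((real k *R X 1) ** (1 *R X 1))"
  by (simp add: slope_step conj_def assoc inv_cancel)
 also have "... = (sg k *R e k) ** (real (Suc k) *R X 1)" unfolding exp_coords by (simp add: conj_scale e_def add.commute)
 finally have "pprod (map (%i. (1, X 1 + sg i *R X 2)) [0..<Suc k]) = ((SUM i<k. sg i *R e i) ** (sg k *R e k)) ** (real (Suc k) *R X 1)"
  by (simp add: pprod_append Suc.IH right_unit assoc)
 moreover have "(SUM i<k. sg i *R e i) ** (sg k *R e k) = (SUM i<Suc k. sg i *R e i)" by (subst ideal_mult) (simp_all add: inner_sum_left e_ideal)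
 ultimately show ?case by simp
qed (simp add: left_unit)

lemma horizontal_cong:
 assumes h: "controlled a b gamma u" and eq: "!!t. t : {a..b} ==> gamma t = gamma' t"
 shows "controlled a b gamma' u"
proof -
 have "abs_continuous_curve a b gamma'" by (rule abs_continuous_dominated[of a b gamma 1 _ _ "%t. t"])
   (use h eq in "auto simp: control_def monotone_on_def")
 moreover have "AE t in lebesgue. t : {a..b} --> (gamma' has_vderiv lif (gamma' t) (u t)) (at t)"
 proof -
  have "AE t in lebesgue. t ~= a & t ~= b" unfolding AE_lebesgue_negligible by (rule negligible_subset[of "{a, b}"]) auto
  moreover have "AE t in lebesgue. t : {a..b} --> (gamma has_vderiv lif (gamma t) (u t)) (at t)" using h by (simp add: control_def)
  ultimately show ?thesis
  proof eventually_elim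
   case (elim t)
   show ?case
   proof
    assume t: "t : {a..b}"
    hence "(gamma has_vderiv lif (gamma t) (u t)) (at t)" using elim by blast
    hence "(gamma' has_vderiv lif (gamma t) (u t)) (at t)" by (rule has_vector_derivative_transform_within_open[of _ _ _ "{a<..<b}"]) (use elim t eq in auto)
    thus "(gamma' has_vderiv lif (gamma' t) (u t)) (at t)" using eq[OF t] by simp
   qed
  qed
 qed
 ultimately show ?thesis using h by (simp add: control_def)
qed

lemma piecewise_lines:
 fixes b :: "nat => real" and V q :: "nat => 'a" and m :: nat
 defines "I \<equiv> %i. if i = 0 then {..b 0} else if i <= m then {b (i - 1)..b i} else {b m..}"
 assumes mono: "!!i. i < m ==> b i <= b (Suc i)"
  and g: "!!i t. i <= Suc m ==> t : I i ==> g t = q i ** (t *R V i)"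
  and V: "!!i. i <= Suc m ==> V i : layer 1 & norm (V i) <= K"
 shows "d (g x) (g y) <= K * abs (x - y)" and "horizontal_on_line g" and "joins_horizontal_lines (m + 2) g"
  and "t ~: b ` {..m} ==> EX i<=Suc m. ((p o g) has_vderiv V i) (at t)"
proof -
 have bmono: "b i <= b j" if "i <= j" "j <= m" for i j using that by (induction j rule: dec_induct) (auto intro: order_trans[OF _ mono])
 have cover: "EX i<=Suc m. x : I i" for x
 proof (cases "x <= b m")
  case True
  have "EX i<=j. x : I i" if "j <= m" "x <= b j" for j using that
  proof (induction j)
   case (Suc j)
   show ?case
   proof (cases "x <= b j")
    case True
    then obtain i where "i <= j" "x : I i" using Suc by auto
    thus ?thesis by (intro exI[of _ i]) simp
   next
    case False
    hence "x : I (Suc j)" using Suc.prems by (simp add: I_def)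
    thus ?thesis by blast
   qed
  qed (simp add: I_def)
  thus ?thesis using True le_SucI by blast
 qed (auto simp: I_def intro: exI[of _ "Suc m"])
 have IS: "t : I (Suc j) \<longleftrightarrow> b j <= t & (j < m --> t <= b (Suc j))" if "j <= m" for j t using that by (cases "j = m") (auto simp: I_def)
 have chain: "P x y" if base: "!!i x y. i <= Suc m ==> x : I i ==> y : I i ==> x <= y ==> P x y"
  and trans: "!!x y z. x <= y ==> y <= z ==> P x y ==> P y z ==> P x z" and xy: "x <= y" for P x y
 proof -
  have "P x y" if "j <= Suc m" "y : I j" "x <= y" for j x y using that
  proof (induction j arbitrary: x y)
   case 0
   thus ?case by (intro base[of 0]) (auto simp: I_def)
  next
   case (Suc j)
   show ?case
   proof (cases "b j <= x")
    case True
    thus ?thesis using Suc.prems by (intro base[of "Suc j"]) (auto simp: IS)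
   next
    case False
    have y: "b j <= y" using Suc.prems by (simp add: IS)
    have "b j : I j" using bmono[of "j - 1" j] Suc.prems by (auto simp: I_def)
    hence "P x (b j)" using False Suc by auto
    moreover have "P (b j) y" using Suc.prems y mono[of j] by (intro base[of "Suc j"]) (auto simp: IS)
    ultimately show ?thesis using trans[of x "b j" y] False y by simp
   qed
  qed
  thus ?thesis using cover xy by blast
 qed
 have "d (g x) (g y) <= K * (y - x)" if "x <= y" for x y
 proof (rule chain[where P = "%x y. d (g x) (g y) <= K * (y - x)", OF _ _ that])
  fix i x y assume i: "i <= Suc m" "x : I i" "y : I i" "x <= (y::real)"
  have "d (g x) (g y) = (y - x) * norm (V i)" using V[OF i(1)] i(4) by (simp add: g[OF i(1,2)] g[OF i(1,3)] d_line del: d_mult_left)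
  also have "... <= (y - x) * K" using V[OF i(1)] i(4) by (intro mult_left_mono) auto
  finally show "d (g x) (g y) <= K * (y - x)" by (simp add: mult.commute)
 next
  fix x y z assume "d (g x) (g y) <= K * (y - x)" "d (g y) (g z) <= K * (z - y)"
  thus "d (g x) (g z) <= K * (z - x)" using d_triangle[of "g x" "g z" "g y"] by (simp add: right_diff_distrib)
 qed
 from this[of x y] this[of y x] show "d (g x) (g y) <= K * abs (x - y)" by (cases "x <= y") (auto simp: d_sym)
 show "horizontal_on_line g" unfolding horizontal_on_line_def
 proof (intro allI impI)
  fix x y :: real assume "x <= y"
  thus "EX u. controlled x y g u"
  proof (rule chain[where P = "%x y. EX u. controlled x y g u", rotated 2])
   fix i x y assume i: "i <= Suc m" "x : I i" "y : I i"
   have "controlled x y (%t. q i ** (t *R V i)) (%_. V i)" using V[OF i(1)] by (intro horizontal_line) simp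
   moreover have "q i ** (t *R V i) = g t" if "t : {x..y}" for t using i that by (intro g[symmetric]) (auto simp: I_def split: if_splits)
   ultimately show "EX u. controlled x y g u" using horizontal_cong by blast
  next
   fix x y z :: real assume "x <= y" "y <= z" "EX u. controlled x y g u" "EX u. controlled y z g u"
   then obtain u v where "controlled x y g u" "controlled y z g v" by blast
   from horizontal_concat(1)[OF this refl \<open>x <= y\<close> \<open>y <= z\<close>] show "EX u. controlled x z g u" by (simp cong: if_cong) blast
  qed
 qed
 show "joins_horizontal_lines (m + 2) g" unfolding joins_horizontal_lines_def
 proof (intro exI[of _ "m + 2"] exI[of _ I] conjI allI impI ballI)
  show "(UN i<m + 2. I i) = UNIV" using cover by (fastforce simp: less_Suc_eq_le)
  fix i assume "i < m + 2"
  thus "is_horizontal_line_on (I i) g" unfolding is_horizontal_line_on_def using g[of i] V[of i] by auto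
  show "is_interval (I i)" by (simp add: I_def)
 next
  fix i j x y assume ij: "i < j & j < m + 2" and x: "x : I i" and y: "y : I j"
  obtain k where k: "j = Suc k" using ij by (cases j) auto
  have "x <= b i" using x ij by (auto simp: I_def split: if_splits)
  moreover have "b k <= y" using y ij by (simp add: k IS)
  moreover have "b i <= b k" using ij k by (intro bmono) auto
  ultimately show "x <= y" by linarith
 qed simp
 assume t: "t ~: b ` {..m}"
 obtain i where i: "i <= Suc m" "t : I i" using cover by blast
 have "EX S. open S & t : S & S <= I i"
 proof -
  consider "i = 0" | "i ~= 0" "i <= m" | "i = Suc m" using i(1) by linarith
  thus ?thesis
  proof cases
   case 1
   hence "t <= b 0" "t ~= b 0" using i(2) t by (auto simp: I_def)
   thus ?thesis using 1 by (intro exI[of _ "{..<b 0}"]) (auto simp: I_def)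
  next
   case 2
   hence "t ~= b (i - 1)" "t ~= b i" "b (i - 1) <= t" "t <= b i" using t i(2) by (auto simp: I_def)
   thus ?thesis using 2 by (intro exI[of _ "{b (i - 1)<..<b i}"]) (auto simp: I_def)
  next
   case 3
   hence "b m <= t" "t ~= b m" using i(2) t by (auto simp: I_def)
   thus ?thesis using 3 by (intro exI[of _ "{b m<..}"]) (auto simp: I_def)
  qed
 qed
 then obtain S where S: "open S" "t : S" "S <= I i" by blast
 have "((%sg. p (q i) + sg *R V i) has_vderiv V i) (at t)" by (auto intro!: derivative_eq_intros)
 hence "((p o g) has_vderiv V i) (at t)" by (rule has_vector_derivative_transform_within_open[OF _ S(1,2)])
   (use S(3) g[OF i(1)] V[OF i(1)] in "auto simp: p_mult p_layer1 layer_scale")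
 thus "EX i<=Suc m. ((p o g) has_vderiv V i) (at t)" using i(1) by blast
qed

lemma walk_nth:
 assumes "near_path E delta L" "i < length L" "duration (take i L) <= tau" "tau <= duration (take (Suc i) L)"
 shows "walk L tau = pprod (take i L) ** ((tau - duration (take i L)) *R snd (L ! i))" using assms
proof (induction L arbitrary: i tau)
 case (Cons tV L)
 obtain t V where tV: "tV = (t, V)" by fastforce
 have nL: "near_path E delta L" using Cons.prems by (simp add: tV)
 show ?case
 proof (cases i)
  case 0
  thus ?thesis using Cons.prems by (simp add: tV left_unit)
 next
  case (Suc j)
  have "near_path E delta (take j L)" using nL by (auto simp: near_path_def dest: in_set_takeD)
  hence "t <= tau" using Cons.prems(3) near_path_duration[of E delta "take j L"] by (simp add: Suc tV)
  hence "walk (tV # L) tau = (t *R V) ** walk L (tau - t)" using walk_0[OF nL] by (cases "tau = t") (auto simp: tV right_unit)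
  also have "walk L (tau - t) = pprod (take j L) ** (((tau - t) - duration (take j L)) *R snd (L ! j))" using Cons.prems by (intro Cons.IH[OF nL]) (auto simp: Suc tV)
  finally show ?thesis by (simp add: Suc tV assoc diff_diff_eq)
 qed
qed simp

lemma inner_mult: "E : layer 1 ==> (x ** y) *. E = x *. E + y *. E"
 using p_inner_layer1[of E "x ** y"] p_inner_layer1[of E x] p_inner_layer1[of E y] by (simp only: p_mult inner_add_left)

lemma duration_eq_inner:
 "E : layer 1 ==> ALL (t, V):set L. V *. E = 1 ==> duration L = pprod L *. E" by (induction L) (auto simp: inner_mult)

text \<open>A deformation of a line is obtained from a path through the prescribed point; the pieces have unit speed along \<open>E\<close>.\<close>

lemma deformation_from_paths:
 assumes E: "E : layer 1" "norm E = 1" and l: "l > 0" and C: "C >= 0"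
  and L: "near_path E delta (L1 @ L2)" "ALL (t, V):set (L1 @ L2). 0 < t & V *. E = 1 & norm V <= K" "L1 ~= []" "L2 ~= []" and K: "K >= 1"
  and z: "pprod L1 = (l *R E) ** z" "z ** pprod L2 = l *R E"
 shows "EX g. Lipschitz_wrt dist d g & horizontal_on_line g & joins_horizontal_lines (length (L1 @ L2) + 2) g &
   (ALL t. abs t >= l --> g t = t *R E) & g (z *. E) = z & Lip_const dist d g <= K &
   (EX F. finite F & (ALL t. t ~: F --> (EX D. ((p o g) has_vderiv D) (at t) & norm (D - p E) <= delta)))"
proof -
 define L where "L = L1 @ L2"
 have nL: "near_path E delta L" "near_path E delta L1" "near_path E delta L2" using L(1) by (auto simp: L_def)
 have LV: "!!t V. (t, V) : set L ==> 0 < t & V *. E = 1 & norm V <= K" using L(2) by (auto simp: L_def)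
 obtain t0 V0 where "(t0, V0) : set L1" using L(3) by (cases L1) auto
 hence "norm (V0 - E) <= delta" using nL(2) by (auto simp: near_path_def)
 hence delta: "delta >= 0" using norm_ge_zero[of "V0 - E"] by linarith
 have EE: "E *. E = 1" using E by (simp add: norm_eq_1)
 have pos: "0 < duration L'" if "L' ~= []" "ALL (t, V):set L'. 0 < t" for L' :: "(real * 'a) list" using that
 proof (induction L')
  case (Cons tV L')
  thus ?case by (cases "L' = []"; cases tV) (auto simp: add_pos_pos)
 qed simp
 have V12: "ALL (t, V):set L1. V *. E = 1" "ALL (t, V):set L2. V *. E = 1" using LV by (auto simp: L_def)
 have dur1: "duration L1 = l + z *. E" "0 < duration L1" using duration_eq_inner[OF E(1) V12(1)] L(2) z(1) EE pos[OF L(3)] by (auto simp: inner_mult[OF E(1)])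
 have dur2: "duration L2 = l - z *. E" "0 < duration L2"
 proof -
  have "z *. E + pprod L2 *. E = l" using arg_cong[OF z(2), of "%x. x *. E"] EE by (simp add: inner_mult[OF E(1)])
  thus "duration L2 = l - z *. E" using duration_eq_inner[OF E(1) V12(2)] by simp
  show "0 < duration L2" using L(2) pos[OF L(4)] by auto
 qed
 have durL: "duration L = 2 * l" by (simp add: L_def dur1 dur2)
 have prodL: "(- (l *R E)) ** pprod L = l *R E" unfolding L_def pprod_append z(1) by (simp add: assoc z(2) inv_cancel)
 define g where "g t = (if l <= abs t then t *R E else (- (l *R E)) ** walk L (t + l))" for t
 have gmid: "g t = (- (l *R E)) ** walk L (t + l)" if "- l <= t" "t <= l" for t
 proof -
  have "t = - l | t = l | abs t < l" using that by arith
  then consider "t = - l" | "t = l" | "abs t < l" by blast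
  thus ?thesis
  proof cases
   case 1
   thus ?thesis using walk_0[OF nL(1)] l by (simp add: g_def right_unit)
  next
   case 2
   thus ?thesis using walk_duration[OF nL(1)] durL prodL l by (simp add: g_def)
  qed (simp add: g_def)
 qed
 define m where "m = length L"
 define b where "b i = duration (take i L) - l" for i
 define V where "V i = (if i = 0 | m < i then E else snd (L ! (i - 1)))" for i
 define q where "q i = (if i = 0 | m < i then 0 else (- (l *R E)) ** pprod (take (i - 1) L) ** ((- b (i - 1)) *R V i))" for i
 have Vi: "(fst (L ! i), snd (L ! i)) : set L" if "i < m" for i using that by (simp add: m_def)
 have bS: "b (Suc i) = b i + fst (L ! i)" if "i < m" for i using that by (cases "L ! i") (simp add: b_def m_def take_Suc_conv_app_nth)
 have b0: "b 0 = - l" "b m = l" by (simp_all add: b_def m_def durL)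
 have bmono: "b i <= b (Suc i)" if "i < m" for i using bS[OF that] LV[OF Vi[OF that]] by simp
 have "b i <= b j" if "i <= j" "j <= m" for i j using that by (induction j rule: dec_induct) (auto intro: order_trans[OF _ bmono])
 hence brange: "- l <= b i & b i <= l" if "i <= m" for i using b0 that by (metis le0 order_refl)
 have glines: "g t = q i ** (t *R V i)" if i: "i <= Suc m" "t : (if i = 0 then {..b 0} else if i <= m then {b (i - 1)..b i} else {b m..})" for i t
 proof -
  consider "i = 0 | m < i" | j where "i = Suc j" "j < m" by (cases i; cases "m < i") auto
  thus ?thesis
  proof cases
   case 1
   hence "l <= abs t" using i(2) b0 l by (auto split: if_splits)
   thus ?thesis using 1 by (auto simp: g_def q_def V_def left_unit)
  next
   case 2
   hence t: "b j <= t" "t <= b (Suc j)" using i(2) by auto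
   hence "- l <= t" "t <= l" using brange[of j] brange[of "Suc j"] 2 by auto
   hence "g t = (- (l *R E)) ** walk L (t + l)" by (rule gmid)
   also have "walk L (t + l) = pprod (take j L) ** ((t + l - duration (take j L)) *R snd (L ! j))" by (rule walk_nth[OF nL(1)]) (use t 2 in "auto simp: b_def m_def")
   also have "t + l - duration (take j L) = - b j + t" by (simp add: b_def)
   finally have "g t = (- (l *R E)) ** (pprod (take j L) ** ((- b j + t) *R V i))" using 2 by (simp add: V_def)
   moreover have "q i = (- (l *R E)) ** pprod (take j L) ** ((- b j) *R V i)" using 2 by (simp add: q_def)
   ultimately show ?thesis by (simp only: assoc exp_coords)
  qed
 qed
 have VK: "V i : layer 1 & norm (V i) <= K" "norm (V i - E) <= delta" if "i <= Suc m" for i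
 proof -
  consider "i = 0 | m < i" | j where "i = Suc j" "j < m" by (cases i; cases "m < i") auto
  hence "(V i : layer 1 & norm (V i) <= K) & norm (V i - E) <= delta"
  proof cases
   case 1
   thus ?thesis using E K delta by (auto simp: V_def)
  next
   case 2
   thus ?thesis using LV[OF Vi[OF 2(2)]] nL(1) Vi[OF 2(2)] by (auto simp: V_def near_path_def)
  qed
  thus "V i : layer 1 & norm (V i) <= K" "norm (V i - E) <= delta" by auto
 qed
 note P = piecewise_lines[of m b g q V K, OF bmono glines VK(1)]
 have lipK: "d (g x) (g y) <= K * dist x y" for x y using P(1)[of x y] by (simp add: dist_real_def)
 have "Lipschitz_wrt dist d g" unfolding Lipschitz_wrt_def using lipK K by (intro exI[of _ K]) auto
 moreover have "Lip_const dist d g <= K" unfolding Lip_const_def by (rule cInf_lower) (use lipK K in "auto intro!: bdd_belowI[of _ 0]")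
 moreover have "g (z *. E) = z"
 proof -
  have "g (z *. E) = (- (l *R E)) ** walk (L1 @ L2) (z *. E + l)" using dur1 dur2 by (subst gmid) (auto simp: L_def)
  also have "walk (L1 @ L2) (z *. E + l) = pprod L1 ** walk L2 (z *. E + l - duration L1)" by (rule walk_append[OF nL(2,3)]) (simp add: dur1)
  also have "z *. E + l - duration L1 = 0" by (simp add: dur1)
  finally show ?thesis using walk_0[OF nL(3)] by (simp add: right_unit z(1) inv_cancel)
 qed
 moreover have "EX F. finite F & (ALL t. t ~: F --> (EX D. ((p o g) has_vderiv D) (at t) & norm (D - p E) <= delta))"
 proof (intro exI[of _ "b ` {..m}"] conjI allI impI)
  fix t assume "t ~: b ` {..m}"
  then obtain i where "i <= Suc m" "((p o g) has_vderiv V i) (at t)" using P(4) by blast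
  thus "EX D. ((p o g) has_vderiv D) (at t) & norm (D - p E) <= delta" using VK(2) E(1) by (auto simp: p_layer1)
 qed simp
 moreover have "ALL t. abs t >= l --> g t = t *R E" by (simp add: g_def)
 ultimately show ?thesis using P(2,3) by (intro exI[of _ g]) (simp add: m_def L_def)
qed

lemma pprod_cong: "(!!i. i : set xs ==> fst (f i) *R snd (f i) = fst (g i) *R snd (g i)) ==> pprod (map f xs) = pprod (map g xs)"
 by (induction xs) (auto simp: pprod_def case_prod_beta)

lemma pprod_scale: "ALL (t, V):set L. V : layer 1 ==> pprod (map (%(t, V). (c * t, V)) L) = dilation c (pprod L)"
 by (induction L) (auto simp: dilation_mult dilation_layer1 layer_scale)

lemma pprod_const: "pprod (map (%i. (1, v)) [0..<k]) = real k *R v"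
proof (induction k)
 case (Suc k)
 have "(real k *R v) ** (1 *R v) = real (Suc k) *R v" unfolding exp_coords by (simp add: add.commute)
 thus ?case by (simp add: pprod_append Suc.IH right_unit)
qed simp

end

context filiform
begin

text \<open>
  Dilated so that its \<open>X 1\<close>-coordinate is \<open>n - 1\<close>, a point near \<open>E\<close> is a product of \<open>n - 1\<close> elements
  \<open>X 1 + sg i *R X 2\<close>; the slopes solve a linear system that does not depend on the point, and for
  \<open>E\<close> itself they are all equal.
\<close>

lemma path_near_line:
 "EX C>0. EX kappa>0. ALL E W. E : layer 1 --> norm E = 1 --> 1 / 2 <= E *. X 1 --> norm (W - E) <= kappa -->
   (EX L. length L = n - 1 & pprod L = W & near_path E (C * norm (W - E)) L & (ALL (t, V):set L. 0 < t & V *. E = 1))"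
proof -
 define k where "k = n - 1"
 define m where "m = real k"
 have m: "m >= 1" using n2 by (simp add: m_def k_def)
 obtain K1 where K1: "K1 >= 0" "ALL v. v *. X 1 = 0 --> (EX c. v = (SUM i<n - 1. c i *R e i) & (ALL i. abs (c i) <= K1 * norm v))" using ideal_coefficients by blast
 define M where "M = (4 * m) ^ (n - 1) + 8 * m"
 have M: "M >= 0" using m by (simp add: M_def)
 obtain K2 where K2: "K2 >= 0" "ALL x y x' y'. norm x <= 2 * m + M --> norm y <= 2 * m + M --> norm x' <= 2 * m + M --> norm y' <= 2 * m + M -->
   norm (x ** y - x' ** y') <= K2 * (norm (x - x') + norm (y - y'))" using mult_lipschitz by blast
 define K3 where "K3 = K1 * (K2 * M)"
 have K3: "K3 >= 0" using K1 K2 M by (simp add: K3_def)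
 define kappa where "kappa = min (1 / 4) (1 / (2 * (K3 + 1)))"
 have kappa: "kappa > 0" "kappa <= 1 / 4" "K3 * kappa <= 1 / 2"
 proof -
  show "kappa > 0" "kappa <= 1 / 4" using K3 by (auto simp: kappa_def)
  have "K3 * kappa <= (K3 + 1) * (1 / (2 * (K3 + 1)))" using K3 by (intro mult_mono) (auto simp: kappa_def)
  moreover have "(K3 + 1) * (1 / (2 * (K3 + 1))) = 1 / 2" using K3 by (simp add: field_simps)
  ultimately show "K3 * kappa <= 1 / 2" by linarith
 qed
 have "EX L. length L = n - 1 & pprod L = W & near_path E ((4 * K3 + 1) * norm (W - E)) L & (ALL (t, V):set L. 0 < t & V *. E = 1)"
  if E: "E : layer 1" "norm E = 1" "1 / 2 <= E *. X 1" and W: "norm (W - E) <= kappa" for E W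
 proof -
  define nu where "nu = norm (W - E)"
  define alpha bt where "alpha = E *. X 1" and "bt = E *. X 2"
  have Eab: "E = alpha *R X 1 + bt *R X 2" using layer1_eq[OF E(1)] by (simp add: alpha_def bt_def)
  have "E *. E = alpha * alpha + bt * bt" by (subst (2) Eab) (simp add: inner_add_right alpha_def bt_def)
  hence ab: "alpha * alpha + bt * bt = 1" using E(2) by (simp add: norm_eq_1)
  have alpha: "alpha >= 1 / 2" "alpha <= 1" "abs bt <= 1" using E Cauchy_Schwarz_ineq2[of E "X 1"] Cauchy_Schwarz_ineq2[of E "X 2"] norm_X by (auto simp: alpha_def bt_def)
  define tau where "tau = bt / alpha"
  have Etau: "E = alpha *R (X 1 + tau *R X 2)" using alpha by (subst Eab) (simp add: tau_def scaleR_add_right)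
  define w where "w = W *. X 1"
  have walpha: "abs (alpha - w) <= nu" using Cauchy_Schwarz_ineq2[of "W - E" "X 1"] norm_X by (simp add: nu_def alpha_def w_def inner_diff_left abs_minus_commute)
  hence w: "w >= 1 / 4" using W kappa alpha by (simp add: nu_def)
  define c c' where "c = m / w" and "c' = m / alpha"
  have c: "0 < c" "c <= 4 * m" using w m by (simp_all add: c_def field_simps)
  have c': "0 < c'" "c' <= 2 * m" using alpha m by (simp_all add: c'_def field_simps)
  have cc: "abs (c - c') <= 8 * m * nu"
  proof -
   have "c - c' = m * (alpha - w) / (w * alpha)" using w alpha by (simp add: c_def c'_def field_simps)
   hence "abs (c - c') = m * abs (alpha - w) / (w * alpha)" using m w alpha by (simp add: abs_mult)
   also have "... <= m * nu / (1 / 4 * (1 / 2))" using m w alpha walpha by (intro frac_le mult_left_mono mult_mono) (auto simp: nu_def)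
   finally show ?thesis by simp
  qed
  define W' E' where "W' = dilation c W" and "E' = dilation c' E"
  have E'E: "E' = c' *R E" using E(1) by (simp add: E'_def dilation_layer1)
  have WE: "norm (W' - E') <= M * nu"
  proof -
   have "W' - E' = dilation c (W - E) + (c - c') *R E" using E(1) by (simp add: W'_def E'_def linear_diff[OF linear_dilation] dilation_layer1 scaleR_diff_left)
   also have "norm ... <= norm (dilation c (W - E)) + abs (c - c')" using norm_triangle_ineq[of "dilation c (W - E)" "(c - c') *R E"] E(2) by simp
   also have "norm (dilation c (W - E)) <= (4 * m) ^ (n - 1) * norm (W - E)"
   proof (rule norm_dilation_le)
    fix i assume i: "i : {1..n - 1}"
    have "abs c ^ i <= (4 * m) ^ i" using c by (intro power_mono) auto
    also have "... <= (4 * m) ^ (n - 1)" using i m by (intro power_increasing) auto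
    finally show "abs c ^ i <= (4 * m) ^ (n - 1)" .
   qed (use m in simp)
   finally show ?thesis using cc by (simp add: M_def nu_def distrib_right)
  qed
  define Y Y0 where "Y = W' ** (- (m *R X 1))" and "Y0 = E' ** (- (m *R X 1))"
  have "norm (Y - Y0) <= K2 * norm (W' - E')"
  proof -
   have nE: "norm E' <= 2 * m" using E'E E(2) c' by simp
   have "M * nu <= M * 1" using M W kappa by (intro mult_left_mono) (auto simp: nu_def)
   hence nW: "norm W' <= 2 * m + M" using nE WE norm_triangle_ineq[of "W' - E'" E'] by simp
   show ?thesis unfolding Y_def Y0_def using K2(2)[rule_format, of W' "- (m *R X 1)" E' "- (m *R X 1)"] nE nW M m norm_X by simp
  qed
  also have "... <= K2 * (M * nu)" using WE K2(1) by (rule mult_left_mono)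
  finally have YY: "norm (Y - Y0) <= K2 * (M * nu)" .
  have "dilation c W *. X 1 = c * (W *. X 1)" unfolding p_inner_layer1[OF X12(1), of "dilation c W"] p_inner_layer1[OF X12(1), of W] p_dilation by simp
  hence "(Y - Y0) *. X 1 = 0" using w alpha by (simp add: Y_def Y0_def inner_diff_left mult_X1 W'_def E'E c_def c'_def alpha_def w_def X12)
  then obtain rho where rho: "Y - Y0 = (SUM i<n - 1. rho i *R e i)" "ALL i. abs (rho i) <= K1 * norm (Y - Y0)" using K1(2) by blast
  have rhoK: "abs (rho i) <= K3 * nu" for i
  proof -
   have "K1 * norm (Y - Y0) <= K1 * (K2 * (M * nu))" using YY K1(1) by (rule mult_left_mono)
   thus ?thesis using rho(2)[rule_format, of i] by (simp add: K3_def)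
  qed
  have "K3 * nu <= K3 * kappa" using W K3 by (intro mult_left_mono) (auto simp: nu_def)
  hence rhohalf: "abs (rho i) <= 1 / 2" for i using rhoK[of i] kappa(3) by linarith
  have "E' = m *R (X 1 + tau *R X 2)" unfolding E'E c'_def using alpha by (subst Etau) simp
  hence E'slopes: "E' = (SUM i<k. tau *R e i) ** (m *R X 1)" using pprod_slopes[of "%_. tau" k] pprod_const[of "X 1 + tau *R X 2" k] by (simp add: m_def)
  define sg where "sg i = tau + rho i" for i
  have "Y0 = (SUM i<k. tau *R e i)" unfolding Y0_def E'slopes by (simp add: inv_cancel)
  hence "Y = (SUM i<k. sg i *R e i)" using rho(1) by (simp add: sg_def scaleR_add_left sum.distrib k_def algebra_simps)
  moreover have "W' = Y ** (m *R X 1)" by (simp add: Y_def inv_cancel)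
  ultimately have W'slopes: "W' = pprod (map (%i. (1, X 1 + sg i *R X 2)) [0..<k])" by (simp add: pprod_slopes m_def)
  define D where "D i = alpha + bt * sg i" for i
  have Drho: "D i = 1 / alpha + bt * rho i" for i
  proof -
   have "alpha + bt * tau = 1 / alpha" using ab alpha by (simp add: tau_def field_simps)
   thus ?thesis by (simp add: D_def sg_def distrib_left)
  qed
  have D: "D i >= 1 / 2" for i
  proof -
   have "abs (bt * rho i) <= 1 * (1 / 2)" unfolding abs_mult using alpha(3) rhohalf by (intro mult_mono) auto
   moreover have "1 / alpha >= 1" using alpha by simp
   ultimately show ?thesis unfolding Drho by linarith
  qed
  have D0: "D i > 0" for i using D[of i] by linarith
  define V where "V i = (1 / D i) *R (X 1 + sg i *R X 2)" for i
  have Vl: "V i : layer 1" for i unfolding V_def by (intro layer_scale subspace_add[OF subspace_layer] X12)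
  have VE1: "V i *. E = 1" for i
  proof -
   have "(X 1 + sg i *R X 2) *. E = D i" by (simp add: D_def inner_add_left inner_commute[of "X 1" E] inner_commute[of "X 2" E] alpha_def bt_def)
   thus ?thesis using D0[of i] by (simp add: V_def)
  qed
  have VE: "norm (V i - E) <= (4 * K3 + 1) * nu" for i
  proof -
   have "X 1 + sg i *R X 2 = (1 / alpha) *R E + rho i *R X 2" using alpha by (subst Etau) (simp add: sg_def scaleR_add_left)
   hence "V i - E = (1 / D i) *R (((1 / alpha) *R E + rho i *R X 2) - D i *R E)" using D0[of i] by (simp add: V_def scaleR_diff_right)
   also have "((1 / alpha) *R E + rho i *R X 2) - D i *R E = rho i *R (X 2 - bt *R E)" unfolding Drho by (simp add: scaleR_add_left scaleR_diff_right mult.commute)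
   finally have "norm (V i - E) = (1 / D i) * (abs (rho i) * norm (X 2 - bt *R E))" using D0[of i] by simp
   also have "... <= 2 * (abs (rho i) * 2)"
   proof (intro mult_mono)
    show "1 / D i <= 2" using D[of i] D0[of i] by (simp add: pos_divide_le_eq)
    show "norm (X 2 - bt *R E) <= 2" using norm_triangle_ineq4[of "X 2" "bt *R E"] norm_X(2) E(2) alpha(3) by simp
   qed (use D0[of i] in auto)
   also have "... <= 4 * (K3 * nu)" using rhoK[of i] by simp
   also have "... <= (4 * K3 + 1) * nu" by (simp add: distrib_right nu_def)
   finally show ?thesis .
  qed
  define L where "L = map (%i. ((1 / c) * D i, V i)) [0..<k]"
  have "pprod L = pprod (map (%i. ((1 / c) * 1, X 1 + sg i *R X 2)) [0..<k])" unfolding L_def by (rule pprod_cong) (use D0 in "simp add: V_def less_imp_neq[OF D0, symmetric]")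
  also have "... = pprod (map (%(t, V). ((1 / c) * t, V)) (map (%i. (1, X 1 + sg i *R X 2)) [0..<k]))" by (simp add: o_def)
  also have "... = dilation (1 / c) W'" unfolding W'slopes by (rule pprod_scale) (auto intro!: layer_scale subspace_add[OF subspace_layer] X12)
  also have "... = W" unfolding W'_def using c(1) by (intro dilation_inverse) simp
  finally have "pprod L = W" .
  moreover have "near_path E ((4 * K3 + 1) * nu) L" using VE Vl D0 c(1) by (auto simp: near_path_def L_def less_imp_le)
  ultimately show ?thesis using VE1 D0 c(1) by (intro exI[of _ L]) (auto simp: L_def k_def nu_def)
 qed
 thus ?thesis using kappa(1) K3 by (intro exI[of _ "4 * K3 + 1"] conjI exI[of _ kappa]) auto
qed

text \<open>
  If \<open>V *. E = 1\<close>, then \<open>(norm V)\<^sup>2 = 1 + (norm (V - E))\<^sup>2\<close>; so pieces with \<open>norm (V - E) <= C * Delta\<close> have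
  speed at most \<open>1 + eta * Delta\<close> as soon as \<open>Delta < eta / C\<^sup>2\<close>.
\<close>

lemma deformable_near_X1:
 "EX C DeltaB. ALL E:layer 1 Int ball (X 1) (1 / 2). norm E = 1 --> deformable_with E C (2 * n) DeltaB"
proof -
 obtain C0 kappa where C0: "C0 > 0" "kappa > 0" "ALL E W. E : layer 1 --> norm E = 1 --> 1 / 2 <= E *. X 1 --> norm (W - E) <= kappa -->
   (EX L. length L = n - 1 & pprod L = W & near_path E (C0 * norm (W - E)) L & (ALL (t, V):set L. 0 < t & V *. E = 1))" using path_near_line by blast
 obtain Ku where Ku: "Ku > 0" "ALL z. d 0 z <= 1 --> norm z <= Ku * d 0 z" using norm_le_d by blast
 obtain K2 where K2: "K2 >= 0" "ALL x y x' y'. norm x <= 1 + Ku --> norm y <= 1 + Ku --> norm x' <= 1 + Ku --> norm y' <= 1 + Ku -->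
   norm (x ** y - x' ** y') <= K2 * (norm (x - x') + norm (y - y'))" using mult_lipschitz by blast
 define A where "A = K2 * Ku + 1"
 have A: "A > 0" using K2 Ku by (simp add: A_def add_nonneg_pos)
 define C where "C = C0 * A"
 have C: "C > 0" using C0 A by (simp add: C_def)
 define DeltaB where "DeltaB eta = min (min 1 (kappa / A)) (eta / C^2)" for eta
 have "deformable_with E C (2 * n) DeltaB" if E: "E : layer 1" "E : ball (X 1) (1 / 2)" "norm E = 1" for E unfolding deformable_with_def
 proof (intro conjI allI impI)
  fix l eta Delta :: real and u :: 'a
  assume "0 < l & l < 1 & 0 < eta & 0 < Delta & Delta < DeltaB eta & d u 0 <= 1"
  hence l: "0 < l" and eta: "0 < eta" and Delta: "0 < Delta" "Delta <= 1" "Delta < kappa / A" "Delta < eta / C^2" and u: "d 0 u <= 1" by (auto simp: DeltaB_def d_sym)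
  have "(X 1 - E) *. X 1 <= norm (X 1 - E) * norm (X 1)" by (rule norm_cauchy_schwarz)
  hence EX: "1 / 2 <= E *. X 1" using E(2) norm_X X12 by (simp add: inner_diff_left dist_norm)
  define z1 where "z1 = dilation Delta u"
  have "norm u <= Ku * d 0 u" "Ku * d 0 u <= Ku * 1" using Ku u by (blast, intro mult_left_mono) auto
  hence "norm u <= Ku" by simp
  hence "Delta * norm u <= Delta * Ku" using Delta by (intro mult_left_mono) auto
  hence z1: "norm z1 <= Delta * Ku" using norm_dilation_small[OF less_imp_le[OF Delta(1)] Delta(2), of u] unfolding z1_def by linarith
  have "Delta * Ku <= 1 * Ku" using Delta Ku by (intro mult_right_mono) auto
  hence z1K: "norm z1 <= 1 + Ku" using z1 by linarith
  have Az: "K2 * norm z1 <= A * Delta"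
  proof -
   have "K2 * norm z1 <= K2 * (Delta * Ku)" using z1 K2(1) by (rule mult_left_mono)
   also have "... <= A * Delta" using Delta by (simp add: A_def algebra_simps)
   finally show ?thesis .
  qed
  have ADelta: "A * Delta <= kappa" using Delta(3) A by (simp add: pos_less_divide_eq mult.commute)
  have path: "EX L. length L = n - 1 & pprod L = dilation l W & near_path E (C * Delta) L & (ALL (t, V):set L. 0 < t & V *. E = 1)"
   if W: "norm (W - E) <= A * Delta" for W
  proof -
   obtain L where L: "length L = n - 1" "pprod L = W" "near_path E (C0 * norm (W - E)) L" "ALL (t, V):set L. 0 < t & V *. E = 1"
    using C0(3)[rule_format, OF E(1,3) EX, of W] W ADelta by auto
   have "C0 * norm (W - E) <= C * Delta" using W C0(1) mult_left_mono[OF W, of C0] by (simp add: C_def mult.assoc)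
   hence "near_path E (C * Delta) (map (%(t, V). (l * t, V)) L)" using L(3) l by (force simp: near_path_def)
   moreover have "pprod (map (%(t, V). (l * t, V)) L) = dilation l W" unfolding L(2)[symmetric] by (rule pprod_scale) (use L(3) in "auto simp: near_path_def")
   ultimately show ?thesis using L(1,4) l by (intro exI[of _ "map (%(t, V). (l * t, V)) L"]) auto
  qed
  have n1: "norm (E ** z1 - E) <= A * Delta" "norm ((- z1) ** E - E) <= A * Delta"
   using K2(2)[rule_format, of E z1 E 0] K2(2)[rule_format, of "- z1" E 0 E] z1K E(3) Ku(1) Az by (simp_all add: right_unit left_unit)
  define z where "z = dilation (Delta * l) u"
  have zz: "z = dilation l z1" by (simp add: z_def z1_def dilation_dilation mult.commute)
  obtain L1 where L1: "length L1 = n - 1" "pprod L1 = dilation l (E ** z1)" "near_path E (C * Delta) L1" "ALL (t, V):set L1. 0 < t & V *. E = 1"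
   using path[OF n1(1)] by blast
  obtain L2 where L2: "length L2 = n - 1" "pprod L2 = dilation l ((- z1) ** E)" "near_path E (C * Delta) L2" "ALL (t, V):set L2. 0 < t & V *. E = 1"
   using path[OF n1(2)] by blast
  have n0: "L1 ~= []" "L2 ~= []" using L1(1) L2(1) n2 by auto
  have p1: "pprod L1 = (l *R E) ** z" using E(1) by (simp add: L1(2) dilation_mult dilation_layer1 zz)
  have p2: "z ** pprod L2 = l *R E" using E(1) by (simp add: L2(2) dilation_mult dilation_layer1 zz dilation_uminus inv_cancel)
  have speed: "norm V <= 1 + eta * Delta" if V: "V *. E = 1" "norm (V - E) <= C * Delta" for V
  proof -
   have EE: "E *. E = 1" using E(3) by (simp add: norm_eq_1)
   have "(norm V)^2 = 1 + (norm (V - E))^2" unfolding power2_norm_eq_inner inner_diff_left inner_diff_right using V(1) EE by (simp add: inner_commute[of E V])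
   moreover have "(norm (V - E))^2 <= (C * Delta)^2" using V(2) by (simp add: power_mono)
   moreover have "(C * Delta)^2 <= eta * Delta"
   proof -
    have "Delta * C^2 <= eta" using Delta(4) C by (simp add: pos_less_divide_eq)
    hence "(Delta * C^2) * Delta <= eta * Delta" using Delta by (intro mult_right_mono) auto
    thus ?thesis by (simp add: power2_eq_square mult_ac)
   qed
   moreover have "1 + eta * Delta <= (1 + eta * Delta)^2" using eta Delta(1) by (intro self_le_power) auto
   ultimately have "(norm V)^2 <= (1 + eta * Delta)^2" by linarith
   moreover have "0 <= eta * Delta" using eta Delta(1) by simp
   ultimately show ?thesis using power2_le_imp_le[of "norm V" "1 + eta * Delta"] by linarith
  qed
  have near: "near_path E (C * Delta) (L1 @ L2)" using L1(3) L2(3) by simp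
  have all: "ALL (t, V):set (L1 @ L2). 0 < t & V *. E = 1 & norm V <= 1 + eta * Delta"
  proof
   fix tV assume tV: "tV : set (L1 @ L2)"
   obtain t V where [simp]: "tV = (t, V)" by fastforce
   have "0 < t & V *. E = 1" using tV L1(4) L2(4) by auto
   moreover have "norm (V - E) <= C * Delta" using tV near by (auto simp: near_path_def)
   ultimately show "case tV of (t, V) => 0 < t & V *. E = 1 & norm V <= 1 + eta * Delta" using speed by simp
  qed
  have len: "length (L1 @ L2) + 2 = 2 * n" using L1(1) L2(1) n2 by simp
  have "0 <= C" "1 <= 1 + eta * Delta" using C eta Delta by auto
  from deformation_from_paths[OF E(1,3) l this(1) near all n0 this(2) p1 p2]
  show "EX g. Lipschitz_wrt dist d g & horizontal_on_line g & joins_horizontal_lines (2 * n) g &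
      (ALL t. abs t >= l --> g t = t *R E) & g (dilation (Delta * l) u *. E) = dilation (Delta * l) u & Lip_const dist d g <= 1 + eta * Delta &
      (EX F. finite F & (ALL t. t ~: F --> (EX D. ((p o g) has_vderiv D) (at t) & norm (D - p E) <= C * Delta)))" unfolding len z_def .
 qed (use E C C0 A n2 in \<open>auto simp: DeltaB_def\<close>)
 thus ?thesis by blast
qed

lemma filiform_deformable: "admits_ball_of_uniformly_deformable_directions"
proof -
 obtain C DeltaB where D: "ALL E:layer 1 Int ball (X 1) (1 / 2). norm E = 1 --> deformable_with E C (2 * n) DeltaB" using deformable_near_X1 by (elim exE)
 have X: "EX E:layer 1 Int ball (X 1) (1 / 2). norm E = 1" using X12 norm_X by (intro bexI[of _ "X 1"]) auto
 show ?thesis unfolding admits_ball_of_uniformly_deformable_directions_def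
  by (rule bexI[OF _ X12(1)], rule exI[of _ "1 / 2"], rule conjI, simp, rule exI[of _ C], rule exI[of _ "2 * n"], rule exI[of _ DeltaB],
   rule conjI, rule X, rule D)
qed

end

theorem theorem1p1:
  shows "(\<forall>(mult :: 'a::euclidean_space \<Rightarrow> 'a \<Rightarrow> 'a) B s.
            carnot_group mult B s \<and> DIM('a) \<noteq> 1 \<and>
            carnot_group.admits_ball_of_uniformly_deformable_directions mult B s \<longrightarrow>
            (\<exists>N. carnot_group.universal_differentiability_set mult B s N \<and>
                 Hausdorff_dim (carnot_group.cc_dist mult B) N = 1 \<and>
                 (\<forall>\<mu>. carnot_group.haar_measure mult \<mu> \<longrightarrow> N \<in> null_sets (completion \<mu>))))
       \<and> (\<forall>n (mult :: 'b::euclidean_space \<Rightarrow> 'b \<Rightarrow> 'b) X.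
            n \<ge> 2 \<and> model_filiform n mult X \<longrightarrow>
            (\<exists>N. carnot_group.universal_differentiability_set mult (filiform_layer X) (n - 1) N \<and>
                 Hausdorff_dim (carnot_group.cc_dist mult (filiform_layer X)) N = 1))"
proof (intro conjI allI impI)
  fix mult :: "'a \<Rightarrow> 'a \<Rightarrow> 'a" and B s
  assume "carnot_group mult B s \<and> DIM('a) \<noteq> 1 \<and> carnot_group.admits_ball_of_uniformly_deformable_directions mult B s"
  then show "\<exists>N. carnot_group.universal_differentiability_set mult B s N \<and> Hausdorff_dim (carnot_group.cc_dist mult B) N = 1 \<and>
      (\<forall>\<mu>. carnot_group.haar_measure mult \<mu> \<longrightarrow> N \<in> null_sets (completion \<mu>))"
    using carnot_group.small_universal_differentiability_set by blast
next
  fix n and mult :: "'b \<Rightarrow> 'b \<Rightarrow> 'b" and X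
  assume A: "n \<ge> 2 \<and> model_filiform n mult X"
  then have "filiform mult X n"
    unfolding model_filiform_def filiform_def filiform_axioms_def by simp
  then have "carnot_group mult (filiform_layer X) (n - 1)"
      "carnot_group.admits_ball_of_uniformly_deformable_directions mult (filiform_layer X) (n - 1)"
    by (rule filiform.axioms(1), rule filiform.filiform_deformable)
  then show "\<exists>N. carnot_group.universal_differentiability_set mult (filiform_layer X) (n - 1) N \<and>
      Hausdorff_dim (carnot_group.cc_dist mult (filiform_layer X)) N = 1"
    using carnot_group.small_universal_differentiability_set by blast
qed

end
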